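(* Let $M$ be a smooth $7$-manifold and let $\sigma\in\Omega^3_+(M)$ be a $\mathrm{G}_2$-structure with associated metric $g_\sigma$ and torsion forms $\tau_0,\tau_1,\tau_2,\tau_3$. Then the scalar curvature of $g_\sigma$ is $$\operatorname{Scal}(g_\sigma) = 12\,\delta\tau_1 + \tfrac{21}{8}\,\tau_0^2 + 30\,|\tau_1|^2-\tfrac12\,|\tau_2|^2 -\tfrac12\,|\tau_3|^2 .$$
   Context: On $\mathbb R^7$ with dual basis $e^1,\dots,e^7$ (write $e^{ijk}=e^i\wedge e^j\wedge e^k$) let $\phi = e^{123}+e^{145}+e^{167}+e^{246}-e^{257}-e^{347}-e^{356}$; $\mathrm{G}_2\subset GL(7,\mathbb R)$ is the stabilizer of $\phi$, and it preserves the standard metric and orientation of $\mathbb R^7$. A $3$-form $\sigma$ on a smooth $7$-manifold $M$ is definite, written $\sigma\in\Omega^3_+(M)$, if for each $x\in M$ there is a linear isomorphism $u:T_xM\to\mathbb R^7$ with $u^*\phi=\sigma_x$; a definite $3$-form is called a $\mathrm{G}_2$-structure. Pulling back the standard metric and orientation by such $u$ gives a well-defined associated metric $g_\sigma$, orientation, and Hodge star $\ast_\sigma$. Norms of forms are the usual ones induced by $g_\sigma$, and $\delta=d^*$ is the formal adjoint of $d$ (so $\delta\alpha=-\ast_\sigma d\ast_\sigma\alpha$ on $1$-forms). Set $\Omega^2_{14}(M,\sigma)=\{\beta\in\Omega^2(M): \beta\wedge\sigma=-\ast_\sigma\beta\}$ and $\Omega^3_{27}(M,\sigma)=\{\gamma\in\Omega^3(M):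 \gamma\wedge\sigma=0,\ \gamma\wedge\ast_\sigma\sigma=0\}$. Torsion forms: the unique $\tau_0\in\Omega^0(M)$, $\tau_1\in\Omega^1(M)$, $\tau_2\in\Omega^2_{14}(M,\sigma)$, $\tau_3\in\Omega^3_{27}(M,\sigma)$ with $$d\sigma=\tau_0\,\ast_\sigma\sigma+3\,\tau_1\wedge\sigma+\ast_\sigma\tau_3,\qquad d\ast_\sigma\sigma=4\,\tau_1\wedge\ast_\sigma\sigma+\tau_2\wedge\sigma .$$ *)

theory Defs
  imports "HOL-Analysis.Analysis"
begin

section \<open>Smooth maps between Euclidean spaces\<close>

text \<open>Meant for open \<open>S\<close>: the derivatives are the full ones at each point of \<open>S\<close>.\<close>

primrec Ck_on ::
  "nat \<Rightarrow> 'a::euclidean_space set \<Rightarrow> ('a \<Rightarrow> 'b::real_normed_vector) \<Rightarrow> bool" where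
  "Ck_on 0 S f \<longleftrightarrow> continuous_on S f"
| "Ck_on (Suc k) S f \<longleftrightarrow>
     (\<forall>x\<in>S. f differentiable (at x)) \<and>
     (\<forall>v. Ck_on k S (\<lambda>x. frechet_derivative f (at x) v))"

definition smooth_on ::
  "'a::euclidean_space set \<Rightarrow> ('a \<Rightarrow> 'b::real_normed_vector) \<Rightarrow> bool" where
  "smooth_on S f \<longleftrightarrow> (\<forall>k. Ck_on k S f)"

section \<open>Smooth manifolds and tangent vectors\<close>

text \<open>
  A chart is a pair \<open>(U, x)\<close> of a domain and a coordinate map; the values of \<open>x\<close> outside \<open>U\<close>
  are irrelevant.
\<close>

type_synonym ('m, 'n) chart = "'m set \<times> ('m \<Rightarrow> real ^ 'n)"

definition chart_inv :: "('m, 'n::finite) chart \<Rightarrow> real ^ 'n \<Rightarrow> 'm" where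
  "chart_inv c = inv_into (fst c) (snd c)"

definition transition ::
  "('m, 'n::finite) chart \<Rightarrow> ('m, 'n) chart \<Rightarrow> real ^ 'n \<Rightarrow> real ^ 'n" where
  "transition c c' = snd c' \<circ> chart_inv c"

definition topological_chart :: "'m topology \<Rightarrow> ('m, 'n::finite) chart \<Rightarrow> bool" where
  "topological_chart M c \<longleftrightarrow>
     openin M (fst c) \<and> open (snd c ` fst c) \<and>
     homeomorphic_map (subtopology M (fst c)) (top_of_set (snd c ` fst c)) (snd c)"

text \<open>The atlas need not be maximal; the dimension is \<open>CARD('n)\<close>.\<close>

definition smooth_manifold :: "'m topology \<Rightarrow> ('m, 'n::finite) chart set \<Rightarrow> bool" where
  "smooth_manifold M A \<longleftrightarrow>
     Hausdorff_space M \<and>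
     (\<exists>B. countable B \<and> (\<forall>V\<in>B. openin M V) \<and>
          (\<forall>U. openin M U \<longrightarrow> (\<exists>C\<subseteq>B. U = \<Union>C))) \<and>
     (\<forall>c\<in>A. topological_chart M c) \<and>
     (\<Union>c\<in>A. fst c) = topspace M \<and>
     (\<forall>c\<in>A. \<forall>c'\<in>A. smooth_on (snd c ` (fst c \<inter> fst c')) (transition c c'))"

definition charts_at :: "('m, 'n::finite) chart set \<Rightarrow> 'm \<Rightarrow> ('m, 'n) chart set" where
  "charts_at A p = {c \<in> A. p \<in> fst c}"

text \<open>
  Used to evaluate chart-independent local expressions at \<open>p\<close>.
\<close>

definition chart_at :: "('m, 'n::finite) chart set \<Rightarrow> 'm \<Rightarrow> ('m, 'n) chart" where
  "chart_at A p = (SOME c. c \<in> charts_at A p)"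

text \<open>
  A tangent vector at \<open>p\<close> assigns to each chart around \<open>p\<close> a coordinate vector, and these
  transform by the Jacobians of the transition maps. Outside the charts around \<open>p\<close> it is
  set to zero, so that tangent vectors are determined by their coordinates.
\<close>

type_synonym ('m, 'n) tvec = "('m, 'n) chart \<Rightarrow> real ^ 'n"

definition tangent_space ::
  "('m, 'n::finite) chart set \<Rightarrow> 'm \<Rightarrow> ('m, 'n) tvec set" where
  "tangent_space A p =
     {v. (\<forall>c. c \<notin> charts_at A p \<longrightarrow> v c = 0) \<and>
         (\<forall>c\<in>charts_at A p. \<forall>c'\<in>charts_at A p.
            v c' = frechet_derivative (transition c c') (at (snd c p)) (v c))}"

text \<open>The tangent vector at \<open>p\<close> whose coordinates in the chart \<open>c\<close> are \<open>w\<close>.\<close>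

definition tvec_of ::
  "('m, 'n::finite) chart set \<Rightarrow> ('m, 'n) chart \<Rightarrow> 'm \<Rightarrow> real ^ 'n \<Rightarrow> ('m, 'n) tvec" where
  "tvec_of A c p w =
     (\<lambda>c'. if c' \<in> charts_at A p
           then frechet_derivative (transition c c') (at (snd c p)) w else 0)"

definition tangent_iso ::
  "('m, 'n::finite) chart set \<Rightarrow> 'm \<Rightarrow> (('m, 'n) tvec \<Rightarrow> real ^ 'n) \<Rightarrow> bool" where
  "tangent_iso A p u \<longleftrightarrow>
     bij_betw u (tangent_space A p) UNIV \<and>
     (\<forall>a b. \<forall>v\<in>tangent_space A p. \<forall>w\<in>tangent_space A p.
        u (\<lambda>c. a *\<^sub>R v c + b *\<^sub>R w c) = a *\<^sub>R u v + b *\<^sub>R u w)"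

section \<open>Exterior algebra\<close>

text \<open>
  A \<open>k\<close>-covector on a vector space is a function of lists of \<open>k\<close> vectors; its values on lists
  of other lengths, or involving elements outside the vector space, are irrelevant.
\<close>

type_synonym 'v covector = "'v list \<Rightarrow> real"

definition wedge :: "nat \<Rightarrow> nat \<Rightarrow> 'v covector \<Rightarrow> 'v covector \<Rightarrow> 'v covector" where
  "wedge k l \<alpha> \<beta> vs =
     (\<Sum>\<pi> | \<pi> permutes {..<k + l}.
        of_int (sign \<pi>) * \<alpha> (map (\<lambda>i. vs ! \<pi> i) [0..<k])
                        * \<beta> (map (\<lambda>i. vs ! \<pi> i) [k..<k + l])) / (fact k * fact l)"

definition pullback :: "('v \<Rightarrow> 'w) \<Rightarrow> 'w covector \<Rightarrow> 'v covector" where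
  "pullback u \<alpha> vs = \<alpha> (map u vs)"

text \<open>\<open>basis_form [i\<^sub>1, \<dots>, i\<^sub>k]\<close> is the wedge product of the dual basis covectors with these indices.\<close>

primrec basis_form :: "'n::finite list \<Rightarrow> (real ^ 'n) covector" where
  "basis_form [] = (\<lambda>vs. 1)"
| "basis_form (i # is) = wedge 1 (length is) (\<lambda>vs. hd vs $ i) (basis_form is)"

text \<open>The index type \<open>7\<close> has the seven elements 1, ..., 7, where the numeral 7 denotes the same
  element as 0.\<close>

definition phi :: "(real ^ 7) covector" where
  "phi vs = basis_form [1,2,3] vs + basis_form [1,4,5] vs + basis_form [1,6,7] vs
          + basis_form [2,4,6] vs - basis_form [2,5,7] vs - basis_form [3,4,7] vs
          - basis_form [3,5,6] vs"

section \<open>Differential forms\<close>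

type_synonym ('m, 'n) form = "'m \<Rightarrow> ('m, 'n) tvec covector"

definition alternating_on ::
  "('m, 'n::finite) tvec set \<Rightarrow> nat \<Rightarrow> ('m, 'n) tvec covector \<Rightarrow> bool" where
  "alternating_on T k \<alpha> \<longleftrightarrow>
     (\<forall>xs ys v w a b.
        set xs \<subseteq> T \<and> set ys \<subseteq> T \<and> v \<in> T \<and> w \<in> T \<and> length xs + 1 + length ys = k \<longrightarrow>
        \<alpha> (xs @ (\<lambda>c. a *\<^sub>R v c + b *\<^sub>R w c) # ys) =
          a * \<alpha> (xs @ v # ys) + b * \<alpha> (xs @ w # ys)) \<and>
     (\<forall>vs. set vs \<subseteq> T \<and> length vs = k \<and> \<not> distinct vs \<longrightarrow> \<alpha> vs = 0)"

definition local_rep ::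
  "('m, 'n::finite) chart set \<Rightarrow> ('m, 'n) chart \<Rightarrow> ('m, 'n) form
     \<Rightarrow> real ^ 'n \<Rightarrow> (real ^ 'n) covector" where
  "local_rep A c \<omega> y = pullback (tvec_of A c (chart_inv c y)) (\<omega> (chart_inv c y))"

definition Omega ::
  "'m topology \<Rightarrow> ('m, 'n::finite) chart set \<Rightarrow> nat \<Rightarrow> ('m, 'n) form set" where
  "Omega M A k =
     {\<omega>. (\<forall>p\<in>topspace M. alternating_on (tangent_space A p) k (\<omega> p)) \<and>
         (\<forall>c\<in>A. \<forall>ws. length ws = k \<longrightarrow>
            smooth_on (snd c ` fst c) (\<lambda>y. local_rep A c \<omega> y ws))}"

definition form_eq ::
  "'m topology \<Rightarrow> ('m, 'n::finite) chart set \<Rightarrow> nat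
     \<Rightarrow> ('m, 'n) form \<Rightarrow> ('m, 'n) form \<Rightarrow> bool" where
  "form_eq M A k \<alpha> \<beta> \<longleftrightarrow>
     (\<forall>p\<in>topspace M. \<forall>vs. length vs = k \<and> set vs \<subseteq> tangent_space A p \<longrightarrow> \<alpha> p vs = \<beta> p vs)"

definition wedge_form ::
  "nat \<Rightarrow> nat \<Rightarrow> ('m, 'n::finite) form \<Rightarrow> ('m, 'n) form \<Rightarrow> ('m, 'n) form" where
  "wedge_form k l \<alpha> \<beta> p = wedge k l (\<alpha> p) (\<beta> p)"

text \<open>
  Exterior derivative on Euclidean space:
  \<open>(d\<eta>)\<^sub>y(w\<^sub>0, \<dots>, w\<^sub>k) = \<Sum>\<^sub>j (-1)^j (D\<^bsub>w\<^sub>j\<^esub> \<eta>)\<^sub>y(w\<^sub>0, \<dots>, w\<^sub>k without w\<^sub>j)\<close>.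
\<close>

definition euclidean_d ::
  "(real ^ 'n \<Rightarrow> (real ^ 'n) covector) \<Rightarrow> real ^ 'n::finite \<Rightarrow> (real ^ 'n) covector" where
  "euclidean_d \<eta> y ws =
     (\<Sum>j<length ws. (-1) ^ j *
        frechet_derivative (\<lambda>z. \<eta> z (take j ws @ drop (Suc j) ws)) (at y) (ws ! j))"

definition ext_deriv ::
  "('m, 'n::finite) chart set \<Rightarrow> ('m, 'n) form \<Rightarrow> ('m, 'n) form" where
  "ext_deriv A \<omega> p =
     (let c = chart_at A p in
        pullback (\<lambda>v. v c) (euclidean_d (local_rep A c \<omega>) (snd c p)))"

section \<open>Riemannian geometry\<close>

type_synonym ('m, 'n) metric = "'m \<Rightarrow> ('m, 'n) tvec \<Rightarrow> ('m, 'n) tvec \<Rightarrow> real"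

definition orthonormal_frame ::
  "('m, 'n::finite) chart set \<Rightarrow> ('m, 'n) metric \<Rightarrow> 'm \<Rightarrow> ('n \<Rightarrow> ('m, 'n) tvec) \<Rightarrow> bool" where
  "orthonormal_frame A g p e \<longleftrightarrow>
     (\<forall>i. e i \<in> tangent_space A p) \<and> (\<forall>i j. g p (e i) (e j) = (if i = j then 1 else 0))"

definition frame_at ::
  "('m, 'n::finite) chart set \<Rightarrow> ('m, 'n) metric \<Rightarrow> 'm \<Rightarrow> 'n \<Rightarrow> ('m, 'n) tvec" where
  "frame_at A g p = (SOME e. orthonormal_frame A g p e)"

text \<open>
  The norm on \<open>k\<close>-forms for which the wedge products of \<open>k\<close> distinct covectors of an orthonormal
  coframe have norm 1. The sum is over all multi-indices, whence the factor \<open>1 / k!\<close>.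
\<close>

definition form_norm ::
  "('m, 'n::finite) chart set \<Rightarrow> ('m, 'n) metric \<Rightarrow> nat \<Rightarrow> ('m, 'n) form \<Rightarrow> 'm \<Rightarrow> real" where
  "form_norm A g k \<omega> p =
     sqrt ((\<Sum>is | length is = k. (\<omega> p (map (frame_at A g p) is))\<^sup>2) / fact k)"

text \<open>
  Hodge star on \<open>k\<close>-forms for a metric \<open>g\<close> and a volume form \<open>\<mu>\<close> of unit length:
  \<open>(\<star>\<omega>)(w\<^sub>1, \<dots>) = (1 / k!) \<Sum> \<omega>(e\<^bsub>i\<^sub>1\<^esub>, \<dots>, e\<^bsub>i\<^sub>k\<^esub>) \<mu>(e\<^bsub>i\<^sub>1\<^esub>, \<dots>, e\<^bsub>i\<^sub>k\<^esub>, w\<^sub>1, \<dots>)\<close>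
  for any orthonormal frame \<open>e\<close>; this is the convention \<open>\<alpha> \<and> \<star>\<beta> = \<langle>\<alpha>, \<beta>\<rangle> \<mu>\<close>.
\<close>

definition hodge_star ::
  "('m, 'n::finite) chart set \<Rightarrow> ('m, 'n) metric \<Rightarrow> ('m, 'n) form \<Rightarrow> nat
     \<Rightarrow> ('m, 'n) form \<Rightarrow> ('m, 'n) form" where
  "hodge_star A g \<mu> k \<omega> p ws =
     (\<Sum>is | length is = k.
        \<omega> p (map (frame_at A g p) is) * \<mu> p (map (frame_at A g p) is @ ws)) / fact k"

definition pderiv_at :: "'n::finite \<Rightarrow> (real ^ 'n \<Rightarrow> real) \<Rightarrow> real ^ 'n \<Rightarrow> real" where
  "pderiv_at i f y = frechet_derivative f (at y) (axis i 1)"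

definition metric_matrix ::
  "('m, 'n::finite) chart set \<Rightarrow> ('m, 'n) metric \<Rightarrow> ('m, 'n) chart \<Rightarrow> real ^ 'n \<Rightarrow> real ^ 'n ^ 'n"
where
  "metric_matrix A g c y =
     (\<chi> i j. g (chart_inv c y) (tvec_of A c (chart_inv c y) (axis i 1))
                              (tvec_of A c (chart_inv c y) (axis j 1)))"

definition christoffel ::
  "(real ^ 'n \<Rightarrow> real ^ 'n ^ 'n) \<Rightarrow> 'n::finite \<Rightarrow> 'n \<Rightarrow> 'n \<Rightarrow> real ^ 'n \<Rightarrow> real" where
  "christoffel G k i j y =
     1 / 2 * (\<Sum>l\<in>UNIV. matrix_inv (G y) $ k $ l *
       (pderiv_at i (\<lambda>z. G z $ j $ l) y + pderiv_at j (\<lambda>z. G z $ i $ l) y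
        - pderiv_at l (\<lambda>z. G z $ i $ j) y))"

text \<open>\<open>riemann G r s m n\<close> is the \<open>\<partial>\<^sub>r\<close>-component of \<open>R(\<partial>\<^sub>m, \<partial>\<^sub>n) \<partial>\<^sub>s\<close>; with the contractions
  below, round spheres have positive scalar curvature.\<close>

definition riemann ::
  "(real ^ 'n \<Rightarrow> real ^ 'n ^ 'n) \<Rightarrow> 'n::finite \<Rightarrow> 'n \<Rightarrow> 'n \<Rightarrow> 'n \<Rightarrow> real ^ 'n \<Rightarrow> real" where
  "riemann G r s m n y =
     pderiv_at m (christoffel G r n s) y - pderiv_at n (christoffel G r m s) y
     + (\<Sum>l\<in>UNIV. christoffel G r m l y * christoffel G l n s y
                 - christoffel G r n l y * christoffel G l m s y)"

definition ricci ::
  "(real ^ 'n \<Rightarrow> real ^ 'n ^ 'n) \<Rightarrow> 'n::finite \<Rightarrow> 'n \<Rightarrow> real ^ 'n \<Rightarrow> real" where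
  "ricci G s n y = (\<Sum>r\<in>UNIV. riemann G r s r n y)"

definition scalar_curvature ::
  "('m, 'n::finite) chart set \<Rightarrow> ('m, 'n) metric \<Rightarrow> 'm \<Rightarrow> real" where
  "scalar_curvature A g p =
     (let c = chart_at A p; G = metric_matrix A g c; y = snd c p in
        \<Sum>s\<in>UNIV. \<Sum>n\<in>UNIV. matrix_inv (G y) $ s $ n * ricci G s n y)"

section \<open>\<open>G\<^sub>2\<close>-structures\<close>

text \<open>The linear isomorphisms \<open>u\<close> from the tangent space at \<open>p\<close> with \<open>u\<^sup>*\<phi> = \<sigma>\<^sub>p\<close>.\<close>

definition g2_coframe ::
  "('m, 7) chart set \<Rightarrow> ('m, 7) form \<Rightarrow> 'm \<Rightarrow> (('m, 7) tvec \<Rightarrow> real ^ 7) \<Rightarrow> bool" where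
  "g2_coframe A \<sigma> p u \<longleftrightarrow>
     tangent_iso A p u \<and>
     (\<forall>vs. length vs = 3 \<and> set vs \<subseteq> tangent_space A p \<longrightarrow> pullback u phi vs = \<sigma> p vs)"

definition definite_forms ::
  "'m topology \<Rightarrow> ('m, 7) chart set \<Rightarrow> ('m, 7) form set" where
  "definite_forms M A = {\<sigma> \<in> Omega M A 3. \<forall>p\<in>topspace M. \<exists>u. g2_coframe A \<sigma> p u}"

text \<open>
  The metric and the oriented volume form are pulled back along any \<open>G\<^sub>2\<close>-coframe; the choice is
  immaterial because the stabilizer of \<open>phi\<close> preserves the standard metric and orientation.
\<close>

definition g2_coframe_at ::
  "('m, 7) chart set \<Rightarrow> ('m, 7) form \<Rightarrow> 'm \<Rightarrow> ('m, 7) tvec \<Rightarrow> real ^ 7" where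
  "g2_coframe_at A \<sigma> p = (SOME u. g2_coframe A \<sigma> p u)"

definition g2_metric :: "('m, 7) chart set \<Rightarrow> ('m, 7) form \<Rightarrow> ('m, 7) metric" where
  "g2_metric A \<sigma> p v w = g2_coframe_at A \<sigma> p v \<bullet> g2_coframe_at A \<sigma> p w"

definition g2_volume :: "('m, 7) chart set \<Rightarrow> ('m, 7) form \<Rightarrow> ('m, 7) form" where
  "g2_volume A \<sigma> p = pullback (g2_coframe_at A \<sigma> p) (basis_form [1,2,3,4,5,6,7])"

definition g2_star ::
  "('m, 7) chart set \<Rightarrow> ('m, 7) form \<Rightarrow> nat \<Rightarrow> ('m, 7) form \<Rightarrow> ('m, 7) form" where
  "g2_star A \<sigma> = hodge_star A (g2_metric A \<sigma>) (g2_volume A \<sigma>)"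

text \<open>The codifferential \<open>\<delta>\<alpha> = -\<star>d\<star>\<alpha>\<close> of a 1-form, as a function.\<close>

definition codiff1 ::
  "('m, 7) chart set \<Rightarrow> ('m, 7) form \<Rightarrow> ('m, 7) form \<Rightarrow> 'm \<Rightarrow> real" where
  "codiff1 A \<sigma> \<alpha> p = - g2_star A \<sigma> 7 (ext_deriv A (g2_star A \<sigma> 1 \<alpha>)) p []"

definition Omega2_14 ::
  "'m topology \<Rightarrow> ('m, 7) chart set \<Rightarrow> ('m, 7) form \<Rightarrow> ('m, 7) form set" where
  "Omega2_14 M A \<sigma> =
     {\<beta> \<in> Omega M A 2.
        form_eq M A 5 (wedge_form 2 3 \<beta> \<sigma>) (\<lambda>p vs. - g2_star A \<sigma> 2 \<beta> p vs)}"

definition Omega3_27 ::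
  "'m topology \<Rightarrow> ('m, 7) chart set \<Rightarrow> ('m, 7) form \<Rightarrow> ('m, 7) form set" where
  "Omega3_27 M A \<sigma> =
     {\<gamma> \<in> Omega M A 3.
        form_eq M A 6 (wedge_form 3 3 \<gamma> \<sigma>) (\<lambda>p vs. 0) \<and>
        form_eq M A 7 (wedge_form 3 4 \<gamma> (g2_star A \<sigma> 3 \<sigma>)) (\<lambda>p vs. 0)}"

definition torsion_forms ::
  "'m topology \<Rightarrow> ('m, 7) chart set \<Rightarrow> ('m, 7) form
     \<Rightarrow> ('m \<Rightarrow> real) \<Rightarrow> ('m, 7) form \<Rightarrow> ('m, 7) form \<Rightarrow> ('m, 7) form \<Rightarrow> bool" where
  "torsion_forms M A \<sigma> \<tau>\<^sub>0 \<tau>\<^sub>1 \<tau>\<^sub>2 \<tau>\<^sub>3 \<longleftrightarrow>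
     (\<lambda>p vs. \<tau>\<^sub>0 p) \<in> Omega M A 0 \<and> \<tau>\<^sub>1 \<in> Omega M A 1 \<and>
     \<tau>\<^sub>2 \<in> Omega2_14 M A \<sigma> \<and> \<tau>\<^sub>3 \<in> Omega3_27 M A \<sigma> \<and>
     form_eq M A 4 (ext_deriv A \<sigma>)
       (\<lambda>p vs. \<tau>\<^sub>0 p * g2_star A \<sigma> 3 \<sigma> p vs + 3 * wedge_form 1 3 \<tau>\<^sub>1 \<sigma> p vs
               + g2_star A \<sigma> 3 \<tau>\<^sub>3 p vs) \<and>
     form_eq M A 5 (ext_deriv A (g2_star A \<sigma> 3 \<sigma>))
       (\<lambda>p vs. 4 * wedge_form 1 4 \<tau>\<^sub>1 (g2_star A \<sigma> 3 \<sigma>) p vs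
               + wedge_form 2 3 \<tau>\<^sub>2 \<sigma> p vs)"

end

theory Submission
  imports Defs "HOL-Combinatorics.Multiset_Permutations"
begin

text \<open>
  Near a point, a definite form is \<open>phi\<close> in a smooth coframe \<open>E\<close>, so the metric is
  \<open>E\<^sup>T E\<close> and the Levi-Civita connection is a skew matrix of 1-forms. Contracting it with
  \<open>phi\<close> gives a 7 by 7 matrix \<open>th\<close>, the intrinsic torsion. The components of
  \<open>d\<sigma>\<close> and \<open>d\<star>\<sigma>\<close> in the coframe are linear in \<open>th\<close>, hence so are the torsion
  forms; in particular \<open>\<tau>\<^sub>1\<close> is a multiple of the vector \<open>tvec th\<close>. By the first Bianchi identity
  the \<open>g\<^sub>2\<close>-part of the curvature does not contribute to the scalar curvature, which is therefore the
  divergence of \<open>tvec th\<close> plus a quadratic form in \<open>th\<close>; that form is a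
  combination of the squared norms of the torsion forms.
\<close>

section \<open>Alternating forms on lists of vectors\<close>

text \<open>The coframe supplied by definiteness is chosen point by point and need not vary
  smoothly. Its inner products and its values of \<open>phi\<close> are nevertheless functions of
  \<sigma> alone, hence smooth, and a Gram-Schmidt process built only from them yields
  \<open>E\<close>.

  \<open>ext_deriv\<close> at a point is computed in a chart chosen for that point, possibly a
  different one at every nearby point. The codifferential differentiates
  \<open>\<tau>\<^sub>1\<close>, so the equation for d\<sigma> has to be exploited on a
  neighbourhood, and for this d on 3-forms is shown not to depend on the chart. The equation for
  d\<star>\<sigma> is used only at the point itself, in its own chart; this suffices because
  d\<sigma> alone already determines \<open>\<tau>\<^sub>1\<close>.

  The quadratic form equals half of trace(th)^2 + |tvec th|^2 - |d\<sigma>|^2 -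
  |d\<star>\<sigma>|^2. By the torsion equations d\<sigma> and d\<star>\<sigma> are sums of mutually
  orthogonal pieces, one for each torsion form that enters, and Pythagoras then produces the
  coefficients.\<close>

definition multilin :: "nat \<Rightarrow> ('v::real_vector) covector \<Rightarrow> bool" where
  "multilin k \<alpha> \<longleftrightarrow> (\<forall>vs m v w a b. length vs = k \<longrightarrow> m < k \<longrightarrow>
     \<alpha> (vs[m := a *\<^sub>R v + b *\<^sub>R w]) = a * \<alpha> (vs[m := v]) + b * \<alpha> (vs[m := w]))"

text \<open>Counterpart of \<open>alternating_on\<close> for vectors ranging over a whole vector
  space; a slot is addressed by list update, so that no splitting of the argument list is
  required.\<close>

definition altf :: "nat \<Rightarrow> ('v::real_vector) covector \<Rightarrow> bool" where
  "altf k \<alpha> \<longleftrightarrow> multilin k \<alpha> \<and> (\<forall>vs. length vs = k \<longrightarrow> \<not> distinct vs \<longrightarrow> \<alpha> vs = 0)"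

lemma multilinD:
  "multilin k \<alpha> \<Longrightarrow> length vs = k \<Longrightarrow> m < k \<Longrightarrow>
     \<alpha> (vs[m := a *\<^sub>R v + b *\<^sub>R w]) = a * \<alpha> (vs[m := v]) + b * \<alpha> (vs[m := w])"
  by (auto simp: multilin_def)

lemma multilin_add:
  "multilin k \<alpha> \<Longrightarrow> length vs = k \<Longrightarrow> m < k \<Longrightarrow>
     \<alpha> (vs[m := v + w]) = \<alpha> (vs[m := v]) + \<alpha> (vs[m := w])"
  using multilinD[of k \<alpha> vs m 1 v 1 w] by simp

lemma multilin_tail: "multilin (Suc k) \<alpha> \<Longrightarrow> multilin k (\<lambda>ws. \<alpha> (v # ws))"
  unfolding multilin_def
proof (intro allI impI)
  fix vs :: "'a list" and m x w a b
  assume A: "\<forall>vs m v w a b. length vs = Suc k \<longrightarrow> m < Suc k \<longrightarrow>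
     \<alpha> (vs[m := a *\<^sub>R v + b *\<^sub>R w]) = a * \<alpha> (vs[m := v]) + b * \<alpha> (vs[m := w])"
    and "length vs = k" "m < k"
  then show "\<alpha> (v # vs[m := a *\<^sub>R x + b *\<^sub>R w]) = a * \<alpha> (v # vs[m := x]) + b * \<alpha> (v # vs[m := w])"
    using A[rule_format, of "v # vs" "Suc m" a x b w] by simp
qed

lemma multilin_head:
  assumes "multilin (Suc k) \<alpha>" "length ws = k"
  shows "linear (\<lambda>v. \<alpha> (v # ws))"
proof (rule linearI)
  fix x y show "\<alpha> ((x + y) # ws) = \<alpha> (x # ws) + \<alpha> (y # ws)"
    using multilinD[OF assms(1), of "x # ws" 0 1 x 1 y] assms(2) by simp
next
  fix r x show "\<alpha> ((r *\<^sub>R x) # ws) = r *\<^sub>R \<alpha> (x # ws)"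
    using multilinD[OF assms(1), of "x # ws" 0 r x 0 x] assms(2) by simp
qed

lemma multilin_append: "multilin (k + length us) \<alpha> \<Longrightarrow> multilin k (\<lambda>ws. \<alpha> (ws @ us))"
  unfolding multilin_def
proof (intro allI impI)
  fix vs :: "'a list" and m x w a b
  assume A: "\<forall>vs m v w a b. length vs = k + length us \<longrightarrow> m < k + length us \<longrightarrow>
     \<alpha> (vs[m := a *\<^sub>R v + b *\<^sub>R w]) = a * \<alpha> (vs[m := v]) + b * \<alpha> (vs[m := w])"
    and "length vs = k" "m < k"
  then show "\<alpha> (vs[m := a *\<^sub>R x + b *\<^sub>R w] @ us) = a * \<alpha> (vs[m := x] @ us) + b * \<alpha> (vs[m := w] @ us)"
    using A[rule_format, of "vs @ us" m a x b w] by (simp add: list_update_append)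
qed

lemma altf_multilin: "altf k \<alpha> \<Longrightarrow> multilin k \<alpha>"
  by (simp add: altf_def)

lemma altf_zero: "altf k \<alpha> \<Longrightarrow> length vs = k \<Longrightarrow> \<not> distinct vs \<Longrightarrow> \<alpha> vs = 0"
  by (simp add: altf_def)

lemma altf_tail: "altf (Suc k) \<alpha> \<Longrightarrow> altf k (\<lambda>ws. \<alpha> (v # ws))"
  unfolding altf_def using multilin_tail by fastforce

lemma altf_append: "altf (k + length us) \<alpha> \<Longrightarrow> altf k (\<lambda>ws. \<alpha> (ws @ us))"
  unfolding altf_def using multilin_append by fastforce

lemma altf_swap:
  assumes \<alpha>: "altf k \<alpha>" and len: "length vs = k" and ij: "i < k" "j < k" "i \<noteq> j"
  shows "\<alpha> (vs[i := vs ! j, j := vs ! i]) = - \<alpha> vs"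
proof -
  let ?a = "vs ! i" and ?b = "vs ! j"
  note ml = altf_multilin[OF \<alpha>]
  have nd: "\<alpha> (vs[i := x, j := x]) = 0" for x
  proof (rule altf_zero[OF \<alpha>])
    have "vs[i := x, j := x] ! i = vs[i := x, j := x] ! j"
      using ij len by (simp add: nth_list_update)
    then show "\<not> distinct (vs[i := x, j := x])"
      using ij len by (metis length_list_update nth_eq_iff_index_eq)
  qed (simp add: len)
  have e: "\<alpha> (vs[i := x, j := y + z]) = \<alpha> (vs[i := x, j := y]) + \<alpha> (vs[i := x, j := z])" for x y z
    using multilin_add[OF ml, of "vs[i := x]" j y z] len ij by simp
  have f: "\<alpha> (vs[i := y + z, j := x]) = \<alpha> (vs[i := y, j := x]) + \<alpha> (vs[i := z, j := x])" for x y z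
    using multilin_add[OF ml, of "vs[j := x]" i y z] len ij by (simp add: list_update_swap)
  have "0 = \<alpha> (vs[i := ?a + ?b, j := ?a + ?b])" by (simp add: nd)
  also have "\<dots> = \<alpha> vs + \<alpha> (vs[i := ?b, j := ?a])"
    unfolding e f using nd[of ?a] nd[of ?b] by simp
  finally show ?thesis by linarith
qed

lemma map_transpose_nth:
  assumes "i < length vs" "j < length vs"
  shows "map (\<lambda>m. vs ! Transposition.transpose i j m) [0..<length vs] = vs[i := vs ! j, j := vs ! i]"
  using assms by (intro nth_equalityI) (auto simp: Transposition.transpose_def nth_list_update)

lemma altf_permute:
  assumes \<alpha>: "altf k \<alpha>" and "\<pi> permutes {..<k}"
  shows "length vs = k \<Longrightarrow> \<alpha> (map (\<lambda>i. vs ! \<pi> i) [0..<k]) = of_int (sign \<pi>) * \<alpha> vs"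
  using assms(2) finite_lessThan
proof (induction \<pi> arbitrary: vs rule: permutes_induct)
  case id
  then show ?case by (simp add: map_nth[of vs, simplified] flip: id)
next
  case (swap a b p)
  have eq: "map (\<lambda>i. vs ! (Transposition.transpose a b \<circ> p) i) [0..<k]
      = map (\<lambda>i. (vs[a := vs ! b, b := vs ! a]) ! p i) [0..<k]"
  proof (rule map_cong[OF refl])
    fix i assume "i \<in> set [0..<k]"
    then have "p i < k" using permutes_in_image[OF swap.hyps(4)] by auto
    then show "vs ! (Transposition.transpose a b \<circ> p) i = (vs[a := vs ! b, b := vs ! a]) ! p i"
      using map_transpose_nth[of a vs b, symmetric] swap by simp
  qed
  have "sign (Transposition.transpose a b \<circ> p) = - sign p"
    using swap by (subst sign_compose)
      (auto simp: sign_swap_id permutation_swap_id intro: permutes_imp_permutation[OF finite_lessThan])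
  then have s: "real_of_int (sign (Transposition.transpose a b \<circ> p)) = - of_int (sign p)"
    by simp
  show ?case
    unfolding eq s using swap altf_swap[OF \<alpha>, of vs a b] by simp
qed

text \<open>The moved vector passes each of the \<open>length xs\<close> others once. This is the
  source of the sign in the contraction rule for wedge products.\<close>

lemma altf_rotate: "altf (Suc (length xs)) \<alpha> \<Longrightarrow> \<alpha> (xs @ [x]) = (-1) ^ length xs * \<alpha> (x # xs)"
proof (induction xs arbitrary: \<alpha>)
  case Nil then show ?case by simp
next
  case (Cons y ys)
  have "\<alpha> ((y # ys) @ [x]) = (-1) ^ length ys * \<alpha> (y # x # ys)"
    using Cons.IH[of "\<lambda>ws. \<alpha> (y # ws)"] altf_tail[of "Suc (length ys)" \<alpha> y] Cons.prems by simp
  also have "\<alpha> (y # x # ys) = - \<alpha> (x # y # ys)"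
    using altf_swap[OF Cons.prems, of "x # y # ys" 0 1] by simp
  finally show ?case by simp
qed

subsection \<open>Wedge products\<close>

lemma wedge_multilin:
  assumes "multilin k \<alpha>" "multilin l \<beta>"
  shows "multilin (k + l) (wedge k l \<alpha> \<beta>)"
  unfolding multilin_def
proof (intro allI impI)
  fix vs :: "'a list" and m and v w :: 'a and a b :: real
  assume len: "length vs = k + l" and m: "m < k + l"
  let ?f = "\<lambda>x \<pi>. \<alpha> (map (\<lambda>i. vs[m := x] ! \<pi> i) [0..<k]) * \<beta> (map (\<lambda>i. vs[m := x] ! \<pi> i) [k..<k + l])"
  have "?f (a *\<^sub>R v + b *\<^sub>R w) \<pi> = a * ?f v \<pi> + b * ?f w \<pi>" if \<pi>: "\<pi> permutes {..<k + l}" for \<pi>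
  proof -
    \<comment> \<open>\<open>j\<close> is the one position that receives the updated entry, so for
      each permutation linearity is used in a single slot of a single factor.\<close>
    define j where "j = inv \<pi> m"
    have j: "\<pi> j = m" "j < k + l"
      using permutes_inverses(1)[OF \<pi>] permutes_in_image[OF permutes_inv[OF \<pi>]] m by (auto simp: j_def)
    have inj: "\<pi> i = m \<longleftrightarrow> i = j" for i using permutes_inj[OF \<pi>] j by (auto dest: injD)
    have lt: "\<pi> i < k + l" if "i < k + l" for i using permutes_in_image[OF \<pi>] that by auto
    have nth: "vs[m := x] ! \<pi> i = (if i = j then x else vs ! \<pi> i)" if "i < k + l" for i x
    proof (cases "i = j")
      case True
      then have "\<pi> i = m" using j by simp
      then show ?thesis using True len m by simp
    next
      case False
      then have "\<pi> i \<noteq> m" using inj by blast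
      then show ?thesis using False by simp
    qed
    let ?A = "map (\<lambda>i. vs ! \<pi> i) [0..<k]" and ?B = "map (\<lambda>i. vs ! \<pi> i) [k..<k + l]"
    show ?thesis
    proof (cases "j < k")
      case True
      have 1: "map (\<lambda>i. vs[m := x] ! \<pi> i) [0..<k] = ?A[j := x]" for x
        using True by (intro nth_equalityI) (auto simp: nth nth_list_update)
      have 2: "map (\<lambda>i. vs[m := x] ! \<pi> i) [k..<k + l] = ?B" for x
        using True by (intro nth_equalityI) (auto simp: nth)
      show ?thesis unfolding 1 2 using multilinD[OF assms(1), of ?A j a v b w] True
        by (simp add: algebra_simps)
    next
      case False
      have 1: "map (\<lambda>i. vs[m := x] ! \<pi> i) [0..<k] = ?A" for x
        using False by (intro nth_equalityI) (auto simp: nth)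
      have 2: "map (\<lambda>i. vs[m := x] ! \<pi> i) [k..<k + l] = ?B[j - k := x]" for x
        using False j by (intro nth_equalityI) (auto simp: nth nth_list_update)
      show ?thesis unfolding 1 2 using multilinD[OF assms(2), of ?B "j - k" a v b w] False j
        by (simp add: algebra_simps)
    qed
  qed
  then have "(\<Sum>\<pi> | \<pi> permutes {..<k + l}. of_int (sign \<pi>) * ?f (a *\<^sub>R v + b *\<^sub>R w) \<pi>)
     = a * (\<Sum>\<pi> | \<pi> permutes {..<k + l}. of_int (sign \<pi>) * ?f v \<pi>)
     + b * (\<Sum>\<pi> | \<pi> permutes {..<k + l}. of_int (sign \<pi>) * ?f w \<pi>)"
    unfolding sum_distrib_left sum.distrib[symmetric] by (intro sum.cong refl) (simp add: algebra_simps)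
  then show "wedge k l \<alpha> \<beta> (vs[m := a *\<^sub>R v + b *\<^sub>R w])
      = a * wedge k l \<alpha> \<beta> (vs[m := v]) + b * wedge k l \<alpha> \<beta> (vs[m := w])"
    by (simp add: wedge_def field_simps)
qed

text \<open>Composing the permutations with the transposition of two equal arguments leaves both
  factors alone and flips every sign, so the sum is its own negative.\<close>

lemma wedge_not_distinct:
  assumes len: "length vs = k + l" and nd: "\<not> distinct vs"
  shows "wedge k l \<alpha> \<beta> vs = 0"
proof -
  obtain i j where ij: "i < k + l" "j < k + l" "i \<noteq> j" "vs ! i = vs ! j"
    using nd len by (auto simp: distinct_conv_nth)
  let ?t = "Transposition.transpose i j"
  let ?f = "\<lambda>\<pi>. of_int (sign \<pi>) * \<alpha> (map (\<lambda>i. vs ! \<pi> i) [0..<k]) * \<beta> (map (\<lambda>i. vs ! \<pi> i) [k..<k + l])"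
  have t: "?t permutes {..<k + l}" using ij by (simp add: permutes_swap_id)
  have "sum ?f {\<pi>. \<pi> permutes {..<k + l}} = sum (\<lambda>\<pi>. ?f (?t \<circ> \<pi>)) {\<pi>. \<pi> permutes {..<k + l}}"
    by (rule setum_permutations_compose_left[OF t])
  also have "\<dots> = (\<Sum>\<pi> | \<pi> permutes {..<k + l}. - ?f \<pi>)"
  proof (intro sum.cong refl)
    fix \<pi> assume "\<pi> \<in> {\<pi>. \<pi> permutes {..<k + l}}"
    then have "permutation \<pi>" by (auto intro: permutes_imp_permutation[OF finite_lessThan])
    then have "sign (?t \<circ> \<pi>) = - sign \<pi>"
      using ij by (subst sign_compose) (auto simp: sign_swap_id permutation_swap_id)
    moreover have "vs ! ?t m = vs ! m" for m using ij by (auto simp: Transposition.transpose_def)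
    ultimately show "?f (?t \<circ> \<pi>) = - ?f \<pi>" by simp
  qed
  finally have "sum ?f {\<pi>. \<pi> permutes {..<k + l}} = 0" by (simp add: sum_negf)
  then show ?thesis by (simp add: wedge_def)
qed

lemma altf_wedge: "altf k \<alpha> \<Longrightarrow> altf l \<beta> \<Longrightarrow> altf (k + l) (wedge k l \<alpha> \<beta>)"
  unfolding altf_def using wedge_multilin wedge_not_distinct by blast

lemma wedge_cong:
  assumes "\<And>vs. length vs = k \<Longrightarrow> \<alpha> vs = \<alpha>' vs" "\<And>vs. length vs = l \<Longrightarrow> \<beta> vs = \<beta>' vs"
  shows "wedge k l \<alpha> \<beta> vs = wedge k l \<alpha>' \<beta>' vs"
  unfolding wedge_def by (simp add: assms)

lemma wedge_pullback:
  assumes "length vs = k + l"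
  shows "wedge k l (pullback u \<alpha>) (pullback u \<beta>) vs = wedge k l \<alpha> \<beta> (map u vs)"
  unfolding wedge_def pullback_def
proof (intro arg_cong[of _ _ "\<lambda>x. x / _"] sum.cong refl)
  fix \<pi> assume "\<pi> \<in> {\<pi>. \<pi> permutes {..<k + l}}"
  then have "\<pi> i < length vs" if "i < k + l" for i
    using that assms permutes_in_image[of \<pi> "{..<k + l}" i] by auto
  then have "map (\<lambda>i. map u vs ! \<pi> i) [0..<k] = map u (map (\<lambda>i. vs ! \<pi> i) [0..<k])"
    "map (\<lambda>i. map u vs ! \<pi> i) [k..<k + l] = map u (map (\<lambda>i. vs ! \<pi> i) [k..<k + l])"
    by auto
  then show "real_of_int (sign \<pi>) * \<alpha> (map u (map (\<lambda>i. vs ! \<pi> i) [0..<k])) * \<beta> (map u (map (\<lambda>i. vs ! \<pi> i) [k..<k + l])) =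
        real_of_int (sign \<pi>) * \<alpha> (map (\<lambda>i. map u vs ! \<pi> i) [0..<k]) * \<beta> (map (\<lambda>i. map u vs ! \<pi> i) [k..<k + l])"
    by presburger
qed

text \<open>Identifies permutations of n indices with permutations of n + 1 indices that fix 0; this
  is how the first vector is split off a wedge product.\<close>

definition lift_perm :: "(nat \<Rightarrow> nat) \<Rightarrow> nat \<Rightarrow> nat" where
  "lift_perm \<rho> i = (case i of 0 \<Rightarrow> 0 | Suc j \<Rightarrow> Suc (\<rho> j))"

lemma lift_perm_simps [simp]: "lift_perm \<rho> 0 = 0" "lift_perm \<rho> (Suc j) = Suc (\<rho> j)"
  by (simp_all add: lift_perm_def)

lemma lift_perm_permutes: "\<rho> permutes {..<n} \<Longrightarrow> lift_perm \<rho> permutes {..<Suc n}"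
proof (rule bij_imp_permutes)
  assume \<rho>: "\<rho> permutes {..<n}"
  have "inj (lift_perm \<rho>)"
    unfolding inj_def lift_perm_def using permutes_inj[OF \<rho>] by (auto dest: injD split: nat.splits)
  moreover have "lift_perm \<rho> i < Suc n" if "i < Suc n" for i
    using that permutes_in_image[OF \<rho>] by (cases i) auto
  then have "lift_perm \<rho> ` {..<Suc n} \<subseteq> {..<Suc n}" by auto
  ultimately show "bij_betw (lift_perm \<rho>) {..<Suc n} {..<Suc n}"
    by (metis bij_betw_def endo_inj_surj finite_lessThan inj_on_subset subset_UNIV)
  show "lift_perm \<rho> x = x" if "x \<notin> {..<Suc n}" for x
    using that permutes_not_in[OF \<rho>] by (cases x) auto
qed

lemma sign_lift_perm:
  assumes "\<rho> permutes {..<n}"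
  shows "sign (lift_perm \<rho>) = sign \<rho>"
  using assms finite_lessThan
proof (induction \<rho> rule: permutes_induct)
  case id
  have "lift_perm id = id" by (auto simp: lift_perm_def fun_eq_iff split: nat.split)
  then show ?case by metis
next
  case (swap a b p)
  have "lift_perm (Transposition.transpose a b \<circ> p) = Transposition.transpose (Suc a) (Suc b) \<circ> lift_perm p"
    by (auto simp: lift_perm_def fun_eq_iff Transposition.transpose_def split: nat.split)
  moreover have "permutation p" "permutation (lift_perm p)"
    using swap.hyps lift_perm_permutes[of p n] by (auto intro: permutes_imp_permutation[OF finite_lessThan])
  ultimately show ?case
    using swap by (simp only: sign_compose sign_swap_id permutation_swap_id) simp
qed

lemma bij_betw_lift_perm:
  "bij_betw lift_perm {\<rho>. \<rho> permutes {..<n}} {\<pi>. \<pi> permutes {..<Suc n} \<and> \<pi> 0 = 0}"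
proof (rule bij_betwI')
  fix x y :: "nat \<Rightarrow> nat"
  show "(lift_perm x = lift_perm y) = (x = y)"
    by (metis ext lift_perm_simps(2) nat.inject)
next
  fix x assume "x \<in> {\<rho>. \<rho> permutes {..<n}}"
  then show "lift_perm x \<in> {\<pi>. \<pi> permutes {..<Suc n} \<and> \<pi> 0 = 0}"
    by (simp add: lift_perm_permutes)
next
  fix \<pi> assume "\<pi> \<in> {\<pi>. \<pi> permutes {..<Suc n} \<and> \<pi> 0 = 0}"
  then have \<pi>: "\<pi> permutes {..<Suc n}" "\<pi> 0 = 0" by auto
  define \<rho> where "\<rho> i = \<pi> (Suc i) - 1" for i
  have nz: "\<pi> (Suc i) \<noteq> 0" for i using permutes_inj[OF \<pi>(1)] \<pi>(2) by (metis injD nat.simps(3))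
  have l: "\<pi> = lift_perm \<rho>"
    using \<pi>(2) nz by (auto simp: fun_eq_iff lift_perm_def \<rho>_def split: nat.split)
  have "\<rho> permutes {..<n}"
  proof (rule bij_imp_permutes)
    have "inj \<rho>" using permutes_inj[OF \<pi>(1)] unfolding l inj_def
      by (metis lift_perm_simps(2) nat.inject)
    moreover have "\<rho> i < n" if "i < n" for i
      using permutes_in_image[OF \<pi>(1), of "Suc i"] nz[of i] that by (auto simp: \<rho>_def)
    then have "\<rho> ` {..<n} \<subseteq> {..<n}" by auto
    ultimately show "bij_betw \<rho> {..<n} {..<n}"
      by (metis bij_betw_def endo_inj_surj finite_lessThan inj_on_subset subset_UNIV)
    show "\<rho> x = x" if "x \<notin> {..<n}" for x
      using that permutes_not_in[OF \<pi>(1), of "Suc x"] by (simp add: \<rho>_def)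
  qed
  then show "\<exists>x\<in>{\<rho>. \<rho> permutes {..<n}}. \<pi> = lift_perm x" using l by blast
qed

lemma map_upt_shift: "map f [Suc a..<Suc b] = map (\<lambda>i. f (Suc i)) [a..<b]"
  by (simp add: map_Suc_upt[symmetric] comp_def del: upt_Suc)

lemma map_upt_0_Suc: "map f [0..<Suc m] = f 0 # map (\<lambda>i. f (Suc i)) [0..<m]"
  by (subst upt_conv_Cons) (simp_all only: zero_less_Suc list.map map_upt_shift)

text \<open>Sorting the permutations by the position of the first vector.\<close>

lemma wedge_Cons:
  assumes \<alpha>: "altf k \<alpha>" and \<beta>: "altf l \<beta>" and len: "Suc (length vs) = k + l"
  shows "wedge k l \<alpha> \<beta> (v # vs) =
      (if k = 0 then 0 else wedge (k - 1) l (\<lambda>ws. \<alpha> (v # ws)) \<beta> vs)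
    + (if l = 0 then 0 else (-1) ^ k * wedge k (l - 1) \<alpha> (\<lambda>ws. \<beta> (v # ws)) vs)"
proof -
  define n where "n = length vs"
  have kl: "k + l = Suc n" using len by (simp add: n_def)
  let ?us = "v # vs"
  let ?S = "{\<pi>. \<pi> permutes {..<Suc n}}"
  define h where "h \<pi> = of_int (sign \<pi>) * \<alpha> (map (\<lambda>i. ?us ! \<pi> i) [0..<k])
      * \<beta> (map (\<lambda>i. ?us ! \<pi> i) [k..<k + l])" for \<pi>
  \<comment> \<open>\<open>Z j\<close> collects the permutations that put the first vector
    \<open>v\<close> into position \<open>j\<close>. Positions inside one factor contribute equally,
    since a transposition flips both the sign and that factor, so only \<open>Z 0\<close> and
    \<open>Z k\<close> survive.\<close>
  define Z where "Z j = (\<Sum>\<pi> | \<pi> permutes {..<Suc n} \<and> \<pi> j = 0. h \<pi>)" for j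
  have fin: "finite ?S" by (simp add: finite_permutations)
  have reidx: "Z j = (\<Sum>\<pi> | \<pi> permutes {..<Suc n} \<and> \<pi> i = 0. h (\<pi> \<circ> Transposition.transpose i j))"
    if "i < Suc n" "j < Suc n" for i j
    unfolding Z_def
  proof (rule sum.reindex_bij_betw[symmetric], rule bij_betw_byWitness[where f' = "\<lambda>\<pi>. \<pi> \<circ> Transposition.transpose i j"])
    show "(\<lambda>\<pi>. \<pi> \<circ> Transposition.transpose i j) ` {\<pi>. \<pi> permutes {..<Suc n} \<and> \<pi> i = 0} \<subseteq> {\<pi>. \<pi> permutes {..<Suc n} \<and> \<pi> j = 0}"
         "(\<lambda>\<pi>. \<pi> \<circ> Transposition.transpose i j) ` {\<pi>. \<pi> permutes {..<Suc n} \<and> \<pi> j = 0} \<subseteq> {\<pi>. \<pi> permutes {..<Suc n} \<and> \<pi> i = 0}"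
      using that by (auto intro!: permutes_compose permutes_swap_id)
  qed (auto simp: comp_assoc)
  have sgn: "sign (\<pi> \<circ> Transposition.transpose i j) = - sign \<pi>" if "\<pi> permutes {..<Suc n}" "i \<noteq> j" for \<pi> i j
    using that by (subst sign_compose)
      (auto simp: sign_swap_id permutation_swap_id intro: permutes_imp_permutation[OF finite_lessThan])
  have Zk: "Z j = Z 0" if j: "j < k" for j
  proof (cases "j = 0")
    case False
    have "h (\<pi> \<circ> Transposition.transpose 0 j) = h \<pi>" if \<pi>: "\<pi> permutes {..<Suc n}" for \<pi>
    proof -
      let ?L = "map (\<lambda>i. ?us ! \<pi> i) [0..<k]"
      have "map (\<lambda>i. ?us ! (\<pi> \<circ> Transposition.transpose 0 j) i) [0..<k] = ?L[0 := ?L ! j, j := ?L ! 0]"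
        using j by (intro nth_equalityI) (auto simp: Transposition.transpose_def nth_list_update)
      moreover have "map (\<lambda>i. ?us ! (\<pi> \<circ> Transposition.transpose 0 j) i) [k..<k + l] = map (\<lambda>i. ?us ! \<pi> i) [k..<k + l]"
        using j by (auto simp: Transposition.transpose_def)
      moreover have "\<alpha> (?L[0 := ?L ! j, j := ?L ! 0]) = - \<alpha> ?L"
        using altf_swap[OF \<alpha>, of ?L 0 j] False j by simp
      moreover have "sign (\<pi> \<circ> Transposition.transpose 0 j) = - sign \<pi>"
        using sgn[OF \<pi>, of 0 j] False by simp
      ultimately show ?thesis unfolding h_def by (simp only: of_int_minus)
    qed
    then show ?thesis using reidx[of 0 j] j kl by (simp add: Z_def)
  qed simp
  have Zl: "Z j = Z k" if j: "j < k + l" "\<not> j < k" for j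
  proof (cases "j = k")
    case False
    have "h (\<pi> \<circ> Transposition.transpose k j) = h \<pi>" if \<pi>: "\<pi> permutes {..<Suc n}" for \<pi>
    proof -
      let ?L = "map (\<lambda>i. ?us ! \<pi> i) [k..<k + l]"
      have "map (\<lambda>i. ?us ! (\<pi> \<circ> Transposition.transpose k j) i) [k..<k + l] = ?L[0 := ?L ! (j - k), (j - k) := ?L ! 0]"
        using j by (intro nth_equalityI) (auto simp: Transposition.transpose_def nth_list_update)
      moreover have "map (\<lambda>i. ?us ! (\<pi> \<circ> Transposition.transpose k j) i) [0..<k] = map (\<lambda>i. ?us ! \<pi> i) [0..<k]"
        using j by (auto simp: Transposition.transpose_def)
      moreover have "\<beta> (?L[0 := ?L ! (j - k), (j - k) := ?L ! 0]) = - \<beta> ?L"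
        using altf_swap[OF \<beta>, of ?L 0 "j - k"] False j by (simp del: nth_map nth_upt)
      moreover have "sign (\<pi> \<circ> Transposition.transpose k j) = - sign \<pi>"
        using sgn[OF \<pi>, of k j] False by simp
      ultimately show ?thesis unfolding h_def by (simp only: of_int_minus)
    qed
    then show ?thesis using reidx[of k j] j kl by (simp add: Z_def)
  qed simp
  have "sum h ?S = (\<Sum>j<k + l. Z j)"
  proof -
    have "(\<Sum>j<k + l. Z j) = (\<Sum>j<k + l. \<Sum>\<pi> \<in> {\<pi> \<in> ?S. inv \<pi> 0 = j}. h \<pi>)"
      unfolding Z_def
    proof (intro sum.cong refl)
      fix j show "{\<pi>. \<pi> permutes {..<Suc n} \<and> \<pi> j = 0} = {\<pi> \<in> ?S. inv \<pi> 0 = j}"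
        using permutes_inverses(1) by (auto simp: permutes_inv_eq)
    qed
    also have "\<dots> = sum h ?S"
    proof (rule sum.group[OF fin])
      have "inv \<pi> 0 < Suc n" if "\<pi> permutes {..<Suc n}" for \<pi> :: "nat \<Rightarrow> nat"
        using permutes_in_image[OF permutes_inv[OF that], of 0] by simp
      then show "(\<lambda>\<pi>. inv \<pi> 0) ` ?S \<subseteq> {..<k + l}"
        using kl by auto
    qed simp
    finally show ?thesis by simp
  qed
  also have "\<dots> = (\<Sum>j<k. Z j) + (\<Sum>j = k..<k + l. Z j)"
    unfolding lessThan_atLeast0 by (rule sum.atLeastLessThan_concat[symmetric]) simp_all
  also have "(\<Sum>j<k. Z j) = (\<Sum>j<k. Z 0)" by (rule sum.cong[OF refl], rule Zk) simp
  also have "(\<Sum>j = k..<k + l. Z j) = (\<Sum>j = k..<k + l. Z k)" by (rule sum.cong[OF refl], rule Zl) simp_all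
  finally have s: "sum h ?S = k * Z 0 + l * Z k" by simp
  have tot: "wedge k l \<alpha> \<beta> (v # vs) = (k * Z 0 + l * Z k) / (fact k * fact l)"
    unfolding s[symmetric] wedge_def h_def kl by (rule refl)
  have lift: "(\<Sum>\<pi> | \<pi> permutes {..<Suc n} \<and> \<pi> 0 = 0. f \<pi>) = (\<Sum>\<rho> | \<rho> permutes {..<n}. f (lift_perm \<rho>))"
    for f :: "(nat \<Rightarrow> nat) \<Rightarrow> real"
    using sum.reindex_bij_betw[OF bij_betw_lift_perm, of f n] by metis
  have Z0: "k * Z 0 / (fact k * fact l) = wedge (k - 1) l (\<lambda>ws. \<alpha> (v # ws)) \<beta> vs" if nz: "k \<noteq> 0"
  proof -
    obtain k' where k': "k = Suc k'" using nz by (cases k) auto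
    have "h (lift_perm \<rho>) = of_int (sign \<rho>) * \<alpha> (v # map (\<lambda>i. vs ! \<rho> i) [0..<k'])
        * \<beta> (map (\<lambda>i. vs ! \<rho> i) [k'..<k' + l])" if "\<rho> permutes {..<n}" for \<rho>
    proof -
      have "map (\<lambda>i. ?us ! lift_perm \<rho> i) [0..<k] = v # map (\<lambda>i. vs ! \<rho> i) [0..<k']"
        unfolding k' map_upt_0_Suc by simp
      moreover have "map (\<lambda>i. ?us ! lift_perm \<rho> i) [k..<k + l] = map (\<lambda>i. vs ! \<rho> i) [k'..<k' + l]"
        unfolding k' add_Suc map_upt_shift by simp
      ultimately show ?thesis using that by (simp add: h_def sign_lift_perm)
    qed
    then have "Z 0 = (\<Sum>\<rho> | \<rho> permutes {..<n}. of_int (sign \<rho>) * \<alpha> (v # map (\<lambda>i. vs ! \<rho> i) [0..<k'])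
        * \<beta> (map (\<lambda>i. vs ! \<rho> i) [k'..<k' + l]))"
      by (simp add: Z_def lift)
    then show ?thesis using kl k' by (simp add: wedge_def divide_simps)
  qed
  have Z1: "l * Z k / (fact k * fact l) = (-1) ^ k * wedge k (l - 1) \<alpha> (\<lambda>ws. \<beta> (v # ws)) vs" if nz: "l \<noteq> 0"
  proof -
    obtain l' where l': "l = Suc l'" using nz by (cases l) auto
    \<comment> \<open>The transposition puts \<open>v\<close> first in \<beta> and the vector
      displaced by it first in \<alpha>. Rotating the latter to the end costs
      \<open>(-1) ^ (k - 1)\<close>, the transposition itself one more sign.\<close>
    have "h (lift_perm \<rho> \<circ> Transposition.transpose 0 k) = (-1) ^ k * (of_int (sign \<rho>) * \<alpha> (map (\<lambda>i. vs ! \<rho> i) [0..<k])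
        * \<beta> (v # map (\<lambda>i. vs ! \<rho> i) [k..<k + l']))" if \<rho>: "\<rho> permutes {..<n}" for \<rho>
    proof (cases k)
      case 0
      have "map (\<lambda>i. ?us ! lift_perm \<rho> i) [0..<Suc l'] = v # map (\<lambda>i. vs ! \<rho> i) [0..<l']"
        unfolding map_upt_0_Suc by simp
      then show ?thesis using \<rho> 0 l' by (simp add: h_def sign_lift_perm del: upt_Suc)
    next
      case (Suc m)
      let ?xs = "map (\<lambda>i. vs ! \<rho> i) [0..<m]" and ?x = "vs ! \<rho> m"
      have "map (\<lambda>i. ?us ! (lift_perm \<rho> \<circ> Transposition.transpose 0 k) i) [0..<k] = ?x # ?xs"
        unfolding Suc map_upt_0_Suc by (simp add: Transposition.transpose_def)
      moreover have "?xs @ [?x] = map (\<lambda>i. vs ! \<rho> i) [0..<k]" unfolding Suc by simp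
      moreover have "map (\<lambda>i. ?us ! (lift_perm \<rho> \<circ> Transposition.transpose 0 k) i) [k..<k + l] = v # map (\<lambda>i. vs ! \<rho> i) [k..<k + l']"
      proof -
        have "map (\<lambda>i. ?us ! (lift_perm \<rho> \<circ> Transposition.transpose 0 k) i) [k..<k + l]
            = ?us ! (lift_perm \<rho> \<circ> Transposition.transpose 0 k) k
              # map (\<lambda>i. ?us ! (lift_perm \<rho> \<circ> Transposition.transpose 0 k) i) [Suc k..<Suc (k + l')]"
          unfolding l' add_Suc_right by (subst upt_conv_Cons) simp_all
        then show ?thesis
          unfolding map_upt_shift by (simp add: Transposition.transpose_def)
      qed
      moreover have "\<alpha> (?x # ?xs) = (-1) ^ m * \<alpha> (?xs @ [?x])"
        using altf_rotate[of ?xs \<alpha> ?x] \<alpha> Suc by simp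
      moreover have "sign (lift_perm \<rho> \<circ> Transposition.transpose 0 k) = - sign \<rho>"
        using sgn[OF lift_perm_permutes[OF \<rho>], of 0 k] Suc sign_lift_perm[OF \<rho>] by simp
      ultimately show ?thesis by (simp add: h_def Suc)
    qed
    then have "Z k = (-1) ^ k * (\<Sum>\<rho> | \<rho> permutes {..<n}. of_int (sign \<rho>) * \<alpha> (map (\<lambda>i. vs ! \<rho> i) [0..<k])
        * \<beta> (v # map (\<lambda>i. vs ! \<rho> i) [k..<k + l']))"
      using reidx[of 0 k] kl l' by (simp add: lift sum_distrib_left)
    then show ?thesis using kl l' by (simp add: wedge_def divide_simps)
  qed
  show ?thesis
    unfolding tot using Z0 Z1 by (auto simp: add_divide_distrib)
qed

lemma wedge_0_0: "wedge 0 0 \<alpha> \<beta> [] = \<alpha> [] * \<beta> []"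
  by (simp add: wedge_def)

section \<open>Multilinear algebra in a basis\<close>

lemma finite_lists_length [simp]: "finite {is :: 'n::finite list. length is = k}"
  using finite_lists_length_eq[of "UNIV :: 'n set" k] by simp

lemma sum_lists_0: "(\<Sum>is | length is = 0. f is) = f []"
  by simp

lemma sum_lists_Suc:
  fixes f :: "'n::finite list \<Rightarrow> 'b::comm_monoid_add"
  shows "(\<Sum>is | length is = Suc k. f is) = (\<Sum>i\<in>UNIV. \<Sum>is | length is = k. f (i # is))"
proof -
  have "{is :: 'n list. length is = Suc k} = (\<lambda>(i, is). i # is) ` (UNIV \<times> {is. length is = k})"
    by (auto simp: length_Suc_conv)
  moreover have "inj_on (\<lambda>(i, is). i # is) (UNIV \<times> {is :: 'n list. length is = k})"
    by (auto simp: inj_on_def)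
  ultimately have "(\<Sum>is | length is = Suc k. f is)
      = (\<Sum>(i, is)\<in>UNIV \<times> {is :: 'n list. length is = k}. f (i # is))"
    by (simp add: sum.reindex case_prod_unfold)
  then show ?thesis by (simp add: sum.cartesian_product)
qed

lemma multilin_head_sum:
  assumes "multilin (Suc k) \<alpha>" "length ws = k"
  shows "\<alpha> ((\<Sum>i\<in>A. c i *\<^sub>R v i) # ws) = (\<Sum>i\<in>A. c i * \<alpha> (v i # ws))"
  using linear_sum[OF multilin_head[OF assms], of "\<lambda>i. c i *\<^sub>R v i" A]
    linear_scale[OF multilin_head[OF assms]] by simp

abbreviation ax :: "'n::finite \<Rightarrow> real ^ 'n" where "ax i \<equiv> axis i 1"

lemma ax_nth: "ax a $ i = (if i = a then 1 else 0)"
  by (simp add: axis_def)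

lemma vec_ax_sum: "(x :: real ^ 'n::finite) = (\<Sum>i\<in>UNIV. (x $ i) *\<^sub>R ax i)"
  using basis_expansion[of x] by (simp add: scalar_mult_eq_scaleR)

lemma multilin_eqI:
  fixes \<alpha> \<beta> :: "(real ^ 'n::finite) covector"
  assumes "multilin k \<alpha>" "multilin k \<beta>"
    and "\<And>is. length is = k \<Longrightarrow> \<alpha> (map ax is) = \<beta> (map ax is)"
    and "length vs = k"
  shows "\<alpha> vs = \<beta> vs"
  using assms
proof (induction k arbitrary: \<alpha> \<beta> vs)
  case 0
  then show ?case using "0.prems"(3)[of "[]"] by simp
next
  case (Suc k)
  obtain v ws where vs: "vs = v # ws" "length ws = k" using Suc.prems(4) by (cases vs) auto
  have tl: "\<alpha> (ax i # ws) = \<beta> (ax i # ws)" for i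
  proof (rule Suc.IH[of "\<lambda>ws. \<alpha> (ax i # ws)" "\<lambda>ws. \<beta> (ax i # ws)"])
    show "\<alpha> (ax i # map ax is) = \<beta> (ax i # map ax is)" if "length is = k" for "is"
      using Suc.prems(3)[of "i # is"] that by simp
  qed (use Suc.prems vs in \<open>auto intro: multilin_tail\<close>)
  have "\<alpha> (v # ws) = (\<Sum>i\<in>UNIV. v $ i * \<alpha> (ax i # ws))"
    using multilin_head_sum[OF Suc.prems(1) vs(2), of "\<lambda>i. v $ i" ax UNIV] vec_ax_sum[of v] by simp
  moreover have "\<beta> (v # ws) = (\<Sum>i\<in>UNIV. v $ i * \<beta> (ax i # ws))"
    using multilin_head_sum[OF Suc.prems(2) vs(2), of "\<lambda>i. v $ i" ax UNIV] vec_ax_sum[of v] by simp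
  ultimately show ?case by (simp add: vs tl)
qed

text \<open>Needed because \<open>form_norm\<close> and \<open>hodge_star\<close> use a frame picked
  by \<open>SOME\<close>, which this replaces by a convenient one. The slots are changed one at a
  time; orthogonality of \<open>Q\<close> collapses each double sum.\<close>

lemma contract_orth:
  fixes e f :: "'n::finite \<Rightarrow> 'v::real_vector" and Q :: "'n \<Rightarrow> 'n \<Rightarrow> real"
  assumes e: "\<And>i. e i = (\<Sum>j\<in>UNIV. Q i j *\<^sub>R f j)"
    and Q: "\<And>j k. (\<Sum>i\<in>UNIV. Q i j * Q i k) = (if j = k then 1 else 0)"
    and "multilin k \<alpha>" "multilin k \<beta>"
  shows "(\<Sum>is | length is = k. \<alpha> (map e is) * \<beta> (map e is))
       = (\<Sum>is | length is = k. \<alpha> (map f is) * \<beta> (map f is))"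
  using assms(3,4)
proof (induction k arbitrary: \<alpha> \<beta>)
  case 0 then show ?case by simp
next
  case (Suc k)
  have "(\<Sum>is | length is = Suc k. \<alpha> (map e is) * \<beta> (map e is))
      = (\<Sum>i\<in>UNIV. \<Sum>is | length is = k. \<alpha> (e i # map e is) * \<beta> (e i # map e is))"
    by (simp add: sum_lists_Suc)
  also have "\<dots> = (\<Sum>i\<in>UNIV. \<Sum>is | length is = k. \<alpha> (e i # map f is) * \<beta> (e i # map f is))"
    by (intro sum.cong refl Suc.IH[of "\<lambda>ws. \<alpha> (e _ # ws)" "\<lambda>ws. \<beta> (e _ # ws)"] multilin_tail Suc.prems)
  also have "\<dots> = (\<Sum>is | length is = k. \<Sum>i\<in>UNIV. \<alpha> (e i # map f is) * \<beta> (e i # map f is))"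
    by (rule sum.swap)
  also have "\<dots> = (\<Sum>is | length is = k. \<Sum>j\<in>UNIV. \<alpha> (f j # map f is) * \<beta> (f j # map f is))"
  proof (rule sum.cong[OF refl])
    fix "is" :: "'n list" assume "is \<in> {is. length is = k}"
    then have l: "length (map f is) = k" by simp
    define a b where "a j = \<alpha> (f j # map f is)" and "b j = \<beta> (f j # map f is)" for j
    have "(\<Sum>i\<in>UNIV. \<alpha> (e i # map f is) * \<beta> (e i # map f is))
        = (\<Sum>i\<in>UNIV. (\<Sum>j\<in>UNIV. Q i j * a j) * (\<Sum>k\<in>UNIV. Q i k * b k))"
      unfolding e multilin_head_sum[OF Suc.prems(1) l] multilin_head_sum[OF Suc.prems(2) l] a_def b_def ..
    also have "\<dots> = (\<Sum>i\<in>UNIV. \<Sum>j\<in>UNIV. \<Sum>k\<in>UNIV. (Q i j * Q i k) * (a j * b k))"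
      by (simp add: sum_product algebra_simps)
    also have "\<dots> = (\<Sum>j\<in>UNIV. \<Sum>i\<in>UNIV. \<Sum>k\<in>UNIV. (Q i j * Q i k) * (a j * b k))"
      by (rule sum.swap)
    also have "\<dots> = (\<Sum>j\<in>UNIV. \<Sum>k\<in>UNIV. \<Sum>i\<in>UNIV. (Q i j * Q i k) * (a j * b k))"
      by (intro sum.cong refl sum.swap)
    also have "\<dots> = (\<Sum>j\<in>UNIV. \<Sum>k\<in>UNIV. (if j = k then 1 else 0) * (a j * b k))"
      by (simp only: sum_distrib_right[symmetric] Q)
    also have "\<dots> = (\<Sum>j\<in>UNIV. a j * b j)"
      by (simp add: if_distrib[of "\<lambda>x. x * y" for y] cong: if_cong)
    finally show "(\<Sum>i\<in>UNIV. \<alpha> (e i # map f is) * \<beta> (e i # map f is))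
        = (\<Sum>j\<in>UNIV. \<alpha> (f j # map f is) * \<beta> (f j # map f is))"
      by (simp add: a_def b_def)
  qed
  also have "\<dots> = (\<Sum>j\<in>UNIV. \<Sum>is | length is = k. \<alpha> (f j # map f is) * \<beta> (f j # map f is))"
    by (rule sum.swap)
  finally show ?case by (simp add: sum_lists_Suc)
qed

lemma distinct_UNIV_perm:
  fixes xs ys :: "'n list"
  assumes "distinct xs" "distinct ys" "set xs = set ys"
  obtains \<pi> where "\<pi> permutes {..<length ys}"
    "\<And>f :: 'n \<Rightarrow> 'v. map f xs = map (\<lambda>i. map f ys ! \<pi> i) [0..<length ys]"
proof -
  have "mset xs = mset ys" using assms set_eq_iff_mset_eq_distinct by blast
  then obtain \<pi> where \<pi>: "\<pi> permutes {..<length ys}" "permute_list \<pi> ys = xs"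
    using mset_eq_permutation by metis
  show ?thesis
  proof (rule that[OF \<pi>(1)])
    fix f :: "'n \<Rightarrow> 'v"
    have "\<pi> i < length ys" if "i < length ys" for i using permutes_in_image[OF \<pi>(1)] that by auto
    then show "map f xs = map (\<lambda>i. map f ys ! \<pi> i) [0..<length ys]"
      by (simp add: \<pi>(2)[symmetric] permute_list_def)
  qed
qed

text \<open>Alternating forms of top degree span a line. Cross-multiplication avoids division by a
  value that may vanish.\<close>

lemma top_form_unique:
  fixes \<alpha> \<beta> :: "(real ^ 'n::finite) covector"
  assumes \<alpha>: "altf (length js) \<alpha>" and \<beta>: "altf (length js) \<beta>"
    and js: "distinct js" "set js = UNIV" and vs: "length vs = length js"
  shows "\<beta> (map ax js) * \<alpha> vs = \<alpha> (map ax js) * \<beta> vs"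
proof (rule multilin_eqI[where k = "length js" and vs = vs])
  let ?n = "length js"
  have m: "multilin ?n (\<lambda>vs. c * \<gamma> vs)" if "altf ?n \<gamma>" for c and \<gamma> :: "(real ^ 'n) covector"
    using altf_multilin[OF that] unfolding multilin_def by (simp add: algebra_simps)
  show "multilin ?n (\<lambda>a. \<beta> (map ax js) * \<alpha> a)" "multilin ?n (\<lambda>a. \<alpha> (map ax js) * \<beta> a)"
    by (intro m \<alpha> \<beta>)+
  fix "is" :: "'n list" assume len: "length is = ?n"
  show "\<beta> (map ax js) * \<alpha> (map ax is) = \<alpha> (map ax js) * \<beta> (map ax is)"
  proof (cases "distinct is")
    case True
    have "set is = UNIV"
      using card_subset_eq[of UNIV "set is"]
        distinct_card[OF True] distinct_card[OF js(1)] js(2) len by simp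
    then have "set is = set js" using js(2) by simp
    from distinct_UNIV_perm[OF True js(1) this, where 'v = "real ^ 'n"]
    obtain \<pi> where \<pi>': "\<pi> permutes {..<?n}"
      "\<And>f :: 'n \<Rightarrow> real ^ 'n. map f is = map (\<lambda>i. map f js ! \<pi> i) [0..<?n]"
      by blast
    note \<pi> = \<pi>'(1) \<pi>'(2)[of ax]
    show ?thesis
      unfolding \<pi>(2) using altf_permute[OF \<alpha> \<pi>(1), of "map ax js"] altf_permute[OF \<beta> \<pi>(1), of "map ax js"]
      by simp
  next
    case False
    then have "\<not> distinct (map ax is)" by (simp add: distinct_map)
    then show ?thesis using altf_zero[OF \<alpha>] altf_zero[OF \<beta>] len by simp
  qed
qed (use vs in simp)

text \<open>The determinant, with rows read off along \<open>js\<close>, is itself an alternating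
  form with value 1 on the standard basis, so \<open>top_form_unique\<close> applies.\<close>

lemma top_form_det:
  fixes \<alpha> :: "(real ^ 'n::finite) covector" and f :: "'n \<Rightarrow> real ^ 'n"
  assumes \<alpha>: "altf (length js) \<alpha>" and js: "distinct js" "set js = UNIV"
  shows "\<alpha> (map f js) = det (\<chi> i. f i) * \<alpha> (map ax js)"
proof -
  let ?n = "length js"
  define idx where "idx i = inv_into {..<?n} ((!) js) i" for i
  have idx: "js ! idx i = i" "idx i < ?n" for i
  proof -
    have "i \<in> (!) js ` {..<?n}" using js(2) by (metis UNIV_I in_set_conv_nth image_eqI lessThan_iff)
    from f_inv_into_f[OF this] inv_into_into[OF this]
    show "js ! idx i = i" "idx i < ?n" by (auto simp: idx_def)
  qed
  have idx': "idx i = m \<longleftrightarrow> i = js ! m" if "m < ?n" for i m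
    using idx that nth_eq_iff_index_eq[OF js(1)] by metis
  define D where "D vs = det (\<chi> i. vs ! idx i)" for vs :: "(real ^ 'n) list"
  have D: "altf ?n D"
    unfolding altf_def multilin_def
  proof safe
    fix vs :: "(real ^ 'n) list" and m :: nat and v w :: "real ^ 'n" and a b :: real
    assume m: "length vs = ?n" "m < ?n"
    have upd: "(\<chi> i. vs[m := x] ! idx i) = (\<chi> i. if i = js ! m then x else vs ! idx i)" for x
    proof -
      have "vs[m := x] ! idx i = (if i = js ! m then x else vs ! idx i)" for i
        by (cases "idx i = m") (use m idx'[OF m(2), of i] in simp_all)
      then show ?thesis by (simp only:)
    qed
    show "D (vs[m := a *\<^sub>R v + b *\<^sub>R w]) = a * D (vs[m := v]) + b * D (vs[m := w])"
      unfolding D_def upd scalar_mult_eq_scaleR[symmetric]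
      using det_row_mul[of "js ! m" a "\<lambda>_. v" "\<lambda>i. vs ! idx i"]
        det_row_mul[of "js ! m" b "\<lambda>_. w" "\<lambda>i. vs ! idx i"]
      by (simp add: det_row_add)
  next
    fix vs :: "(real ^ 'n) list" assume vs: "length vs = ?n" "\<not> distinct vs"
    then obtain i j where ij: "i < ?n" "j < ?n" "i \<noteq> j" "vs ! i = vs ! j"
      by (auto simp: distinct_conv_nth)
    have "idx (js ! k) = k" if "k < ?n" for k using idx'[OF that] by blast
    moreover have "js ! i \<noteq> js ! j" using ij js(1) by (simp add: nth_eq_iff_index_eq)
    ultimately show "D vs = 0"
      unfolding D_def using ij by (intro det_identical_rows[of "js ! i" "js ! j"]) (auto simp: row_def vec_eq_iff)
  qed
  have "D (map g js) = det (\<chi> i. g i)" for g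
    using idx by (simp add: D_def)
  moreover have "det (\<chi> i. ax i :: real ^ 'n ^ 'n) = 1"
  proof -
    have "(\<chi> i. ax i) = (mat 1 :: real ^ 'n ^ 'n)" by (simp add: vec_eq_iff mat_def axis_def)
    then show ?thesis by simp
  qed
  ultimately show ?thesis
    using top_form_unique[OF \<alpha> D js, of "map f js"] by simp
qed

text \<open>Among all multi-indices only rearrangements of the complement of \<open>js\<close>
  survive. All contribute the same amount, since the sign of the rearrangement enters squared, and
  their number cancels \<open>fact k\<close>.\<close>

lemma hodge_sum:
  fixes f :: "'n::finite \<Rightarrow> 'v::real_vector"
  assumes \<alpha>: "altf k \<alpha>" and \<mu>: "altf (k + length js) \<mu>"
    and ij: "distinct (is0 @ js)" "set (is0 @ js) = UNIV" and k: "length is0 = k"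
  shows "(\<Sum>is | length is = k. \<alpha> (map f is) * \<mu> (map f is @ map f js)) / fact k
       = \<alpha> (map f is0) * \<mu> (map f is0 @ map f js)"
proof -
  let ?t = "\<lambda>is. \<alpha> (map f is) * \<mu> (map f is @ map f js)"
  let ?P = "permutations_of_set (set is0)"
  have disj: "set is0 \<inter> set js = {}" "set is0 \<union> set js = UNIV" using ij by auto
  have sub: "?P \<subseteq> {is. length is = k}"
    using ij k by (auto simp: permutations_of_set_def) (metis distinct_card)
  have out: "?t is = 0" if "is \<in> {is. length is = k} - ?P" for "is"
  proof (cases "distinct (is @ js)")
    case True
    then have "set is \<subseteq> set is0" using disj by auto
    moreover have "card (set is) = card (set is0)" using True that ij k by (auto simp: distinct_card)
    ultimately have "set is = set is0" by (simp add: card_subset_eq)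
    then show ?thesis using that True by (auto simp: permutations_of_set_def)
  next
    case False
    then have "\<not> distinct (map f is @ map f js)" by (metis distinct_map map_append)
    then show ?thesis using altf_zero[OF \<mu>] that by simp
  qed
  have eq: "?t is = ?t is0" if "is \<in> ?P" for "is"
  proof -
    have "distinct is" "distinct is0" "set is = set is0" using that ij by (auto simp: permutations_of_set_def)
    from distinct_UNIV_perm[OF this, where 'v = 'v] obtain \<pi> where
      \<pi>': "\<pi> permutes {..<length is0}"
      "\<And>f :: 'n \<Rightarrow> 'v. map f is = map (\<lambda>i. map f is0 ! \<pi> i) [0..<length is0]"
      by blast
    note \<pi> = \<pi>'(1)[unfolded k] \<pi>'(2)[of f, unfolded k]
    have "altf k (\<lambda>ws. \<mu> (ws @ map f js))" using altf_append[of k "map f js" \<mu>] \<mu> by simp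
    from altf_permute[OF this \<pi>(1)] altf_permute[OF \<alpha> \<pi>(1)]
    have "?t is = (of_int (sign \<pi>) * of_int (sign \<pi>)) * ?t is0"
      unfolding \<pi>(2) using k by simp
    then show ?thesis by (simp flip: of_int_mult)
  qed
  have "(\<Sum>is | length is = k. ?t is) = (\<Sum>is\<in>?P. ?t is)"
    by (rule sum.mono_neutral_right[OF finite_lists_length sub], rule ballI, rule out)
  also have "\<dots> = (\<Sum>is\<in>?P. ?t is0)" using eq by (rule sum.cong[OF refl])
  also have "\<dots> = fact k * ?t is0"
    using ij k by (simp add: distinct_card)
  finally show ?thesis by simp
qed

subsection \<open>Basis forms\<close>

lemma altf_coord: "altf (Suc 0) (\<lambda>vs :: (real ^ 'n::finite) list. hd vs $ i)"
  by (auto simp: altf_def multilin_def length_Suc_conv)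

lemma altf_basis_form: "altf (length is) (basis_form is)"
proof (induction "is")
  case Nil
  then show ?case by (simp add: altf_def multilin_def)
next
  case (Cons i "is")
  then show ?case using altf_wedge[OF altf_coord[of i] Cons.IH] by simp
qed

lemma wedge_0_left:
  assumes "altf k \<beta>" "length vs = k"
  shows "wedge 0 k \<alpha> \<beta> vs = \<alpha> [] * \<beta> vs"
proof -
  have "(\<Sum>\<pi> | \<pi> permutes {..<k}. real_of_int (sign \<pi>) * \<alpha> [] * \<beta> (map (\<lambda>i. vs ! \<pi> i) [0..<k]))
     = (\<Sum>\<pi> | \<pi> permutes {..<k}. \<alpha> [] * \<beta> vs)"
  proof (rule sum.cong[OF refl])
    fix \<pi> assume "\<pi> \<in> {\<pi>. \<pi> permutes {..<k}}"
    then have "\<pi> permutes {..<k}" by simp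
    from altf_permute[OF assms(1) this assms(2)]
    show "real_of_int (sign \<pi>) * \<alpha> [] * \<beta> (map (\<lambda>i. vs ! \<pi> i) [0..<k]) = \<alpha> [] * \<beta> vs"
      by (simp flip: of_int_mult)
  qed
  also have "\<dots> = fact k * (\<alpha> [] * \<beta> vs)"
    by (simp add: card_permutations)
  finally show ?thesis by (simp add: wedge_def)
qed

lemma basis_form_Cons:
  assumes "length vs = length is"
  shows "basis_form (i # is) (v # vs) = v $ i * basis_form is vs
     - (if is = [] then 0 else wedge 1 (length is - 1) (\<lambda>vs. hd vs $ i) (\<lambda>ws. basis_form is (v # ws)) vs)"
proof -
  have "wedge 0 (length is) (\<lambda>ws. v $ i) (basis_form is) vs = v $ i * basis_form is vs"
    using wedge_0_left[OF altf_basis_form assms] .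
  then show ?thesis
    using wedge_Cons[OF altf_coord[of i] altf_basis_form, of vs "is" v] assms by simp
qed

lemma basis_form_axis_notin:
  assumes "a \<notin> set is" "Suc (length vs) = length is"
  shows "basis_form is (ax a # vs) = 0"
  using assms
proof (induction "is" arbitrary: vs)
  case (Cons i "is")
  have *: "wedge 1 (length is - 1) (\<lambda>vs. hd vs $ i) (\<lambda>ws. basis_form is (ax a # ws)) vs = 0" if "is \<noteq> []"
  proof -
    have "wedge 1 (length is - 1) (\<lambda>vs. hd vs $ i) (\<lambda>ws. basis_form is (ax a # ws)) vs
        = wedge 1 (length is - 1) (\<lambda>vs. hd vs $ i) (\<lambda>ws. 0) vs"
      by (rule wedge_cong) (use that Cons in auto)
    then show ?thesis by (simp add: wedge_def)
  qed
  show ?case using Cons.prems * by (auto simp: basis_form_Cons ax_nth simp del: basis_form.simps)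
qed simp

lemma basis_form_axis_in:
  assumes "distinct (xs @ a # ys)" "length vs = length xs + length ys"
  shows "basis_form (xs @ a # ys) (ax a # vs) = (-1) ^ length xs * basis_form (xs @ ys) vs"
  using assms
proof (induction xs arbitrary: vs)
  case Nil
  have *: "wedge 1 (length ys - 1) (\<lambda>vs. hd vs $ a) (\<lambda>ws. basis_form ys (ax a # ws)) vs = 0" if "ys \<noteq> []"
  proof -
    have "wedge 1 (length ys - 1) (\<lambda>vs. hd vs $ a) (\<lambda>ws. basis_form ys (ax a # ws)) vs
        = wedge 1 (length ys - 1) (\<lambda>vs. hd vs $ a) (\<lambda>ws. 0) vs"
      by (rule wedge_cong) (use that Nil in \<open>auto intro: basis_form_axis_notin\<close>)
    then show ?thesis by (simp add: wedge_def)
  qed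
  show ?case using Nil * by (auto simp: basis_form_Cons ax_nth simp del: basis_form.simps)
next
  case (Cons i xs)
  have "wedge 1 (length xs + length ys) (\<lambda>vs. hd vs $ i) (\<lambda>ws. basis_form (xs @ a # ys) (ax a # ws)) vs
      = wedge 1 (length xs + length ys) (\<lambda>vs. hd vs $ i) (\<lambda>ws. (-1) ^ length xs * basis_form (xs @ ys) ws) vs"
    by (rule wedge_cong) (use Cons in auto)
  also have "\<dots> = (-1) ^ length xs * basis_form (i # xs @ ys) vs"
    by (simp add: wedge_def sum_distrib_left algebra_simps)
  finally have w: "wedge 1 (length xs + length ys) (\<lambda>vs. hd vs $ i) (\<lambda>ws. basis_form (xs @ a # ys) (ax a # ws)) vs
      = (-1) ^ length xs * basis_form (i # xs @ ys) vs" .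
  show ?case
    using Cons.prems w basis_form_Cons[of vs "xs @ a # ys" i "ax a"]
    by (auto simp: ax_nth simp del: basis_form.simps)
qed

text \<open>The value of a basis form on basis vectors as a recursive sign: each entry of the first
  list is located in the second and struck out, at the cost of one sign for every entry before it.
  Unlike a sum over permutations, simplification can evaluate this.\<close>

fun epsl :: "'n list \<Rightarrow> 'n list \<Rightarrow> real" where
  "epsl [] is = 1"
| "epsl (a # as) is = (if a \<in> set is
     then (-1) ^ length (takeWhile (\<lambda>b. b \<noteq> a) is) * epsl as (remove1 a is) else 0)"

lemma basis_form_ax:
  "distinct is \<Longrightarrow> length as = length is \<Longrightarrow> basis_form is (map ax as) = epsl as is"
proof (induction as arbitrary: "is")
  case (Cons a as)
  show ?case
  proof (cases "a \<in> set is")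
    case True
    then obtain xs ys where "is": "is = xs @ a # ys" "a \<notin> set xs" using split_list_first[OF True] by blast
    have "takeWhile (\<lambda>b. b \<noteq> a) (xs @ a # ys) = xs" using "is"(2) by (induction xs) auto
    then have "takeWhile (\<lambda>b. b \<noteq> a) is = xs" unfolding "is"(1) .
    moreover have "remove1 a is = xs @ ys" using "is" by (simp add: remove1_append)
    ultimately show ?thesis
      using Cons basis_form_axis_in[of xs a ys "map ax as"] "is" by simp
  qed (use Cons basis_form_axis_notin[of a "is" "map ax as"] in simp)
qed simp

text \<open>Reduces an identity of forms to increasing multi-indices, which \<open>subseqs\<close>
  enumerates. In dimension 7 at most 35 tuples of a given length remain, few enough to evaluate the
  tensor identities below one by one.\<close>

lemma altf_eqI:
  fixes \<alpha> \<beta> :: "(real ^ 'n::finite) covector"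
  assumes \<alpha>: "altf k \<alpha>" and \<beta>: "altf k \<beta>" and js: "distinct js" "set js = UNIV"
    and eq: "\<forall>is\<in>set (subseqs js). length is = k \<longrightarrow> \<alpha> (map ax is) = \<beta> (map ax is)"
    and vs: "length vs = k"
  shows "\<alpha> vs = \<beta> vs"
proof (rule multilin_eqI[OF altf_multilin[OF \<alpha>] altf_multilin[OF \<beta>] _ vs])
  fix "is" :: "'n list" assume len: "length is = k"
  show "\<alpha> (map ax is) = \<beta> (map ax is)"
  proof (cases "distinct is")
    case True
    have "set is \<in> set ` set (subseqs js)" using js(2) by (simp add: subseqs_powset)
    then obtain ks where ks: "ks \<in> set (subseqs js)" "set ks = set is" by blast
    have dk: "distinct ks" using ks(1) js(1) by (rule subseqs_distinctD)
    have lk: "length ks = k" using True len dk ks(2) by (metis distinct_card)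
    from distinct_UNIV_perm[OF True dk ks(2)[symmetric], where 'v = "real ^ 'n"] obtain \<pi> where
      \<pi>': "\<pi> permutes {..<length ks}"
      "\<And>f :: 'n \<Rightarrow> real ^ 'n. map f is = map (\<lambda>i. map f ks ! \<pi> i) [0..<length ks]"
      by blast
    note \<pi> = \<pi>'(1)[unfolded lk] \<pi>'(2)[of ax, unfolded lk]
    show ?thesis
      unfolding \<pi>(2) using altf_permute[OF \<alpha> \<pi>(1), of "map ax ks"] altf_permute[OF \<beta> \<pi>(1), of "map ax ks"]
        eq ks(1) lk by simp
  next
    case False
    then have "\<not> distinct (map ax is)" by (simp add: distinct_map)
    then show ?thesis using altf_zero[OF \<alpha>] altf_zero[OF \<beta>] len by simp
  qed
qed

text \<open>The right-hand side has the shape of \<open>euclidean_d\<close>; through it the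
  alternating sum in an exterior derivative is recognised as a wedge product.\<close>

lemma wedge_1_left:
  assumes "altf 1 \<alpha>" "altf k \<beta>" "length vs = Suc k"
  shows "wedge 1 k \<alpha> \<beta> vs = (\<Sum>j<Suc k. (-1) ^ j * \<alpha> [vs ! j] * \<beta> (take j vs @ drop (Suc j) vs))"
  using assms(2,3)
proof (induction k arbitrary: \<beta> vs)
  case 0
  then obtain v where "vs = [v]" by (auto simp: length_Suc_conv)
  then show ?case
    using wedge_Cons[OF assms(1) 0(1), of "[]" v] wedge_0_left[OF 0(1), of "[]" "\<lambda>ws. \<alpha> (v # ws)"] by simp
next
  case (Suc k)
  obtain v ws where vs: "vs = v # ws" "length ws = Suc k" using Suc.prems(2) by (cases vs) auto
  have "wedge 1 (Suc k) \<alpha> \<beta> (v # ws) = \<alpha> [v] * \<beta> ws - wedge 1 k \<alpha> (\<lambda>us. \<beta> (v # us)) ws"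
    using wedge_Cons[OF assms(1) Suc.prems(1), of ws v] vs
      wedge_0_left[OF Suc.prems(1) vs(2), of "\<lambda>us. \<alpha> (v # us)"] by simp
  also have "wedge 1 k \<alpha> (\<lambda>us. \<beta> (v # us)) ws
     = (\<Sum>j<Suc k. (-1) ^ j * \<alpha> [ws ! j] * \<beta> (v # take j ws @ drop (Suc j) ws))"
    using Suc.IH[OF altf_tail[OF Suc.prems(1)] vs(2)] by simp
  finally show ?case
    unfolding vs(1) by (simp add: sum.lessThan_Suc_shift[of _ "Suc k"] sum_negf del: sum.lessThan_Suc)
qed

section \<open>The standard \<open>G\<^sub>2\<close> form in components\<close>

lemma exhaust_7: fixes x :: 7 shows "x = 1 \<or> x = 2 \<or> x = 3 \<or> x = 4 \<or> x = 5 \<or> x = 6 \<or> x = 7"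
proof (induct x)
  case (of_int z)
  then have "z = 0 \<or> z = 1 \<or> z = 2 \<or> z = 3 \<or> z = 4 \<or> z = 5 \<or> z = 6" by auto
  then show ?case by auto
qed

lemma UNIV_7: "(UNIV :: 7 set) = {1,2,3,4,5,6,7}" using exhaust_7 by auto

lemma sum_7: "sum f (UNIV :: 7 set) = f 1 + f 2 + f 3 + f 4 + f 5 + f 6 + f 7"
  unfolding UNIV_7 by (simp add: add.assoc)

lemma forall_7: "(\<forall>i :: 7. P i) \<longleftrightarrow> P 1 \<and> P 2 \<and> P 3 \<and> P 4 \<and> P 5 \<and> P 6 \<and> P 7"
  by (metis exhaust_7)

abbreviation I7 :: "7 list" where "I7 \<equiv> [1,2,3,4,5,6,7]"

lemma I7: "distinct I7" "set I7 = UNIV" "length I7 = 7"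
  using UNIV_7 by simp_all

lemma altf_add: "altf k \<alpha> \<Longrightarrow> altf k \<beta> \<Longrightarrow> altf k (\<lambda>vs. \<alpha> vs + \<beta> vs)"
  by (simp add: altf_def multilin_def algebra_simps)

lemma altf_diff: "altf k \<alpha> \<Longrightarrow> altf k \<beta> \<Longrightarrow> altf k (\<lambda>vs. \<alpha> vs - \<beta> vs)"
  by (simp add: altf_def multilin_def algebra_simps)

lemma altf_cmult: "altf k \<alpha> \<Longrightarrow> altf k (\<lambda>vs. c * \<alpha> vs)"
  by (simp add: altf_def multilin_def algebra_simps)

lemma altf_pullback: "linear u \<Longrightarrow> altf k \<alpha> \<Longrightarrow> altf k (pullback u \<alpha>)"
  by (auto simp: altf_def multilin_def pullback_def map_update linear_add linear_scale distinct_map)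

text \<open>The Hodge dual of \<open>phi\<close>, written out; \<open>star_phi\<close> confirms
  this.\<close>

definition psi :: "(real ^ 7) covector" where
  "psi vs = basis_form [4,5,6,7] vs + basis_form [2,3,6,7] vs + basis_form [2,3,4,5] vs
          + basis_form [1,3,5,7] vs - basis_form [1,3,4,6] vs - basis_form [1,2,5,6] vs
          - basis_form [1,2,4,7] vs"

definition vol :: "(real ^ 7) covector" where "vol = basis_form I7"

lemma altf_phi: "altf 3 phi"
  unfolding phi_def[abs_def]
  using altf_basis_form[of "[_, _, _] :: 7 list"]
  by (intro altf_add altf_diff) (simp_all only: list.size numeral_3_eq_3 add_0 One_nat_def add_Suc_right add_0_right)

lemma altf_psi: "altf 4 psi"
proof -
  have "altf 4 (basis_form [i, j, k, l])" for i j k l :: 7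
    using altf_basis_form[of "[i, j, k, l]"] by (simp add: numeral_eq_Suc del: basis_form.simps)
  then show ?thesis unfolding psi_def[abs_def] by (intro altf_add altf_diff)
qed

lemma altf_vol: "altf 7 vol"
  unfolding vol_def using altf_basis_form[of I7] by (simp only: I7(3))

definition ph :: "7 \<Rightarrow> 7 \<Rightarrow> 7 \<Rightarrow> real" where "ph i j k = phi [ax i, ax j, ax k]"
definition ps :: "7 \<Rightarrow> 7 \<Rightarrow> 7 \<Rightarrow> 7 \<Rightarrow> real" where "ps i j k l = psi [ax i, ax j, ax k, ax l]"

lemma ph_epsl:
  "ph i j k = epsl [i,j,k] [1,2,3] + epsl [i,j,k] [1,4,5] + epsl [i,j,k] [1,6,7]
     + epsl [i,j,k] [2,4,6] - epsl [i,j,k] [2,5,7] - epsl [i,j,k] [3,4,7] - epsl [i,j,k] [3,5,6]"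
  unfolding ph_def phi_def
  using basis_form_ax[of _ "[i,j,k]"] by (simp del: basis_form.simps epsl.simps)

lemma ps_epsl:
  "ps i j k l = epsl [i,j,k,l] [4,5,6,7] + epsl [i,j,k,l] [2,3,6,7] + epsl [i,j,k,l] [2,3,4,5]
     + epsl [i,j,k,l] [1,3,5,7] - epsl [i,j,k,l] [1,3,4,6] - epsl [i,j,k,l] [1,2,5,6] - epsl [i,j,k,l] [1,2,4,7]"
  unfolding ps_def psi_def
  using basis_form_ax[of _ "[i,j,k,l]"] by (simp del: basis_form.simps epsl.simps)

lemma phi_last: "phi [v, w, z] = (\<Sum>k\<in>UNIV. z $ k * phi [v, w, ax k])"
proof -
  have "multilin (Suc (Suc (Suc 0))) phi" using altf_multilin[OF altf_phi] by (simp add: numeral_3_eq_3)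
  from multilin_head_sum[OF multilin_tail[OF multilin_tail[OF this]], of "[]" v w "\<lambda>i. z $ i" ax UNIV]
  show ?thesis using vec_ax_sum[of z] by simp
qed

lemma phi_expand: "phi [x, y, z] = (\<Sum>i\<in>UNIV. \<Sum>j\<in>UNIV. \<Sum>k\<in>UNIV. x $ i * y $ j * z $ k * ph i j k)"
proof -
  have m: "multilin (Suc (Suc (Suc 0))) phi" using altf_multilin[OF altf_phi] by (simp add: numeral_3_eq_3)
  have e1: "phi [x, y, z] = (\<Sum>i\<in>UNIV. x $ i * phi [ax i, y, z])"
    using multilin_head_sum[OF m, of "[y, z]" "\<lambda>i. x $ i" ax UNIV] vec_ax_sum[of x] by simp
  have e2: "phi [v, y, z] = (\<Sum>j\<in>UNIV. y $ j * phi [v, ax j, z])" for v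
    using multilin_head_sum[OF multilin_tail[OF m], of "[z]" v "\<lambda>i. y $ i" ax UNIV] vec_ax_sum[of y] by simp
  show ?thesis
    unfolding e1 unfolding e2 unfolding phi_last[of _ _ z] ph_def sum_distrib_left mult.assoc ..
qed

lemma alt3_swap:
  assumes "altf 3 \<alpha>"
  shows "\<alpha> [y, x, z] = - \<alpha> [x, y, z]" "\<alpha> [x, z, y] = - \<alpha> [x, y, z]" "\<alpha> [z, y, x] = - \<alpha> [x, y, z]"
    "\<alpha> [x, x, z] = 0" "\<alpha> [x, z, z] = 0" "\<alpha> [x, z, x] = 0"
  using altf_swap[OF assms, of "[x, y, z]" 0 1] altf_swap[OF assms, of "[x, y, z]" 1 2]
    altf_swap[OF assms, of "[x, y, z]" 0 2] altf_zero[OF assms, of "[x, x, z]"]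
    altf_zero[OF assms, of "[x, z, z]"] altf_zero[OF assms, of "[x, z, x]"]
  by (simp_all add: numeral_2_eq_2)

lemma ph_eq: "ph i i k = 0" "ph i k k = 0" "ph i k i = 0"
  by (simp_all add: ph_def altf_zero[OF altf_phi])

lemma ps_eq: "ps i i k l = 0" "ps i k i l = 0" "ps i k l i = 0" "ps i k k l = 0" "ps i k l k = 0" "ps i k l l = 0"
  by (simp_all add: ps_def altf_zero[OF altf_psi])

lemmas alt_phi = alt3_swap[OF altf_phi]

lemma ph_table:
  "ph 1 2 3 = 1" "ph 1 2 4 = 0" "ph 1 2 5 = 0" "ph 1 2 6 = 0" "ph 1 2 7 = 0" "ph 1 3 2 = -1"
  "ph 1 3 4 = 0" "ph 1 3 5 = 0" "ph 1 3 6 = 0" "ph 1 3 7 = 0" "ph 1 4 2 = 0" "ph 1 4 3 = 0"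
  "ph 1 4 5 = 1" "ph 1 4 6 = 0" "ph 1 4 7 = 0" "ph 1 5 2 = 0" "ph 1 5 3 = 0" "ph 1 5 4 = -1"
  "ph 1 5 6 = 0" "ph 1 5 7 = 0" "ph 1 6 2 = 0" "ph 1 6 3 = 0" "ph 1 6 4 = 0" "ph 1 6 5 = 0"
  "ph 1 6 7 = 1" "ph 1 7 2 = 0" "ph 1 7 3 = 0" "ph 1 7 4 = 0" "ph 1 7 5 = 0" "ph 1 7 6 = -1"
  "ph 2 1 3 = -1" "ph 2 1 4 = 0" "ph 2 1 5 = 0" "ph 2 1 6 = 0" "ph 2 1 7 = 0" "ph 2 3 1 = 1"
  "ph 2 3 4 = 0" "ph 2 3 5 = 0" "ph 2 3 6 = 0" "ph 2 3 7 = 0" "ph 2 4 1 = 0" "ph 2 4 3 = 0"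
  "ph 2 4 5 = 0" "ph 2 4 6 = 1" "ph 2 4 7 = 0" "ph 2 5 1 = 0" "ph 2 5 3 = 0" "ph 2 5 4 = 0"
  "ph 2 5 6 = 0" "ph 2 5 7 = -1" "ph 2 6 1 = 0" "ph 2 6 3 = 0" "ph 2 6 4 = -1" "ph 2 6 5 = 0"
  "ph 2 6 7 = 0" "ph 2 7 1 = 0" "ph 2 7 3 = 0" "ph 2 7 4 = 0" "ph 2 7 5 = 1" "ph 2 7 6 = 0"
  "ph 3 1 2 = 1" "ph 3 1 4 = 0" "ph 3 1 5 = 0" "ph 3 1 6 = 0" "ph 3 1 7 = 0" "ph 3 2 1 = -1"
  "ph 3 2 4 = 0" "ph 3 2 5 = 0" "ph 3 2 6 = 0" "ph 3 2 7 = 0" "ph 3 4 1 = 0" "ph 3 4 2 = 0"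
  "ph 3 4 5 = 0" "ph 3 4 6 = 0" "ph 3 4 7 = -1" "ph 3 5 1 = 0" "ph 3 5 2 = 0" "ph 3 5 4 = 0"
  "ph 3 5 6 = -1" "ph 3 5 7 = 0" "ph 3 6 1 = 0" "ph 3 6 2 = 0" "ph 3 6 4 = 0" "ph 3 6 5 = 1"
  "ph 3 6 7 = 0" "ph 3 7 1 = 0" "ph 3 7 2 = 0" "ph 3 7 4 = 1" "ph 3 7 5 = 0" "ph 3 7 6 = 0"
  "ph 4 1 2 = 0" "ph 4 1 3 = 0" "ph 4 1 5 = -1" "ph 4 1 6 = 0" "ph 4 1 7 = 0" "ph 4 2 1 = 0"
  "ph 4 2 3 = 0" "ph 4 2 5 = 0" "ph 4 2 6 = -1" "ph 4 2 7 = 0" "ph 4 3 1 = 0" "ph 4 3 2 = 0"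
  "ph 4 3 5 = 0" "ph 4 3 6 = 0" "ph 4 3 7 = 1" "ph 4 5 1 = 1" "ph 4 5 2 = 0" "ph 4 5 3 = 0"
  "ph 4 5 6 = 0" "ph 4 5 7 = 0" "ph 4 6 1 = 0" "ph 4 6 2 = 1" "ph 4 6 3 = 0" "ph 4 6 5 = 0"
  "ph 4 6 7 = 0" "ph 4 7 1 = 0" "ph 4 7 2 = 0" "ph 4 7 3 = -1" "ph 4 7 5 = 0" "ph 4 7 6 = 0"
  "ph 5 1 2 = 0" "ph 5 1 3 = 0" "ph 5 1 4 = 1" "ph 5 1 6 = 0" "ph 5 1 7 = 0" "ph 5 2 1 = 0"
  "ph 5 2 3 = 0" "ph 5 2 4 = 0" "ph 5 2 6 = 0" "ph 5 2 7 = 1" "ph 5 3 1 = 0" "ph 5 3 2 = 0"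
  "ph 5 3 4 = 0" "ph 5 3 6 = 1" "ph 5 3 7 = 0" "ph 5 4 1 = -1" "ph 5 4 2 = 0" "ph 5 4 3 = 0"
  "ph 5 4 6 = 0" "ph 5 4 7 = 0" "ph 5 6 1 = 0" "ph 5 6 2 = 0" "ph 5 6 3 = -1" "ph 5 6 4 = 0"
  "ph 5 6 7 = 0" "ph 5 7 1 = 0" "ph 5 7 2 = -1" "ph 5 7 3 = 0" "ph 5 7 4 = 0" "ph 5 7 6 = 0"
  "ph 6 1 2 = 0" "ph 6 1 3 = 0" "ph 6 1 4 = 0" "ph 6 1 5 = 0" "ph 6 1 7 = -1" "ph 6 2 1 = 0"
  "ph 6 2 3 = 0" "ph 6 2 4 = 1" "ph 6 2 5 = 0" "ph 6 2 7 = 0" "ph 6 3 1 = 0" "ph 6 3 2 = 0"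
  "ph 6 3 4 = 0" "ph 6 3 5 = -1" "ph 6 3 7 = 0" "ph 6 4 1 = 0" "ph 6 4 2 = -1" "ph 6 4 3 = 0"
  "ph 6 4 5 = 0" "ph 6 4 7 = 0" "ph 6 5 1 = 0" "ph 6 5 2 = 0" "ph 6 5 3 = 1" "ph 6 5 4 = 0"
  "ph 6 5 7 = 0" "ph 6 7 1 = 1" "ph 6 7 2 = 0" "ph 6 7 3 = 0" "ph 6 7 4 = 0" "ph 6 7 5 = 0"
  "ph 7 1 2 = 0" "ph 7 1 3 = 0" "ph 7 1 4 = 0" "ph 7 1 5 = 0" "ph 7 1 6 = 1" "ph 7 2 1 = 0"
  "ph 7 2 3 = 0" "ph 7 2 4 = 0" "ph 7 2 5 = -1" "ph 7 2 6 = 0" "ph 7 3 1 = 0" "ph 7 3 2 = 0"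
  "ph 7 3 4 = -1" "ph 7 3 5 = 0" "ph 7 3 6 = 0" "ph 7 4 1 = 0" "ph 7 4 2 = 0" "ph 7 4 3 = 1"
  "ph 7 4 5 = 0" "ph 7 4 6 = 0" "ph 7 5 1 = 0" "ph 7 5 2 = 1" "ph 7 5 3 = 0" "ph 7 5 4 = 0"
  "ph 7 5 6 = 0" "ph 7 6 1 = -1" "ph 7 6 2 = 0" "ph 7 6 3 = 0" "ph 7 6 4 = 0" "ph 7 6 5 = 0"
  by (simp_all add: ph_epsl)

text \<open>Only increasing last three indices are listed, because an arbitrary vector is always
  moved to the first slot before it is expanded.\<close>

lemma ps_table:
  "ps 4 1 2 3 = 0" "ps 5 1 2 3 = 0" "ps 6 1 2 3 = 0" "ps 7 1 2 3 = 0" "ps 3 1 2 4 = 0"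
  "ps 5 1 2 4 = 0" "ps 6 1 2 4 = 0" "ps 7 1 2 4 = 1" "ps 3 1 2 5 = 0" "ps 4 1 2 5 = 0"
  "ps 6 1 2 5 = 1" "ps 7 1 2 5 = 0" "ps 3 1 2 6 = 0" "ps 4 1 2 6 = 0" "ps 5 1 2 6 = -1"
  "ps 7 1 2 6 = 0" "ps 3 1 2 7 = 0" "ps 4 1 2 7 = -1" "ps 5 1 2 7 = 0" "ps 6 1 2 7 = 0"
  "ps 2 1 3 4 = 0" "ps 5 1 3 4 = 0" "ps 6 1 3 4 = 1" "ps 7 1 3 4 = 0" "ps 2 1 3 5 = 0"
  "ps 4 1 3 5 = 0" "ps 6 1 3 5 = 0" "ps 7 1 3 5 = -1" "ps 2 1 3 6 = 0" "ps 4 1 3 6 = -1"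
  "ps 5 1 3 6 = 0" "ps 7 1 3 6 = 0" "ps 2 1 3 7 = 0" "ps 4 1 3 7 = 0" "ps 5 1 3 7 = 1"
  "ps 6 1 3 7 = 0" "ps 2 1 4 5 = 0" "ps 3 1 4 5 = 0" "ps 6 1 4 5 = 0" "ps 7 1 4 5 = 0"
  "ps 2 1 4 6 = 0" "ps 3 1 4 6 = 1" "ps 5 1 4 6 = 0" "ps 7 1 4 6 = 0" "ps 2 1 4 7 = 1"
  "ps 3 1 4 7 = 0" "ps 5 1 4 7 = 0" "ps 6 1 4 7 = 0" "ps 2 1 5 6 = 1" "ps 3 1 5 6 = 0"
  "ps 4 1 5 6 = 0" "ps 7 1 5 6 = 0" "ps 2 1 5 7 = 0" "ps 3 1 5 7 = -1" "ps 4 1 5 7 = 0"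
  "ps 6 1 5 7 = 0" "ps 2 1 6 7 = 0" "ps 3 1 6 7 = 0" "ps 4 1 6 7 = 0" "ps 5 1 6 7 = 0"
  "ps 1 2 3 4 = 0" "ps 5 2 3 4 = -1" "ps 6 2 3 4 = 0" "ps 7 2 3 4 = 0" "ps 1 2 3 5 = 0"
  "ps 4 2 3 5 = 1" "ps 6 2 3 5 = 0" "ps 7 2 3 5 = 0" "ps 1 2 3 6 = 0" "ps 4 2 3 6 = 0"
  "ps 5 2 3 6 = 0" "ps 7 2 3 6 = -1" "ps 1 2 3 7 = 0" "ps 4 2 3 7 = 0" "ps 5 2 3 7 = 0"
  "ps 6 2 3 7 = 1" "ps 1 2 4 5 = 0" "ps 3 2 4 5 = -1" "ps 6 2 4 5 = 0" "ps 7 2 4 5 = 0"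
  "ps 1 2 4 6 = 0" "ps 3 2 4 6 = 0" "ps 5 2 4 6 = 0" "ps 7 2 4 6 = 0" "ps 1 2 4 7 = -1"
  "ps 3 2 4 7 = 0" "ps 5 2 4 7 = 0" "ps 6 2 4 7 = 0" "ps 1 2 5 6 = -1" "ps 3 2 5 6 = 0"
  "ps 4 2 5 6 = 0" "ps 7 2 5 6 = 0" "ps 1 2 5 7 = 0" "ps 3 2 5 7 = 0" "ps 4 2 5 7 = 0"
  "ps 6 2 5 7 = 0" "ps 1 2 6 7 = 0" "ps 3 2 6 7 = -1" "ps 4 2 6 7 = 0" "ps 5 2 6 7 = 0"
  "ps 1 3 4 5 = 0" "ps 2 3 4 5 = 1" "ps 6 3 4 5 = 0" "ps 7 3 4 5 = 0" "ps 1 3 4 6 = -1"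
  "ps 2 3 4 6 = 0" "ps 5 3 4 6 = 0" "ps 7 3 4 6 = 0" "ps 1 3 4 7 = 0" "ps 2 3 4 7 = 0"
  "ps 5 3 4 7 = 0" "ps 6 3 4 7 = 0" "ps 1 3 5 6 = 0" "ps 2 3 5 6 = 0" "ps 4 3 5 6 = 0"
  "ps 7 3 5 6 = 0" "ps 1 3 5 7 = 1" "ps 2 3 5 7 = 0" "ps 4 3 5 7 = 0" "ps 6 3 5 7 = 0"
  "ps 1 3 6 7 = 0" "ps 2 3 6 7 = 1" "ps 4 3 6 7 = 0" "ps 5 3 6 7 = 0" "ps 1 4 5 6 = 0"
  "ps 2 4 5 6 = 0" "ps 3 4 5 6 = 0" "ps 7 4 5 6 = -1" "ps 1 4 5 7 = 0" "ps 2 4 5 7 = 0"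
  "ps 3 4 5 7 = 0" "ps 6 4 5 7 = 1" "ps 1 4 6 7 = 0" "ps 2 4 6 7 = 0" "ps 3 4 6 7 = 0"
  "ps 5 4 6 7 = -1" "ps 1 5 6 7 = 0" "ps 2 5 6 7 = 0" "ps 3 5 6 7 = 0" "ps 4 5 6 7 = 1"
  by (simp_all add: ps_epsl)

lemma phi_ax:
  "phi [x, y, ax 1] = (x $ 2 * y $ 3 - x $ 3 * y $ 2) + (x $ 4 * y $ 5 - x $ 5 * y $ 4) + (x $ 6 * y $ 7 - x $ 7 * y $ 6)"
  "phi [x, y, ax 2] = (x $ 3 * y $ 1 - x $ 1 * y $ 3) + (x $ 4 * y $ 6 - x $ 6 * y $ 4) + (x $ 7 * y $ 5 - x $ 5 * y $ 7)"
  "phi [x, y, ax 3] = (x $ 1 * y $ 2 - x $ 2 * y $ 1) + (x $ 7 * y $ 4 - x $ 4 * y $ 7) + (x $ 6 * y $ 5 - x $ 5 * y $ 6)"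
  "phi [x, y, ax 4] = (x $ 5 * y $ 1 - x $ 1 * y $ 5) + (x $ 6 * y $ 2 - x $ 2 * y $ 6) + (x $ 3 * y $ 7 - x $ 7 * y $ 3)"
  "phi [x, y, ax 5] = (x $ 1 * y $ 4 - x $ 4 * y $ 1) + (x $ 2 * y $ 7 - x $ 7 * y $ 2) + (x $ 3 * y $ 6 - x $ 6 * y $ 3)"
  "phi [x, y, ax 6] = (x $ 7 * y $ 1 - x $ 1 * y $ 7) + (x $ 2 * y $ 4 - x $ 4 * y $ 2) + (x $ 5 * y $ 3 - x $ 3 * y $ 5)"
  "phi [x, y, ax 7] = (x $ 1 * y $ 6 - x $ 6 * y $ 1) + (x $ 5 * y $ 2 - x $ 2 * y $ 5) + (x $ 4 * y $ 3 - x $ 3 * y $ 4)"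
  by (simp_all add: phi_expand sum_7 ax_nth ph_table ph_eq)

text \<open>The seven-dimensional cross product, that is, \<open>phi\<close> with its last index
  raised.\<close>

definition cr :: "real ^ 7 \<Rightarrow> real ^ 7 \<Rightarrow> real ^ 7" where "cr x y = (\<chi> m. phi [x, y, ax m])"

lemma phi_cr: "phi [x, y, z] = cr x y \<bullet> z"
  unfolding phi_last[of x y z] by (simp add: cr_def inner_vec_def mult.commute)

lemma cr_nth: "cr x y $ m = phi [x, y, ax m]"
  by (simp add: cr_def)

lemma inner_7: "(x :: real ^ 7) \<bullet> y = x $ 1 * y $ 1 + x $ 2 * y $ 2 + x $ 3 * y $ 3 + x $ 4 * y $ 4
    + x $ 5 * y $ 5 + x $ 6 * y $ 6 + x $ 7 * y $ 7"
  by (simp add: inner_vec_def sum_7)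

lemma cr_inner: "cr x y \<bullet> cr x w = (x \<bullet> x) * (y \<bullet> w) - (x \<bullet> y) * (x \<bullet> w)"
  unfolding inner_7 cr_nth phi_ax by algebra

text \<open>Polarisation of x \<times> (x \<times> z) = - |x|^2 z + <x, z> x, which is the
  alternative law of the octonions in terms of the cross product. Checked as a polynomial identity
  in the coordinates.\<close>

lemma cr_cr: "cr x (cr y z) + cr y (cr x z) = (-2 * (x \<bullet> y)) *\<^sub>R z + (x \<bullet> z) *\<^sub>R y + (y \<bullet> z) *\<^sub>R x"
proof -
  have "\<forall>m. (cr x (cr y z) + cr y (cr x z)) $ m
      = ((-2 * (x \<bullet> y)) *\<^sub>R z + (x \<bullet> z) *\<^sub>R y + (y \<bullet> z) *\<^sub>R x) $ m"
    unfolding forall_7 vector_add_component vector_scaleR_component inner_7 cr_nth phi_ax real_scaleR_def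
    by (intro conjI; algebra)
  then show ?thesis by (simp add: vec_eq_iff)
qed

subsection \<open>The identity relating \<open>phi\<close> and its Hodge dual\<close>

lemma linear_phi:
  "phi [a *\<^sub>R x + b *\<^sub>R x', y, z] = a * phi [x, y, z] + b * phi [x', y, z]"
  "phi [x, a *\<^sub>R y + b *\<^sub>R y', z] = a * phi [x, y, z] + b * phi [x, y', z]"
  "phi [x, y, a *\<^sub>R z + b *\<^sub>R z'] = a * phi [x, y, z] + b * phi [x, y, z']"
  using multilinD[OF altf_multilin[OF altf_phi], of "[x, y, z]" 0 a x b x']
    multilinD[OF altf_multilin[OF altf_phi], of "[x, y, z]" 1 a y b y']
    multilinD[OF altf_multilin[OF altf_phi], of "[x, y, z]" 2 a z b z']
  by (simp_all add: numeral_2_eq_2)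

lemma linear_phi_simple:
  "phi [x + x', y, z] = phi [x, y, z] + phi [x', y, z]" "phi [x, y + y', z] = phi [x, y, z] + phi [x, y', z]"
  "phi [x, y, z + z'] = phi [x, y, z] + phi [x, y, z']"
  "phi [a *\<^sub>R x, y, z] = a * phi [x, y, z]" "phi [x, a *\<^sub>R y, z] = a * phi [x, y, z]"
  "phi [x, y, a *\<^sub>R z] = a * phi [x, y, z]"
  using linear_phi(1)[of 1 x 1 x'] linear_phi(2)[of x 1 y 1 y'] linear_phi(3)[of x y 1 z 1 z']
    linear_phi(1)[of a x 0 0] linear_phi(2)[of x a y 0 0] linear_phi(3)[of x y a z 0 0]
  by simp_all

lemma cr_linear:
  "cr (x + x') y = cr x y + cr x' y" "cr x (y + y') = cr x y + cr x y'"
  "cr (a *\<^sub>R x) y = a *\<^sub>R cr x y" "cr x (a *\<^sub>R y) = a *\<^sub>R cr x y"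
  by (simp_all add: vec_eq_iff cr_nth linear_phi_simple)

lemma cr_self: "cr x x = 0"
  by (simp add: vec_eq_iff cr_nth alt_phi(4))

lemma cr_skew: "cr y x = - cr x y"
  by (simp add: vec_eq_iff cr_nth alt_phi(1)[of y x])

lemma cr_minus: "cr (- x) y = - cr x y" "cr x (- y) = - cr x y"
  using cr_linear(3)[of "-1" x y] cr_linear(4)[of x "-1" y] by simp_all

lemma ax_inner: "ax i \<bullet> ax j = (if i = j then 1 else 0)"
  by (simp add: inner_axis_axis)

lemma phi_ph: "phi [ax i, ax j, ax k] = ph i j k"
  by (simp add: ph_def)

lemma psi_ps: "psi [ax i, ax j, ax k, ax l] = ps i j k l"
  by (simp add: ps_def)

lemma length4: "length vs = 4 \<longleftrightarrow> (\<exists>x y z w. vs = [x, y, z, w])"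
  by (auto simp: length_Suc_conv numeral_eq_Suc)

lemma length3: "length vs = 3 \<longleftrightarrow> (\<exists>x y z. vs = [x, y, z])"
  by (auto simp: length_Suc_conv numeral_eq_Suc)

lemma less4: "m < (4 :: nat) \<longleftrightarrow> m = 0 \<or> m = 1 \<or> m = 2 \<or> m = 3"
  by auto

lemma less3: "m < (3 :: nat) \<longleftrightarrow> m = 0 \<or> m = 1 \<or> m = 2"
  by auto

lemma subseqs_3: "filter (\<lambda>is. length is = 3) (subseqs I7) =
  [[1,2,3], [1,2,4], [1,2,5], [1,2,6], [1,2,7], [1,3,4], [1,3,5], [1,3,6], [1,3,7], [1,4,5], [1,4,6], [1,4,7],
    [1,5,6], [1,5,7], [1,6,7], [2,3,4], [2,3,5], [2,3,6], [2,3,7], [2,4,5], [2,4,6], [2,4,7], [2,5,6], [2,5,7],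
    [2,6,7], [3,4,5], [3,4,6], [3,4,7], [3,5,6], [3,5,7], [3,6,7], [4,5,6], [4,5,7], [4,6,7], [5,6,7]]"
  by (simp add: Let_def)

lemma subseqs_4: "filter (\<lambda>is. length is = 4) (subseqs I7) =
  [[1,2,3,4], [1,2,3,5], [1,2,3,6], [1,2,3,7], [1,2,4,5], [1,2,4,6], [1,2,4,7], [1,2,5,6], [1,2,5,7], [1,2,6,7],
    [1,3,4,5], [1,3,4,6], [1,3,4,7], [1,3,5,6], [1,3,5,7], [1,3,6,7], [1,4,5,6], [1,4,5,7], [1,4,6,7], [1,5,6,7],
    [2,3,4,5], [2,3,4,6], [2,3,4,7], [2,3,5,6], [2,3,5,7], [2,3,6,7], [2,4,5,6], [2,4,5,7], [2,4,6,7], [2,5,6,7],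
    [3,4,5,6], [3,4,5,7], [3,4,6,7], [3,5,6,7], [4,5,6,7]]"
  by (simp add: Let_def)

lemma altf_eqI_7:
  assumes "altf k \<alpha>" "altf k \<beta>"
    and "\<forall>is\<in>set (filter (\<lambda>is. length is = k) (subseqs I7)). \<alpha> (map ax is) = \<beta> (map ax is)"
    and "length vs = k"
  shows "\<alpha> vs = \<beta> vs"
  by (rule altf_eqI[OF assms(1,2) I7(1,2) _ assms(4)]) (use assms(3) in \<open>simp only: set_filter mem_Collect_eq Ball_def imp_conjL\<close>)

text \<open>All contractions of \<open>phi\<close> with itself come from here. By
  \<open>cr_inner\<close> the defect \<open>Q\<close> from the Gram determinant vanishes on repeated
  arguments, so it is a 4-form and a comparison on increasing indices identifies it.\<close>

lemma cr_inner_psi: "cr x y \<bullet> cr z w = (x \<bullet> z) * (y \<bullet> w) - (x \<bullet> w) * (y \<bullet> z) + psi [x, y, z, w]"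
proof -
  define Q where "Q vs = cr (vs ! 0) (vs ! 1) \<bullet> cr (vs ! 2) (vs ! 3) - (vs ! 0 \<bullet> vs ! 2) * (vs ! 1 \<bullet> vs ! 3)
     + (vs ! 0 \<bullet> vs ! 3) * (vs ! 1 \<bullet> vs ! 2)" for vs :: "(real ^ 7) list"
  have "altf 4 Q"
    unfolding altf_def multilin_def
  proof safe
    fix vs :: "(real ^ 7) list" and m :: nat and v w :: "real ^ 7" and a b :: real
    assume "length vs = 4" "m < 4"
    then show "Q (vs[m := a *\<^sub>R v + b *\<^sub>R w]) = a * Q (vs[m := v]) + b * Q (vs[m := w])"
      unfolding length4 less4
      by (elim disjE exE)
        (simp_all add: Q_def cr_linear inner_add_left inner_add_right algebra_simps)
  next
    fix vs :: "(real ^ 7) list"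
    assume "length vs = 4" "\<not> distinct vs"
    then obtain x y z w where vs: "vs = [x, y, z, w]"
      and "x = y \<or> x = z \<or> x = w \<or> y = z \<or> y = w \<or> z = w"
      unfolding length4 by auto
    then show "Q vs = 0"
      using cr_inner[of x y w] cr_inner[of x y z] cr_inner[of y x w] cr_inner[of w x z]
        cr_skew[of x y] cr_skew[of x w] cr_skew[of y z] cr_skew[of z w] cr_skew[of y w]
      by (elim disjE) (auto simp: Q_def cr_self inner_commute algebra_simps)
  qed
  then have "Q [x, y, z, w] = psi [x, y, z, w]"
  proof (rule altf_eqI_7[OF _ altf_psi])
    show "\<forall>is\<in>set (filter (\<lambda>is. length is = 4) (subseqs I7)). Q (map ax is) = psi (map ax is)"
      unfolding subseqs_4 by (simp add: Q_def ax_inner ax_nth inner_7 cr_nth phi_ph psi_ps ph_table ps_table ph_eq ps_eq)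
  qed simp
  then show ?thesis by (simp add: Q_def)
qed

text \<open>A wedge product without permutations: the arguments are dealt out one by one to
  \<open>as\<close> and \<open>bs\<close>, while \<open>k\<close> and \<open>l\<close> count the
  slots still free. A vector given to \<beta> passes the \<open>k\<close> arguments that \<alpha>
  still awaits, whence its sign.\<close>

primrec shuffle :: "'v covector \<Rightarrow> 'v covector \<Rightarrow> nat \<Rightarrow> nat \<Rightarrow> 'v list \<Rightarrow> 'v list \<Rightarrow> 'v list \<Rightarrow> real" where
  "shuffle \<alpha> \<beta> k l as bs [] = \<alpha> as * \<beta> bs"
| "shuffle \<alpha> \<beta> k l as bs (v # vs) =
     (if k = 0 then 0 else shuffle \<alpha> \<beta> (k - 1) l (as @ [v]) bs vs)
   + (if l = 0 then 0 else (-1) ^ k * shuffle \<alpha> \<beta> k (l - 1) as (bs @ [v]) vs)"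

lemma wedge_shuffle_aux:
  "altf k (\<lambda>ws. \<alpha> (as @ ws)) \<Longrightarrow> altf l (\<lambda>ws. \<beta> (bs @ ws)) \<Longrightarrow> length vs = k + l \<Longrightarrow>
   wedge k l (\<lambda>ws. \<alpha> (as @ ws)) (\<lambda>ws. \<beta> (bs @ ws)) vs = shuffle \<alpha> \<beta> k l as bs vs"
proof (induction vs arbitrary: k l as bs)
  case Nil
  then show ?case by (simp add: wedge_0_0)
next
  case (Cons v vs)
  have 1: "wedge (k - 1) l (\<lambda>ws. \<alpha> (as @ v # ws)) (\<lambda>ws. \<beta> (bs @ ws)) vs
      = shuffle \<alpha> \<beta> (k - 1) l (as @ [v]) bs vs" if "k \<noteq> 0"
    using Cons.IH[of "k - 1" "as @ [v]" l bs] altf_tail[of "k - 1" "\<lambda>ws. \<alpha> (as @ ws)" v] Cons.prems that by simp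
  have 2: "wedge k (l - 1) (\<lambda>ws. \<alpha> (as @ ws)) (\<lambda>ws. \<beta> (bs @ v # ws)) vs
      = shuffle \<alpha> \<beta> k (l - 1) as (bs @ [v]) vs" if "l \<noteq> 0"
    using Cons.IH[of k as "l - 1" "bs @ [v]"] altf_tail[of "l - 1" "\<lambda>ws. \<beta> (bs @ ws)" v] Cons.prems that by simp
  show ?case
    using wedge_Cons[OF Cons.prems(1,2), of vs v] Cons.prems(3) 1 2 by auto
qed

lemma wedge_shuffle:
  "altf k \<alpha> \<Longrightarrow> altf l \<beta> \<Longrightarrow> length vs = k + l \<Longrightarrow> wedge k l \<alpha> \<beta> vs = shuffle \<alpha> \<beta> k l [] [] vs"
  using wedge_shuffle_aux[of k \<alpha> "[]" l \<beta> "[]" vs] by simp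

subsection \<open>The metric determined by a definite form\<close>

text \<open>The bilinear form given by contracting \<open>s\<close> with \<open>v\<close> and with
  \<open>w\<close> and wedging both with \<open>s\<close>; the resulting 7-form is read off on the
  standard basis. It encodes the metric and the orientation of a definite form together.\<close>

definition bform :: "(real ^ 7) covector \<Rightarrow> real ^ 7 \<Rightarrow> real ^ 7 \<Rightarrow> real" where
  "bform s v w = wedge 2 5 (\<lambda>ws. s (v # ws)) (wedge 2 3 (\<lambda>ws. s (w # ws)) s) (map ax I7)"

lemma altf_tail3: "altf 3 \<alpha> \<Longrightarrow> altf 2 (\<lambda>ws. \<alpha> (v # ws))"
  using altf_tail[of 2 \<alpha> v] by (simp add: numeral_3_eq_3 numeral_2_eq_2)

lemma phi_cyc: "phi [x, y, z] = phi [y, z, x]"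
  using alt_phi(1)[of x y z] alt_phi(2)[of y x z] by simp

lemma phi_first: "phi [v, ax i, ax j] = (\<Sum>k\<in>UNIV. v $ k * ph k i j)"
proof -
  have "ph k i j = phi [ax i, ax j, ax k]" for k unfolding ph_def by (rule phi_cyc)
  then show ?thesis using phi_cyc[of v "ax i" "ax j"] phi_last[of "ax i" "ax j" v] by simp
qed
lemma bform_phi: "bform phi v w = 6 * (v \<bullet> w)"
proof -
  have 5: "wedge 2 3 (\<lambda>ws. phi (w # ws)) phi vs = shuffle (\<lambda>ws. phi (w # ws)) phi 2 3 [] [] vs"
    if "length vs = 5" for vs
    using wedge_shuffle[OF altf_tail3[OF altf_phi] altf_phi] that by simp
  have "altf 5 (wedge 2 3 (\<lambda>ws. phi (w # ws)) phi)"
    using altf_wedge[OF altf_tail3[OF altf_phi] altf_phi] by simp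
  from wedge_shuffle[OF altf_tail3[OF altf_phi] this]
  have 7: "bform phi v w = shuffle (\<lambda>ws. phi (v # ws)) (wedge 2 3 (\<lambda>ws. phi (w # ws)) phi) 2 5 [] [] (map ax I7)"
    by (simp add: bform_def)
  show ?thesis
    unfolding 7
    by (simp add: 5 phi_first ax_nth sum_7 ph_table ph_eq inner_7 del: One_nat_def)
qed

text \<open>A 7-form pulled back by \<open>u\<close> acquires the determinant of \<open>u\<close>.
  The metric is thus known only up to this factor until \<open>det_of\<close> isolates it.\<close>

lemma bform_pullback:
  assumes u: "linear u" and s: "\<And>vs. length vs = 3 \<Longrightarrow> s vs = phi (map u vs)"
  shows "bform s v w = det (\<chi> i. u (ax i)) * (6 * (u v \<bullet> u w))"
proof -
  let ?\<beta> = "wedge 2 3 (\<lambda>ws. phi (u w # ws)) phi"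
  have "bform s v w = wedge 2 5 (pullback u (\<lambda>ws. phi (u v # ws))) (pullback u ?\<beta>) (map ax I7)"
    unfolding bform_def
  proof (rule wedge_cong)
    fix vs :: "(real ^ 7) list" assume l: "length vs = 5"
    have "wedge 2 3 (\<lambda>ws. s (w # ws)) s vs = wedge 2 3 (pullback u (\<lambda>ws. phi (u w # ws))) (pullback u phi) vs"
      by (rule wedge_cong) (simp_all add: s pullback_def)
    also have "\<dots> = pullback u ?\<beta> vs" using wedge_pullback[of vs 2 3] l by (simp add: pullback_def)
    finally show "wedge 2 3 (\<lambda>ws. s (w # ws)) s vs = pullback u ?\<beta> vs" .
  qed (simp add: s pullback_def)
  also have "\<dots> = wedge 2 5 (\<lambda>ws. phi (u v # ws)) ?\<beta> (map u (map ax I7))"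
    by (rule wedge_pullback) simp
  also have "\<dots> = wedge 2 5 (\<lambda>ws. phi (u v # ws)) ?\<beta> (map (\<lambda>i. u (ax i)) I7)"
    by simp
  also have "\<dots> = det (\<chi> i. u (ax i)) * bform phi (u v) (u w)"
    unfolding bform_def
  proof (rule top_form_det[OF _ I7(1,2)])
    have "altf 5 ?\<beta>" using altf_wedge[OF altf_tail3[OF altf_phi] altf_phi] by simp
    then have "altf 7 (wedge 2 5 (\<lambda>ws. phi (u v # ws)) ?\<beta>)"
      using altf_wedge[OF altf_tail3[OF altf_phi], of 5 ?\<beta> "u v"] by simp
    then show "altf (length I7) (wedge 2 5 (\<lambda>ws. phi (u v # ws)) ?\<beta>)" unfolding I7(3) .
  qed
  finally show ?thesis by (simp add: bform_phi)
qed

subsection \<open>Frames adapted to \<open>phi\<close>\<close>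

text \<open>The rows multiply like the imaginary octonion units: \<open>a\<close>, \<open>b\<close>,
  \<open>d\<close> generate and the other four are products of them. The minus sign in the last row
  reflects the coefficient -1 of the basis form 347 in \<open>phi\<close>.\<close>

definition g2_frame :: "real ^ 7 \<Rightarrow> real ^ 7 \<Rightarrow> real ^ 7 \<Rightarrow> real ^ 7 ^ 7" where
  "g2_frame a b d = (\<chi> i. if i = 1 then a else if i = 2 then b else if i = 3 then cr a b else if i = 4 then d
     else if i = 5 then cr a d else if i = 6 then cr b d else - cr (cr a b) d)"

text \<open>Such triples are exactly what a G2-frame can start with. \<open>transpose K\<close>
  sends the standard basis to the rows of \<open>K\<close>, whose cross and inner products are all
  forced by \<open>cr_cr\<close> and \<open>cr_inner\<close>, so it preserves \<open>phi\<close> and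
  the metric; \<open>K\<close> is its inverse.\<close>

lemma g2_frame_phi:
  assumes n: "a \<bullet> a = 1" "b \<bullet> b = 1" "d \<bullet> d = 1" and o: "a \<bullet> b = 0" "a \<bullet> d = 0" "b \<bullet> d = 0" "d \<bullet> cr a b = 0"
  defines "K \<equiv> g2_frame a b d"
  shows "transpose K ** K = mat 1" and "phi [K *v x, K *v y, K *v z] = phi [x, y, z]"
proof -
  define c e f h where "c = cr a b" and "e = cr a d" and "f = cr b d" and "h = - cr c d"
  have o': "b \<bullet> a = 0" "d \<bullet> a = 0" "d \<bullet> b = 0" "c \<bullet> d = 0" "d \<bullet> c = 0"
    using o by (simp_all add: inner_commute c_def)
  have perp1: "cr x y \<bullet> x = 0" "cr x y \<bullet> y = 0" for x y
    using alt_phi(5,6)[of x y] by (simp_all add: phi_cr)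
  have perp: "cr x y \<bullet> x = 0" "cr x y \<bullet> y = 0 \<and> y \<bullet> cr x y = 0" "x \<bullet> cr x y = 0" for x y
    using perp1[of x y] by (simp_all add: inner_commute[of _ "cr x y"])
  have cyc: "cr x y \<bullet> z = cr y z \<bullet> x" for x y z
    using phi_cyc[of x y z] by (simp add: phi_cr)
  have dbl: "cr x (cr x z) = (- (x \<bullet> x)) *\<^sub>R z + (x \<bullet> z) *\<^sub>R x" for x z
  proof -
    have "cr x (cr x z) $ i = ((- (x \<bullet> x)) *\<^sub>R z + (x \<bullet> z) *\<^sub>R x) $ i" for i
      using arg_cong[OF cr_cr[of x x z], of "\<lambda>v. v $ i"]
      unfolding vector_add_component vector_scaleR_component real_scaleR_def by algebra
    then show ?thesis by (simp add: vec_eq_iff)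
  qed
  have ca: "c \<bullet> a = 0" "a \<bullet> c = 0" "c \<bullet> b = 0" "b \<bullet> c = 0" "c \<bullet> c = 1"
    using perp[of a b] cr_inner[of a b b] n o o' by (simp_all add: c_def)
  have ac: "cr a c = - b" using dbl[of a b] n o by (simp add: c_def)
  have bc: "cr b c = a"
    using dbl[of b a] cr_skew[of a b] n o' by (simp add: c_def cr_minus)
  have ea: "e \<bullet> a = 0" "a \<bullet> e = 0" "e \<bullet> d = 0" "d \<bullet> e = 0" "e \<bullet> e = 1"
    using perp[of a d] cr_inner[of a d d] n o o' by (simp_all add: e_def)
  have eb: "e \<bullet> b = 0" "b \<bullet> e = 0"
    using cyc[of a b d] cyc[of b d a] cr_skew[of a d] o by (simp_all add: e_def inner_commute)
  have ec: "e \<bullet> c = 0" "c \<bullet> e = 0"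
    using cr_inner[of a d b] cr_inner[of a b d] n o o' by (simp_all add: e_def c_def)
  have fa: "f \<bullet> b = 0" "b \<bullet> f = 0" "f \<bullet> d = 0" "d \<bullet> f = 0" "f \<bullet> f = 1"
    using perp[of b d] cr_inner[of b d d] n o o' by (simp_all add: f_def)
  have fb: "f \<bullet> a = 0" "a \<bullet> f = 0"
    using cyc[of a b d] o by (simp_all add: f_def inner_commute)
  have fc: "f \<bullet> c = 0" "c \<bullet> f = 0"
    using cr_inner[of b d a] cr_inner[of b a d] cr_skew[of a b] n o o' by (simp_all add: f_def c_def)
  have fe: "f \<bullet> e = 0" "e \<bullet> f = 0"
    using cr_inner[of d b a] cr_inner[of d a b] cr_skew[of d a] cr_skew[of d b] n o o' by (simp_all add: f_def e_def)
  have hc: "h \<bullet> c = 0" "c \<bullet> h = 0" "h \<bullet> d = 0" "d \<bullet> h = 0" "h \<bullet> h = 1"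
    using perp[of c d] cr_inner[of c d d] n o o' ca by (simp_all add: h_def)
  have ha: "h \<bullet> a = 0" "a \<bullet> h = 0"
    using cyc[of a c d] ac o' by (simp_all add: h_def inner_commute)
  have hb: "h \<bullet> b = 0" "b \<bullet> h = 0"
    using cyc[of b c d] bc o by (simp_all add: h_def inner_commute)
  have he: "h \<bullet> e = 0" "e \<bullet> h = 0"
    using cr_inner[of d c a] cr_inner[of d a c] cr_skew[of d c] cr_skew[of d a] n o o' ca by (simp_all add: h_def e_def)
  have hf: "h \<bullet> f = 0" "f \<bullet> h = 0"
    using cr_inner[of d c b] cr_inner[of d b c] cr_skew[of d c] cr_skew[of d b] n o o' ca by (simp_all add: h_def f_def)
  note inners = n o o' ca ea eb ec fa fb fc fe hc ha hb he hf
  have ae: "cr a e = - d" using dbl[of a d] n o by (simp add: e_def)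
  have bf: "cr b f = - d" using dbl[of b d] n o by (simp add: f_def)
  have dc: "cr d c = h" and cd: "cr c d = - h" using cr_skew[of d c] by (simp_all add: h_def)
  have db: "cr d b = - f" and ba: "cr b a = - c" and da: "cr d a = - e"
    using cr_skew[of d b] cr_skew[of b a] cr_skew[of d a] by (simp_all add: f_def c_def e_def)
  note folds = c_def[symmetric] e_def[symmetric] f_def[symmetric] cd db ba da dc cr_minus
  \<comment> \<open>From here the multiplication table of the rows is filled in: each use of
    \<open>cr_cr\<close> expresses a new product by products already known.\<close>
  have "cr a f + cr b e = 0" using cr_cr[of a b d] unfolding folds by (simp add: inners)
  from minus_unique[OF this] have be: "cr b e = - cr a f" by simp
  have "- cr a f + h = 0" using cr_cr[of a d b] unfolding folds by (simp add: inners)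
  from minus_unique[OF this] have af: "cr a f = h" by simp
  have ah: "cr a h = - f" using dbl[of a f] unfolding af by (simp add: inners)
  have "f + cr c e = 0" using cr_cr[of c a d] unfolding folds by (simp add: inners ah add.commute)
  from minus_unique[OF this] have ce: "cr c e = - f" by simp
  have bh: "cr b h = e" using dbl[of b e] unfolding be af by (simp add: inners cr_minus)
  have "- e + cr c f = 0" using cr_cr[of c b d] unfolding folds by (simp add: inners bh)
  from minus_unique[OF this] have cf: "cr c f = e" by simp
  have de: "cr d e = a" using dbl[of d a] unfolding folds by (simp add: inners)
  have df: "cr d f = b" using dbl[of d b] unfolding folds by (simp add: inners)
  have ed: "cr e d = - a" using cr_skew[of e d] de by simp
  have "c + cr e f = 0" using cr_cr[of e b d] unfolding folds ed by (simp add: inners add.commute)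
  from minus_unique[OF this] have ef: "cr e f = - c" by simp
  define k where "k i = K $ i" for i
  have k: "k 1 = a" "k 2 = b" "k 3 = c" "k 4 = d" "k 5 = e" "k 6 = f" "k 7 = h"
    by (simp_all add: k_def K_def g2_frame_def c_def e_def f_def h_def)
  have orth: "k i \<bullet> k j = (if i = j then 1 else 0)" for i j
  proof -
    have "\<forall>i j. k i \<bullet> k j = (if i = j then 1 else 0)"
      unfolding forall_7 k by (simp add: inners)
    then show ?thesis by blast
  qed
  have "K ** transpose K = mat 1"
    using orth by (simp add: vec_eq_iff matrix_matrix_mult_def transpose_def mat_def k_def inner_vec_def)
  then show KK: "transpose K ** K = mat 1" by (simp add: matrix_left_right_inverse)
  have kax: "transpose K *v ax i = k i" for i
    by (simp add: matrix_vector_mult_basis column_def transpose_def k_def vec_eq_iff)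
  have kax': "ax i v* K = k i" for i using kax[of i] by (simp add: transpose_matrix_vector)
  have pk: "phi [k i, k j, k l] = cr (k i) (k j) \<bullet> k l" for i j l by (rule phi_cr)
  have "phi [transpose K *v x, transpose K *v y, transpose K *v z] = phi [x, y, z]" for x y z
  proof -
    have "pullback ((*v) (transpose K)) phi [x, y, z] = phi [x, y, z]"
    proof (rule altf_eqI_7[OF _ altf_phi])
      show "altf 3 (pullback ((*v) (transpose K)) phi)"
        by (rule altf_pullback[OF matrix_vector_mul_linear altf_phi])
      show "\<forall>is\<in>set (filter (\<lambda>is. length is = 3) (subseqs I7)).
          pullback ((*v) (transpose K)) phi (map ax is) = phi (map ax is)"
        unfolding subseqs_3 by (simp add: pullback_def phi_ph ph_table kax' pk)
          (simp add: k inners c_def[symmetric] e_def[symmetric] f_def[symmetric] cd ac bc ae be af bf ce cf de df ef)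
    qed simp
    then show ?thesis by (simp add: pullback_def)
  qed
  \<comment> \<open>\<open>transpose K\<close> inverts \<open>K\<close>, so invariance under the one
    gives invariance under the other.\<close>
  from this[of "K *v x" "K *v y" "K *v z"]
  show "phi [K *v x, K *v y, K *v z] = phi [x, y, z]"
    by (simp add: matrix_vector_mul_assoc KK)
qed

section \<open>Calculus of smooth functions\<close>

lemma frechet_derivative_eqI: "(f has_derivative f') (at x) \<Longrightarrow> frechet_derivative f (at x) = f'"
  by (rule frechet_derivative_at[symmetric])

lemma frechet_derivative_cong:
  assumes "open S" "x \<in> S" "\<And>y. y \<in> S \<Longrightarrow> f y = g y"
  shows "frechet_derivative f (at x) = frechet_derivative g (at x)"
proof -
  have "(f has_derivative f') (at x) \<longleftrightarrow> (g has_derivative f') (at x)" for f'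
    using has_derivative_transform_within_open[of f f' x UNIV S g]
      has_derivative_transform_within_open[of g f' x UNIV S f] assms by fastforce
  then show ?thesis unfolding frechet_derivative_def by simp
qed

lemma differentiable_cong:
  assumes "open S" "x \<in> S" "\<And>y. y \<in> S \<Longrightarrow> f y = g y"
  shows "f differentiable (at x) \<longleftrightarrow> g differentiable (at x)"
proof -
  have "(f has_derivative f') (at x) \<longleftrightarrow> (g has_derivative f') (at x)" for f'
    using has_derivative_transform_within_open[of f f' x UNIV S g]
      has_derivative_transform_within_open[of g f' x UNIV S f] assms by fastforce
  then show ?thesis unfolding differentiable_def by simp
qed

lemma Ck_on_cong:
  assumes "open S" "\<And>y. y \<in> S \<Longrightarrow> f y = g y"
  shows "Ck_on k S f \<longleftrightarrow> Ck_on k S g"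
  using assms(2)
proof (induction k arbitrary: f g)
  case 0
  then show ?case using continuous_on_cong[of S S f g] by simp
next
  case (Suc k)
  have "f differentiable (at x) \<longleftrightarrow> g differentiable (at x)" if "x \<in> S" for x
    using differentiable_cong[OF assms(1) that] Suc.prems by blast
  moreover have "Ck_on k S (\<lambda>x. frechet_derivative f (at x) v) \<longleftrightarrow> Ck_on k S (\<lambda>x. frechet_derivative g (at x) v)" for v
    by (rule Suc.IH) (use frechet_derivative_cong[OF assms(1)] Suc.prems in metis)
  ultimately show ?case by simp
qed

lemma Ck_on_Suc_imp: "Ck_on (Suc k) S f \<Longrightarrow> Ck_on k S f"
proof (induction k arbitrary: f)
  case 0
  then show ?case
    by (auto intro!: continuous_at_imp_continuous_on differentiable_imp_continuous_within)
next
  case (Suc k)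
  have "Ck_on k S (\<lambda>x. frechet_derivative f (at x) v)" for v
    by (rule Suc.IH) (use Suc.prems in simp)
  then show ?case using Suc.prems by simp
qed

text \<open>The derivative may be given by a formula that is valid on \<open>S\<close> only; since
  \<open>S\<close> is open, its values elsewhere do not influence the iterated derivatives.\<close>

lemma Ck_on_SucI:
  assumes "open S" "\<And>x. x \<in> S \<Longrightarrow> (f has_derivative f' x) (at x)"
    and "\<And>v. Ck_on k S (\<lambda>x. f' x v)"
  shows "Ck_on (Suc k) S f"
proof -
  have "Ck_on k S (\<lambda>x. frechet_derivative f (at x) v)" for v
    using Ck_on_cong[OF assms(1), of "\<lambda>x. frechet_derivative f (at x) v" "\<lambda>x. f' x v" k]
      frechet_derivative_eqI[OF assms(2)] assms(3) by simp
  then show ?thesis using assms(2) by (auto simp: differentiable_def)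
qed

lemma Ck_on_has_derivative:
  "Ck_on (Suc k) S f \<Longrightarrow> x \<in> S \<Longrightarrow> (f has_derivative frechet_derivative f (at x)) (at x)"
  using frechet_derivative_works by auto

lemma Ck_on_deriv: "Ck_on (Suc k) S f \<Longrightarrow> Ck_on k S (\<lambda>x. frechet_derivative f (at x) v)"
  by simp

lemma Ck_on_const: "Ck_on k S (\<lambda>x. c)"
proof (induction k arbitrary: c)
  case (Suc k)
  have "frechet_derivative (\<lambda>x. c) (at x) = (\<lambda>v. 0)" for x :: 'a
    by (rule frechet_derivative_eqI) (rule has_derivative_const)
  then show ?case using Suc by simp
qed simp

lemma Ck_on_bounded_linear:
  assumes "open S" "bounded_linear L"
  shows "Ck_on k S f \<Longrightarrow> Ck_on k S (\<lambda>x. L (f x))"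
proof (induction k arbitrary: f)
  case 0
  then show ?case by (simp add: bounded_linear.continuous_on[OF assms(2)])
next
  case (Suc k)
  show ?case
  proof (rule Ck_on_SucI[OF assms(1)])
    show "((\<lambda>x. L (f x)) has_derivative (\<lambda>v. L (frechet_derivative f (at x) v))) (at x)" if "x \<in> S" for x
      by (rule bounded_linear.has_derivative[OF assms(2) Ck_on_has_derivative[OF Suc.prems that]])
    show "Ck_on k S (\<lambda>x. L (frechet_derivative f (at x) v))" for v
      by (rule Suc.IH[OF Ck_on_deriv[OF Suc.prems]])
  qed
qed

lemma Ck_on_add:
  assumes "open S"
  shows "Ck_on k S f \<Longrightarrow> Ck_on k S g \<Longrightarrow> Ck_on k S (\<lambda>x. f x + g x)"
proof (induction k arbitrary: f g)
  case (Suc k)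
  show ?case
    by (rule Ck_on_SucI[OF assms has_derivative_add[OF Ck_on_has_derivative[OF Suc.prems(1)] Ck_on_has_derivative[OF Suc.prems(2)]]])
      (use Suc.IH[OF Ck_on_deriv[OF Suc.prems(1)] Ck_on_deriv[OF Suc.prems(2)]] in auto)
qed (auto intro: continuous_on_add)

lemma Ck_on_mult:
  fixes f g :: "'a::euclidean_space \<Rightarrow> real"
  assumes "open S"
  shows "Ck_on k S f \<Longrightarrow> Ck_on k S g \<Longrightarrow> Ck_on k S (\<lambda>x. f x * g x)"
proof (induction k arbitrary: f g)
  case (Suc k)
  show ?case
  proof (rule Ck_on_SucI[OF assms, where f' = "\<lambda>x v. f x * frechet_derivative g (at x) v + frechet_derivative f (at x) v * g x"])
    fix x assume "x \<in> S"
    from has_derivative_mult[OF Ck_on_has_derivative[OF Suc.prems(1) this] Ck_on_has_derivative[OF Suc.prems(2) this]]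
    show "((\<lambda>x. f x * g x) has_derivative (\<lambda>v. f x * frechet_derivative g (at x) v + frechet_derivative f (at x) v * g x)) (at x)" .
  next
    fix v
    show "Ck_on k S (\<lambda>x. f x * frechet_derivative g (at x) v + frechet_derivative f (at x) v * g x)"
      by (rule Ck_on_add[OF assms Suc.IH[OF Ck_on_Suc_imp[OF Suc.prems(1)] Ck_on_deriv[OF Suc.prems(2)]]
            Suc.IH[OF Ck_on_deriv[OF Suc.prems(1)] Ck_on_Suc_imp[OF Suc.prems(2)]]])
  qed
qed (auto intro: continuous_on_mult)

lemma Ck_on_compose_real:
  fixes f :: "'a::euclidean_space \<Rightarrow> real"
  assumes S: "open S" and f: "Ck_on (Suc k) S f"
    and h: "\<And>x. x \<in> S \<Longrightarrow> (h has_real_derivative h' x) (at (f x))" and h': "Ck_on k S h'"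
  shows "Ck_on (Suc k) S (\<lambda>x. h (f x))"
proof (rule Ck_on_SucI[OF S])
  fix x assume x: "x \<in> S"
  have "(h has_derivative (\<lambda>v. h' x * v)) (at (f x))"
    using h[OF x] by (simp add: has_field_derivative_def)
  from has_derivative_compose[OF Ck_on_has_derivative[OF f x] this]
  show "((\<lambda>x. h (f x)) has_derivative (\<lambda>v. h' x * frechet_derivative f (at x) v)) (at x)" .
next
  show "Ck_on k S (\<lambda>x. h' x * frechet_derivative f (at x) v)" for v
    by (intro Ck_on_mult[OF S] h' Ck_on_deriv f)
qed

text \<open>The derivative of \<open>inverse\<close> is written through \<open>inverse\<close>
  itself, so the induction hypothesis covers it. The square root and the ninth root follow the same
  pattern.\<close>

lemma Ck_on_inverse:
  fixes f :: "'a::euclidean_space \<Rightarrow> real"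
  assumes S: "open S" and nz: "\<And>x. x \<in> S \<Longrightarrow> f x \<noteq> 0"
  shows "Ck_on k S f \<Longrightarrow> Ck_on k S (\<lambda>x. inverse (f x))"
proof (induction k)
  case 0
  then show ?case using nz by (auto intro: continuous_on_inverse)
next
  case (Suc k)
  note IH = Suc.IH[OF Ck_on_Suc_imp[OF Suc.prems]]
  show ?case
  proof (rule Ck_on_compose_real[OF S Suc.prems, where h' = "\<lambda>x. - 1 * (inverse (f x) * inverse (f x))"])
    show "(inverse has_real_derivative - 1 * (inverse (f x) * inverse (f x))) (at (f x))" if "x \<in> S" for x
      using DERIV_inverse[OF nz[OF that]] by (simp add: power2_eq_square numeral_2_eq_2)
    show "Ck_on k S (\<lambda>x. - 1 * (inverse (f x) * inverse (f x)))"
      by (intro Ck_on_mult[OF S] Ck_on_const IH)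
  qed
qed

lemma Ck_on_sqrt:
  fixes f :: "'a::euclidean_space \<Rightarrow> real"
  assumes S: "open S" and pos: "\<And>x. x \<in> S \<Longrightarrow> f x > 0"
  shows "Ck_on k S f \<Longrightarrow> Ck_on k S (\<lambda>x. sqrt (f x))"
proof (induction k)
  case 0
  then show ?case by (auto intro: continuous_on_real_sqrt)
next
  case (Suc k)
  note IH = Suc.IH[OF Ck_on_Suc_imp[OF Suc.prems]]
  show ?case
  proof (rule Ck_on_compose_real[OF S Suc.prems, where h' = "\<lambda>x. inverse (sqrt (f x)) * (1 / 2)"])
    show "(sqrt has_real_derivative inverse (sqrt (f x)) * (1 / 2)) (at (f x))" if "x \<in> S" for x
      using DERIV_real_sqrt[OF pos[OF that]] by simp
    show "Ck_on k S (\<lambda>x. inverse (sqrt (f x)) * (1 / 2))"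
      by (intro Ck_on_mult[OF S] Ck_on_const Ck_on_inverse[OF S] IH) (use pos in force)
  qed
qed

text \<open>The ninth root will recover a determinant of either sign, so negative arguments must be
  allowed. Its derivative is rewritten as \<open>root 9 y / (9 * y)\<close> to close the
  induction.\<close>

lemma Ck_on_root9:
  fixes f :: "'a::euclidean_space \<Rightarrow> real"
  assumes S: "open S" and nz: "\<And>x. x \<in> S \<Longrightarrow> f x \<noteq> 0"
  shows "Ck_on k S f \<Longrightarrow> Ck_on k S (\<lambda>x. root 9 (f x))"
proof (induction k)
  case 0
  then show ?case by (auto intro: continuous_on_real_root)
next
  case (Suc k)
  note IH = Suc.IH[OF Ck_on_Suc_imp[OF Suc.prems]]
  have inv: "inverse (9 * root 9 y ^ 8) = root 9 y * inverse (9 * y)" if "y \<noteq> 0" for y :: real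
  proof -
    have "root 9 y ^ 9 = y" by (rule odd_real_root_pow) simp
    then have "root 9 y * root 9 y ^ 8 = y" by (simp flip: power_Suc)
    then show ?thesis using that by (auto simp: field_simps)
  qed
  show ?case
  proof (rule Ck_on_compose_real[OF S Suc.prems, where h' = "\<lambda>x. root 9 (f x) * inverse (9 * f x)"])
    show "(root 9 has_real_derivative root 9 (f x) * inverse (9 * f x)) (at (f x))" if "x \<in> S" for x
      using DERIV_odd_real_root[of 9 "f x"] nz[OF that] inv[OF nz[OF that]] by simp
    show "Ck_on k S (\<lambda>x. root 9 (f x) * inverse (9 * f x))"
      by (intro Ck_on_mult[OF S] Ck_on_const Ck_on_inverse[OF S] IH Ck_on_Suc_imp[OF Suc.prems]) (use nz in force)
  qed
qed

subsection \<open>Closure properties of smoothness\<close>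

lemma smooth_on_cong: "open S \<Longrightarrow> (\<And>y. y \<in> S \<Longrightarrow> f y = g y) \<Longrightarrow> smooth_on S f \<longleftrightarrow> smooth_on S g"
  using Ck_on_cong[of S f g] by (simp add: smooth_on_def)

lemma smooth_on_const: "smooth_on S (\<lambda>x. c)"
  by (simp add: smooth_on_def Ck_on_const)

lemma smooth_on_add: "open S \<Longrightarrow> smooth_on S f \<Longrightarrow> smooth_on S g \<Longrightarrow> smooth_on S (\<lambda>x. f x + g x)"
  by (simp add: smooth_on_def Ck_on_add)

lemma smooth_on_mult:
  fixes f g :: "'a::euclidean_space \<Rightarrow> real"
  shows "open S \<Longrightarrow> smooth_on S f \<Longrightarrow> smooth_on S g \<Longrightarrow> smooth_on S (\<lambda>x. f x * g x)"
  by (simp add: smooth_on_def Ck_on_mult)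

lemma smooth_on_uminus:
  fixes f :: "'a::euclidean_space \<Rightarrow> real"
  shows "open S \<Longrightarrow> smooth_on S f \<Longrightarrow> smooth_on S (\<lambda>x. - f x)"
  using smooth_on_mult[of S "\<lambda>x. -1" f] smooth_on_const[of S "-1 :: real"] by simp

lemma smooth_on_diff:
  fixes f g :: "'a::euclidean_space \<Rightarrow> real"
  shows "open S \<Longrightarrow> smooth_on S f \<Longrightarrow> smooth_on S g \<Longrightarrow> smooth_on S (\<lambda>x. f x - g x)"
  using smooth_on_add[of S f "\<lambda>x. - g x"] smooth_on_uminus[of S g] by simp

lemma smooth_on_inverse:
  fixes f :: "'a::euclidean_space \<Rightarrow> real"
  shows "open S \<Longrightarrow> smooth_on S f \<Longrightarrow> (\<And>x. x \<in> S \<Longrightarrow> f x \<noteq> 0) \<Longrightarrow> smooth_on S (\<lambda>x. inverse (f x))"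
  by (simp add: smooth_on_def Ck_on_inverse)

lemma smooth_on_divide:
  fixes f g :: "'a::euclidean_space \<Rightarrow> real"
  shows "open S \<Longrightarrow> smooth_on S f \<Longrightarrow> smooth_on S g \<Longrightarrow> (\<And>x. x \<in> S \<Longrightarrow> g x \<noteq> 0) \<Longrightarrow>
    smooth_on S (\<lambda>x. f x / g x)"
  unfolding divide_inverse by (intro smooth_on_mult smooth_on_inverse)

lemma smooth_on_sqrt:
  "open S \<Longrightarrow> smooth_on S f \<Longrightarrow> (\<And>x. x \<in> S \<Longrightarrow> f x > 0) \<Longrightarrow> smooth_on S (\<lambda>x. sqrt (f x))"
  by (simp add: smooth_on_def Ck_on_sqrt)

lemma smooth_on_root9:
  "open S \<Longrightarrow> smooth_on S f \<Longrightarrow> (\<And>x. x \<in> S \<Longrightarrow> f x \<noteq> 0) \<Longrightarrow> smooth_on S (\<lambda>x. root 9 (f x))"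
  by (simp add: smooth_on_def Ck_on_root9)

lemma smooth_on_sum:
  fixes f :: "'i \<Rightarrow> 'a::euclidean_space \<Rightarrow> 'b::real_normed_vector"
  assumes "open S" "\<And>i. i \<in> I \<Longrightarrow> smooth_on S (f i)"
  shows "smooth_on S (\<lambda>x. \<Sum>i\<in>I. f i x)"
  using assms(2) by (induction I rule: infinite_finite_induct) (simp_all add: smooth_on_const smooth_on_add[OF assms(1)])

lemma smooth_on_prod:
  fixes f :: "'i \<Rightarrow> 'a::euclidean_space \<Rightarrow> real"
  assumes "open S" "\<And>i. i \<in> I \<Longrightarrow> smooth_on S (f i)"
  shows "smooth_on S (\<lambda>x. \<Prod>i\<in>I. f i x)"
  using assms(2) by (induction I rule: infinite_finite_induct) (simp_all add: smooth_on_const smooth_on_mult[OF assms(1)])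

lemma smooth_on_bounded_linear: "open S \<Longrightarrow> bounded_linear L \<Longrightarrow> smooth_on S f \<Longrightarrow> smooth_on S (\<lambda>x. L (f x))"
  by (simp add: smooth_on_def Ck_on_bounded_linear)

lemma smooth_on_subset:
  assumes "T \<subseteq> S" "smooth_on S f" shows "smooth_on T f"
proof -
  have "Ck_on k S f \<Longrightarrow> Ck_on k T f" for k
    using assms(1) by (induction k arbitrary: f) (auto intro: continuous_on_subset)
  then show ?thesis using assms(2) by (simp add: smooth_on_def)
qed

lemma smooth_on_deriv: "smooth_on S f \<Longrightarrow> smooth_on S (\<lambda>x. frechet_derivative f (at x) v)"
  unfolding smooth_on_def using Ck_on_deriv by blast

lemma smooth_on_pderiv: "smooth_on S f \<Longrightarrow> smooth_on S (pderiv_at i f)"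
  using smooth_on_deriv[of S f "axis i 1"] by (simp add: pderiv_at_def[abs_def])

lemma smooth_on_has_derivative:
  "smooth_on S f \<Longrightarrow> x \<in> S \<Longrightarrow> (f has_derivative frechet_derivative f (at x)) (at x)"
  using Ck_on_has_derivative[of 0 S f x] by (simp only: smooth_on_def)

lemma smooth_on_continuous: "smooth_on S f \<Longrightarrow> continuous_on S f"
  using Ck_on.simps(1) unfolding smooth_on_def by blast

lemma smooth_on_det:
  fixes A :: "'a::euclidean_space \<Rightarrow> real ^ 'n ^ 'n::finite"
  assumes "open S" "\<And>i j. smooth_on S (\<lambda>x. A x $ i $ j)"
  shows "smooth_on S (\<lambda>x. det (A x))"
  unfolding det_def by (intro smooth_on_sum smooth_on_mult smooth_on_prod smooth_on_const assms)

text \<open>Cramer's rule. It yields smoothness of a solution that is only known pointwise, such as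
  an inverse matrix or a vector defined through an inverse map.\<close>

lemma smooth_on_solve:
  fixes A :: "'a::euclidean_space \<Rightarrow> real ^ 'n ^ 'n::finite"
  assumes S: "open S" and A: "\<And>i j. smooth_on S (\<lambda>x. A x $ i $ j)" and b: "\<And>i. smooth_on S (\<lambda>x. b x $ i)"
    and nz: "\<And>x. x \<in> S \<Longrightarrow> det (A x) \<noteq> 0" and sol: "\<And>x. x \<in> S \<Longrightarrow> A x *v z x = b x"
  shows "smooth_on S (\<lambda>x. z x $ k)"
proof -
  have "smooth_on S (\<lambda>x. det (\<chi> i j. if j = k then b x $ i else A x $ i $ j) / det (A x))"
  proof (intro smooth_on_divide S smooth_on_det A nz)
    show "smooth_on S (\<lambda>x. (\<chi> i j. if j = k then b x $ i else A x $ i $ j) $ i $ j)" for i j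
      by (cases "j = k") (simp_all add: A b)
  qed
  moreover have "z x $ k = det (\<chi> i j. if j = k then b x $ i else A x $ i $ j) / det (A x)" if "x \<in> S" for x
    using cramer[OF nz[OF that], of "z x" "b x"] sol[OF that] by (simp add: vec_eq_iff)
  ultimately show ?thesis using smooth_on_cong[OF S, of "\<lambda>x. z x $ k"] by simp
qed

subsection \<open>Partial derivatives\<close>

lemma frechet_pderiv:
  fixes f :: "real ^ 'n::finite \<Rightarrow> real"
  assumes "f differentiable (at y)"
  shows "frechet_derivative f (at y) v = (\<Sum>i\<in>UNIV. v $ i * pderiv_at i f y)"
proof -
  have lin: "linear (frechet_derivative f (at y))"
    using assms frechet_derivative_works has_derivative_linear by blast
  have "v = (\<Sum>i\<in>UNIV. (v $ i) *\<^sub>R axis i 1)"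
    using basis_expansion[of v] by (simp add: scalar_mult_eq_scaleR)
  then have "frechet_derivative f (at y) v = frechet_derivative f (at y) (\<Sum>i\<in>UNIV. (v $ i) *\<^sub>R axis i 1)"
    by metis
  then show ?thesis by (simp add: linear_sum[OF lin] linear_scale[OF lin] pderiv_at_def)
qed

text \<open>Mean value theorem for the second difference quotient, in both orders.\<close>

lemma second_difference:
  fixes f :: "'a::euclidean_space \<Rightarrow> real"
  assumes S: "open S" and f: "smooth_on S f" and h: "h > 0"
    and sub: "\<And>s t. 0 \<le> s \<Longrightarrow> s \<le> h \<Longrightarrow> 0 \<le> t \<Longrightarrow> t \<le> h \<Longrightarrow> y + s *\<^sub>R u + t *\<^sub>R v \<in> S"
  obtains s t where "0 < s" "s < h" "0 < t" "t < h"
    "f (y + h *\<^sub>R u + h *\<^sub>R v) - f (y + h *\<^sub>R u) - f (y + h *\<^sub>R v) + f y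
      = h * (h * frechet_derivative (\<lambda>x. frechet_derivative f (at x) u) (at (y + s *\<^sub>R u + t *\<^sub>R v)) v)"
proof -
  define Du where "Du x = frechet_derivative f (at x) u" for x
  have Du: "smooth_on S Du" unfolding Du_def[abs_def] by (rule smooth_on_deriv[OF f])
  have d1: "((\<lambda>s. f (y + s *\<^sub>R u + t *\<^sub>R v)) has_real_derivative Du (y + s *\<^sub>R u + t *\<^sub>R v)) (at s)"
    if "0 \<le> s" "s \<le> h" "0 \<le> t" "t \<le> h" for s t
  proof -
    have "((\<lambda>s. y + s *\<^sub>R u + t *\<^sub>R v) has_derivative (\<lambda>r. r *\<^sub>R u)) (at s)"
      by (auto intro!: derivative_eq_intros)
    from has_derivative_compose[OF this smooth_on_has_derivative[OF f sub[OF that]]]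
    have "((\<lambda>s. f (y + s *\<^sub>R u + t *\<^sub>R v)) has_derivative
        (\<lambda>r. frechet_derivative f (at (y + s *\<^sub>R u + t *\<^sub>R v)) (r *\<^sub>R u))) (at s)" .
    moreover have "linear (frechet_derivative f (at (y + s *\<^sub>R u + t *\<^sub>R v)))"
      using smooth_on_has_derivative[OF f sub[OF that]] by (rule has_derivative_linear)
    ultimately show ?thesis
      by (simp add: has_field_derivative_def Du_def linear_scale mult_commute_abs)
  qed
  have d2: "((\<lambda>t. Du (y + s *\<^sub>R u + t *\<^sub>R v)) has_real_derivative
      frechet_derivative Du (at (y + s *\<^sub>R u + t *\<^sub>R v)) v) (at t)"
    if "0 \<le> s" "s \<le> h" "0 \<le> t" "t \<le> h" for s t
  proof -
    have "((\<lambda>t. y + s *\<^sub>R u + t *\<^sub>R v) has_derivative (\<lambda>r. r *\<^sub>R v)) (at t)"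
      by (auto intro!: derivative_eq_intros)
    from has_derivative_compose[OF this smooth_on_has_derivative[OF Du sub[OF that]]]
    have "((\<lambda>t. Du (y + s *\<^sub>R u + t *\<^sub>R v)) has_derivative
        (\<lambda>r. frechet_derivative Du (at (y + s *\<^sub>R u + t *\<^sub>R v)) (r *\<^sub>R v))) (at t)" .
    moreover have "linear (frechet_derivative Du (at (y + s *\<^sub>R u + t *\<^sub>R v)))"
      using smooth_on_has_derivative[OF Du sub[OF that]] by (rule has_derivative_linear)
    ultimately show ?thesis
      by (simp add: has_field_derivative_def linear_scale mult_commute_abs)
  qed
  define g where "g s = f (y + s *\<^sub>R u + h *\<^sub>R v) - f (y + s *\<^sub>R u + 0 *\<^sub>R v)" for s
  have "\<exists>s>0. s < h \<and> g h - g 0 = (h - 0) * (Du (y + s *\<^sub>R u + h *\<^sub>R v) - Du (y + s *\<^sub>R u + 0 *\<^sub>R v))"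
    unfolding g_def using h by (intro MVT2 DERIV_diff d1) auto
  then obtain s where s: "0 < s" "s < h"
    "g h - g 0 = h * (Du (y + s *\<^sub>R u + h *\<^sub>R v) - Du (y + s *\<^sub>R u + 0 *\<^sub>R v))" by auto
  have "\<exists>t>0. t < h \<and> Du (y + s *\<^sub>R u + h *\<^sub>R v) - Du (y + s *\<^sub>R u + 0 *\<^sub>R v)
      = (h - 0) * frechet_derivative Du (at (y + s *\<^sub>R u + t *\<^sub>R v)) v"
    using h s by (intro MVT2 d2) auto
  then obtain t where t: "0 < t" "t < h" "Du (y + s *\<^sub>R u + h *\<^sub>R v) - Du (y + s *\<^sub>R u + 0 *\<^sub>R v)
      = h * frechet_derivative Du (at (y + s *\<^sub>R u + t *\<^sub>R v)) v" by auto
  show ?thesis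
    by (rule that[OF s(1,2) t(1,2)]) (use s(3) t(3) in \<open>simp add: g_def Du_def[abs_def]\<close>)
qed

text \<open>Both mixed derivatives, each at some nearby point, are equal to the same second
  difference quotient; continuity then identifies them at \<open>y\<close>.\<close>

lemma second_derivative_symmetric:
  fixes f :: "'a::euclidean_space \<Rightarrow> real"
  assumes S: "open S" and f: "smooth_on S f" and y: "y \<in> S"
  shows "frechet_derivative (\<lambda>x. frechet_derivative f (at x) u) (at y) v
       = frechet_derivative (\<lambda>x. frechet_derivative f (at x) v) (at y) u"
proof -
  define A where "A x = frechet_derivative (\<lambda>x. frechet_derivative f (at x) u) (at x) v" for x
  define B where "B x = frechet_derivative (\<lambda>x. frechet_derivative f (at x) v) (at x) u" for x
  have cA: "continuous_on S A" and cB: "continuous_on S B"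
    unfolding A_def[abs_def] B_def[abs_def] by (intro smooth_on_continuous smooth_on_deriv f)+
  have "A y = B y"
  proof (rule ccontr)
    assume "A y \<noteq> B y"
    define \<epsilon> where "\<epsilon> = \<bar>A y - B y\<bar> / 2"
    have \<epsilon>: "\<epsilon> > 0" using \<open>A y \<noteq> B y\<close> by (simp add: \<epsilon>_def)
    have "isCont A y" "isCont B y" using cA cB S y by (simp_all add: continuous_on_eq_continuous_at)
    then obtain d1 d2 where d: "d1 > 0" "\<And>x. dist x y < d1 \<Longrightarrow> dist (A x) (A y) < \<epsilon>"
      "d2 > 0" "\<And>x. dist x y < d2 \<Longrightarrow> dist (B x) (B y) < \<epsilon>"
      using \<epsilon> unfolding continuous_at_eps_delta by (metis dist_norm)
    obtain d3 where d3: "d3 > 0" "ball y d3 \<subseteq> S" using S y open_contains_ball by blast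
    define d where "d = min d1 (min d2 d3)"
    \<comment> \<open>This keeps the parallelogram within distance \<open>d / 2\<close> of
      \<open>y\<close>; the summand 1 makes the denominator positive even if \<open>u\<close> and
      \<open>v\<close> vanish.\<close>
    define h where "h = d / (2 * (norm u + norm v + 1))"
    have dp: "d > 0" using d d3 by (simp add: d_def)
    have np: "norm u + norm v + 1 > 0" using norm_ge_zero[of u] norm_ge_zero[of v] by linarith
    have h: "h > 0" using dp np by (simp add: h_def)
    have near: "dist (y + s *\<^sub>R u + t *\<^sub>R v) y < d" if "0 \<le> s" "s \<le> h" "0 \<le> t" "t \<le> h" for s t
    proof -
      have "dist (y + s *\<^sub>R u + t *\<^sub>R v) y = norm (s *\<^sub>R u + t *\<^sub>R v)" by (simp add: dist_norm)
      also have "\<dots> \<le> s * norm u + t * norm v" using norm_triangle_ineq[of "s *\<^sub>R u" "t *\<^sub>R v"] that by simp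
      also have "\<dots> \<le> h * norm u + h * norm v" using that by (intro add_mono mult_right_mono) auto
      finally have 1: "dist (y + s *\<^sub>R u + t *\<^sub>R v) y \<le> h * norm u + h * norm v" .
      have 2: "h * norm u + h * norm v \<le> h * (norm u + norm v + 1)" using h by (simp add: algebra_simps)
      have "d / (2 * N) * N = d / 2" if "N > 0" for N :: real using that by simp
      from this[OF np] have "h * (norm u + norm v + 1) = d / 2" unfolding h_def .
      with 1 2 show ?thesis using dp by linarith
    qed
    have near': "dist (y + s *\<^sub>R v + t *\<^sub>R u) y < d" if "0 \<le> s" "s \<le> h" "0 \<le> t" "t \<le> h" for s t
      using near[OF that(3,4,1,2)] by (simp add: add.assoc add.commute[of "t *\<^sub>R u"])
    have inS: "x \<in> S" if "dist x y < d" for x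
      using that d3(2) by (auto simp: d_def dist_commute)
    obtain s t where st: "0 < s" "s < h" "0 < t" "t < h"
      "f (y + h *\<^sub>R u + h *\<^sub>R v) - f (y + h *\<^sub>R u) - f (y + h *\<^sub>R v) + f y = h * (h * A (y + s *\<^sub>R u + t *\<^sub>R v))"
      unfolding A_def by (rule second_difference[OF S f h, of y u v]) (use inS near in auto)
    obtain s' t' where st': "0 < s'" "s' < h" "0 < t'" "t' < h"
      "f (y + h *\<^sub>R v + h *\<^sub>R u) - f (y + h *\<^sub>R v) - f (y + h *\<^sub>R u) + f y = h * (h * B (y + s' *\<^sub>R v + t' *\<^sub>R u))"
      unfolding B_def by (rule second_difference[OF S f h, of y v u]) (use inS near' in auto)
    have "y + h *\<^sub>R v + h *\<^sub>R u = y + h *\<^sub>R u + h *\<^sub>R v" by simp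
    then have "f (y + h *\<^sub>R v + h *\<^sub>R u) = f (y + h *\<^sub>R u + h *\<^sub>R v)" by (rule arg_cong)
    then have "h * (h * A (y + s *\<^sub>R u + t *\<^sub>R v)) = h * (h * B (y + s' *\<^sub>R v + t' *\<^sub>R u))"
      using st(5) st'(5) by linarith
    then have eq: "A (y + s *\<^sub>R u + t *\<^sub>R v) = B (y + s' *\<^sub>R v + t' *\<^sub>R u)" using h by simp
    have "dist (A (y + s *\<^sub>R u + t *\<^sub>R v)) (A y) < \<epsilon>"
      by (rule d(2)) (use near[of s t] st in \<open>simp add: d_def\<close>)
    moreover have "dist (B (y + s' *\<^sub>R v + t' *\<^sub>R u)) (B y) < \<epsilon>"
      by (rule d(4)) (use near'[of s' t'] st' in \<open>simp add: d_def\<close>)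
    ultimately have "\<bar>A y - B y\<bar> < 2 * \<epsilon>" unfolding eq dist_real_def by linarith
    then show False by (simp add: \<epsilon>_def)
  qed
  then show ?thesis by (simp add: A_def B_def)
qed

lemma pderiv_symmetric:
  assumes "open S" "smooth_on S f" "y \<in> S"
  shows "pderiv_at i (pderiv_at j f) y = pderiv_at j (pderiv_at i f) y"
  using second_derivative_symmetric[OF assms, of "axis j 1" "axis i 1"]
  by (simp add: pderiv_at_def[abs_def])

section \<open>Algebra of the torsion at a point\<close>

lemma altf_sum: "(\<And>i. i \<in> I \<Longrightarrow> altf k (f i)) \<Longrightarrow> altf k (\<lambda>vs. \<Sum>i\<in>I. f i vs)"
proof (induction I rule: infinite_finite_induct)
  case (insert x F)
  then show ?case using altf_add[of k "f x" "\<lambda>vs. \<Sum>i\<in>F. f i vs"] by simp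
qed (simp_all add: altf_def multilin_def)

lemma altf_prepend: "altf (length us + k) \<alpha> \<Longrightarrow> altf k (\<lambda>ws. \<alpha> (us @ ws))"
proof (induction us arbitrary: \<alpha>)
  case (Cons u us)
  then show ?case using altf_tail[of "length us + k" \<alpha> u] Cons.IH[of "\<lambda>ws. \<alpha> (u # ws)"] by simp
qed simp

section \<open>The Hodge star of the standard metric\<close>

definition star :: "nat \<Rightarrow> (real ^ 7) covector \<Rightarrow> (real ^ 7) covector" where
  "star k \<alpha> ws = (\<Sum>is | length is = k. \<alpha> (map ax is) * vol (map ax is @ ws)) / fact k"

definition compl7 :: "7 list \<Rightarrow> 7 list" where "compl7 js = filter (\<lambda>i. i \<notin> set js) I7"

lemma compl7: "distinct js \<Longrightarrow> distinct (compl7 js @ js)" "set (compl7 js @ js) = UNIV"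
  "distinct js \<Longrightarrow> length (compl7 js) + length js = 7"
proof -
  have s: "set (compl7 js) = - set js" unfolding compl7_def set_filter I7(2) by blast
  have f: "distinct (compl7 js)" unfolding compl7_def by (rule distinct_filter[OF I7(1)])
  show "set (compl7 js @ js) = UNIV" using s by auto
  show d: "distinct (compl7 js @ js)" if "distinct js" using that s f by simp
  show "length (compl7 js) + length js = 7" if "distinct js"
    using distinct_card[OF d[OF that]] \<open>set (compl7 js @ js) = UNIV\<close> by simp
qed

lemma altf_star: "altf k \<alpha> \<Longrightarrow> k + l = 7 \<Longrightarrow> altf l (star k \<alpha>)"
proof -
  assume "k + l = 7"
  then have "altf l (\<lambda>ws. (1 / fact k) * (\<Sum>is | length is = k. \<alpha> (map ax is) * vol (map ax is @ ws)))"
    by (intro altf_cmult altf_sum altf_prepend) (use altf_vol in auto)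
  then show ?thesis by (simp add: star_def[abs_def])
qed

lemma vol_ax: "length js = 7 \<Longrightarrow> vol (map ax js) = epsl js I7"
  unfolding vol_def by (rule basis_form_ax) (simp_all add: I7)

lemma star_ax:
  assumes "altf k \<alpha>" "distinct js" "k + length js = 7"
  shows "star k \<alpha> (map ax js) = \<alpha> (map ax (compl7 js)) * epsl (compl7 js @ js) I7"
proof -
  have l: "length (compl7 js) = k" using compl7(3)[OF assms(2)] assms(3) by simp
  show ?thesis
    unfolding star_def
    using hodge_sum[OF assms(1), of js vol "compl7 js" ax] altf_vol assms(3) compl7[of js] assms(2) l
      vol_ax[of "compl7 js @ js"]
    by simp
qed

lemma star_phi: "length ws = 4 \<Longrightarrow> star 3 phi ws = psi ws"
proof (rule altf_eqI_7[OF altf_star[OF altf_phi] altf_psi])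
  have "star 3 phi (map ax js) = phi (map ax (compl7 js)) * epsl (compl7 js @ js) I7"
    if "js \<in> set (filter (\<lambda>is. length is = 4) (subseqs I7))" for js
    using that subseqs_distinctD[OF _ I7(1), of js] by (intro star_ax altf_phi) (simp_all only: set_filter mem_Collect_eq)
  moreover have "\<forall>js\<in>set (filter (\<lambda>is. length is = 4) (subseqs I7)).
      phi (map ax (compl7 js)) * epsl (compl7 js @ js) I7 = psi (map ax js)"
    unfolding subseqs_4 by (simp add: compl7_def phi_ph psi_ps ph_table ps_table)
  ultimately show "\<forall>js\<in>set (filter (\<lambda>is. length is = 4) (subseqs I7)). star 3 phi (map ax js) = psi (map ax js)"
    by metis
qed simp_all

subsection \<open>The action of skew matrices\<close>

definition skewm :: "real ^ 'n ^ 'n \<Rightarrow> bool" where "skewm A \<longleftrightarrow> (\<forall>i j. A $ j $ i = - A $ i $ j)"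

text \<open>Projection of a skew matrix, viewed as a 2-form, to the 7-dimensional summand; the
  kernel on skew matrices is the Lie algebra g2.\<close>

definition Pv :: "real ^ 7 ^ 7 \<Rightarrow> real ^ 7" where
  "Pv A = (\<chi> k. \<Sum>i\<in>UNIV. \<Sum>j\<in>UNIV. A $ i $ j * ph i j k)"

lemma skewm_entries:
  fixes A :: "real ^ 7 ^ 7"
  assumes "skewm A"
  shows 
    "A $ 1 $ 1 = 0" "A $ 2 $ 2 = 0" "A $ 2 $ 1 = - A $ 1 $ 2" "A $ 3 $ 3 = 0"
    "A $ 3 $ 1 = - A $ 1 $ 3" "A $ 3 $ 2 = - A $ 2 $ 3" "A $ 4 $ 4 = 0" "A $ 4 $ 1 = - A $ 1 $ 4"
    "A $ 4 $ 2 = - A $ 2 $ 4" "A $ 4 $ 3 = - A $ 3 $ 4" "A $ 5 $ 5 = 0" "A $ 5 $ 1 = - A $ 1 $ 5"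
    "A $ 5 $ 2 = - A $ 2 $ 5" "A $ 5 $ 3 = - A $ 3 $ 5" "A $ 5 $ 4 = - A $ 4 $ 5" "A $ 6 $ 6 = 0"
    "A $ 6 $ 1 = - A $ 1 $ 6" "A $ 6 $ 2 = - A $ 2 $ 6" "A $ 6 $ 3 = - A $ 3 $ 6" "A $ 6 $ 4 = - A $ 4 $ 6"
    "A $ 6 $ 5 = - A $ 5 $ 6" "A $ 7 $ 7 = 0" "A $ 7 $ 1 = - A $ 1 $ 7" "A $ 7 $ 2 = - A $ 2 $ 7"
    "A $ 7 $ 3 = - A $ 3 $ 7" "A $ 7 $ 4 = - A $ 4 $ 7" "A $ 7 $ 5 = - A $ 5 $ 7" "A $ 7 $ 6 = - A $ 6 $ 7"
proof -
  have z: "A $ i $ i = 0" for i using assms[unfolded skewm_def, rule_format, of i i] by simp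
  show "A $ 1 $ 1 = 0" "A $ 2 $ 2 = 0" "A $ 3 $ 3 = 0" "A $ 4 $ 4 = 0" "A $ 5 $ 5 = 0" "A $ 6 $ 6 = 0" "A $ 7 $ 7 = 0" by (rule z)+
  show "A $ 2 $ 1 = - A $ 1 $ 2" "A $ 3 $ 1 = - A $ 1 $ 3" "A $ 3 $ 2 = - A $ 2 $ 3" "A $ 4 $ 1 = - A $ 1 $ 4" "A $ 4 $ 2 = - A $ 2 $ 4" "A $ 4 $ 3 = - A $ 3 $ 4" "A $ 5 $ 1 = - A $ 1 $ 5" "A $ 5 $ 2 = - A $ 2 $ 5" "A $ 5 $ 3 = - A $ 3 $ 5" "A $ 5 $ 4 = - A $ 4 $ 5" "A $ 6 $ 1 = - A $ 1 $ 6" "A $ 6 $ 2 = - A $ 2 $ 6" "A $ 6 $ 3 = - A $ 3 $ 6" "A $ 6 $ 4 = - A $ 4 $ 6" "A $ 6 $ 5 = - A $ 5 $ 6" "A $ 7 $ 1 = - A $ 1 $ 7" "A $ 7 $ 2 = - A $ 2 $ 7" "A $ 7 $ 3 = - A $ 3 $ 7" "A $ 7 $ 4 = - A $ 4 $ 7" "A $ 7 $ 5 = - A $ 5 $ 7" "A $ 7 $ 6 = - A $ 6 $ 7"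
    by (rule assms[unfolded skewm_def, rule_format])+
qed

lemma Pv_nth:
  assumes "skewm A"
  shows
    "Pv A $ 1 = 2 * (A $ 2 $ 3 + A $ 4 $ 5 + A $ 6 $ 7)"
    "Pv A $ 2 = 2 * (- A $ 1 $ 3 + A $ 4 $ 6 - A $ 5 $ 7)"
    "Pv A $ 3 = 2 * (A $ 1 $ 2 - A $ 4 $ 7 - A $ 5 $ 6)"
    "Pv A $ 4 = 2 * (- A $ 1 $ 5 - A $ 2 $ 6 + A $ 3 $ 7)"
    "Pv A $ 5 = 2 * (A $ 1 $ 4 + A $ 2 $ 7 + A $ 3 $ 6)"
    "Pv A $ 6 = 2 * (- A $ 1 $ 7 + A $ 2 $ 4 - A $ 3 $ 5)"
    "Pv A $ 7 = 2 * (A $ 1 $ 6 - A $ 2 $ 5 - A $ 3 $ 4)"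
  by (simp_all add: Pv_def sum_7 ph_table ph_eq skewm_entries[OF assms])

lemma phi_ax_first: "phi [v, ax i, ax j] = (\<Sum>n\<in>UNIV. v $ n * ph n i j)"
  by (rule phi_first)

lemma phi_ax_mid: "phi [ax i, v, ax j] = (\<Sum>n\<in>UNIV. v $ n * ph i n j)"
proof -
  have "ph i n j = - ph n i j" for n unfolding ph_def by (rule alt_phi(1))
  then show ?thesis using phi_first[of v i j] alt_phi(1)[of "ax i" v "ax j"] by (simp add: sum_negf)
qed

lemma phi_ax_last: "phi [ax i, ax j, v] = (\<Sum>n\<in>UNIV. v $ n * ph i j n)"
  by (simp add: phi_last[of _ _ v] ph_def)

lemma matrix_ax: "A *v ax j = column j A" "column j A $ i = A $ i $ j"
  by (simp_all add: matrix_vector_mult_basis column_def)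

lemma psi_swap:
  "psi [y, x, z, w] = - psi [x, y, z, w]" "psi [x, z, y, w] = - psi [x, y, z, w]" "psi [x, y, w, z] = - psi [x, y, z, w]"
  using altf_swap[OF altf_psi, of "[x, y, z, w]" 0 1] altf_swap[OF altf_psi, of "[x, y, z, w]" 1 2]
    altf_swap[OF altf_psi, of "[x, y, z, w]" 2 3]
  by (simp_all add: numeral_2_eq_2 numeral_3_eq_3)

lemma psi_first: "psi [v, ax i, ax j, ax k] = (\<Sum>n\<in>UNIV. v $ n * ps n i j k)"
proof -
  have "multilin (Suc 3) psi" using altf_multilin[OF altf_psi] by simp
  from multilin_head_sum[OF this, of "[ax i, ax j, ax k]" "\<lambda>n. v $ n" ax UNIV]
  show ?thesis using vec_ax_sum[of v] by (simp add: ps_def)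
qed

lemma mv_linear: "A *v (a *\<^sub>R x + b *\<^sub>R y) = a *\<^sub>R (A *v x) + b *\<^sub>R (A *v y)" for A :: "real ^ 7 ^ 7"
  by (simp add: linear_add[OF matrix_vector_mul_linear] linear_scale[OF matrix_vector_mul_linear])

lemma altf_psi3: "altf 3 (\<lambda>ws. psi (v # ws))"
  using altf_tail[of 3 psi v] altf_psi by simp

text \<open>The g2-part of \<open>A\<close> annihilates \<open>phi\<close>, so only
  \<open>Pv A\<close> can enter, and equivariance leaves a multiple of the right-hand side. The
  constant, and with it the identity, is obtained by comparison on increasing triples.\<close>

lemma skew_phi:
  assumes A: "skewm A"
  shows "phi [A *v x, y, z] + phi [x, A *v y, z] + phi [x, y, A *v z] = - (1 / 2) * psi [Pv A, x, y, z]"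
proof -
  define Q where "Q vs = phi [A *v (vs ! 0), vs ! 1, vs ! 2] + phi [vs ! 0, A *v (vs ! 1), vs ! 2]
    + phi [vs ! 0, vs ! 1, A *v (vs ! 2)]" for vs
  have "altf 3 Q"
    unfolding altf_def multilin_def
  proof safe
    fix vs :: "(real ^ 7) list" and m :: nat and v w :: "real ^ 7" and a b :: real
    assume "length vs = 3" "m < 3"
    then show "Q (vs[m := a *\<^sub>R v + b *\<^sub>R w]) = a * Q (vs[m := v]) + b * Q (vs[m := w])"
      unfolding length3 less3
      by (elim disjE exE) (simp_all add: Q_def mv_linear linear_phi algebra_simps)
  next
    fix vs :: "(real ^ 7) list"
    assume "length vs = 3" "\<not> distinct vs"
    then obtain x y z where vs: "vs = [x, y, z]" and "x = y \<or> x = z \<or> y = z"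
      unfolding length3 by auto
    then show "Q vs = 0"
      using alt_phi(1)[of "A *v x" x z] alt_phi(3)[of "A *v x" y x] alt_phi(2)[of x "A *v y" y]
        alt_phi(4)[of x "A *v x"] alt_phi(4)[of x "A *v z"] alt_phi(6)[of x "A *v y"] alt_phi(5)[of "A *v x" y]
      by (elim disjE) (simp_all add: Q_def)
  qed
  then have "Q [x, y, z] = - (1 / 2) * psi [Pv A, x, y, z]"
  proof (rule altf_eqI_7[OF _ altf_cmult[OF altf_psi3]])
    show "\<forall>is\<in>set (filter (\<lambda>is. length is = 3) (subseqs I7)). Q (map ax is) = - (1 / 2) * psi (Pv A # map ax is)"
      unfolding subseqs_3
      by (simp add: Q_def matrix_ax phi_ax_first phi_ax_mid phi_ax_last psi_first sum_7 ph_table ph_eq ps_table ps_eq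
          Pv_nth[OF A] skewm_entries[OF A]) (simp add: field_simps)
  qed simp
  then show ?thesis by (simp add: Q_def)
qed

lemma linear_psi:
  "psi [a *\<^sub>R x + b *\<^sub>R x', y, z, w] = a * psi [x, y, z, w] + b * psi [x', y, z, w]"
  "psi [x, a *\<^sub>R y + b *\<^sub>R y', z, w] = a * psi [x, y, z, w] + b * psi [x, y', z, w]"
  "psi [x, y, a *\<^sub>R z + b *\<^sub>R z', w] = a * psi [x, y, z, w] + b * psi [x, y, z', w]"
  "psi [x, y, z, a *\<^sub>R w + b *\<^sub>R w'] = a * psi [x, y, z, w] + b * psi [x, y, z, w']"
  using multilinD[OF altf_multilin[OF altf_psi], of "[x, y, z, w]" 0 a x b x']
    multilinD[OF altf_multilin[OF altf_psi], of "[x, y, z, w]" 1 a y b y']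
    multilinD[OF altf_multilin[OF altf_psi], of "[x, y, z, w]" 2 a z b z']
    multilinD[OF altf_multilin[OF altf_psi], of "[x, y, z, w]" 3 a w b w']
  by (simp_all add: numeral_2_eq_2 numeral_3_eq_3)

lemma psi_mid:
  "psi [ax i, v, ax j, ax k] = (\<Sum>n\<in>UNIV. v $ n * - ps n i j k)"
  "psi [ax i, ax j, v, ax k] = (\<Sum>n\<in>UNIV. v $ n * ps n i j k)"
  "psi [ax i, ax j, ax k, v] = (\<Sum>n\<in>UNIV. v $ n * - ps n i j k)"
  using psi_swap(1)[of "ax i" v "ax j" "ax k"] psi_swap(2)[of "ax i" "ax j" v "ax k"]
    psi_swap(3)[of "ax i" "ax j" "ax k" v]
  by (simp_all add: psi_first sum_negf)

definition lform :: "real ^ 7 \<Rightarrow> (real ^ 7) covector" where "lform t vs = t \<bullet> hd vs"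

lemma altf_lform: "altf 1 (lform t)"
  by (auto simp: altf_def multilin_def length_Suc_conv lform_def inner_add_right)

lemma lform_ax: "lform t [ax i] = t $ i"
  by (simp add: lform_def inner_axis)

text \<open>The analogue of \<open>skew_phi\<close> for the dual form. Increasing indices are what
  the components of the 5-form d\<star>\<sigma> lead to.\<close>

lemma skew_psi:
  assumes A: "skewm A" and "is": "[i, j, k, l] \<in> set (filter (\<lambda>is. length is = 4) (subseqs I7))"
  shows "psi [A *v ax i, ax j, ax k, ax l] + psi [ax i, A *v ax j, ax k, ax l]
     + psi [ax i, ax j, A *v ax k, ax l] + psi [ax i, ax j, ax k, A *v ax l]
     = 1 / 2 * wedge 1 3 (lform (Pv A)) phi [ax i, ax j, ax k, ax l]"
proof -
  have "wedge 1 3 (lform (Pv A)) phi [ax i, ax j, ax k, ax l] = shuffle (lform (Pv A)) phi 1 3 [] [] [ax i, ax j, ax k, ax l]"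
    by (rule wedge_shuffle[OF altf_lform altf_phi]) simp
  then show ?thesis
    using "is" unfolding subseqs_4
    by (auto simp: matrix_ax psi_first psi_mid sum_7 phi_ph ph_table ph_eq ps_table ps_eq lform_ax
          Pv_nth[OF A] skewm_entries[OF A])
qed

text \<open>If \<open>Pv A\<close> vanishes this is the equivariance of \<open>Pv\<close> under g2;
  the cross product accounts for the bracket of two 7-parts. It expresses the 7-part of the
  curvature by the intrinsic torsion up to terms linear in the connection.\<close>

lemma Pv_commutator:
  assumes A: "skewm A" and B: "skewm B"
  shows "Pv (A ** B - B ** A) = A *v Pv B - B *v Pv A + (1 / 2) *\<^sub>R cr (Pv A) (Pv B)"
proof -
  have c: "skewm (A ** B - B ** A)"
  proof -
    have t: "(A ** B) $ j $ i = (B ** A) $ i $ j" if "skewm A" "skewm B" for A B :: "real ^ 7 ^ 7" and i j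
    proof -
      have "A $ j $ k * B $ k $ i = B $ i $ k * A $ k $ j" for k
        using that(1)[unfolded skewm_def, rule_format, of k j] that(2)[unfolded skewm_def, rule_format, of i k] by simp
      then show ?thesis by (simp add: matrix_matrix_mult_def)
    qed
    show ?thesis unfolding skewm_def using t[OF A B] t[OF B A] by simp
  qed
  have "\<forall>k. 2 * Pv (A ** B - B ** A) $ k = 2 * (A *v Pv B) $ k - 2 * (B *v Pv A) $ k + cr (Pv A) (Pv B) $ k"
    unfolding forall_7 Pv_nth[OF c]
    by (simp add: matrix_matrix_mult_def matrix_vector_mult_def sum_7 cr_nth phi_ax
        Pv_nth[OF A] Pv_nth[OF B] skewm_entries[OF A] skewm_entries[OF B]) (intro conjI; algebra)
  then show ?thesis by (simp add: vec_eq_iff field_simps)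
qed

subsection \<open>Scalar curvature of a connection with skew matrices\<close>

lemma Pv_sum: "Pv W \<bullet> v = (\<Sum>i\<in>UNIV. \<Sum>j\<in>UNIV. W $ i $ j * phi [ax i, ax j, v])"
proof -
  have "Pv W \<bullet> v = (\<Sum>k\<in>UNIV. \<Sum>i\<in>UNIV. \<Sum>j\<in>UNIV. W $ i $ j * (v $ k * ph i j k))"
    by (simp add: Pv_def inner_vec_def sum_distrib_left sum_distrib_right mult_ac)
  also have "\<dots> = (\<Sum>i\<in>UNIV. \<Sum>k\<in>UNIV. \<Sum>j\<in>UNIV. W $ i $ j * (v $ k * ph i j k))"
    by (rule sum.swap)
  also have "\<dots> = (\<Sum>i\<in>UNIV. \<Sum>j\<in>UNIV. \<Sum>k\<in>UNIV. W $ i $ j * (v $ k * ph i j k))"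
    by (intro sum.cong refl sum.swap)
  finally show ?thesis by (simp add: phi_ax_last sum_distrib_left)
qed

text \<open>A cyclic rotation of \<open>a\<close>, \<open>b\<close>, \<open>j\<close> with
  \<open>i\<close> fixed, the same three indices that the Bianchi identity rotates.\<close>

lemma sum4_rotate:
  "(\<Sum>a\<in>A. \<Sum>b\<in>A. \<Sum>i\<in>A. \<Sum>j\<in>A. f a b i j) = (\<Sum>a\<in>A. \<Sum>b\<in>A. \<Sum>i\<in>A. \<Sum>j\<in>A. f j a i b)"
proof -
  have "(\<Sum>a\<in>A. \<Sum>b\<in>A. \<Sum>i\<in>A. \<Sum>j\<in>A. f j a i b) = (\<Sum>a\<in>A. \<Sum>j\<in>A. \<Sum>b\<in>A. \<Sum>i\<in>A. f j a i b)"
  proof (rule sum.cong[OF refl])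
    fix a
    have "(\<Sum>b\<in>A. \<Sum>i\<in>A. \<Sum>j\<in>A. f j a i b) = (\<Sum>b\<in>A. \<Sum>j\<in>A. \<Sum>i\<in>A. f j a i b)"
      by (intro sum.cong refl sum.swap)
    also have "\<dots> = (\<Sum>j\<in>A. \<Sum>b\<in>A. \<Sum>i\<in>A. f j a i b)" by (rule sum.swap)
    finally show "(\<Sum>b\<in>A. \<Sum>i\<in>A. \<Sum>j\<in>A. f j a i b) = (\<Sum>j\<in>A. \<Sum>b\<in>A. \<Sum>i\<in>A. f j a i b)" .
  qed
  also have "\<dots> = (\<Sum>j\<in>A. \<Sum>a\<in>A. \<Sum>b\<in>A. \<Sum>i\<in>A. f j a i b)" by (rule sum.swap)
  also have "\<dots> = (\<Sum>j\<in>A. \<Sum>a\<in>A. \<Sum>i\<in>A. \<Sum>b\<in>A. f j a i b)" by (intro sum.cong refl sum.swap)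
  finally show ?thesis by simp
qed

text \<open>The first Bianchi identity annihilates the contraction with \<open>psi\<close>.\<close>

lemma bianchi_psi:
  fixes W :: "7 \<Rightarrow> 7 \<Rightarrow> real ^ 7 ^ 7"
  assumes b: "\<And>a b i j. W a b $ i $ j + W b j $ i $ a + W j a $ i $ b = 0"
  shows "(\<Sum>a\<in>UNIV. \<Sum>b\<in>UNIV. \<Sum>i\<in>UNIV. \<Sum>j\<in>UNIV. W a b $ i $ j * ps a b i j) = 0"
proof -
  let ?Z = "\<lambda>f :: 7 \<Rightarrow> 7 \<Rightarrow> 7 \<Rightarrow> 7 \<Rightarrow> real. \<Sum>a\<in>UNIV. \<Sum>b\<in>UNIV. \<Sum>i\<in>UNIV. \<Sum>j\<in>UNIV. f a b i j"
  have ps: "ps j a i b = ps a b i j" for a b i j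
    unfolding ps_def using psi_swap(1)[of "ax j" "ax a" "ax i" "ax b"] psi_swap(2)[of "ax a" "ax j" "ax i" "ax b"]
      psi_swap(3)[of "ax a" "ax i" "ax j" "ax b"] psi_swap(2)[of "ax a" "ax i" "ax b" "ax j"] by simp
  have 1: "?Z (\<lambda>a b i j. W b j $ i $ a * ps a b i j) = ?Z (\<lambda>a b i j. W a b $ i $ j * ps a b i j)"
    by (subst sum4_rotate) (simp only: ps)
  have 2: "?Z (\<lambda>a b i j. W j a $ i $ b * ps a b i j) = ?Z (\<lambda>a b i j. W b j $ i $ a * ps a b i j)"
  proof -
    have "?Z (\<lambda>a b i j. W j a $ i $ b * ps a b i j) = ?Z (\<lambda>a b i j. W b j $ i $ a * ps j a i b)"
      by (rule sum4_rotate)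
    then show ?thesis by (simp only: ps)
  qed
  have "0 = ?Z (\<lambda>a b i j. (W a b $ i $ j + W b j $ i $ a + W j a $ i $ b) * ps a b i j)" by (simp add: b)
  also have "\<dots> = ?Z (\<lambda>a b i j. W a b $ i $ j * ps a b i j) + ?Z (\<lambda>a b i j. W b j $ i $ a * ps a b i j)
      + ?Z (\<lambda>a b i j. W j a $ i $ b * ps a b i j)"
    by (simp add: distrib_right sum.distrib)
  finally show ?thesis unfolding 2 1 by simp
qed

text \<open>By \<open>cr_inner_psi\<close> the contraction of \<open>phi\<close> with itself yields
  two traces of the curvature, equal by skewness, and a \<open>psi\<close> term removed by
  \<open>bianchi_psi\<close>. Hence the 7-part of the curvature determines the scalar
  curvature.\<close>

lemma scal_from_phi:
  fixes W :: "7 \<Rightarrow> 7 \<Rightarrow> real ^ 7 ^ 7"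
  assumes b: "\<And>a b i j. W a b $ i $ j + W b j $ i $ a + W j a $ i $ b = 0"
    and sk: "\<And>a b. skewm (W a b)"
  shows "(\<Sum>a\<in>UNIV. \<Sum>b\<in>UNIV. phi [ax a, ax b, Pv (W a b)]) = 2 * (\<Sum>a\<in>UNIV. \<Sum>b\<in>UNIV. W a b $ a $ b)"
proof -
  have delta: "(\<Sum>i\<in>UNIV. \<Sum>j\<in>UNIV. if i = x then if j = y then f i j else 0 else 0) = f x y"
    for x y :: 7 and f :: "7 \<Rightarrow> 7 \<Rightarrow> real"
  proof -
    have "(\<Sum>j\<in>UNIV. if i = x then if j = y then f i j else 0 else 0) = (if i = x then f i y else 0)" for i
      by (cases "i = x") simp_all
    then have "(\<Sum>i\<in>UNIV. \<Sum>j\<in>UNIV. if i = x then if j = y then f i j else 0 else 0)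
        = (\<Sum>i\<in>UNIV. if i = x then f i y else 0)" by (rule sum.cong[OF refl])
    also have "\<dots> = f x y" by simp
    finally show ?thesis .
  qed
  have 1: "phi [ax a, ax b, Pv (W a b)] = 2 * W a b $ a $ b + (\<Sum>i\<in>UNIV. \<Sum>j\<in>UNIV. W a b $ i $ j * ps a b i j)" for a b
  proof -
    have "phi [ax a, ax b, Pv (W a b)] = Pv (W a b) \<bullet> cr (ax a) (ax b)"
      by (simp add: phi_cr inner_commute)
    also have "\<dots> = (\<Sum>i\<in>UNIV. \<Sum>j\<in>UNIV. W a b $ i $ j * (cr (ax a) (ax b) \<bullet> cr (ax i) (ax j)))"
      by (simp add: Pv_sum phi_cr inner_commute)
    also have "\<dots> = (\<Sum>i\<in>UNIV. \<Sum>j\<in>UNIV. (if i = a then if j = b then W a b $ i $ j else 0 else 0)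
        - (if i = b then if j = a then W a b $ i $ j else 0 else 0) + W a b $ i $ j * ps a b i j)"
      by (intro sum.cong refl) (auto simp: cr_inner_psi ax_inner psi_ps algebra_simps)
    also have "\<dots> = W a b $ a $ b - W a b $ b $ a + (\<Sum>i\<in>UNIV. \<Sum>j\<in>UNIV. W a b $ i $ j * ps a b i j)"
      unfolding sum.distrib sum_subtractf delta ..
    finally show ?thesis unfolding sk[of a b, unfolded skewm_def, rule_format, of b a] by simp
  qed
  show ?thesis
    unfolding 1 sum.distrib using bianchi_psi[of W] b by (simp add: sum_distrib_left)
qed

lemma trace_terms:
  fixes th :: "7 \<Rightarrow> real ^ 7"
  shows "(\<Sum>a\<in>UNIV. \<Sum>b\<in>UNIV. phi [ax a, ax b, cr (th a) (th b)])
    = (\<Sum>a\<in>UNIV. \<Sum>b\<in>UNIV. th a $ a * th b $ b - th b $ a * th a $ b + psi [ax a, ax b, th a, th b])"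
  by (intro sum.cong refl) (simp add: phi_cr cr_inner_psi inner_axis' mult.commute)

text \<open>\<open>divt\<close> is the divergence of the vector with components \<open>\<Sum>\<^sub>b phi(e\<^sub>a, e\<^sub>b, th\<^sub>b)\<close>.\<close>

lemma scal_algebra:
  fixes om :: "7 \<Rightarrow> real ^ 7 ^ 7" and X :: "7 \<Rightarrow> 7 \<Rightarrow> real ^ 7" and W :: "7 \<Rightarrow> 7 \<Rightarrow> real ^ 7 ^ 7"
  assumes sk: "\<And>a. skewm (om a)"
    and th: "\<And>a. th a = Pv (om a)"
    and W: "\<And>a b i j. W a b $ i $ j + W b j $ i $ a + W j a $ i $ b = 0" "\<And>a b. skewm (W a b)"
    and PW: "\<And>a b. Pv (W a b) = X a b - X b a + Pv (om a ** om b - om b ** om a)"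
    and divt: "divt = (\<Sum>a\<in>UNIV. \<Sum>b\<in>UNIV. phi [ax a, ax b, X a b] - phi [om a *v ax a, ax b, th b]
      - phi [ax a, om a *v ax b, th b])"
  shows "(\<Sum>a\<in>UNIV. \<Sum>b\<in>UNIV. W a b $ a $ b) = divt
    + 1 / 4 * (\<Sum>a\<in>UNIV. \<Sum>b\<in>UNIV. 2 * (th a $ a * th b $ b - th b $ a * th a $ b) - phi [ax a, ax b, cr (th a) (th b)])"
proof -
  define S where "S f = (\<Sum>a\<in>UNIV. \<Sum>b\<in>UNIV. f a b)" for f :: "7 \<Rightarrow> 7 \<Rightarrow> real"
  have Sadd: "S (\<lambda>a b. f a b + g a b) = S f + S g" for f g by (simp add: S_def sum.distrib)
  have Sdiff: "S (\<lambda>a b. f a b - g a b) = S f - S g" for f g by (simp add: S_def sum_subtractf)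
  have Sc: "S (\<lambda>a b. c * f a b) = c * S f" for c f by (simp add: S_def sum_distrib_left)
  have Ssw: "S (\<lambda>a b. f b a) = S f" for f unfolding S_def by (rule sum.swap)
  define FX where "FX a b = phi [ax a, ax b, X a b]" for a b
  define U1 where "U1 a b = phi [om a *v ax a, ax b, th b]" for a b
  define U2 where "U2 a b = phi [ax a, om a *v ax b, th b]" for a b
  define U3 where "U3 a b = phi [ax a, ax b, om a *v th b]" for a b
  define V where "V a b = psi [ax a, ax b, th a, th b]" for a b
  define C where "C a b = phi [ax a, ax b, cr (th a) (th b)]" for a b
  define N where "N a b = th a $ a * th b $ b - th b $ a * th a $ b" for a b
  have lin: "phi [x, y, u - v + (w - z + c *\<^sub>R q)] = phi [x, y, u] - phi [x, y, v] + (phi [x, y, w] - phi [x, y, z] + c * phi [x, y, q])"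
    for x y u v w z q c
    by (simp add: phi_cr inner_add_right inner_diff_right)
  \<comment> \<open>Every term is paired with its copy under exchange of \<open>a\<close> and
    \<open>b\<close>, which doubles it in the double sum.\<close>
  have 1: "phi [ax a, ax b, Pv (W a b)] = (FX a b + FX b a) + ((U3 a b + U3 b a) + 1 / 2 * C a b)" for a b
    unfolding PW Pv_commutator[OF sk sk] lin FX_def U3_def C_def th
    using alt_phi(1)[of "ax a" "ax b" "X b a"] alt_phi(1)[of "ax a" "ax b" "om b *v Pv (om a)"] by simp
  have e1: "2 * S (\<lambda>a b. W a b $ a $ b) = 2 * S FX + 2 * S U3 + 1 / 2 * S C"
  proof -
    have "2 * S (\<lambda>a b. W a b $ a $ b) = S (\<lambda>a b. phi [ax a, ax b, Pv (W a b)])"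
      unfolding S_def using scal_from_phi[of W] W by simp
    also have "\<dots> = (S FX + S (\<lambda>a b. FX b a)) + ((S U3 + S (\<lambda>a b. U3 b a)) + 1 / 2 * S C)"
      unfolding 1 Sadd Sc ..
    finally show ?thesis using Ssw[of FX] Ssw[of U3] by linarith
  qed
  \<comment> \<open>Letting the connection act on all three arguments of \<open>phi\<close> replaces
    terms linear in the connection by a term in the torsion alone. With \<open>e1\<close> this
    leaves nothing that depends on the choice of the frame.\<close>
  have e2: "S U1 + S U2 + S U3 = - (1 / 2) * S V"
  proof -
    have "U1 a b + U2 a b + U3 a b = - (1 / 2) * V a b" for a b
      unfolding U1_def U2_def U3_def V_def skew_phi[OF sk] th[symmetric]
      using psi_swap(1)[of "th a" "ax a" "ax b" "th b"] psi_swap(2)[of "ax a" "th a" "ax b" "th b"] by simp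
    then show ?thesis unfolding Sadd[symmetric] Sc[symmetric] by simp
  qed
  have e3: "S C = S N + S V"
    using trace_terms[of th] unfolding S_def[symmetric] C_def[symmetric] N_def[symmetric] V_def[symmetric] Sadd .
  have e4: "divt = S FX - S U1 - S U2"
    unfolding divt FX_def[symmetric] U1_def[symmetric] U2_def[symmetric] S_def[symmetric] Sdiff ..
  have "S (\<lambda>a b. W a b $ a $ b) = divt + 1 / 4 * (2 * S N - S C)"
  proof -
    have "w = d + 1 / 4 * (2 * n - c)"
      if "2 * w = 2 * f + 2 * u3 + 1 / 2 * c" "u1 + u2 + u3 = - (1 / 2) * v" "c = n + v" "d = f - u1 - u2"
      for w f u1 u2 u3 c v n d :: real
      using that by (simp add: field_simps)
    from this[OF e1 e2 e3 e4] show ?thesis .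
  qed
  then show ?thesis
    unfolding S_def[symmetric] N_def[symmetric] C_def[symmetric] Sdiff Sc .
qed

subsection \<open>The torsion forms in terms of the connection\<close>

lemma subseqs_2: "filter (\<lambda>is. length is = 2) (subseqs I7) =
  [[1,2], [1,3], [1,4], [1,5], [1,6], [1,7], [2,3], [2,4], [2,5], [2,6], [2,7], [3,4], [3,5], [3,6], [3,7], [4,5], [4,6], [4,7], [5,6], [5,7], [6,7]]"
  by (simp add: Let_def)

lemma subseqs_5: "filter (\<lambda>is. length is = 5) (subseqs I7) =
  [[1,2,3,4,5], [1,2,3,4,6], [1,2,3,4,7], [1,2,3,5,6], [1,2,3,5,7], [1,2,3,6,7], [1,2,4,5,6], [1,2,4,5,7], [1,2,4,6,7], [1,2,5,6,7], [1,3,4,5,6], [1,3,4,5,7], [1,3,4,6,7], [1,3,5,6,7], [1,4,5,6,7], [2,3,4,5,6], [2,3,4,5,7], [2,3,4,6,7], [2,3,5,6,7], [2,4,5,6,7], [3,4,5,6,7]]"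
  by (simp add: Let_def)

lemma norm_sorted_3:
  assumes "altf 3 \<alpha>"
  shows "(\<Sum>is | length is = 3. (\<alpha> (map ax is))\<^sup>2) / fact 3
    = (\<Sum>is\<leftarrow>filter (\<lambda>is. length is = 3) (subseqs I7). (\<alpha> (map ax is))\<^sup>2)"
proof -
  define f where "f i j k = (\<alpha> [ax i, ax j, ax k])\<^sup>2" for i j k
  have f: "f i i k = 0" "f i k i = 0" "f i k k = 0" for i k
    using altf_zero[OF assms] by (simp_all add: f_def)
  have s1: "f j i k = f i j k" and s2: "f i k j = f i j k" for i j k
    unfolding f_def alt3_swap(1)[OF assms, of "ax j" "ax i" "ax k"] alt3_swap(2)[OF assms, of "ax i" "ax k" "ax j"]
    by (rule power2_minus)+
  have "(\<Sum>is | length is = 3. (\<alpha> (map ax is))\<^sup>2) = (\<Sum>i\<in>UNIV. \<Sum>j\<in>UNIV. \<Sum>k\<in>UNIV. f i j k)"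
    unfolding numeral_3_eq_3 sum_lists_Suc sum_lists_0 by (simp add: f_def)
  moreover have "(\<Sum>is\<leftarrow>filter (\<lambda>is. length is = 3) (subseqs I7). (\<alpha> (map ax is))\<^sup>2)
    = (\<Sum>is\<leftarrow>filter (\<lambda>is. length is = 3) (subseqs I7). f (is ! 0) (is ! 1) (is ! 2))"
    unfolding subseqs_3 by (simp add: f_def)
  ultimately show ?thesis
    unfolding subseqs_3 by (simp add: sum_7 f s1 s2 fact_numeral)
qed

lemma norm_sorted_2:
  assumes "altf 2 \<alpha>"
  shows "(\<Sum>is | length is = 2. (\<alpha> (map ax is))\<^sup>2) / fact 2
    = (\<Sum>is\<leftarrow>filter (\<lambda>is. length is = 2) (subseqs I7). (\<alpha> (map ax is))\<^sup>2)"
proof -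
  define f where "f i j = (\<alpha> [ax i, ax j])\<^sup>2" for i j
  have f: "f i i = 0" for i using altf_zero[OF assms] by (simp add: f_def)
  have s1: "f j i = f i j" for i j
    using altf_swap[OF assms, of "[ax i, ax j]" 0 1] by (simp add: f_def power2_eq_square)
  have "(\<Sum>is | length is = 2. (\<alpha> (map ax is))\<^sup>2) = (\<Sum>i\<in>UNIV. \<Sum>j\<in>UNIV. f i j)"
  proof -
    have "{is :: 7 list. length is = 2} = {is. length is = Suc (Suc 0)}" by (simp only: numeral_2_eq_2)
    then show ?thesis by (simp only: sum_lists_Suc sum_lists_0 f_def list.map)
  qed
  moreover have "(\<Sum>is\<leftarrow>filter (\<lambda>is. length is = 2) (subseqs I7). (\<alpha> (map ax is))\<^sup>2)
    = (\<Sum>is\<leftarrow>filter (\<lambda>is. length is = 2) (subseqs I7). f (is ! 0) (is ! 1))"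
    unfolding subseqs_2 by (simp add: f_def)
  ultimately show ?thesis
    unfolding subseqs_2 by (simp add: sum_7 f s1)
qed

text \<open>Frame components of d\<sigma>: the alternation of the covariant derivative, which in
  direction a is 1/2 psi(th a, ...) by \<open>skew_phi\<close>. See
  \<open>d_phi_frame\<close>.\<close>

definition dphi :: "(7 \<Rightarrow> real ^ 7) \<Rightarrow> 7 list \<Rightarrow> real" where
  "dphi th is = 1 / 2 * (\<Sum>j<4. (-1) ^ j * psi (th (is ! j) # map ax (take j is @ drop (Suc j) is)))"

text \<open>Frame components of d\<star>\<sigma>, the covariant derivative in direction a being -1/2
  th(a) \<and> phi by \<open>skew_psi\<close>. See \<open>d_psi_frame\<close>.\<close>

definition dpsi :: "(7 \<Rightarrow> real ^ 7) \<Rightarrow> 7 list \<Rightarrow> real" where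
  "dpsi th is = - 1 / 2 * (\<Sum>j<5. (-1) ^ j * wedge 1 3 (lform (th (is ! j))) phi (map ax (take j is @ drop (Suc j) is)))"

lemma wedge_lform_phi: "wedge 1 3 (lform t) phi [x, y, z, w]
    = lform t [x] * phi [y, z, w] - lform t [y] * phi [x, z, w] + lform t [z] * phi [x, y, w] - lform t [w] * phi [x, y, z]"
  using wedge_shuffle[OF altf_lform altf_phi, of "[x, y, z, w]" t] by simp

text \<open>The quadratic form in the torsion that remains after subtracting the divergence from the scalar curvature.\<close>

definition qform :: "(7 \<Rightarrow> real ^ 7) \<Rightarrow> real" where
  "qform th = 1 / 4 * (\<Sum>a\<in>UNIV. \<Sum>b\<in>UNIV.
     2 * (th a $ a * th b $ b - th b $ a * th a $ b) - phi [ax a, ax b, cr (th a) (th b)])"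

text \<open>The 7-part of the intrinsic torsion; it turns out to be -12 times the vector dual to
  \<open>\<tau>\<^sub>1\<close>.\<close>

definition tvec :: "(7 \<Rightarrow> real ^ 7) \<Rightarrow> 7 \<Rightarrow> real" where
  "tvec th a = (\<Sum>b\<in>UNIV. phi [ax a, ax b, th b])"

lemma dphi_explicit:
  shows "dphi th [1,2,3,4] = 1 / 2 * (- th 1 $ 5 - th 2 $ 6 + th 3 $ 7)"
    "dphi th [1,2,3,5] = 1 / 2 * (th 1 $ 4 + th 2 $ 7 + th 3 $ 6)"
    "dphi th [1,2,3,6] = 1 / 2 * (- th 1 $ 7 + th 2 $ 4 - th 3 $ 5)"
    "dphi th [1,2,3,7] = 1 / 2 * (th 1 $ 6 - th 2 $ 5 - th 3 $ 4)"
    "dphi th [1,2,4,5] = 1 / 2 * (- th 1 $ 3 + th 4 $ 6 - th 5 $ 7)"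
    "dphi th [1,2,4,6] = 1 / 2 * (- th 2 $ 3 - th 4 $ 5 - th 6 $ 7)"
    "dphi th [1,2,4,7] = 1 / 2 * (- th 1 $ 1 - th 2 $ 2 - th 4 $ 4 - th 7 $ 7)"
    "dphi th [1,2,5,6] = 1 / 2 * (- th 1 $ 1 - th 2 $ 2 - th 5 $ 5 - th 6 $ 6)"
    "dphi th [1,2,5,7] = 1 / 2 * (th 2 $ 3 - th 5 $ 4 - th 7 $ 6)"
    "dphi th [1,2,6,7] = 1 / 2 * (- th 1 $ 3 - th 6 $ 4 + th 7 $ 5)"
    "dphi th [1,3,4,5] = 1 / 2 * (th 1 $ 2 - th 4 $ 7 - th 5 $ 6)"
    "dphi th [1,3,4,6] = 1 / 2 * (- th 1 $ 1 - th 3 $ 3 - th 4 $ 4 - th 6 $ 6)"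
    "dphi th [1,3,4,7] = 1 / 2 * (- th 3 $ 2 + th 4 $ 5 - th 7 $ 6)"
    "dphi th [1,3,5,6] = 1 / 2 * (- th 3 $ 2 - th 5 $ 4 + th 6 $ 7)"
    "dphi th [1,3,5,7] = 1 / 2 * (th 1 $ 1 + th 3 $ 3 + th 5 $ 5 + th 7 $ 7)"
    "dphi th [1,3,6,7] = 1 / 2 * (th 1 $ 2 + th 6 $ 5 + th 7 $ 4)"
    "dphi th [1,4,5,6] = 1 / 2 * (- th 1 $ 7 - th 4 $ 2 + th 5 $ 3)"
    "dphi th [1,4,5,7] = 1 / 2 * (th 1 $ 6 + th 4 $ 3 + th 5 $ 2)"
    "dphi th [1,4,6,7] = 1 / 2 * (- th 1 $ 5 + th 6 $ 2 - th 7 $ 3)"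
    "dphi th [1,5,6,7] = 1 / 2 * (th 1 $ 4 - th 6 $ 3 - th 7 $ 2)"
    "dphi th [2,3,4,5] = 1 / 2 * (th 2 $ 2 + th 3 $ 3 + th 4 $ 4 + th 5 $ 5)"
    "dphi th [2,3,4,6] = 1 / 2 * (- th 2 $ 1 - th 4 $ 7 + th 6 $ 5)"
    "dphi th [2,3,4,7] = 1 / 2 * (th 3 $ 1 + th 4 $ 6 + th 7 $ 5)"
    "dphi th [2,3,5,6] = 1 / 2 * (th 3 $ 1 - th 5 $ 7 - th 6 $ 4)"
    "dphi th [2,3,5,7] = 1 / 2 * (th 2 $ 1 + th 5 $ 6 - th 7 $ 4)"
    "dphi th [2,3,6,7] = 1 / 2 * (th 2 $ 2 + th 3 $ 3 + th 6 $ 6 + th 7 $ 7)"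
    "dphi th [2,4,5,6] = 1 / 2 * (- th 2 $ 7 + th 4 $ 1 + th 6 $ 3)"
    "dphi th [2,4,5,7] = 1 / 2 * (th 2 $ 6 - th 5 $ 1 + th 7 $ 3)"
    "dphi th [2,4,6,7] = 1 / 2 * (- th 2 $ 5 + th 4 $ 3 - th 6 $ 1)"
    "dphi th [2,5,6,7] = 1 / 2 * (th 2 $ 4 + th 5 $ 3 + th 7 $ 1)"
    "dphi th [3,4,5,6] = 1 / 2 * (- th 3 $ 7 - th 5 $ 1 - th 6 $ 2)"
    "dphi th [3,4,5,7] = 1 / 2 * (th 3 $ 6 - th 4 $ 1 - th 7 $ 2)"
    "dphi th [3,4,6,7] = 1 / 2 * (- th 3 $ 5 - th 4 $ 2 + th 7 $ 1)"
    "dphi th [3,5,6,7] = 1 / 2 * (th 3 $ 4 - th 5 $ 2 + th 6 $ 1)"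
    "dphi th [4,5,6,7] = 1 / 2 * (th 4 $ 4 + th 5 $ 5 + th 6 $ 6 + th 7 $ 7)"
    
  by (simp_all add: dphi_def lessThan_nat_numeral lessThan_Suc psi_first sum_7 ps_table ps_eq)

lemma dpsi_explicit:
  shows "dpsi th [1,2,3,4,5] = - 1 / 2 * (th 2 $ 3 - th 3 $ 2 + th 4 $ 5 - th 5 $ 4)"
    "dpsi th [1,2,3,4,6] = - 1 / 2 * (- th 1 $ 3 + th 3 $ 1 + th 4 $ 6 - th 6 $ 4)"
    "dpsi th [1,2,3,4,7] = - 1 / 2 * (- th 1 $ 2 + th 2 $ 1 + th 4 $ 7 - th 7 $ 4)"
    "dpsi th [1,2,3,5,6] = - 1 / 2 * (- th 1 $ 2 + th 2 $ 1 + th 5 $ 6 - th 6 $ 5)"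
    "dpsi th [1,2,3,5,7] = - 1 / 2 * (th 1 $ 3 - th 3 $ 1 + th 5 $ 7 - th 7 $ 5)"
    "dpsi th [1,2,3,6,7] = - 1 / 2 * (th 2 $ 3 - th 3 $ 2 + th 6 $ 7 - th 7 $ 6)"
    "dpsi th [1,2,4,5,6] = - 1 / 2 * (th 1 $ 5 + th 2 $ 6 - th 5 $ 1 - th 6 $ 2)"
    "dpsi th [1,2,4,5,7] = - 1 / 2 * (th 1 $ 4 + th 2 $ 7 - th 4 $ 1 - th 7 $ 2)"
    "dpsi th [1,2,4,6,7] = - 1 / 2 * (- th 1 $ 7 + th 2 $ 4 - th 4 $ 2 + th 7 $ 1)"
    "dpsi th [1,2,5,6,7] = - 1 / 2 * (- th 1 $ 6 + th 2 $ 5 - th 5 $ 2 + th 6 $ 1)"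
    "dpsi th [1,3,4,5,6] = - 1 / 2 * (th 1 $ 4 + th 3 $ 6 - th 4 $ 1 - th 6 $ 3)"
    "dpsi th [1,3,4,5,7] = - 1 / 2 * (- th 1 $ 5 + th 3 $ 7 + th 5 $ 1 - th 7 $ 3)"
    "dpsi th [1,3,4,6,7] = - 1 / 2 * (- th 1 $ 6 + th 3 $ 4 - th 4 $ 3 + th 6 $ 1)"
    "dpsi th [1,3,5,6,7] = - 1 / 2 * (th 1 $ 7 + th 3 $ 5 - th 5 $ 3 - th 7 $ 1)"
    "dpsi th [1,4,5,6,7] = - 1 / 2 * (th 4 $ 5 - th 5 $ 4 + th 6 $ 7 - th 7 $ 6)"
    "dpsi th [2,3,4,5,6] = - 1 / 2 * (th 2 $ 4 - th 3 $ 5 - th 4 $ 2 + th 5 $ 3)"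
    "dpsi th [2,3,4,5,7] = - 1 / 2 * (- th 2 $ 5 - th 3 $ 4 + th 4 $ 3 + th 5 $ 2)"
    "dpsi th [2,3,4,6,7] = - 1 / 2 * (- th 2 $ 6 + th 3 $ 7 + th 6 $ 2 - th 7 $ 3)"
    "dpsi th [2,3,5,6,7] = - 1 / 2 * (th 2 $ 7 + th 3 $ 6 - th 6 $ 3 - th 7 $ 2)"
    "dpsi th [2,4,5,6,7] = - 1 / 2 * (th 4 $ 6 - th 5 $ 7 - th 6 $ 4 + th 7 $ 5)"
    "dpsi th [3,4,5,6,7] = - 1 / 2 * (- th 4 $ 7 - th 5 $ 6 + th 6 $ 5 + th 7 $ 4)"
    
  by (simp_all add: dpsi_def lessThan_nat_numeral lessThan_Suc wedge_lform_phi[unfolded One_nat_def] lform_ax phi_ph ph_table ph_eq)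

lemma tvec_explicit:
  shows "tvec th 1 = th 2 $ 3 - th 3 $ 2 + th 4 $ 5 - th 5 $ 4 + th 6 $ 7 - th 7 $ 6"
    "tvec th 2 = - th 1 $ 3 + th 3 $ 1 + th 4 $ 6 - th 5 $ 7 - th 6 $ 4 + th 7 $ 5"
    "tvec th 3 = th 1 $ 2 - th 2 $ 1 - th 4 $ 7 - th 5 $ 6 + th 6 $ 5 + th 7 $ 4"
    "tvec th 4 = - th 1 $ 5 - th 2 $ 6 + th 3 $ 7 + th 5 $ 1 + th 6 $ 2 - th 7 $ 3"
    "tvec th 5 = th 1 $ 4 + th 2 $ 7 + th 3 $ 6 - th 4 $ 1 - th 6 $ 3 - th 7 $ 2"
    "tvec th 6 = - th 1 $ 7 + th 2 $ 4 - th 3 $ 5 - th 4 $ 2 + th 5 $ 3 + th 7 $ 1"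
    "tvec th 7 = th 1 $ 6 - th 2 $ 5 - th 3 $ 4 + th 4 $ 3 + th 5 $ 2 - th 6 $ 1"
    
  by (simp_all add: tvec_def sum_7 phi_ax_last ph_table ph_eq)

text \<open>The left-hand side is the inner product with \<open>psi\<close>, whose seven terms
  supply the indices and signs. It will give the trace of \<open>th\<close> as 7/2 of
  \<open>\<tau>\<^sub>0\<close>.\<close>

lemma trace_dphi: "- dphi th [1,2,4,7] - dphi th [1,2,5,6] - dphi th [1,3,4,6] + dphi th [1,3,5,7] + dphi th [2,3,4,5] + dphi th [2,3,6,7] + dphi th [4,5,6,7]
   = 2 * (th 1 $ 1 + th 2 $ 2 + th 3 $ 3 + th 4 $ 4 + th 5 $ 5 + th 6 $ 6 + th 7 $ 7)"
  by (simp add: dphi_explicit field_simps)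

text \<open>The inner products with e^a \<and> phi; for each a four of the seven terms of
  \<open>phi\<close> do not contain the index a.\<close>

lemma vector_dphi:
  shows "dphi th [1,2,4,6] - dphi th [1,2,5,7] - dphi th [1,3,4,7] - dphi th [1,3,5,6] = - tvec th 1"
    "- dphi th [1,2,4,5] - dphi th [1,2,6,7] - dphi th [2,3,4,7] - dphi th [2,3,5,6] = - tvec th 2"
    "- dphi th [1,3,4,5] - dphi th [1,3,6,7] - dphi th [2,3,4,6] + dphi th [2,3,5,7] = - tvec th 3"
    "- dphi th [1,2,3,4] - dphi th [1,4,6,7] + dphi th [2,4,5,7] + dphi th [3,4,5,6] = - tvec th 4"
    "- dphi th [1,2,3,5] - dphi th [1,5,6,7] + dphi th [2,4,5,6] - dphi th [3,4,5,7] = - tvec th 5"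
    "- dphi th [1,2,3,6] - dphi th [1,4,5,6] - dphi th [2,5,6,7] - dphi th [3,4,6,7] = - tvec th 6"
    "- dphi th [1,2,3,7] - dphi th [1,4,5,7] - dphi th [2,4,6,7] + dphi th [3,5,6,7] = - tvec th 7"
  by (simp_all add: dphi_explicit tvec_explicit field_simps)

text \<open>The inner products with e^a \<and> psi, which has three terms for each a. They agree
  with those in \<open>vector_dphi\<close>, so both torsion equations see the same
  \<open>\<tau>\<^sub>1\<close>.\<close>

lemma vector_dpsi:
  shows "dpsi th [1,2,3,4,5] + dpsi th [1,2,3,6,7] + dpsi th [1,4,5,6,7] = - tvec th 1"
    "dpsi th [1,2,3,4,6] - dpsi th [1,2,3,5,7] + dpsi th [2,4,5,6,7] = - tvec th 2"
    "- dpsi th [1,2,3,4,7] - dpsi th [1,2,3,5,6] + dpsi th [3,4,5,6,7] = - tvec th 3"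
    "- dpsi th [1,2,4,5,6] + dpsi th [1,3,4,5,7] + dpsi th [2,3,4,6,7] = - tvec th 4"
    "dpsi th [1,2,4,5,7] + dpsi th [1,3,4,5,6] + dpsi th [2,3,5,6,7] = - tvec th 5"
    "dpsi th [1,2,4,6,7] - dpsi th [1,3,5,6,7] + dpsi th [2,3,4,5,6] = - tvec th 6"
    "- dpsi th [1,2,5,6,7] - dpsi th [1,3,4,6,7] + dpsi th [2,3,4,5,7] = - tvec th 7"
  by (simp_all add: dpsi_explicit tvec_explicit field_simps)

text \<open>This is where the coefficients of the curvature formula are decided.\<close>

lemma qform_identity:
  "qform th = 1 / 2 * (th 1 $ 1 + th 2 $ 2 + th 3 $ 3 + th 4 $ 4 + th 5 $ 5 + th 6 $ 6 + th 7 $ 7)\<^sup>2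
     + 1 / 2 * (\<Sum>a\<in>UNIV. (tvec th a)\<^sup>2)
     - 1 / 2 * (\<Sum>is\<leftarrow>filter (\<lambda>is. length is = 4) (subseqs I7). (dphi th is)\<^sup>2)
     - 1 / 2 * (\<Sum>is\<leftarrow>filter (\<lambda>is. length is = 5) (subseqs I7). (dpsi th is)\<^sup>2)"
proof -
  \<comment> \<open>Doubling absorbs the factor 1/2 in \<open>dphi\<close> and \<open>dpsi\<close>,
    so the identity to be checked has integer coefficients.\<close>
  define P Q where "P is = 2 * dphi th is" and "Q is = 2 * dpsi th is" for "is"
  define S where "S = (\<Sum>a\<in>UNIV. \<Sum>b\<in>UNIV.
     2 * (th a $ a * th b $ b - th b $ a * th a $ b) - phi [ax a, ax b, cr (th a) (th b)])"
  have double: "2 * (1 / 2 * x) = x" "2 * (- 1 / 2 * x) = - x" for x :: real by simp_all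
  have A: "2 * S = 4 * (th 1 $ 1 + th 2 $ 2 + th 3 $ 3 + th 4 $ 4 + th 5 $ 5 + th 6 $ 6 + th 7 $ 7)\<^sup>2
     + 4 * (\<Sum>a\<in>UNIV. (tvec th a)\<^sup>2)
     - (\<Sum>is\<leftarrow>filter (\<lambda>is. length is = 4) (subseqs I7). (P is)\<^sup>2)
     - (\<Sum>is\<leftarrow>filter (\<lambda>is. length is = 5) (subseqs I7). (Q is)\<^sup>2)"
    unfolding subseqs_4 subseqs_5 S_def P_def Q_def sum_7 tvec_explicit phi_ax_last cr_nth phi_ax ph_table ph_eq
      list.map sum_list.Cons sum_list.Nil dphi_explicit dpsi_explicit double
    by algebra
  have B: "(\<Sum>is\<leftarrow>xs. (P is)\<^sup>2) = 4 * (\<Sum>is\<leftarrow>xs. (dphi th is)\<^sup>2)"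
    "(\<Sum>is\<leftarrow>xs. (Q is)\<^sup>2) = 4 * (\<Sum>is\<leftarrow>xs. (dpsi th is)\<^sup>2)" for xs
    by (induction xs) (simp_all add: P_def Q_def power_mult_distrib algebra_simps)
  have "1 / 4 * q = 1 / 2 * s + 1 / 2 * t - 1 / 2 * x - 1 / 2 * y" if "2 * q = 4 * s + 4 * t - 4 * x - 4 * y"
    for q s t x y :: real using that by (simp add: field_simps)
  from this[OF A[unfolded B]] show ?thesis unfolding qform_def S_def .
qed

section \<open>The torsion equations at a point, solved for the torsion forms\<close>

locale pointwise_torsion =
  fixes th :: "7 \<Rightarrow> real ^ 7" and T0 :: real and T1 T3 :: "(real ^ 7) covector"
  assumes T1: "altf 1 T1" and T3: "altf 3 T3"
    and d4: "\<And>is. is \<in> set (filter (\<lambda>is. length is = 4) (subseqs I7)) \<Longrightarrow>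
        dphi th is = T0 * star 3 phi (map ax is) + 3 * wedge 1 3 T1 phi (map ax is) + star 3 T3 (map ax is)"
    and T3_7: "\<And>vs. length vs = 6 \<Longrightarrow> wedge 3 3 T3 phi vs = 0"
    and T3_1: "\<And>vs. length vs = 7 \<Longrightarrow> wedge 3 4 T3 (star 3 phi) vs = 0"
begin

lemma T3_1': "length vs = 7 \<Longrightarrow> shuffle T3 psi 3 4 [] [] vs = 0"
  using T3_1[of vs] wedge_cong[of 3 T3 T3 4 "star 3 phi" psi vs] star_phi wedge_shuffle[OF T3 altf_psi, of vs] by simp

lemma T3_7': "length vs = 6 \<Longrightarrow> shuffle T3 phi 3 3 [] [] vs = 0"
  using T3_7[of vs] wedge_shuffle[OF T3 altf_phi, of vs] by simp

lemma d4': "is \<in> set (filter (\<lambda>is. length is = 4) (subseqs I7)) \<Longrightarrow>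
   T3 (map ax (compl7 is)) * epsl (compl7 is @ is) I7
   = dphi th is - T0 * psi (map ax is) - 3 * shuffle T1 phi 1 3 [] [] (map ax is)"
  using d4[of "is"] star_ax[OF T3, of "is"] star_phi[of "map ax is"] wedge_shuffle[OF T1 altf_phi, of "map ax is"]
    subseqs_distinctD[OF _ I7(1), of "is"] by (simp only: set_filter mem_Collect_eq length_map)

lemmas eval_rules = compl7_def sum_7 ps_table ps_eq psi_ps phi_ph ph_table ph_eq

text \<open>The first torsion equation paired with \<open>psi\<close>: \<open>T3\<close> drops out
  by \<open>T3_1\<close>, T1 \<and> phi is orthogonal to \<open>psi\<close>, and the squared norm of
  \<open>psi\<close> is 7.\<close>

lemma dphi_psi: "- dphi th [1,2,4,7] - dphi th [1,2,5,6] - dphi th [1,3,4,6] + dphi th [1,3,5,7] + dphi th [2,3,4,5] + dphi th [2,3,6,7] + dphi th [4,5,6,7] = 7 * T0"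
proof -
  note T3_1'[of "map ax I7"]
  moreover note d4'[of "[1,2,4,7]"] d4'[of "[1,2,5,6]"] d4'[of "[1,3,4,6]"] d4'[of "[1,3,5,7]"] d4'[of "[2,3,4,5]"] d4'[of "[2,3,6,7]"] d4'[of "[4,5,6,7]"]
  ultimately show ?thesis
    unfolding subseqs_4 by (simp add: eval_rules)
qed

text \<open>The first torsion equation paired with e^a \<and> phi: \<open>T0\<close> drops out by
  orthogonality and \<open>T3\<close> by \<open>T3_7\<close>. The constant 12 is 3 times 4, the
  squared norm of e^a \<and> phi.\<close>

lemma dphi_phi:
  shows "dphi th [1,2,4,6] - dphi th [1,2,5,7] - dphi th [1,3,4,7] - dphi th [1,3,5,6] = 12 * T1 [ax 1]"
    "- dphi th [1,2,4,5] - dphi th [1,2,6,7] - dphi th [2,3,4,7] - dphi th [2,3,5,6] = 12 * T1 [ax 2]"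
    "- dphi th [1,3,4,5] - dphi th [1,3,6,7] - dphi th [2,3,4,6] + dphi th [2,3,5,7] = 12 * T1 [ax 3]"
    "- dphi th [1,2,3,4] - dphi th [1,4,6,7] + dphi th [2,4,5,7] + dphi th [3,4,5,6] = 12 * T1 [ax 4]"
    "- dphi th [1,2,3,5] - dphi th [1,5,6,7] + dphi th [2,4,5,6] - dphi th [3,4,5,7] = 12 * T1 [ax 5]"
    "- dphi th [1,2,3,6] - dphi th [1,4,5,6] - dphi th [2,5,6,7] - dphi th [3,4,6,7] = 12 * T1 [ax 6]"
    "- dphi th [1,2,3,7] - dphi th [1,4,5,7] - dphi th [2,4,6,7] + dphi th [3,5,6,7] = 12 * T1 [ax 7]"
proof -
  show "dphi th [1,2,4,6] - dphi th [1,2,5,7] - dphi th [1,3,4,7] - dphi th [1,3,5,6] = 12 * T1 [ax 1]"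
    using T3_7'[of "map ax [2,3,4,5,6,7]"] d4'[of "[1,2,4,6]"] d4'[of "[1,2,5,7]"] d4'[of "[1,3,4,7]"] d4'[of "[1,3,5,6]"]
    unfolding subseqs_4 by (simp add: eval_rules)
  show "- dphi th [1,2,4,5] - dphi th [1,2,6,7] - dphi th [2,3,4,7] - dphi th [2,3,5,6] = 12 * T1 [ax 2]"
    using T3_7'[of "map ax [1,3,4,5,6,7]"] d4'[of "[1,2,4,5]"] d4'[of "[1,2,6,7]"] d4'[of "[2,3,4,7]"] d4'[of "[2,3,5,6]"]
    unfolding subseqs_4 by (simp add: eval_rules)
  show "- dphi th [1,3,4,5] - dphi th [1,3,6,7] - dphi th [2,3,4,6] + dphi th [2,3,5,7] = 12 * T1 [ax 3]"
    using T3_7'[of "map ax [1,2,4,5,6,7]"] d4'[of "[1,3,4,5]"] d4'[of "[1,3,6,7]"] d4'[of "[2,3,4,6]"] d4'[of "[2,3,5,7]"]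
    unfolding subseqs_4 by (simp add: eval_rules)
  show "- dphi th [1,2,3,4] - dphi th [1,4,6,7] + dphi th [2,4,5,7] + dphi th [3,4,5,6] = 12 * T1 [ax 4]"
    using T3_7'[of "map ax [1,2,3,5,6,7]"] d4'[of "[1,2,3,4]"] d4'[of "[1,4,6,7]"] d4'[of "[2,4,5,7]"] d4'[of "[3,4,5,6]"]
    unfolding subseqs_4 by (simp add: eval_rules)
  show "- dphi th [1,2,3,5] - dphi th [1,5,6,7] + dphi th [2,4,5,6] - dphi th [3,4,5,7] = 12 * T1 [ax 5]"
    using T3_7'[of "map ax [1,2,3,4,6,7]"] d4'[of "[1,2,3,5]"] d4'[of "[1,5,6,7]"] d4'[of "[2,4,5,6]"] d4'[of "[3,4,5,7]"]
    unfolding subseqs_4 by (simp add: eval_rules)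
  show "- dphi th [1,2,3,6] - dphi th [1,4,5,6] - dphi th [2,5,6,7] - dphi th [3,4,6,7] = 12 * T1 [ax 6]"
    using T3_7'[of "map ax [1,2,3,4,5,7]"] d4'[of "[1,2,3,6]"] d4'[of "[1,4,5,6]"] d4'[of "[2,5,6,7]"] d4'[of "[3,4,6,7]"]
    unfolding subseqs_4 by (simp add: eval_rules)
  show "- dphi th [1,2,3,7] - dphi th [1,4,5,7] - dphi th [2,4,6,7] + dphi th [3,5,6,7] = 12 * T1 [ax 7]"
    using T3_7'[of "map ax [1,2,3,4,5,6]"] d4'[of "[1,2,3,7]"] d4'[of "[1,4,5,7]"] d4'[of "[2,4,6,7]"] d4'[of "[3,5,6,7]"]
    unfolding subseqs_4 by (simp add: eval_rules)
qed

text \<open>This rests on the equation for d\<sigma> only. It will be applied on a whole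
  neighbourhood, where it turns the codifferential of \<open>\<tau>\<^sub>1\<close> into a
  divergence of \<open>tvec\<close>.\<close>

lemma T1_tvec: "12 * T1 [ax a] = - tvec th a"
proof -
  have "\<forall>a. 12 * T1 [ax a] = - tvec th a"
    unfolding forall_7 using dphi_phi vector_dphi[of th] by simp
  then show ?thesis by blast
qed

end

text \<open>Kept apart from the first torsion equation, because the second one will be available
  only at points whose chosen chart is the one in use.\<close>

locale pointwise_torsion2 = pointwise_torsion +
  fixes T2 :: "(real ^ 7) covector"
  assumes T2: "altf 2 T2"
    and d5: "\<And>is. is \<in> set (filter (\<lambda>is. length is = 5) (subseqs I7)) \<Longrightarrow>
        dpsi th is = 4 * wedge 1 4 T1 (star 3 phi) (map ax is) + wedge 2 3 T2 phi (map ax is)"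
    and T2_14: "\<And>vs. length vs = 5 \<Longrightarrow> wedge 2 3 T2 phi vs = - star 2 T2 vs"
begin

text \<open>Membership of \<open>T2\<close> in the 14-dimensional summand converts T2 \<and> phi
  into minus the star of \<open>T2\<close>, which on basis vectors is a single component.\<close>

lemma d5': "is \<in> set (filter (\<lambda>is. length is = 5) (subseqs I7)) \<Longrightarrow>
   T2 (map ax (compl7 is)) * epsl (compl7 is @ is) I7
   = - (dpsi th is - 4 * shuffle T1 psi 1 4 [] [] (map ax is))"
  using d5[of "is"] star_ax[OF T2, of "is"] T2_14[of "map ax is"]
    wedge_cong[of 1 T1 T1 4 "star 3 phi" psi "map ax is"] star_phi wedge_shuffle[OF T1 altf_psi, of "map ax is"]
    subseqs_distinctD[OF _ I7(1), of "is"] by (simp only: set_filter mem_Collect_eq length_map)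

lemma epsl_square: "distinct is \<Longrightarrow> (epsl (compl7 is @ is) I7)\<^sup>2 = 1"
proof -
  assume d: "distinct is"
  let ?xs = "compl7 is @ is"
  have l: "length ?xs = 7" using compl7(3)[OF d] by simp
  have s: "set ?xs = set I7" by (simp only: compl7(2) I7(2))
  from distinct_UNIV_perm[OF compl7(1)[OF d] I7(1) s, where 'v = "real ^ 7"] obtain \<pi> where
    \<pi>': "\<pi> permutes {..<length I7}"
      "\<And>f :: 7 \<Rightarrow> real ^ 7. map f ?xs = map (\<lambda>i. map f I7 ! \<pi> i) [0..<length I7]"
    by blast
  note \<pi> = \<pi>'[unfolded I7(3)]
  have "vol (map ax ?xs) = of_int (sign \<pi>) * vol (map ax I7)"
    unfolding \<pi>(2) by (rule altf_permute[OF altf_vol \<pi>(1)]) simp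
  moreover have "vol (map ax I7) = 1" unfolding vol_ax[OF I7(3)] by simp
  ultimately have "epsl ?xs I7 = of_int (sign \<pi>)" using vol_ax[OF l] by simp
  then show ?thesis by (simp add: power2_eq_square flip: of_int_mult)
qed

text \<open>Passing to complementary indices changes components by signs only, so sums of squares
  can be taken over 5-tuples; \<open>norm_T3\<close> does the same with 4-tuples.\<close>

lemma norm_T2: "(\<Sum>is\<leftarrow>filter (\<lambda>is. length is = 2) (subseqs I7). (T2 (map ax is))\<^sup>2)
  = (\<Sum>is\<leftarrow>filter (\<lambda>is. length is = 5) (subseqs I7). (dpsi th is - 4 * shuffle T1 psi 1 4 [] [] (map ax is))\<^sup>2)"
proof -
  have "(T2 (map ax (compl7 is)))\<^sup>2 = (dpsi th is - 4 * shuffle T1 psi 1 4 [] [] (map ax is))\<^sup>2"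
    if "is \<in> set (filter (\<lambda>is. length is = 5) (subseqs I7))" for "is"
  proof -
    have "distinct is" using that subseqs_distinctD[OF _ I7(1), of "is"] by (simp only: set_filter mem_Collect_eq)
    then show ?thesis
      using arg_cong[OF d5'[OF that], of "\<lambda>x. x\<^sup>2"] by (simp only: power_mult_distrib epsl_square power2_minus)
  qed
  then have A: "(\<Sum>is\<leftarrow>filter (\<lambda>is. length is = 5) (subseqs I7). (T2 (map ax (compl7 is)))\<^sup>2)
     = (\<Sum>is\<leftarrow>filter (\<lambda>is. length is = 5) (subseqs I7). (dpsi th is - 4 * shuffle T1 psi 1 4 [] [] (map ax is))\<^sup>2)"
    by (intro arg_cong[of _ _ sum_list] map_cong[OF refl])
  have B: "(\<Sum>is\<leftarrow>filter (\<lambda>is. length is = 5) (subseqs I7). (T2 (map ax (compl7 is)))\<^sup>2)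
    = (\<Sum>is\<leftarrow>filter (\<lambda>is. length is = 2) (subseqs I7). (T2 (map ax is))\<^sup>2)"
    unfolding subseqs_2 subseqs_5 by (simp add: compl7_def)
  show ?thesis unfolding B[symmetric] by (rule A)
qed

lemma norm_T3: "(\<Sum>is\<leftarrow>filter (\<lambda>is. length is = 3) (subseqs I7). (T3 (map ax is))\<^sup>2)
  = (\<Sum>is\<leftarrow>filter (\<lambda>is. length is = 4) (subseqs I7).
      (dphi th is - T0 * psi (map ax is) - 3 * shuffle T1 phi 1 3 [] [] (map ax is))\<^sup>2)"
proof -
  have "(T3 (map ax (compl7 is)))\<^sup>2 = (dphi th is - T0 * psi (map ax is) - 3 * shuffle T1 phi 1 3 [] [] (map ax is))\<^sup>2"
    if "is \<in> set (filter (\<lambda>is. length is = 4) (subseqs I7))" for "is"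
  proof -
    have "distinct is" using that subseqs_distinctD[OF _ I7(1), of "is"] by (simp only: set_filter mem_Collect_eq)
    then show ?thesis
      using arg_cong[OF d4'[OF that], of "\<lambda>x. x\<^sup>2"] by (simp only: power_mult_distrib epsl_square)
  qed
  then have A: "(\<Sum>is\<leftarrow>filter (\<lambda>is. length is = 4) (subseqs I7). (T3 (map ax (compl7 is)))\<^sup>2)
     = (\<Sum>is\<leftarrow>filter (\<lambda>is. length is = 4) (subseqs I7).
      (dphi th is - T0 * psi (map ax is) - 3 * shuffle T1 phi 1 3 [] [] (map ax is))\<^sup>2)"
    by (intro arg_cong[of _ _ sum_list] map_cong[OF refl])
  have B: "(\<Sum>is\<leftarrow>filter (\<lambda>is. length is = 4) (subseqs I7). (T3 (map ax (compl7 is)))\<^sup>2)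
    = (\<Sum>is\<leftarrow>filter (\<lambda>is. length is = 3) (subseqs I7). (T3 (map ax is))\<^sup>2)"
    unfolding subseqs_3 subseqs_4 by (simp add: compl7_def)
  show ?thesis unfolding B[symmetric] by (rule A)
qed

text \<open>Pythagoras: the squared norm of \<open>psi\<close> is 7, that of T1 \<and> phi is 4
  |T1|^2, and 36 is 4 times the square of the coefficient 3. The mixed terms are the pairings
  computed above.\<close>

lemma norm_dphi: "(\<Sum>is\<leftarrow>filter (\<lambda>is. length is = 4) (subseqs I7).
      (dphi th is - T0 * psi (map ax is) - 3 * shuffle T1 phi 1 3 [] [] (map ax is))\<^sup>2)
   = (\<Sum>is\<leftarrow>filter (\<lambda>is. length is = 4) (subseqs I7). (dphi th is)\<^sup>2) - 7 * T0\<^sup>2 - 36 * (\<Sum>a\<in>UNIV. (T1 [ax a])\<^sup>2)"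
  unfolding subseqs_4 using dphi_psi dphi_phi
  by (simp add: psi_ps phi_ph ps_table ph_table sum_7) algebra

text \<open>T1 \<and> psi has squared norm 3 |T1|^2 and inner product 12 |T1|^2 with
  \<open>dpsi\<close>, by \<open>vector_dpsi\<close> and \<open>T1_tvec\<close>; the constant is 16
  * 3 - 8 * 12 = -48.\<close>

lemma norm_dpsi: "(\<Sum>is\<leftarrow>filter (\<lambda>is. length is = 5) (subseqs I7). (dpsi th is - 4 * shuffle T1 psi 1 4 [] [] (map ax is))\<^sup>2)
   = (\<Sum>is\<leftarrow>filter (\<lambda>is. length is = 5) (subseqs I7). (dpsi th is)\<^sup>2) - 48 * (\<Sum>a\<in>UNIV. (T1 [ax a])\<^sup>2)"
  unfolding subseqs_5 using vector_dpsi[of th, folded T1_tvec]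
  by (simp add: psi_ps ps_table sum_7) algebra

text \<open>With trace 7/2 T0 and tvec = -12 T1, the identity \<open>qform_identity\<close> gives
  49/8 - 7/2 = 21/8 for the square of \<open>T0\<close> and 72 - 18 - 24 = 30 for that of
  \<open>T1\<close>.\<close>

lemma torsion_norms:
  "21 / 8 * T0\<^sup>2 + 30 * (\<Sum>a\<in>UNIV. (T1 [ax a])\<^sup>2)
     - 1 / 2 * (\<Sum>is\<leftarrow>filter (\<lambda>is. length is = 2) (subseqs I7). (T2 (map ax is))\<^sup>2)
     - 1 / 2 * (\<Sum>is\<leftarrow>filter (\<lambda>is. length is = 3) (subseqs I7). (T3 (map ax is))\<^sup>2) = qform th"
proof -
  have "(tvec th a)\<^sup>2 = 144 * (T1 [ax a])\<^sup>2" for a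
    using arg_cong[OF T1_tvec[of a], of "\<lambda>x. x\<^sup>2"] by (simp add: power_mult_distrib)
  then have t: "(\<Sum>a\<in>UNIV. (tvec th a)\<^sup>2) = 144 * (\<Sum>a\<in>UNIV. (T1 [ax a])\<^sup>2)"
    by (simp add: sum_distrib_left)
  have "7 * T0 = 2 * (th 1 $ 1 + th 2 $ 2 + th 3 $ 3 + th 4 $ 4 + th 5 $ 5 + th 6 $ 6 + th 7 $ 7)"
    using dphi_psi trace_dphi[of th] by simp
  then have "th 1 $ 1 + th 2 $ 2 + th 3 $ 3 + th 4 $ 4 + th 5 $ 5 + th 6 $ 6 + th 7 $ 7 = 7 / 2 * T0"
  proof -
    have "x = 7 / 2 * t" if "7 * t = 2 * x" for x t :: real using that by simp
    from this[OF \<open>7 * T0 = _\<close>] show ?thesis .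
  qed
  then have sq: "(th 1 $ 1 + th 2 $ 2 + th 3 $ 3 + th 4 $ 4 + th 5 $ 5 + th 6 $ 6 + th 7 $ 7)\<^sup>2 = 49 / 4 * T0\<^sup>2"
    by (simp only: power_mult_distrib) (simp add: power_divide)
  have "21 / 8 * z + 30 * w - 1 / 2 * (x - 48 * w) - 1 / 2 * (y - 7 * z - 36 * w)
      = 1 / 2 * (49 / 4 * z) + 1 / 2 * (144 * w) - 1 / 2 * y - 1 / 2 * x" for x y z w :: real
    by (simp add: field_simps)
  then show ?thesis
    unfolding norm_T2 norm_T3 norm_dphi norm_dpsi qform_identity t sq .
qed

end

section \<open>Matrix-valued functions\<close>

definition smoothM :: "(real ^ 'n) set \<Rightarrow> (real ^ 'n::finite \<Rightarrow> real ^ 'k::finite ^ 'l::finite) \<Rightarrow> bool" where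
  "smoothM V A \<longleftrightarrow> (\<forall>i j. smooth_on V (\<lambda>z. A z $ i $ j))"

definition pdm :: "'n \<Rightarrow> (real ^ 'n::finite \<Rightarrow> real ^ 'k::finite ^ 'l::finite) \<Rightarrow> real ^ 'n \<Rightarrow> real ^ 'k ^ 'l" where
  "pdm m A z = (\<chi> i j. pderiv_at m (\<lambda>z. A z $ i $ j) z)"

lemma smoothMD: "smoothM V A \<Longrightarrow> smooth_on V (\<lambda>z. A z $ i $ j)"
  by (simp add: smoothM_def)

lemma pderiv_cong:
  assumes "open V" "z \<in> V" "\<And>y. y \<in> V \<Longrightarrow> f y = g y"
  shows "pderiv_at m f z = pderiv_at m g z"
  unfolding pderiv_at_def using frechet_derivative_cong[OF assms] by simp

lemma pderiv_add:
  "smooth_on V f \<Longrightarrow> smooth_on V g \<Longrightarrow> z \<in> V \<Longrightarrow> pderiv_at m (\<lambda>z. f z + g z) z = pderiv_at m f z + pderiv_at m g z"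
  unfolding pderiv_at_def
  by (subst frechet_derivative_eqI[OF has_derivative_add[OF smooth_on_has_derivative smooth_on_has_derivative]]) simp_all

lemma pderiv_mult:
  fixes f g :: "real ^ 'n::finite \<Rightarrow> real"
  shows "smooth_on V f \<Longrightarrow> smooth_on V g \<Longrightarrow> z \<in> V \<Longrightarrow>
    pderiv_at m (\<lambda>z. f z * g z) z = pderiv_at m f z * g z + f z * pderiv_at m g z"
  unfolding pderiv_at_def
  by (subst frechet_derivative_eqI[OF has_derivative_mult[OF smooth_on_has_derivative smooth_on_has_derivative]]) simp_all

lemma pderiv_const: "pderiv_at m (\<lambda>z. c) z = 0"
  unfolding pderiv_at_def by (subst frechet_derivative_eqI[OF has_derivative_const]) simp

lemma pderiv_cmult:
  fixes f :: "real ^ 'n::finite \<Rightarrow> real"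
  shows "smooth_on V f \<Longrightarrow> z \<in> V \<Longrightarrow> pderiv_at m (\<lambda>z. c * f z) z = c * pderiv_at m f z"
  using pderiv_mult[of V "\<lambda>z. c" f z m] by (simp add: pderiv_const smooth_on_const)

lemma pderiv_sum:
  fixes f :: "'i \<Rightarrow> real ^ 'n::finite \<Rightarrow> real"
  assumes "\<And>i. i \<in> I \<Longrightarrow> smooth_on V (f i)" "z \<in> V"
  shows "pderiv_at m (\<lambda>z. \<Sum>i\<in>I. f i z) z = (\<Sum>i\<in>I. pderiv_at m (f i) z)"
  unfolding pderiv_at_def
  by (subst frechet_derivative_eqI[OF has_derivative_sum[OF smooth_on_has_derivative[OF assms]]]) simp_all

lemma smoothM_mult:
  fixes A :: "real ^ 'n::finite \<Rightarrow> real ^ 'k::finite ^ 'l::finite" and B :: "real ^ 'n \<Rightarrow> real ^ 'j::finite ^ 'k"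
  assumes "open V" "smoothM V A" "smoothM V B"
  shows "smoothM V (\<lambda>z. A z ** B z)"
  unfolding smoothM_def
proof (intro allI)
  fix i j
  show "smooth_on V (\<lambda>z. (A z ** B z) $ i $ j)"
    unfolding matrix_matrix_mult_def
    by (simp, intro smooth_on_sum smooth_on_mult smoothMD assms)
qed

lemma pdm_mult:
  fixes A :: "real ^ 'n::finite \<Rightarrow> real ^ 'k::finite ^ 'l::finite" and B :: "real ^ 'n \<Rightarrow> real ^ 'j::finite ^ 'k"
  assumes V: "open V" and A: "smoothM V A" and B: "smoothM V B" and z: "z \<in> V"
  shows "pdm m (\<lambda>z. A z ** B z) z = pdm m A z ** B z + A z ** pdm m B z"
proof -
  have "pderiv_at m (\<lambda>z. \<Sum>k\<in>UNIV. A z $ i $ k * B z $ k $ j) z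
      = (\<Sum>k\<in>UNIV. pderiv_at m (\<lambda>z. A z $ i $ k) z * B z $ k $ j + A z $ i $ k * pderiv_at m (\<lambda>z. B z $ k $ j) z)" for i j
    using smooth_on_mult[OF V smoothMD[OF A] smoothMD[OF B]]
    by (subst pderiv_sum[of _ V]) (simp_all add: z pderiv_mult[OF smoothMD[OF A] smoothMD[OF B] z])
  then show ?thesis
    by (simp add: vec_eq_iff pdm_def matrix_matrix_mult_def sum.distrib)
qed

lemma pdm_nth: "pdm m A z $ i $ j = pderiv_at m (\<lambda>z. A z $ i $ j) z"
  by (simp add: pdm_def)

lemma pdm_add:
  assumes "smoothM V A" "smoothM V B" "z \<in> V"
  shows "pdm m (\<lambda>z. A z + B z) z = pdm m A z + pdm m B z"
  using pderiv_add[OF smoothMD[OF assms(1)] smoothMD[OF assms(2)] assms(3)] by (simp add: vec_eq_iff pdm_nth)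

lemma pdm_cong:
  assumes "open V" "z \<in> V" "\<And>y. y \<in> V \<Longrightarrow> A y = B y"
  shows "pdm m A z = pdm m B z"
proof -
  have "pderiv_at m (\<lambda>z. A z $ i $ j) z = pderiv_at m (\<lambda>z. B z $ i $ j) z" for i j
    by (rule pderiv_cong[OF assms(1,2)]) (simp add: assms(3))
  then show ?thesis by (simp add: vec_eq_iff pdm_nth)
qed

lemma smoothM_pdm: "smoothM V A \<Longrightarrow> smoothM V (pdm m A)"
  by (simp add: smoothM_def pdm_nth smooth_on_pderiv[unfolded pderiv_at_def] pderiv_at_def)

lemma pdm_symmetric:
  assumes "open V" "smoothM V A" "z \<in> V"
  shows "pdm m (pdm n A) z = pdm n (pdm m A) z"
proof -
  have "pderiv_at m (pderiv_at n (\<lambda>z. A z $ i $ j)) z = pderiv_at n (pderiv_at m (\<lambda>z. A z $ i $ j)) z" for i j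
    by (rule pderiv_symmetric[OF assms(1) smoothMD[OF assms(2)] assms(3)])
  then show ?thesis by (simp add: vec_eq_iff pdm_nth)
qed

lemma matrix_sub_ldistrib: "A ** (B - C) = A ** B - A ** C" for A :: "real ^ 'k::finite ^ 'l::finite"
  by (simp add: vec_eq_iff matrix_matrix_mult_def algebra_simps sum_subtractf)

lemma matrix_sub_rdistrib: "(A - B) ** C = A ** C - B ** C" for C :: "real ^ 'k::finite ^ 'l::finite"
  by (simp add: vec_eq_iff matrix_matrix_mult_def algebra_simps sum_subtractf)

lemma matrix_add_ldistr: "A ** (B + C) = A ** B + A ** C" for A :: "real ^ 'k::finite ^ 'l::finite"
  by (simp add: vec_eq_iff matrix_matrix_mult_def algebra_simps sum.distrib)

lemma matrix_add_rdistr: "(A + B) ** C = A ** C + B ** C" for C :: "real ^ 'k::finite ^ 'l::finite"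
  by (simp add: vec_eq_iff matrix_matrix_mult_def algebra_simps sum.distrib)

lemmas matrix_distribs = matrix_sub_ldistrib matrix_sub_rdistrib matrix_add_ldistr matrix_add_rdistr

section \<open>The Levi-Civita connection in a moving frame\<close>

text \<open>Symmetry of \<open>G\<close> is asked for at every point, so that opposite entries are
  equal as functions and their partial derivatives agree without passing to a neighbourhood.\<close>

locale coframe_field =
  fixes V :: "(real ^ 'n::finite) set" and E G :: "real ^ 'n \<Rightarrow> real ^ 'n ^ 'n"
  assumes V: "open V" and smE: "smoothM V E" and inv: "\<And>z. z \<in> V \<Longrightarrow> invertible (E z)"
    and G: "\<And>z. z \<in> V \<Longrightarrow> G z = transpose (E z) ** E z"
    and Gsym: "\<And>z i j. G z $ i $ j = G z $ j $ i"
begin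

definition F where "F z = matrix_inv (E z)"

lemma EF: "z \<in> V \<Longrightarrow> E z ** F z = mat 1" and FE: "z \<in> V \<Longrightarrow> F z ** E z = mat 1"
proof -
  assume "z \<in> V"
  then have "\<exists>B. E z ** B = mat 1 \<and> B ** E z = mat 1" using inv unfolding invertible_def by blast
  then have "E z ** F z = mat 1 \<and> F z ** E z = mat 1" unfolding F_def matrix_inv_def by (rule someI_ex)
  then show "E z ** F z = mat 1" "F z ** E z = mat 1" by auto
qed

lemma smF: "smoothM V F"
  unfolding smoothM_def
proof (intro allI)
  fix i j
  show "smooth_on V (\<lambda>z. F z $ i $ j)"
  proof (rule smooth_on_cong[OF V, THEN iffD1])
    show "smooth_on V (\<lambda>z. (F z *v ax j) $ i)"
    proof (rule smooth_on_solve[OF V, of E "\<lambda>z. ax j"])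
      show "E z *v (F z *v ax j) = ax j" if "z \<in> V" for z
        using EF[OF that] by (simp add: matrix_vector_mul_assoc)
      show "det (E z) \<noteq> 0" if "z \<in> V" for z using inv[OF that] by (simp add: invertible_det_nz)
    qed (simp_all add: smoothMD[OF smE] smooth_on_const)
    show "(F z *v ax j) $ i = F z $ i $ j" for z by (simp add: matrix_vector_mult_basis column_def)
  qed
qed

lemma smT: "smoothM V A \<Longrightarrow> smoothM V (\<lambda>z. transpose (A z))"
  by (simp add: smoothM_def transpose_def)

lemma Ginv: "z \<in> V \<Longrightarrow> matrix_inv (G z) = F z ** transpose (F z)"
proof -
  assume z: "z \<in> V"
  have tt: "transpose (F z) ** transpose (E z) = mat 1" "transpose (E z) ** transpose (F z) = mat 1"
    by (simp_all add: matrix_transpose_mul[symmetric] EF[OF z] FE[OF z] transpose_mat)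
  have 1: "G z ** (F z ** transpose (F z)) = mat 1"
  proof -
    have "G z ** (F z ** transpose (F z)) = transpose (E z) ** (E z ** F z) ** transpose (F z)"
      by (simp add: G[OF z] matrix_mul_assoc)
    then show ?thesis by (simp add: EF[OF z] tt)
  qed
  have 2: "(F z ** transpose (F z)) ** G z = mat 1"
  proof -
    have "(F z ** transpose (F z)) ** G z = F z ** (transpose (F z) ** transpose (E z)) ** E z"
      by (simp add: G[OF z] matrix_mul_assoc)
    then show ?thesis by (simp add: FE[OF z] tt)
  qed
  have "invertible (G z)" unfolding invertible_def using 1 2 by blast
  then have "matrix_inv (G z) ** G z = mat 1"
    unfolding invertible_def matrix_inv_def by (rule someI2_ex) simp
  then have "matrix_inv (G z) ** (G z ** (F z ** transpose (F z))) = F z ** transpose (F z)"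
    by (simp add: matrix_mul_assoc)
  then show ?thesis by (simp add: 1)
qed

lemma smG: "smooth_on V (\<lambda>z. G z $ i $ j)"
proof (rule smooth_on_cong[OF V, THEN iffD1])
  show "smooth_on V (\<lambda>z. (transpose (E z) ** E z) $ i $ j)"
    by (rule smoothMD[OF smoothM_mult[OF V smT[OF smE] smE]])
qed (simp add: G)

text \<open>Christoffel symbols as a matrix acting on vectors: covariant differentiation in
  direction \<open>m\<close> is the partial derivative plus \<open>Gam m\<close>.\<close>

definition Gam where "Gam m z = (\<chi> r n. christoffel G r m n z)"

lemma Gam_sym: "Gam m z $ r $ n = Gam n z $ r $ m"
proof -
  have "(\<lambda>z. G z $ m $ n) = (\<lambda>z. G z $ n $ m)" by (simp add: Gsym fun_eq_iff)
  then show ?thesis by (simp add: Gam_def christoffel_def add.commute)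
qed

lemma smGam: "smoothM V (Gam m)"
  unfolding smoothM_def
proof (intro allI)
  fix i j
  have "smooth_on V (\<lambda>z. 1 / 2 * (\<Sum>l\<in>UNIV. (F z ** transpose (F z)) $ i $ l *
       (pderiv_at m (\<lambda>z. G z $ j $ l) z + pderiv_at j (\<lambda>z. G z $ m $ l) z - pderiv_at l (\<lambda>z. G z $ m $ j) z)))"
    by (intro smooth_on_mult smooth_on_sum smooth_on_add smooth_on_diff smooth_on_const V smooth_on_pderiv smG
        smoothMD[OF smoothM_mult[OF V smF smT[OF smF]]])
  then show "smooth_on V (\<lambda>z. Gam m z $ i $ j)"
    by (rule smooth_on_cong[OF V, THEN iffD1, rotated]) (simp add: Gam_def christoffel_def Ginv)
qed

lemma G_Gam: "z \<in> V \<Longrightarrow> (G z ** Gam m z) $ b $ a =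
    1 / 2 * (pdm m G z $ a $ b + pdm a G z $ m $ b - pdm b G z $ m $ a)"
proof -
  assume z: "z \<in> V"
  define q where "q l = pdm m G z $ a $ l + pdm a G z $ m $ l - pdm l G z $ m $ a" for l
  have GG: "(\<Sum>r\<in>UNIV. G z $ b $ r * matrix_inv (G z) $ r $ l) = (if b = l then 1 else 0)" for l
  proof -
    have "G z ** matrix_inv (G z) = mat 1"
    proof -
      have "transpose (E z) ** E z ** (F z ** transpose (F z)) = transpose (E z) ** (E z ** F z) ** transpose (F z)"
        by (simp add: matrix_mul_assoc)
      also have "\<dots> = transpose (F z ** E z)" by (simp add: EF[OF z] matrix_transpose_mul)
      also have "\<dots> = mat 1" by (simp add: FE[OF z] transpose_mat)
      finally show ?thesis unfolding Ginv[OF z] unfolding G[OF z] .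
    qed
    then have "(G z ** matrix_inv (G z)) $ b $ l = mat 1 $ b $ l" by simp
    then show ?thesis by (simp add: matrix_matrix_mult_def mat_def)
  qed
  have "(G z ** Gam m z) $ b $ a = (\<Sum>r\<in>UNIV. G z $ b $ r * (1 / 2 * (\<Sum>l\<in>UNIV. matrix_inv (G z) $ r $ l * q l)))"
    by (simp add: matrix_matrix_mult_def Gam_def christoffel_def q_def pdm_nth)
  also have "\<dots> = 1 / 2 * (\<Sum>r\<in>UNIV. \<Sum>l\<in>UNIV. G z $ b $ r * matrix_inv (G z) $ r $ l * q l)"
    by (simp add: sum_distrib_left algebra_simps)
  also have "(\<Sum>r\<in>UNIV. \<Sum>l\<in>UNIV. G z $ b $ r * matrix_inv (G z) $ r $ l * q l)
     = (\<Sum>l\<in>UNIV. (\<Sum>r\<in>UNIV. G z $ b $ r * matrix_inv (G z) $ r $ l) * q l)"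
    unfolding sum_distrib_right by (rule sum.swap)
  also have "\<dots> = (\<Sum>l\<in>UNIV. if l = b then q l else 0)"
    unfolding GG by (intro sum.cong refl) auto
  also have "\<dots> = q b" by simp
  finally show ?thesis by (simp add: q_def)
qed

text \<open>The sum of the two lowered Christoffel symbols from \<open>G_Gam\<close> leaves only the
  derivative of the metric in direction \<open>m\<close>.\<close>

lemma metric_compatible: "z \<in> V \<Longrightarrow> pdm m G z = transpose (Gam m z) ** G z + G z ** Gam m z"
proof -
  assume z: "z \<in> V"
  have "(transpose (Gam m z) ** G z) $ a $ b = (G z ** Gam m z) $ b $ a" for a b
    by (simp add: matrix_matrix_mult_def transpose_def mult.commute Gsym[of z b])
  then have T: "(transpose (Gam m z) ** G z + G z ** Gam m z) $ a $ b = (G z ** Gam m z) $ b $ a + (G z ** Gam m z) $ a $ b"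
    for a b by simp
  have sy: "pdm l G z $ i $ j = pdm l G z $ j $ i" for l i j
    unfolding pdm_nth Gsym[of _ i j] ..
  have "pdm m G z $ a $ b = (transpose (Gam m z) ** G z + G z ** Gam m z) $ a $ b" for a b
    unfolding T G_Gam[OF z] using sy[of m a b] by (simp add: field_simps)
  then show ?thesis unfolding vec_eq_iff by blast
qed

text \<open>The connection matrix in the frame formed by the columns of \<open>F\<close>, that is,
  the gauge transform of \<open>Gam\<close> by \<open>E\<close>.\<close>

definition om where "om m z = E z ** Gam m z ** F z - pdm m E z ** F z"

lemma om_E: "z \<in> V \<Longrightarrow> om m z ** E z = E z ** Gam m z - pdm m E z"
proof -
  assume z: "z \<in> V"
  have "om m z ** E z = E z ** Gam m z ** (F z ** E z) - pdm m E z ** (F z ** E z)"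
    by (simp add: om_def matrix_distribs matrix_mul_assoc)
  then show ?thesis by (simp add: FE[OF z])
qed

lemma smom: "smoothM V (om m)"
proof -
  have "smoothM V (\<lambda>z. E z ** Gam m z ** F z)" "smoothM V (\<lambda>z. pdm m E z ** F z)"
    by (intro smoothM_mult V smE smGam smF smoothM_pdm)+
  then show ?thesis
    unfolding smoothM_def om_def by (simp add: smooth_on_diff[OF V])
qed

text \<open>The frame is orthonormal, so compatibility with the metric becomes skewness of the
  connection matrix: both sides are compared after conjugation with \<open>E\<close>, which is then
  cancelled by \<open>F\<close>.\<close>

lemma om_skew: "z \<in> V \<Longrightarrow> skewm (om m z)"
proof -
  assume z: "z \<in> V"
  have pE: "pdm m (\<lambda>z. transpose (E z)) z = transpose (pdm m E z)"
    by (simp add: vec_eq_iff pdm_nth transpose_def)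
  have "pdm m G z = pdm m (\<lambda>z. transpose (E z) ** E z) z"
    by (rule pdm_cong[OF V z]) (rule G)
  also have "\<dots> = transpose (pdm m E z) ** E z + transpose (E z) ** pdm m E z"
    using pdm_mult[OF V smT[OF smE] smE z, of m] by (simp add: pE)
  finally have 1: "transpose (pdm m E z) ** E z + transpose (E z) ** pdm m E z
      = transpose (Gam m z) ** (transpose (E z) ** E z) + transpose (E z) ** E z ** Gam m z"
    using metric_compatible[OF z, of m] G[OF z] by simp
  have 2: "transpose (E z) ** (om m z ** E z) = transpose (E z) ** E z ** Gam m z - transpose (E z) ** pdm m E z"
    unfolding om_E[OF z] by (simp add: matrix_distribs matrix_mul_assoc)
  have 3: "transpose (om m z ** E z) ** E z = transpose (Gam m z) ** (transpose (E z) ** E z) - transpose (pdm m E z) ** E z"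
  proof -
    have "transpose (E z ** Gam m z - pdm m E z) = transpose (Gam m z) ** transpose (E z) - transpose (pdm m E z)"
      by (simp add: matrix_transpose_mul[symmetric]) (simp add: transpose_def vec_eq_iff)
    then show ?thesis unfolding om_E[OF z] by (simp add: matrix_distribs matrix_mul_assoc)
  qed
  have "transpose (E z) ** (om m z ** E z) + transpose (om m z ** E z) ** E z = 0"
    unfolding 2 3 using 1 by (simp add: algebra_simps)
  then have "transpose (E z) ** (om m z + transpose (om m z)) ** E z = 0"
    by (simp add: matrix_transpose_mul matrix_distribs matrix_mul_assoc)
  then have "transpose (F z) ** (transpose (E z) ** (om m z + transpose (om m z)) ** E z) ** F z = 0"
    by simp
  moreover have "transpose (F z) ** (transpose (E z) ** (om m z + transpose (om m z)) ** E z) ** F z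
     = (transpose (F z) ** transpose (E z)) ** (om m z + transpose (om m z)) ** (E z ** F z)"
    by (simp add: matrix_mul_assoc)
  moreover have "transpose (F z) ** transpose (E z) = mat 1"
    by (simp add: matrix_transpose_mul[symmetric] EF[OF z] transpose_mat)
  ultimately have "om m z + transpose (om m z) = 0" by (simp add: EF[OF z])
  then have "om m z $ i $ j + om m z $ j $ i = 0" for i j
    by (simp add: vec_eq_iff transpose_def)
  then show ?thesis unfolding skewm_def by (metis add.commute add_eq_0_iff)
qed

definition Rm where "Rm m n z = pdm m (Gam n) z - pdm n (Gam m) z + (Gam m z ** Gam n z - Gam n z ** Gam m z)"

definition Om where "Om m n z = pdm m (om n) z - pdm n (om m) z + (om m z ** om n z - om n z ** om m z)"

lemma riemann_Rm: "riemann G r s m n z = Rm m n z $ r $ s"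
  by (simp add: riemann_def Rm_def pdm_nth Gam_def matrix_matrix_mult_def sum_subtractf)

text \<open>Gauge covariance of curvature. Differentiating \<open>om_E\<close> once more and
  antisymmetrising in \<open>m\<close> and \<open>n\<close> removes the second derivatives of
  \<open>E\<close>; the first derivatives are then eliminated by \<open>om_E\<close>.\<close>

lemma structure_equation: "z \<in> V \<Longrightarrow> E z ** Rm m n z = Om m n z ** E z"
proof -
  assume z: "z \<in> V"
  have d: "pdm m E z ** Gam n z + E z ** pdm m (Gam n) z
      = pdm m (pdm n E) z + (pdm m (om n) z ** E z + om n z ** pdm m E z)" for m n
  proof -
    have "pdm m (\<lambda>z. E z ** Gam n z) z = pdm m (\<lambda>z. pdm n E z + om n z ** E z) z"
      by (rule pdm_cong[OF V z]) (simp add: om_E)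
    then show ?thesis
      unfolding pdm_mult[OF V smE smGam z] pdm_mult[OF V smom smE z]
        pdm_add[OF smoothM_pdm[OF smE] smoothM_mult[OF V smom smE] z] .
  qed
  have dE: "pdm m E z = E z ** Gam m z - om m z ** E z" for m using om_E[OF z, of m] by simp
  have A: "E z ** pdm m (Gam n) z - E z ** pdm n (Gam m) z
      = (pdm m (om n) z ** E z - pdm n (om m) z ** E z)
        + (om n z ** pdm m E z - om m z ** pdm n E z - pdm m E z ** Gam n z + pdm n E z ** Gam m z)"
  proof -
    have d': "E z ** pdm m (Gam n) z
        = pdm m (pdm n E) z + (pdm m (om n) z ** E z + om n z ** pdm m E z) - pdm m E z ** Gam n z" for m n
      using d[of m n] by (simp add: eq_diff_eq add.commute)
    show ?thesis unfolding d'[of m n] d'[of n m] pdm_symmetric[OF V smE z, of m n] by (simp add: algebra_simps)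
  qed
  have B: "om n z ** pdm m E z - om m z ** pdm n E z - pdm m E z ** Gam n z + pdm n E z ** Gam m z
     = (om m z ** om n z ** E z - om n z ** om m z ** E z) - (E z ** (Gam m z ** Gam n z) - E z ** (Gam n z ** Gam m z))"
    unfolding dE by (simp add: matrix_distribs matrix_mul_assoc)
  have "E z ** Rm m n z = E z ** pdm m (Gam n) z - E z ** pdm n (Gam m) z
     + (E z ** (Gam m z ** Gam n z) - E z ** (Gam n z ** Gam m z))"
    by (simp add: Rm_def matrix_distribs)
  also have "\<dots> = (pdm m (om n) z ** E z - pdm n (om m) z ** E z) + (om m z ** om n z ** E z - om n z ** om m z ** E z)"
    unfolding A B by simp
  also have "\<dots> = Om m n z ** E z" by (simp add: Om_def matrix_distribs)
  finally show ?thesis .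
qed

lemma Om_skew: "z \<in> V \<Longrightarrow> skewm (Om m n z)"
proof -
  assume z: "z \<in> V"
  have s: "om m y $ j $ i = - om m y $ i $ j" if "y \<in> V" for m y i j
    using om_skew[OF that] unfolding skewm_def by blast
  have p: "pdm m (om n) z $ j $ i = - pdm m (om n) z $ i $ j" for m n i j
  proof -
    have "pderiv_at m (\<lambda>z. om n z $ j $ i) z = pderiv_at m (\<lambda>z. - 1 * om n z $ i $ j) z"
    proof (rule pderiv_cong[OF V z])
      show "om n y $ j $ i = - 1 * om n y $ i $ j" if "y \<in> V" for y using s[OF that, of n j i] by simp
    qed
    then show ?thesis
      unfolding pdm_nth using pderiv_cmult[OF smoothMD[OF smom] z, of m "- 1"] by simp
  qed
  have t: "(om m z ** om n z) $ j $ i = (om n z ** om m z) $ i $ j" for m n i j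
  proof -
    have "om m z $ j $ k * om n z $ k $ i = om n z $ i $ k * om m z $ k $ j" for k
      using s[OF z, of m k j] s[OF z, of n i k] by simp
    then show ?thesis by (simp add: matrix_matrix_mult_def)
  qed
  show ?thesis unfolding skewm_def
  proof (intro allI)
    fix i j
    show "Om m n z $ j $ i = - Om m n z $ i $ j"
      unfolding Om_def vector_add_component vector_minus_component
      using p[of m n j i] p[of n m j i] t[of m n j i] t[of n m j i] by simp
  qed
qed

text \<open>Since the Christoffel symbols are symmetric in their lower indices, the cyclic sum
  cancels term by term.\<close>

lemma bianchi: "Rm m n z $ r $ s + Rm n s z $ r $ m + Rm s m z $ r $ n = 0"
proof -
  have p: "pdm m (Gam n) z $ r $ s = pdm m (Gam s) z $ r $ n" for m n s
    unfolding pdm_nth Gam_sym[of n _ r s] ..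
  have q: "(Gam m z ** Gam n z) $ r $ s = (Gam m z ** Gam s z) $ r $ n" for m n s
    unfolding matrix_matrix_mult_def using Gam_sym[of n z _ s] by simp
  show ?thesis
    unfolding Rm_def vector_add_component vector_minus_component
    using p[of m n s] p[of n m s] p[of s n m] q[of m n s] q[of n m s] q[of s n m] by simp
qed

end

section \<open>Vector-valued functions and the determinant\<close>

definition pdv :: "'n \<Rightarrow> (real ^ 'n::finite \<Rightarrow> real ^ 'k::finite) \<Rightarrow> real ^ 'n \<Rightarrow> real ^ 'k" where
  "pdv m x z = (\<chi> k. pderiv_at m (\<lambda>z. x z $ k) z)"

definition smoothV :: "(real ^ 'n::finite) set \<Rightarrow> (real ^ 'n \<Rightarrow> real ^ 'k::finite) \<Rightarrow> bool" where
  "smoothV V x \<longleftrightarrow> (\<forall>k. smooth_on V (\<lambda>z. x z $ k))"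

lemma pdv_nth: "pdv m x z $ k = pderiv_at m (\<lambda>z. x z $ k) z"
  by (simp add: pdv_def)

lemma smoothVD: "smoothV V x \<Longrightarrow> smooth_on V (\<lambda>z. x z $ k)"
  by (simp add: smoothV_def)

lemma smoothV_mv:
  fixes A :: "real ^ 'n::finite \<Rightarrow> real ^ 'k::finite ^ 'l::finite"
  assumes "open V" "smoothM V A" "smoothV V x"
  shows "smoothV V (\<lambda>z. A z *v x z)"
  unfolding smoothV_def matrix_vector_mult_def
  by (simp, intro allI smooth_on_sum smooth_on_mult smoothMD smoothVD assms)

lemma pdv_mv:
  fixes A :: "real ^ 'n::finite \<Rightarrow> real ^ 'k::finite ^ 'l::finite"
  assumes V: "open V" and A: "smoothM V A" and x: "smoothV V x" and z: "z \<in> V"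
  shows "pdv m (\<lambda>z. A z *v x z) z = pdm m A z *v x z + A z *v pdv m x z"
proof -
  have "pderiv_at m (\<lambda>z. \<Sum>k\<in>UNIV. A z $ i $ k * x z $ k) z
      = (\<Sum>k\<in>UNIV. pderiv_at m (\<lambda>z. A z $ i $ k) z * x z $ k + A z $ i $ k * pderiv_at m (\<lambda>z. x z $ k) z)" for i
    using smooth_on_mult[OF V smoothMD[OF A] smoothVD[OF x]]
    by (subst pderiv_sum[of _ V]) (simp_all add: z pderiv_mult[OF smoothMD[OF A] smoothVD[OF x] z])
  then show ?thesis
    by (simp add: vec_eq_iff pdv_nth pdm_nth matrix_vector_mult_def sum.distrib)
qed

lemma pdv_cong:
  assumes "open V" "z \<in> V" "\<And>y. y \<in> V \<Longrightarrow> x y = w y"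
  shows "pdv m x z = pdv m w z"
proof -
  have "pderiv_at m (\<lambda>z. x z $ i) z = pderiv_at m (\<lambda>z. w z $ i) z" for i
    by (rule pderiv_cong[OF assms(1,2)]) (simp add: assms(3))
  then show ?thesis by (simp add: vec_eq_iff pdv_nth)
qed

lemma det_replace_row:
  fixes A B :: "real ^ 'n::finite ^ 'n"
  shows "det (\<chi> j. if j = i then (B ** A) $ i else A $ j) = B $ i $ i * det A"
proof -
  have row: "(B ** A) $ i = (\<Sum>l\<in>UNIV. B $ i $ l *s A $ l)"
    by (simp add: vec_eq_iff matrix_matrix_mult_def)
  have "det (\<chi> j. if j = i then (B ** A) $ i else A $ j)
      = (\<Sum>l\<in>UNIV. det (\<chi> j. if j = i then B $ i $ l *s A $ l else A $ j))"
    unfolding row by (rule det_linear_row_sum) simp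
  also have "\<dots> = (\<Sum>l\<in>UNIV. B $ i $ l * det (\<chi> j. if j = i then A $ l else A $ j))"
    by (intro sum.cong refl det_row_mul)
  also have "\<dots> = (\<Sum>l\<in>UNIV. if l = i then B $ i $ l * det A else 0)"
  proof (intro sum.cong refl)
    fix l
    show "B $ i $ l * det (\<chi> j. if j = i then A $ l else A $ j) = (if l = i then B $ i $ l * det A else 0)"
    proof (cases "l = i")
      case True
      have "(\<chi> j. if j = i then A $ l else A $ j) = A" using True by (simp add: vec_eq_iff)
      then show ?thesis unfolding True by simp
    next
      case False
      then have "det (\<chi> j. if j = i then A $ l else A $ j) = 0"
        by (intro det_identical_rows[of i l]) (auto simp: row_def vec_eq_iff)
      then show ?thesis using False by simp
    qed
  qed
  finally show ?thesis by simp
qed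

text \<open>Jacobi's formula for a derivative of the form \<open>B ** E\<close>. Differentiating one
  row at a time, row i of \<open>B ** E\<close> contributes only through its multiple of row i of
  \<open>E\<close>.\<close>

lemma pderiv_det:
  fixes E :: "real ^ 'n::finite \<Rightarrow> real ^ 'n ^ 'n"
  assumes V: "open V" and E: "smoothM V E" and z: "z \<in> V" and B: "pdm m E z = B ** E z"
  shows "pderiv_at m (\<lambda>z. det (E z)) z = trace B * det (E z)"
proof -
  let ?P = "{p. p permutes (UNIV :: 'n set)}"
  have prod: "pderiv_at m (\<lambda>z. \<Prod>i\<in>UNIV. E z $ i $ p i) z
      = (\<Sum>i\<in>UNIV. \<Prod>j\<in>UNIV. if j = i then pdm m E z $ i $ p i else E z $ j $ p j)" for p :: "'n \<Rightarrow> 'n"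
  proof -
    have "((\<lambda>z. \<Prod>i\<in>UNIV. E z $ i $ p i) has_derivative
        (\<lambda>v. \<Sum>i\<in>UNIV. frechet_derivative (\<lambda>z. E z $ i $ p i) (at z) v * (\<Prod>j\<in>UNIV - {i}. E z $ j $ p j))) (at z)"
      by (rule has_derivative_prod) (rule smooth_on_has_derivative[OF smoothMD[OF E] z])
    from frechet_derivative_eqI[OF this]
    have "pderiv_at m (\<lambda>z. \<Prod>i\<in>UNIV. E z $ i $ p i) z
        = (\<Sum>i\<in>UNIV. pdm m E z $ i $ p i * (\<Prod>j\<in>UNIV - {i}. E z $ j $ p j))"
      by (simp add: pderiv_at_def pdm_nth)
    also have "\<dots> = (\<Sum>i\<in>UNIV. \<Prod>j\<in>UNIV. if j = i then pdm m E z $ i $ p i else E z $ j $ p j)"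
    proof (intro sum.cong refl)
      fix i
      have "(\<Prod>j\<in>UNIV - {i}. if j = i then pdm m E z $ i $ p i else E z $ j $ p j) = (\<Prod>j\<in>UNIV - {i}. E z $ j $ p j)"
        by (intro prod.cong) auto
      then show "pdm m E z $ i $ p i * (\<Prod>j\<in>UNIV - {i}. E z $ j $ p j)
          = (\<Prod>j\<in>UNIV. if j = i then pdm m E z $ i $ p i else E z $ j $ p j)"
        using prod.remove[of UNIV i "\<lambda>j. if j = i then pdm m E z $ i $ p i else E z $ j $ p j"] by simp
    qed
    finally show ?thesis .
  qed
  have "pderiv_at m (\<lambda>z. det (E z)) z
      = (\<Sum>p\<in>?P. of_int (sign p) * pderiv_at m (\<lambda>z. \<Prod>i\<in>UNIV. E z $ i $ p i) z)"
    unfolding det_def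
    by (subst pderiv_sum[of _ V])
      (auto intro!: smooth_on_mult V smooth_on_const smooth_on_prod smoothMD[OF E] z
        pderiv_cmult[of V] sum.cong)
  also have "\<dots> = (\<Sum>p\<in>?P. \<Sum>i\<in>UNIV. of_int (sign p) * (\<Prod>j\<in>UNIV. if j = i then pdm m E z $ i $ p i else E z $ j $ p j))"
    by (simp only: prod sum_distrib_left)
  also have "\<dots> = (\<Sum>i\<in>UNIV. \<Sum>p\<in>?P. of_int (sign p) * (\<Prod>j\<in>UNIV. if j = i then pdm m E z $ i $ p i else E z $ j $ p j))"
    by (rule sum.swap)
  also have "\<dots> = (\<Sum>i\<in>UNIV. det (\<chi> j. if j = i then pdm m E z $ i else E z $ j))"
    unfolding det_def by (intro sum.cong refl arg_cong2[of _ _ _ _ "(*)"] prod.cong) auto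
  also have "\<dots> = (\<Sum>i\<in>UNIV. B $ i $ i * det (E z))"
    unfolding B det_replace_row ..
  finally show ?thesis by (simp add: trace_def sum_distrib_right)
qed

lemma trace_conj: "trace (A ** C ** B) = trace C" if "B ** A = mat 1" for A B C :: "real ^ 'n::finite ^ 'n"
proof -
  have "trace (A ** C ** B) = trace (B ** (A ** C))" by (rule trace_mul_sym)
  then show ?thesis by (simp add: matrix_mul_assoc that)
qed

section \<open>Connection, curvature and divergence in frame components\<close>

context coframe_field
begin

definition omf where "omf a z = (\<Sum>m\<in>UNIV. F z $ m $ a *\<^sub>R om m z)"

definition W where "W a b z = (\<Sum>m\<in>UNIV. \<Sum>n\<in>UNIV. (F z $ m $ a * F z $ n $ b) *\<^sub>R Om m n z)"

lemma W_nth: "W a b z $ i $ j = (\<Sum>m\<in>UNIV. \<Sum>n\<in>UNIV. F z $ m $ a * F z $ n $ b * Om m n z $ i $ j)"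
  by (simp add: W_def)

lemma F_E_sum: "z \<in> V \<Longrightarrow> (\<Sum>a\<in>UNIV. F z $ m $ a * E z $ a $ n) = (if m = n then 1 else 0)"
  using FE[of z] by (simp add: vec_eq_iff matrix_matrix_mult_def mat_def)

lemma E_F_sum: "z \<in> V \<Longrightarrow> (\<Sum>m\<in>UNIV. E z $ a $ m * F z $ m $ b) = (if a = b then 1 else 0)"
  using EF[of z] by (simp add: vec_eq_iff matrix_matrix_mult_def mat_def)

lemma omf_skew: "z \<in> V \<Longrightarrow> skewm (omf a z)"
proof -
  assume z: "z \<in> V"
  have s: "om m z $ j $ i = - om m z $ i $ j" for m i j using om_skew[OF z, of m] unfolding skewm_def by blast
  have t: "(\<Sum>m\<in>UNIV. F z $ m $ a * om m z $ j $ i) = (\<Sum>m\<in>UNIV. - (F z $ m $ a * om m z $ i $ j))" for i j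
    unfolding s[of _ j i] by (intro sum.cong refl) simp
  show ?thesis unfolding skewm_def
  proof (intro allI)
    fix i j
    show "omf a z $ j $ i = - omf a z $ i $ j" using t[of j i] by (simp add: omf_def sum_negf)
  qed
qed

lemma W_skew: "z \<in> V \<Longrightarrow> skewm (W a b z)"
proof -
  assume z: "z \<in> V"
  have s: "F z $ m $ a * F z $ n $ b * Om m n z $ j $ i = - (F z $ m $ a * F z $ n $ b * Om m n z $ i $ j)" for m n i j
    using Om_skew[OF z, of m n, unfolded skewm_def, rule_format, of j i] by simp
  have t: "W a b z $ j $ i = (\<Sum>m\<in>UNIV. \<Sum>n\<in>UNIV. - (F z $ m $ a * F z $ n $ b * Om m n z $ i $ j))" for i j
    unfolding W_nth by (rule sum.cong[OF refl], rule sum.cong[OF refl], rule s)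
  show ?thesis unfolding skewm_def
  proof (intro allI)
    fix i j
    show "W a b z $ j $ i = - W a b z $ i $ j" unfolding t[of j i] by (simp add: W_nth sum_negf)
  qed
qed

lemma Om_Rm: "z \<in> V \<Longrightarrow> Om m n z = E z ** Rm m n z ** F z"
proof -
  assume z: "z \<in> V"
  have "E z ** Rm m n z ** F z = Om m n z ** (E z ** F z)"
    by (simp add: structure_equation[OF z] matrix_mul_assoc)
  then show ?thesis by (simp add: EF[OF z])
qed

lemma sum3_rotate: "(\<Sum>n\<in>A. \<Sum>s\<in>B. \<Sum>m\<in>C. f m n s) = (\<Sum>m\<in>C. \<Sum>n\<in>A. \<Sum>s\<in>B. f m n s)"
proof -
  have "(\<Sum>n\<in>A. \<Sum>s\<in>B. \<Sum>m\<in>C. f m n s) = (\<Sum>n\<in>A. \<Sum>m\<in>C. \<Sum>s\<in>B. f m n s)"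
    by (intro sum.cong refl sum.swap)
  also have "\<dots> = (\<Sum>m\<in>C. \<Sum>n\<in>A. \<Sum>s\<in>B. f m n s)" by (rule sum.swap)
  finally show ?thesis .
qed

lemma W_bianchi: "z \<in> V \<Longrightarrow> W a b z $ i $ j + W b j z $ i $ a + W j a z $ i $ b = 0"
proof -
  assume z: "z \<in> V"
  define B where "B m n s = (\<Sum>r\<in>UNIV. E z $ i $ r * Rm m n z $ r $ s)" for m n s
  have B: "B m n s + B n s m + B s m n = 0" for m n s
    unfolding B_def sum.distrib[symmetric] distrib_left[symmetric] bianchi by simp
  have Wf: "W a b z $ i $ j = (\<Sum>m\<in>UNIV. \<Sum>n\<in>UNIV. \<Sum>s\<in>UNIV. F z $ m $ a * F z $ n $ b * F z $ s $ j * B m n s)" for a b j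
  proof -
    have "Om m n z $ i $ j = (\<Sum>s\<in>UNIV. F z $ s $ j * B m n s)" for m n
      unfolding Om_Rm[OF z] by (simp add: matrix_matrix_mult_def B_def mult.commute)
    then show ?thesis unfolding W_nth by (simp add: sum_distrib_left mult.assoc)
  qed
  have 2: "W b j z $ i $ a = (\<Sum>m\<in>UNIV. \<Sum>n\<in>UNIV. \<Sum>s\<in>UNIV. F z $ m $ a * F z $ n $ b * F z $ s $ j * B n s m)"
    unfolding Wf[of b j a] by (subst sum3_rotate) (simp add: mult_ac)
  have 3: "W j a z $ i $ b = (\<Sum>m\<in>UNIV. \<Sum>n\<in>UNIV. \<Sum>s\<in>UNIV. F z $ m $ a * F z $ n $ b * F z $ s $ j * B s m n)"
    unfolding Wf[of j a b] by (subst sum3_rotate[symmetric]) (simp add: mult_ac)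
  have "W a b z $ i $ j + W b j z $ i $ a + W j a z $ i $ b
     = (\<Sum>m\<in>UNIV. \<Sum>n\<in>UNIV. \<Sum>s\<in>UNIV. F z $ m $ a * F z $ n $ b * F z $ s $ j * (B m n s + B n s m + B s m n))"
    unfolding Wf[of a b j] 2 3 by (simp add: sum.distrib distrib_left)
  then show ?thesis by (simp add: B)
qed

text \<open>The inverse metric is \<open>F\<close> times its transpose, so contracting coordinates
  with it amounts to contracting frame indices.\<close>

lemma scalar_W: "z \<in> V \<Longrightarrow>
  (\<Sum>s\<in>UNIV. \<Sum>n\<in>UNIV. matrix_inv (G z) $ s $ n * ricci G s n z) = (\<Sum>a\<in>UNIV. \<Sum>b\<in>UNIV. W a b z $ a $ b)"
proof -
  assume z: "z \<in> V"
  have FO: "F z ** Om m n z = Rm m n z ** F z" for m n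
  proof -
    have "F z ** Om m n z = (F z ** E z) ** Rm m n z ** F z" by (simp add: Om_Rm[OF z] matrix_mul_assoc)
    then show ?thesis by (simp add: FE[OF z])
  qed
  have 1: "(\<Sum>a\<in>UNIV. W a b z $ a $ b) = (\<Sum>m\<in>UNIV. \<Sum>n\<in>UNIV. \<Sum>s\<in>UNIV. F z $ n $ b * F z $ s $ b * Rm m n z $ m $ s)" for b
  proof -
    have "(\<Sum>a\<in>UNIV. W a b z $ a $ b) = (\<Sum>m\<in>UNIV. \<Sum>n\<in>UNIV. \<Sum>a\<in>UNIV. F z $ m $ a * F z $ n $ b * Om m n z $ a $ b)"
      unfolding W_nth by (rule sum3_rotate[symmetric])
    also have "\<dots> = (\<Sum>m\<in>UNIV. \<Sum>n\<in>UNIV. F z $ n $ b * (F z ** Om m n z) $ m $ b)"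
      unfolding matrix_matrix_mult_def vec_lambda_beta sum_distrib_left
      by (intro sum.cong refl) simp
    finally have q: "(\<Sum>a\<in>UNIV. W a b z $ a $ b) = (\<Sum>m\<in>UNIV. \<Sum>n\<in>UNIV. F z $ n $ b * (F z ** Om m n z) $ m $ b)" .
    show ?thesis
      unfolding q FO unfolding matrix_matrix_mult_def vec_lambda_beta sum_distrib_left
      by (intro sum.cong refl) simp
  qed
  have Gi: "matrix_inv (G z) $ s $ n = (\<Sum>b\<in>UNIV. F z $ n $ b * F z $ s $ b)" for s n
    unfolding Ginv[OF z] by (simp add: matrix_matrix_mult_def transpose_def mult.commute)
  have "(\<Sum>a\<in>UNIV. \<Sum>b\<in>UNIV. W a b z $ a $ b) = (\<Sum>b\<in>UNIV. \<Sum>a\<in>UNIV. W a b z $ a $ b)" by (rule sum.swap)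
  also have "\<dots> = (\<Sum>b\<in>UNIV. \<Sum>m\<in>UNIV. \<Sum>n\<in>UNIV. \<Sum>s\<in>UNIV. F z $ n $ b * F z $ s $ b * Rm m n z $ m $ s)"
    unfolding 1 ..
  also have "\<dots> = (\<Sum>m\<in>UNIV. \<Sum>b\<in>UNIV. \<Sum>n\<in>UNIV. \<Sum>s\<in>UNIV. F z $ n $ b * F z $ s $ b * Rm m n z $ m $ s)"
    by (rule sum.swap)
  also have "\<dots> = (\<Sum>m\<in>UNIV. \<Sum>n\<in>UNIV. \<Sum>s\<in>UNIV. \<Sum>b\<in>UNIV. F z $ n $ b * F z $ s $ b * Rm m n z $ m $ s)"
    by (intro sum.cong refl sum3_rotate[symmetric])
  also have "\<dots> = (\<Sum>m\<in>UNIV. \<Sum>n\<in>UNIV. \<Sum>s\<in>UNIV. matrix_inv (G z) $ s $ n * Rm m n z $ m $ s)"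
    unfolding Gi sum_distrib_right ..
  also have "\<dots> = (\<Sum>n\<in>UNIV. \<Sum>s\<in>UNIV. \<Sum>m\<in>UNIV. matrix_inv (G z) $ s $ n * Rm m n z $ m $ s)"
    by (rule sum3_rotate[symmetric])
  also have "\<dots> = (\<Sum>s\<in>UNIV. \<Sum>n\<in>UNIV. \<Sum>m\<in>UNIV. matrix_inv (G z) $ s $ n * Rm m n z $ m $ s)"
    by (rule sum.swap)
  finally show ?thesis by (simp add: ricci_def riemann_Rm sum_distrib_left)
qed

text \<open>\<open>Kf\<close> measures the failure of \<open>E\<close> to be parallel; its symmetry is the vanishing of the torsion.\<close>

definition Mf where "Mf a z = (\<Sum>m\<in>UNIV. F z $ m $ a *\<^sub>R (pdm m E z ** F z))"
definition Kf where "Kf a z = (\<Sum>m\<in>UNIV. F z $ m $ a *\<^sub>R (E z ** Gam m z ** F z))"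

lemma Mf_Kf: "Mf a z = Kf a z - omf a z"
  unfolding Mf_def Kf_def omf_def om_def by (simp add: sum_subtractf[symmetric] scaleR_diff_right)

lemma Kf_sym: "Kf a z $ i $ b = Kf b z $ i $ a"
proof -
  have e: "Kf a z $ i $ b = (\<Sum>m\<in>UNIV. \<Sum>n\<in>UNIV. \<Sum>r\<in>UNIV. E z $ i $ r * (F z $ m $ a * F z $ n $ b * Gam m z $ r $ n))" for a b
    by (simp add: Kf_def matrix_matrix_mult_def sum_distrib_left sum_distrib_right mult_ac)
  have "Kf a z $ i $ b = (\<Sum>n\<in>UNIV. \<Sum>m\<in>UNIV. \<Sum>r\<in>UNIV. E z $ i $ r * (F z $ m $ a * F z $ n $ b * Gam m z $ r $ n))"
    unfolding e by (rule sum.swap)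
  also have "\<dots> = Kf b z $ i $ a"
    unfolding e[of b a] by (intro sum.cong refl) (subst Gam_sym, simp)
  finally show ?thesis .
qed

text \<open>The left-hand side is what d produces from the contraction of the vector
  \<open>F t\<close> with the volume form; the right-hand side is the divergence in the frame. The
  trace of \<open>Gam\<close> from differentiating \<open>det E\<close> cancels the Christoffel term
  of the vector, by symmetry of the lower indices.\<close>

lemma divergence_frame:
  assumes z: "z \<in> V" and t: "smoothV V t"
  shows "(\<Sum>m\<in>UNIV. pderiv_at m (\<lambda>z. det (E z) * (F z *v t z) $ m) z)
    = det (E z) * (\<Sum>i\<in>UNIV. (\<Sum>m\<in>UNIV. F z $ m $ i * pderiv_at m (\<lambda>z. t z $ i) z) + (omf i z *v t z) $ i)"
proof -
  define X where "X z = F z *v t z" for z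
  have smX: "smoothV V X" unfolding X_def by (rule smoothV_mv[OF V smF t])
  have EX: "E y *v X y = t y" if "y \<in> V" for y
    using EF[OF that] by (simp add: X_def matrix_vector_mul_assoc)
  have sd: "smooth_on V (\<lambda>z. det (E z))" by (rule smooth_on_det[OF V smoothMD[OF smE]])
  have dE: "pdm m E z = (E z ** Gam m z ** F z - om m z) ** E z" for m
  proof -
    have "(E z ** Gam m z ** F z) ** E z = E z ** Gam m z ** (F z ** E z)" by (simp add: matrix_mul_assoc)
    then show ?thesis using om_E[OF z, of m] by (simp add: matrix_distribs FE[OF z])
  qed
  have tr: "trace (E z ** Gam m z ** F z - om m z) = (\<Sum>r\<in>UNIV. Gam m z $ r $ r)" for m
  proof -
    have "om m z $ i $ i = 0" for i
      using om_skew[OF z, of m, unfolded skewm_def, rule_format, of i i] by simp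
    then have "trace (om m z) = 0" by (simp add: trace_def)
    then show ?thesis by (simp add: trace_sub trace_conj[OF FE[OF z]]) (simp add: trace_def)
  qed
  have dX: "pdv m X z = F z *v (pdv m t z + om m z *v t z) - Gam m z *v X z" for m
  proof -
    have "pdv m t z = pdv m (\<lambda>z. E z *v X z) z" by (rule pdv_cong[OF V z]) (simp add: EX)
    also have "\<dots> = pdm m E z *v X z + E z *v pdv m X z" by (rule pdv_mv[OF V smE smX z])
    also have "pdm m E z *v X z = E z *v (Gam m z *v X z) - om m z *v t z"
    proof -
      have "pdm m E z = E z ** Gam m z - om m z ** E z" using om_E[OF z, of m] by simp
      then show ?thesis
        by (simp add: matrix_vector_mult_diff_rdistrib matrix_vector_mul_assoc[symmetric] EX[OF z])
    qed
    finally have "E z *v pdv m X z = (pdv m t z + om m z *v t z) - E z *v (Gam m z *v X z)" by simp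
    then have "F z *v (E z *v pdv m X z) = F z *v ((pdv m t z + om m z *v t z) - E z *v (Gam m z *v X z))" by simp
    then show ?thesis
      by (simp add: matrix_vector_mul_assoc FE[OF z] matrix_vector_mult_diff_distrib matrix_mul_assoc)
  qed
  have "(\<Sum>m\<in>UNIV. pderiv_at m (\<lambda>z. det (E z) * X z $ m) z)
      = (\<Sum>m\<in>UNIV. (\<Sum>r\<in>UNIV. Gam m z $ r $ r) * det (E z) * X z $ m + det (E z) * pdv m X z $ m)"
    unfolding pderiv_mult[OF sd smoothVD[OF smX] z] pderiv_det[OF V smE z dE] tr pdv_nth ..
  also have "\<dots> = det (E z) * ((\<Sum>m\<in>UNIV. (\<Sum>r\<in>UNIV. Gam m z $ r $ r) * X z $ m) - (\<Sum>m\<in>UNIV. (Gam m z *v X z) $ m)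
       + (\<Sum>m\<in>UNIV. (F z *v (pdv m t z + om m z *v t z)) $ m))"
    unfolding dX by (simp add: sum_distrib_left sum.distrib sum_subtractf algebra_simps)
  also have "(\<Sum>m\<in>UNIV. (Gam m z *v X z) $ m) = (\<Sum>m\<in>UNIV. (\<Sum>r\<in>UNIV. Gam m z $ r $ r) * X z $ m)"
  proof -
    have "(\<Sum>m\<in>UNIV. (Gam m z *v X z) $ m) = (\<Sum>m\<in>UNIV. \<Sum>r\<in>UNIV. Gam m z $ m $ r * X z $ r)"
      by (simp add: matrix_vector_mult_def)
    also have "\<dots> = (\<Sum>r\<in>UNIV. \<Sum>m\<in>UNIV. Gam m z $ m $ r * X z $ r)" by (rule sum.swap)
    also have "\<dots> = (\<Sum>r\<in>UNIV. \<Sum>m\<in>UNIV. Gam r z $ m $ m * X z $ r)"      by (rule sum.cong[OF refl], rule sum.cong[OF refl], rule arg_cong[of _ _ "\<lambda>x. x * _"], rule Gam_sym)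
    finally show ?thesis by (simp add: sum_distrib_right)
  qed
  also have "(\<Sum>m\<in>UNIV. (F z *v (pdv m t z + om m z *v t z)) $ m)
     = (\<Sum>i\<in>UNIV. \<Sum>m\<in>UNIV. F z $ m $ i * (pdv m t z + om m z *v t z) $ i)"
    by (subst sum.swap) (simp add: matrix_vector_mult_def)
  also have "\<dots> = (\<Sum>i\<in>UNIV. (\<Sum>m\<in>UNIV. F z $ m $ i * pderiv_at m (\<lambda>z. t z $ i) z) + (omf i z *v t z) $ i)"
  proof (intro sum.cong refl)
    fix i
    have "(omf i z *v t z) $ i = (\<Sum>k\<in>UNIV. \<Sum>m\<in>UNIV. F z $ m $ i * (om m z $ i $ k * t z $ k))"
      by (simp add: omf_def matrix_vector_mult_def sum_distrib_right mult.assoc)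
    also have "\<dots> = (\<Sum>m\<in>UNIV. F z $ m $ i * (om m z *v t z) $ i)"
      by (subst sum.swap) (simp add: matrix_vector_mult_def sum_distrib_left)
    finally show "(\<Sum>m\<in>UNIV. F z $ m $ i * (pdv m t z + om m z *v t z) $ i)
        = (\<Sum>m\<in>UNIV. F z $ m $ i * pderiv_at m (\<lambda>z. t z $ i) z) + (omf i z *v t z) $ i"
      by (simp add: pdv_nth distrib_left sum.distrib)
  qed
  finally show ?thesis by (simp add: X_def)
qed

end

section \<open>Exterior derivatives of pulled-back constant forms\<close>

lemma multilin_slot_sum:
  assumes \<alpha>: "multilin k \<alpha>" and l: "length vs = k" and j: "j < k" and "finite I"
  shows "\<alpha> (vs[j := \<Sum>i\<in>I. c i *\<^sub>R x i]) = (\<Sum>i\<in>I. c i * \<alpha> (vs[j := x i]))"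
  using assms(4)
proof (induction I rule: finite_induct)
  case empty
  show ?case using multilinD[OF \<alpha> l j, of 0 0 0 0] by simp
next
  case (insert i I)
  then show ?case
    using multilinD[OF \<alpha> l j, of "c i" "x i" 1 "\<Sum>i\<in>I. c i *\<^sub>R x i"] by simp
qed

lemma smoothV_const: "smoothV V (\<lambda>z. w)"
  by (simp add: smoothV_def smooth_on_const)

lemma pdv_const: "pdv m (\<lambda>z. w) z = 0"
  by (simp add: vec_eq_iff pdv_nth pderiv_const)

lemma pderiv_pullback:
  fixes E :: "real ^ 'n::finite \<Rightarrow> real ^ 'n ^ 'n"
  assumes V: "open V" and E: "smoothM V E"
  shows "multilin k \<alpha> \<Longrightarrow> length ws = k \<Longrightarrow>
    smooth_on V (\<lambda>z. \<alpha> (map ((*v) (E z)) ws)) \<and>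
    (\<forall>z\<in>V. pderiv_at m (\<lambda>z. \<alpha> (map ((*v) (E z)) ws)) z
       = (\<Sum>l<k. \<alpha> ((map ((*v) (E z)) ws)[l := pdm m E z *v (ws ! l)])))"
proof (induction k arbitrary: \<alpha> ws)
  case 0
  then show ?case by (simp add: smooth_on_const pderiv_const)
next
  case (Suc k)
  obtain w us where ws: "ws = w # us" "length us = k" using Suc.prems(2) by (cases ws) auto
  have exp: "\<alpha> (x # vs) = (\<Sum>i\<in>UNIV. x $ i * \<alpha> (ax i # vs))" if "length vs = k" for x vs
    using multilin_head_sum[OF Suc.prems(1) that, of "\<lambda>i. x $ i" ax UNIV] vec_ax_sum[of x] by simp
  have a: "smooth_on V (\<lambda>z. \<alpha> (ax i # map ((*v) (E z)) us))"
    and b: "z \<in> V \<Longrightarrow> pderiv_at m (\<lambda>z. \<alpha> (ax i # map ((*v) (E z)) us)) z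
       = (\<Sum>l<k. \<alpha> (ax i # (map ((*v) (E z)) us)[l := pdm m E z *v (us ! l)]))" for i z
    using Suc.IH[OF multilin_tail[OF Suc.prems(1)] ws(2)] by blast+
  have c: "smooth_on V (\<lambda>z. (E z *v w) $ i)" for i
    by (rule smoothVD[OF smoothV_mv[OF V E smoothV_const]])
  have d: "pderiv_at m (\<lambda>z. (E z *v w) $ i) z = (pdm m E z *v w) $ i" if "z \<in> V" for i z
    using pdv_mv[OF V E smoothV_const that, of m w] by (simp add: pdv_const pdv_nth[symmetric])
  have eq: "\<alpha> (map ((*v) (E z)) ws) = (\<Sum>i\<in>UNIV. (E z *v w) $ i * \<alpha> (ax i # map ((*v) (E z)) us))" for z
    using exp[of "map ((*v) (E z)) us" "E z *v w"] by (simp add: ws)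
  have s: "smooth_on V (\<lambda>z. (E z *v w) $ i * \<alpha> (ax i # map ((*v) (E z)) us))" for i
    by (rule smooth_on_mult[OF V c a])
  show ?case unfolding eq
  proof (intro conjI ballI)
    show "smooth_on V (\<lambda>z. \<Sum>i\<in>UNIV. (E z *v w) $ i * \<alpha> (ax i # map ((*v) (E z)) us))"
      by (rule smooth_on_sum[OF V s])
    fix z assume z: "z \<in> V"
    have "pderiv_at m (\<lambda>z. \<Sum>i\<in>UNIV. (E z *v w) $ i * \<alpha> (ax i # map ((*v) (E z)) us)) z
        = (\<Sum>i\<in>UNIV. (pdm m E z *v w) $ i * \<alpha> (ax i # map ((*v) (E z)) us)
           + (E z *v w) $ i * (\<Sum>l<k. \<alpha> (ax i # (map ((*v) (E z)) us)[l := pdm m E z *v (us ! l)])))"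
      by (subst pderiv_sum[of _ V, OF s z]) (simp only: pderiv_mult[OF c a z] d[OF z] b[OF z])
    also have "\<dots> = \<alpha> ((pdm m E z *v w) # map ((*v) (E z)) us)
        + (\<Sum>l<k. \<Sum>i\<in>UNIV. (E z *v w) $ i * \<alpha> (ax i # (map ((*v) (E z)) us)[l := pdm m E z *v (us ! l)]))"
      unfolding sum.distrib sum_distrib_left using exp[of "map ((*v) (E z)) us" "pdm m E z *v w"] ws(2)
      by (subst (2) sum.swap) simp
    also have "(\<Sum>l<k. \<Sum>i\<in>UNIV. (E z *v w) $ i * \<alpha> (ax i # (map ((*v) (E z)) us)[l := pdm m E z *v (us ! l)]))
        = (\<Sum>l<k. \<alpha> ((E z *v w) # (map ((*v) (E z)) us)[l := pdm m E z *v (us ! l)]))"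
      by (intro sum.cong refl exp[symmetric]) (simp add: ws(2))
    also have "\<alpha> ((pdm m E z *v w) # map ((*v) (E z)) us) + \<dots>
        = (\<Sum>l<Suc k. \<alpha> ((map ((*v) (E z)) ws)[l := pdm m E z *v (ws ! l)]))"
      by (simp add: sum.lessThan_Suc_shift ws(1) del: sum.lessThan_Suc)
    finally show "pderiv_at m (\<lambda>z. \<Sum>i\<in>UNIV. (E z *v w) $ i * \<alpha> (ax i # map ((*v) (E z)) us)) z
        = (\<Sum>l<Suc k. \<alpha> ((map ((*v) (E z)) ws)[l := pdm m E z *v (ws ! l)]))" .
  qed
qed

context coframe_field
begin

text \<open>The form \<alpha> is constant, so the derivatives fall on \<open>E\<close>. The
  arguments are frame vectors frozen at \<open>z\<close>, and on those the derivative of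
  \<open>E\<close> is \<open>Mf\<close>.\<close>

lemma d_pullback_frame:
  assumes z: "z \<in> V" and \<alpha>: "multilin k \<alpha>" and l: "length is = Suc k"
  shows "euclidean_d (\<lambda>z ws. \<alpha> (map ((*v) (E z)) ws)) z (map (\<lambda>i. F z *v ax i) is)
    = (\<Sum>j<Suc k. (-1) ^ j * (\<Sum>l<k. \<alpha> ((map ax (take j is @ drop (Suc j) is))
         [l := Mf (is ! j) z *v ax ((take j is @ drop (Suc j) is) ! l)])))"
proof -
  let ?f = "\<lambda>i. F z *v ax i"
  have Ef: "E z *v ?f i = ax i" for i by (simp add: matrix_vector_mul_assoc EF[OF z])
  have "frechet_derivative (\<lambda>y. \<alpha> (map ((*v) (E y)) (take j (map ?f is) @ drop (Suc j) (map ?f is)))) (at z) (map ?f is ! j)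
     = (\<Sum>l<k. \<alpha> ((map ax (take j is @ drop (Suc j) is))[l := Mf (is ! j) z *v ax ((take j is @ drop (Suc j) is) ! l)]))"
    if j: "j < Suc k" for j
  proof -
    define rs where "rs = take j is @ drop (Suc j) is"
    have rs: "length rs = k" using l j by (simp add: rs_def)
    have ws: "take j (map ?f is) @ drop (Suc j) (map ?f is) = map ?f rs"
      by (simp add: rs_def take_map drop_map)
    have len: "length (map ?f rs) = k" using rs by simp
    note pp = pderiv_pullback[OF V smE \<alpha> len]
    have diff: "(\<lambda>y. \<alpha> (map ((*v) (E y)) (map ?f rs))) differentiable (at z)"
      using smooth_on_has_derivative[OF conjunct1[OF pp] z] differentiableI by blast
    have Emap: "map ((*v) (E z)) (map ?f rs) = map ax rs" by (simp add: Ef)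
    have "frechet_derivative (\<lambda>y. \<alpha> (map ((*v) (E y)) (map ?f rs))) (at z) (?f (is ! j))
       = (\<Sum>m\<in>UNIV. (?f (is ! j)) $ m * (\<Sum>l<k. \<alpha> ((map ax rs)[l := pdm m E z *v (map ?f rs ! l)])))"
      unfolding frechet_pderiv[OF diff] using pp z by (simp only: Emap)
    also have "\<dots> = (\<Sum>l<k. \<Sum>m\<in>UNIV. F z $ m $ (is ! j) * \<alpha> ((map ax rs)[l := pdm m E z *v ?f (rs ! l)]))"
    proof -
      have "(?f (is ! j)) $ m = F z $ m $ (is ! j)" for m by (simp add: matrix_vector_mult_basis column_def)
      moreover have "map ?f rs ! l = ?f (rs ! l)" if "l < k" for l using that rs by simp
      ultimately show ?thesis unfolding sum_distrib_left by (subst sum.swap) (intro sum.cong refl, simp)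
    qed
    also have "\<dots> = (\<Sum>l<k. \<alpha> ((map ax rs)[l := Mf (is ! j) z *v ax (rs ! l)]))"
    proof (intro sum.cong refl)
      fix l assume "l \<in> {..<k}"
      then have lk: "l < k" by simp
      have lr: "length (map ax rs :: (real ^ 'n) list) = k" using rs by simp
      have "Mf (is ! j) z *v ax (rs ! l) = (\<Sum>m\<in>UNIV. F z $ m $ (is ! j) *\<^sub>R (pdm m E z *v ?f (rs ! l)))"
        by (simp add: Mf_def vec_eq_iff matrix_ax matrix_vector_mult_basis column_def matrix_matrix_mult_def
            matrix_vector_mult_def axis_def if_distrib cong: if_cong)
      then show "(\<Sum>m\<in>UNIV. F z $ m $ (is ! j) * \<alpha> ((map ax rs)[l := pdm m E z *v ?f (rs ! l)]))
          = \<alpha> ((map ax rs)[l := Mf (is ! j) z *v ax (rs ! l)])"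
        using multilin_slot_sum[OF \<alpha> lr lk finite, of "\<lambda>m. F z $ m $ (is ! j)" "\<lambda>m. pdm m E z *v ?f (rs ! l)" UNIV]
        by simp
    qed
    finally show ?thesis using j l unfolding ws rs_def by simp
  qed
  then show ?thesis unfolding euclidean_d_def by (simp add: l del: sum.lessThan_Suc)
qed

lemma Kf_ax: "Kf a z *v ax b = Kf b z *v ax a"
  by (simp add: vec_eq_iff matrix_vector_mult_basis column_def) (metis Kf_sym)

lemma Mf_ax: "Mf a z *v ax b = Kf a z *v ax b - omf a z *v ax b"
  by (simp add: Mf_Kf matrix_vector_mult_diff_rdistrib)

end

section \<open>Scalar curvature of a \<open>G\<^sub>2\<close>-coframe field\<close>

lemma phi_sum3: "phi [x, y, \<Sum>i\<in>I. c i *\<^sub>R v i] = (\<Sum>i\<in>I. c i * phi [x, y, v i])"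
  by (simp add: phi_cr inner_sum_right)

lemma phi_sum1: "phi [\<Sum>i\<in>I. c i *\<^sub>R v i, x, y] = (\<Sum>i\<in>I. c i * phi [v i, x, y])"
  using phi_sum3[of x y c v I] by (simp add: phi_cyc[of _ x y])

lemma phi_sum2: "phi [x, \<Sum>i\<in>I. c i *\<^sub>R v i, y] = (\<Sum>i\<in>I. c i * phi [x, v i, y])"
  using phi_sum3[of y x c v I] by (simp add: phi_cyc[of y x])

locale coframe_field_7 = coframe_field V E G for V :: "(real ^ 7) set" and E G :: "real ^ 7 \<Rightarrow> real ^ 7 ^ 7"
begin

definition thh where "thh n z = Pv (om n z)"
definition th where "th z a = Pv (omf a z)"
text \<open>Coordinate derivatives of the vector-valued 1-form \<open>thh\<close>, in frame
  components. Only the skew part in \<open>a\<close> and \<open>b\<close> has invariant meaning: it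
  is half the exterior derivative of \<open>thh\<close>.\<close>

definition X where "X z a b = (\<Sum>m\<in>UNIV. \<Sum>n\<in>UNIV. (F z $ m $ a * F z $ n $ b) *\<^sub>R pdv m (thh n) z)"

lemma linear_Pv: "linear Pv"
  by (rule linearI) (simp_all add: Pv_def vec_eq_iff sum.distrib sum_distrib_left algebra_simps)

lemma Pv_simps: "Pv (A + B) = Pv A + Pv B" "Pv (A - B) = Pv A - Pv B" "Pv (c *\<^sub>R A) = c *\<^sub>R Pv A"
  "Pv (\<Sum>i\<in>I. f i) = (\<Sum>i\<in>I. Pv (f i))"
  by (simp_all add: linear_add linear_diff linear_scale linear_sum linear_Pv)

lemma smthh: "smoothV V (thh n)"
  unfolding smoothV_def thh_def Pv_def
  by (simp, intro allI smooth_on_sum smooth_on_mult smooth_on_const V smoothMD[OF smom])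

lemma pdv_thh: "z \<in> V \<Longrightarrow> pdv m (thh n) z = Pv (pdm m (om n) z)"
proof -
  assume z: "z \<in> V"
  have s: "smooth_on V (\<lambda>z. om n z $ i $ j * ph i j k)" for i j k
    by (intro smooth_on_mult smooth_on_const V smoothMD[OF smom])
  have e: "pderiv_at m (\<lambda>z. om n z $ i $ j * ph i j k) z = pderiv_at m (\<lambda>z. om n z $ i $ j) z * ph i j k" for i j k
    using pderiv_cmult[OF smoothMD[OF smom] z, of m "ph i j k" n i j] by (simp only: mult.commute)
  have "pderiv_at m (\<lambda>z. \<Sum>i\<in>UNIV. \<Sum>j\<in>UNIV. om n z $ i $ j * ph i j k) z
     = (\<Sum>i\<in>UNIV. \<Sum>j\<in>UNIV. pderiv_at m (\<lambda>z. om n z $ i $ j) z * ph i j k)" for k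
    by (simp only: pderiv_sum[of _ V, OF smooth_on_sum[OF V s] z] pderiv_sum[of _ V, OF s z] e)
  then show ?thesis by (simp add: vec_eq_iff pdv_nth thh_def Pv_def pdm_nth)
qed

lemma smth: "smoothV V (\<lambda>z. th z a)"
proof -
  have "th z a $ k = (\<Sum>m\<in>UNIV. F z $ m $ a * thh m z $ k)" for z k
    by (simp add: th_def omf_def thh_def Pv_simps)
  then show ?thesis unfolding smoothV_def
    by (simp, intro allI smooth_on_sum smooth_on_mult V smoothMD[OF smF] smoothVD[OF smthh])
qed

lemma matrix_sum_mult: "(\<Sum>m\<in>UNIV. c m *\<^sub>R A m) ** (\<Sum>n\<in>UNIV. d n *\<^sub>R B n)
    = (\<Sum>m\<in>UNIV. \<Sum>n\<in>UNIV. (c m * d n) *\<^sub>R (A m ** B n))" for A B :: "7 \<Rightarrow> real ^ 7 ^ 7"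
proof -
  have "(\<Sum>k\<in>UNIV. (\<Sum>m\<in>UNIV. c m * A m $ i $ k) * (\<Sum>n\<in>UNIV. d n * B n $ k $ j))
     = (\<Sum>m\<in>UNIV. \<Sum>n\<in>UNIV. c m * d n * (\<Sum>k\<in>UNIV. A m $ i $ k * B n $ k $ j))" for i j
  proof -
    have "(\<Sum>k\<in>UNIV. (\<Sum>m\<in>UNIV. c m * A m $ i $ k) * (\<Sum>n\<in>UNIV. d n * B n $ k $ j))
        = (\<Sum>k\<in>UNIV. \<Sum>m\<in>UNIV. \<Sum>n\<in>UNIV. c m * d n * (A m $ i $ k * B n $ k $ j))"
      unfolding sum_product by (intro sum.cong refl) simp
    also have "\<dots> = (\<Sum>m\<in>UNIV. \<Sum>n\<in>UNIV. \<Sum>k\<in>UNIV. c m * d n * (A m $ i $ k * B n $ k $ j))"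
      by (rule sum3_rotate[symmetric])
    finally show ?thesis by (simp add: sum_distrib_left)
  qed
  then show ?thesis by (simp add: vec_eq_iff matrix_matrix_mult_def)
qed

lemma Pv_W: "z \<in> V \<Longrightarrow> Pv (W a b z) = X z a b - X z b a + Pv (omf a z ** omf b z - omf b z ** omf a z)"
proof -
  assume z: "z \<in> V"
  let ?S = "\<lambda>f :: 7 \<Rightarrow> 7 \<Rightarrow> real ^ 7. \<Sum>m\<in>UNIV. \<Sum>n\<in>UNIV. (F z $ m $ a * F z $ n $ b) *\<^sub>R f m n"
  have 1: "Pv (W a b z) = ?S (\<lambda>m n. pdv m (thh n) z) - ?S (\<lambda>m n. pdv n (thh m) z)
     + (?S (\<lambda>m n. Pv (om m z ** om n z)) - ?S (\<lambda>m n. Pv (om n z ** om m z)))"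
    unfolding W_def Om_def Pv_simps pdv_thh[OF z]
    by (simp add: scaleR_add_right scaleR_diff_right sum.distrib sum_subtractf)
  have 2: "?S (\<lambda>m n. pdv n (thh m) z) = X z b a"
    unfolding X_def by (subst sum.swap) (simp add: mult.commute)
  have 3: "Pv (omf a z ** omf b z) = ?S (\<lambda>m n. Pv (om m z ** om n z))"
    unfolding omf_def matrix_sum_mult Pv_simps ..
  have 4: "Pv (omf b z ** omf a z) = ?S (\<lambda>m n. Pv (om n z ** om m z))"
    unfolding omf_def matrix_sum_mult Pv_simps by (subst sum.swap) (simp add: mult.commute)
  show ?thesis unfolding Pv_simps(2)[of "omf a z ** omf b z"] 3 4 1 2 X_def[of z a b] ..
qed

lemma thh_th: "z \<in> V \<Longrightarrow> thh n z = (\<Sum>b\<in>UNIV. E z $ b $ n *\<^sub>R th z b)"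
proof -
  assume z: "z \<in> V"
  have "(\<Sum>b\<in>UNIV. E z $ b $ n *\<^sub>R th z b) = (\<Sum>b\<in>UNIV. \<Sum>m\<in>UNIV. (F z $ m $ b * E z $ b $ n) *\<^sub>R thh m z)"
    by (simp add: th_def omf_def Pv_simps thh_def scaleR_sum_right mult.commute)
  also have "\<dots> = (\<Sum>m\<in>UNIV. \<Sum>b\<in>UNIV. (F z $ m $ b * E z $ b $ n) *\<^sub>R thh m z)" by (rule sum.swap)
  also have "\<dots> = (\<Sum>m\<in>UNIV. if m = n then thh m z else 0)"
    by (intro sum.cong refl) (simp add: scaleR_sum_left[symmetric] F_E_sum[OF z])
  finally show ?thesis by simp
qed

text \<open>The product rule for \<open>thh\<close>, whose coordinate components are those of
  \<open>th\<close> multiplied by \<open>E\<close>.\<close>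

lemma X_Mf: "z \<in> V \<Longrightarrow> X z a b = (\<Sum>j\<in>UNIV. Mf a z $ j $ b *\<^sub>R th z j)
    + (\<Sum>m\<in>UNIV. F z $ m $ a *\<^sub>R pdv m (\<lambda>z. th z b) z)"
proof -
  assume z: "z \<in> V"
  have d: "pdv m (thh n) z = (\<Sum>j\<in>UNIV. pdm m E z $ j $ n *\<^sub>R th z j + E z $ j $ n *\<^sub>R pdv m (\<lambda>z. th z j) z)" for m n
  proof -
    have s: "smooth_on V (\<lambda>z. E z $ j $ n * th z j $ k)" for j k
      by (rule smooth_on_mult[OF V smoothMD[OF smE] smoothVD[OF smth]])
    have "pdv m (thh n) z = pdv m (\<lambda>z. \<Sum>b\<in>UNIV. E z $ b $ n *\<^sub>R th z b) z"
      by (rule pdv_cong[OF V z]) (rule thh_th)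
    moreover have "pderiv_at m (\<lambda>z. \<Sum>b\<in>UNIV. E z $ b $ n * th z b $ k) z
       = (\<Sum>j\<in>UNIV. pdm m E z $ j $ n * th z j $ k + E z $ j $ n * pdv m (\<lambda>z. th z j) z $ k)" for k
      by (simp only: pderiv_sum[of _ V, OF s z] pderiv_mult[OF smoothMD[OF smE] smoothVD[OF smth] z] pdm_nth pdv_nth)
    ultimately show ?thesis by (simp add: vec_eq_iff pdv_nth)
  qed
  have "X z a b $ k = ((\<Sum>j\<in>UNIV. Mf a z $ j $ b *\<^sub>R th z j) + (\<Sum>m\<in>UNIV. F z $ m $ a *\<^sub>R pdv m (\<lambda>z. th z b) z)) $ k" for k
  proof -
    define p q where "p j = th z j $ k" and "q m j = pdv m (\<lambda>z. th z j) z $ k" for m j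
    have "X z a b $ k = (\<Sum>m\<in>UNIV. \<Sum>n\<in>UNIV. \<Sum>j\<in>UNIV. F z $ m $ a * F z $ n $ b * pdm m E z $ j $ n * p j
        + F z $ m $ a * F z $ n $ b * E z $ j $ n * q m j)"
      unfolding X_def d by (simp add: p_def q_def sum_distrib_left distrib_left mult.assoc)
    also have "\<dots> = (\<Sum>m\<in>UNIV. \<Sum>n\<in>UNIV. \<Sum>j\<in>UNIV. F z $ m $ a * F z $ n $ b * pdm m E z $ j $ n * p j)
        + (\<Sum>m\<in>UNIV. \<Sum>n\<in>UNIV. \<Sum>j\<in>UNIV. F z $ m $ a * F z $ n $ b * E z $ j $ n * q m j)"
      by (simp only: sum.distrib)
    also have "(\<Sum>m\<in>UNIV. \<Sum>n\<in>UNIV. \<Sum>j\<in>UNIV. F z $ m $ a * F z $ n $ b * pdm m E z $ j $ n * p j)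
        = (\<Sum>j\<in>UNIV. Mf a z $ j $ b * p j)"
    proof -
      have Mp: "Mf a z $ j $ b * p j = (\<Sum>m\<in>UNIV. \<Sum>n\<in>UNIV. F z $ m $ a * F z $ n $ b * pdm m E z $ j $ n * p j)" for j
      proof -
        have "Mf a z $ j $ b * p j = (\<Sum>m\<in>UNIV. F z $ m $ a * (\<Sum>n\<in>UNIV. pdm m E z $ j $ n * F z $ n $ b)) * p j"
          by (simp add: Mf_def matrix_matrix_mult_def)
        also have "\<dots> = (\<Sum>m\<in>UNIV. \<Sum>n\<in>UNIV. F z $ m $ a * F z $ n $ b * pdm m E z $ j $ n * p j)"
          unfolding sum_distrib_left sum_distrib_right by (intro sum.cong refl) simp
        finally show ?thesis .
      qed
      show ?thesis by (simp only: Mp) (rule sum3_rotate)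
    qed
    also have "(\<Sum>m\<in>UNIV. \<Sum>n\<in>UNIV. \<Sum>j\<in>UNIV. F z $ m $ a * F z $ n $ b * E z $ j $ n * q m j)
        = (\<Sum>m\<in>UNIV. F z $ m $ a * q m b)"
    proof (intro sum.cong refl)
      fix m
      have "(\<Sum>n\<in>UNIV. \<Sum>j\<in>UNIV. F z $ m $ a * F z $ n $ b * E z $ j $ n * q m j)
          = (\<Sum>j\<in>UNIV. \<Sum>n\<in>UNIV. E z $ j $ n * F z $ n $ b * (F z $ m $ a * q m j))"
        by (subst sum.swap) (intro sum.cong refl, simp)
      also have "\<dots> = (\<Sum>j\<in>UNIV. if j = b then F z $ m $ a * q m j else 0)"
        by (intro sum.cong refl) (simp add: sum_distrib_right[symmetric] E_F_sum[OF z])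
      finally show "(\<Sum>n\<in>UNIV. \<Sum>j\<in>UNIV. F z $ m $ a * F z $ n $ b * E z $ j $ n * q m j) = F z $ m $ a * q m b"
        by simp
    qed
    finally show ?thesis by (simp add: p_def q_def)
  qed
  then show ?thesis by (simp add: vec_eq_iff)
qed

definition tv where "tv z = (\<chi> a. tvec (th z) a)"

lemma smtv: "smoothV V tv"
proof -
  have "tv z $ a = (\<Sum>b\<in>UNIV. \<Sum>n\<in>UNIV. th z b $ n * ph a b n)" for z a
    by (simp add: tv_def tvec_def phi_ax_last)
  then show ?thesis unfolding smoothV_def
    by (simp, intro allI smooth_on_sum smooth_on_mult smooth_on_const V smoothVD[OF smth])
qed

definition divt where "divt z = (\<Sum>a\<in>UNIV. \<Sum>b\<in>UNIV. phi [ax a, ax b, X z a b] - phi [omf a z *v ax a, ax b, th z b]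
      - phi [ax a, omf a z *v ax b, th z b])"

lemma mv_ax_sum: "A *v ax j = (\<Sum>i\<in>UNIV. A $ i $ j *\<^sub>R ax i)" for A :: "real ^ 7 ^ 7"
  using vec_ax_sum[of "A *v ax j"] by (simp add: matrix_ax)

text \<open>Of the terms in \<open>X_Mf\<close>, the part with \<open>Kf\<close> is symmetric in
  \<open>a\<close> and \<open>b\<close> and dies against \<open>phi\<close>; the part with
  \<open>omf\<close> becomes, by skewness, one of the two corrections in \<open>divt\<close>. The
  other correction is the connection term of \<open>divergence_frame\<close>.\<close>

lemma divergence_tv:
  assumes z: "z \<in> V"
  shows "(\<Sum>m\<in>UNIV. pderiv_at m (\<lambda>z. det (E z) * (F z *v tv z) $ m) z) = det (E z) * divt z"
proof -
  let ?D = "\<lambda>a b. \<Sum>m\<in>UNIV. F z $ m $ a *\<^sub>R pdv m (\<lambda>z. th z b) z"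
  have sk: "omf a z $ j $ i = - omf a z $ i $ j" for a i j
    using omf_skew[OF z, of a] unfolding skewm_def by blast
  have 1: "(\<Sum>m\<in>UNIV. F z $ m $ a * pderiv_at m (\<lambda>z. tv z $ a) z) = (\<Sum>b\<in>UNIV. phi [ax a, ax b, ?D a b])" for a
  proof -
    have s: "smooth_on V (\<lambda>z. th z b $ n * ph a b n)" for b n
      by (intro smooth_on_mult smooth_on_const V smoothVD[OF smth])
    have e: "pderiv_at m (\<lambda>z. th z b $ n * ph a b n) z = pdv m (\<lambda>z. th z b) z $ n * ph a b n" for m b n
      using pderiv_cmult[OF smoothVD[OF smth] z, of m "ph a b n" b n] by (simp only: mult.commute pdv_nth)
    have "pderiv_at m (\<lambda>z. tv z $ a) z = (\<Sum>b\<in>UNIV. \<Sum>n\<in>UNIV. pdv m (\<lambda>z. th z b) z $ n * ph a b n)" for m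
    proof -
      have "(\<lambda>z. tv z $ a) = (\<lambda>z. \<Sum>b\<in>UNIV. \<Sum>n\<in>UNIV. th z b $ n * ph a b n)"
        by (simp add: tv_def tvec_def phi_ax_last)
      then show ?thesis
        by (simp only: pderiv_sum[of _ V, OF smooth_on_sum[OF V s] z] pderiv_sum[of _ V, OF s z] e)
    qed
    then have "(\<Sum>m\<in>UNIV. F z $ m $ a * pderiv_at m (\<lambda>z. tv z $ a) z)
        = (\<Sum>m\<in>UNIV. \<Sum>b\<in>UNIV. F z $ m $ a * phi [ax a, ax b, pdv m (\<lambda>z. th z b) z])"
      by (simp only: phi_ax_last sum_distrib_left)
    also have "\<dots> = (\<Sum>b\<in>UNIV. \<Sum>m\<in>UNIV. F z $ m $ a * phi [ax a, ax b, pdv m (\<lambda>z. th z b) z])" by (rule sum.swap)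
    finally show ?thesis by (simp only: phi_sum3)
  qed
  have 2: "(omf a z *v tv z) $ a = - (\<Sum>b\<in>UNIV. phi [omf a z *v ax a, ax b, th z b])" for a
  proof -
    have "(\<Sum>b\<in>UNIV. phi [omf a z *v ax a, ax b, th z b]) = (\<Sum>b\<in>UNIV. \<Sum>i\<in>UNIV. omf a z $ i $ a * phi [ax i, ax b, th z b])"
      by (simp only: mv_ax_sum phi_sum1)
    also have "\<dots> = (\<Sum>i\<in>UNIV. \<Sum>b\<in>UNIV. omf a z $ i $ a * phi [ax i, ax b, th z b])" by (rule sum.swap)
    also have "\<dots> = (\<Sum>i\<in>UNIV. - (omf a z $ a $ i * tv z $ i))"
      unfolding sk[of a _ a] by (simp add: tv_def tvec_def sum_distrib_left sum_negf)
    finally show ?thesis by (simp add: matrix_vector_mult_def sum_negf)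
  qed
  have 3: "(\<Sum>a\<in>UNIV. \<Sum>b\<in>UNIV. phi [ax a, ax b, \<Sum>j\<in>UNIV. Kf a z $ j $ b *\<^sub>R th z j]) = 0" (is "?L = 0")
  proof -
    define f where "f a b = phi [ax a, ax b, \<Sum>j\<in>UNIV. Kf a z $ j $ b *\<^sub>R th z j]" for a b
    have "f b a = - f a b" for a b
      unfolding f_def Kf_sym[of b z _ a] by (rule alt_phi(1))
    then have "(\<Sum>a\<in>UNIV. \<Sum>b\<in>UNIV. f b a) = (\<Sum>a\<in>UNIV. \<Sum>b\<in>UNIV. - f a b)" by (intro sum.cong refl)
    moreover have "(\<Sum>a\<in>UNIV. \<Sum>b\<in>UNIV. f b a) = (\<Sum>a\<in>UNIV. \<Sum>b\<in>UNIV. f a b)" by (rule sum.swap)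
    ultimately show ?thesis by (simp add: f_def[symmetric] sum_negf)
  qed
  have 4: "(\<Sum>b\<in>UNIV. phi [ax a, ax b, \<Sum>j\<in>UNIV. omf a z $ j $ b *\<^sub>R th z j])
     = - (\<Sum>b\<in>UNIV. phi [ax a, omf a z *v ax b, th z b])" for a
  proof -
    have "(\<Sum>b\<in>UNIV. phi [ax a, omf a z *v ax b, th z b]) = (\<Sum>j\<in>UNIV. \<Sum>b\<in>UNIV. omf a z $ b $ j * phi [ax a, ax b, th z j])"
      by (simp only: mv_ax_sum phi_sum2)
    also have "\<dots> = (\<Sum>b\<in>UNIV. \<Sum>j\<in>UNIV. omf a z $ b $ j * phi [ax a, ax b, th z j])" by (rule sum.swap)
    also have "\<dots> = (\<Sum>b\<in>UNIV. \<Sum>j\<in>UNIV. - (omf a z $ j $ b * phi [ax a, ax b, th z j]))"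
    proof (intro sum.cong refl)
      fix b j show "omf a z $ b $ j * phi [ax a, ax b, th z j] = - (omf a z $ j $ b * phi [ax a, ax b, th z j])"
        using sk[of a b j] by simp
    qed
    finally show ?thesis by (simp only: phi_sum3 sum_negf minus_minus)
  qed
  have 5: "phi [ax a, ax b, X z a b] = phi [ax a, ax b, ?D a b] + phi [ax a, ax b, \<Sum>j\<in>UNIV. Kf a z $ j $ b *\<^sub>R th z j]
     - phi [ax a, ax b, \<Sum>j\<in>UNIV. omf a z $ j $ b *\<^sub>R th z j]" for a b
    unfolding X_Mf[OF z] Mf_Kf
    by (simp add: phi_cr scaleR_diff_left sum_subtractf inner_add_right inner_diff_right)
  have "(\<Sum>i\<in>UNIV. (\<Sum>m\<in>UNIV. F z $ m $ i * pderiv_at m (\<lambda>z. tv z $ i) z) + (omf i z *v tv z) $ i) = divt z"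
    unfolding 1 2 divt_def sum_subtractf sum.distrib 5 3 4 by (simp add: sum_negf)
  then show ?thesis using divergence_frame[OF z smtv] by simp
qed

lemma scalar_formula:
  assumes z: "z \<in> V"
  shows "(\<Sum>s\<in>UNIV. \<Sum>n\<in>UNIV. matrix_inv (G z) $ s $ n * ricci G s n z) = divt z + qform (th z)"
proof -
  have "(\<Sum>a\<in>UNIV. \<Sum>b\<in>UNIV. W a b z $ a $ b) = divt z + qform (th z)"
    unfolding qform_def
    by (rule scal_algebra[OF omf_skew[OF z] _ W_bianchi[OF z] W_skew[OF z] Pv_W[OF z] divt_def]) (simp add: th_def)
  then show ?thesis using scalar_W[OF z] by simp
qed

text \<open>Vanishing torsion makes the \<open>K\<close> terms symmetric, so they cancel in the
  alternating sum. What remains in each summand is the connection acting on all three slots of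
  \<open>phi\<close>, to which \<open>skew_phi\<close> applies.\<close>

lemma d_phi_frame:
  assumes z: "z \<in> V"
  shows "euclidean_d (\<lambda>z ws. phi (map ((*v) (E z)) ws)) z (map (\<lambda>i. F z *v ax i) [a, b, c, d]) = dphi (th z) [a, b, c, d]"
proof -
  define K where "K a b = Kf a z *v ax b" for a b
  define Q where "Q a b = omf a z *v ax b" for a b
  have Ks: "K b a = K a b" for a b unfolding K_def by (rule Kf_ax)
  have M: "Mf a z *v ax b = K a b - Q a b" for a b unfolding K_def Q_def by (rule Mf_ax)
  have m: "multilin 3 phi" by (rule altf_multilin[OF altf_phi])
  have diff: "phi [x - x', y, w] = phi [x, y, w] - phi [x', y, w]" "phi [x, y - y', w] = phi [x, y, w] - phi [x, y', w]"
    "phi [x, y, w - w'] = phi [x, y, w] - phi [x, y, w']" for x x' y y' w w'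
    using linear_phi(1)[of 1 x "-1" x' y w] linear_phi(2)[of x 1 y "-1" y' w] linear_phi(3)[of x y 1 w "-1" w'] by simp_all
  have sk: "phi [Q a x, ax y, ax w] + phi [ax x, Q a y, ax w] + phi [ax x, ax y, Q a w]
      = - (1 / 2) * psi [th z a, ax x, ax y, ax w]" for a x y w
    unfolding Q_def th_def by (rule skew_phi[OF omf_skew[OF z]])
  have "euclidean_d (\<lambda>z ws. phi (map ((*v) (E z)) ws)) z (map (\<lambda>i. F z *v ax i) [a, b, c, d])
    = (phi [K a b - Q a b, ax c, ax d] + phi [ax b, K a c - Q a c, ax d] + phi [ax b, ax c, K a d - Q a d])
    - (phi [K b a - Q b a, ax c, ax d] + phi [ax a, K b c - Q b c, ax d] + phi [ax a, ax c, K b d - Q b d])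
    + (phi [K c a - Q c a, ax b, ax d] + phi [ax a, K c b - Q c b, ax d] + phi [ax a, ax b, K c d - Q c d])
    - (phi [K d a - Q d a, ax b, ax c] + phi [ax a, K d b - Q d b, ax c] + phi [ax a, ax b, K d c - Q d c])"
    unfolding M[symmetric]
    by (subst d_pullback_frame[OF z m]) (simp_all add: eval_nat_numeral)
  also have "\<dots> = 1 / 2 * (psi [th z a, ax b, ax c, ax d] - psi [th z b, ax a, ax c, ax d]
      + psi [th z c, ax a, ax b, ax d] - psi [th z d, ax a, ax b, ax c])"
    unfolding diff Ks[of b a] Ks[of c a] Ks[of d a] Ks[of c b] Ks[of d b] Ks[of d c]
    using sk[of a b c d] sk[of b a c d] sk[of c a b d] sk[of d a b c]
      alt_phi(1)[of "ax b" "K a c" "ax d"] phi_cyc[of "K a d" "ax b" "ax c"] alt_phi(2)[of "ax a" "ax c" "K b d"]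
    by simp
  also have "\<dots> = dphi (th z) [a, b, c, d]"
    by (simp add: dphi_def eval_nat_numeral)
  finally show ?thesis .
qed

text \<open>The cancellation in \<open>d_psi_frame\<close> reduced to linear arithmetic:
  \<open>kab\<close> and its like stand for the symmetric terms, \<open>qab\<close> and its like for
  the action of the connection.\<close>

lemma d_psi_arith:
  fixes wa wb wc wd we :: real
  assumes "qab + qac + qad + qae = 1 / 2 * wa" "qba + qbc + qbd + qbe = 1 / 2 * wb" "qca + qcb + qcd + qce = 1 / 2 * wc" "qda + qdb + qdc + qde = 1 / 2 * wd" "qea + qeb + qec + qed = 1 / 2 * we"
  shows "((kab - qab) + (kac - qac) + (kad - qad) + (kae - qae)) - ((kab - qba) + (kbc - qbc) + (kbd - qbd) + (kbe - qbe)) + ((- kac - qca) + (kbc - qcb) + (kcd - qcd) + (kce - qce)) - ((kad - qda) + (- kbd - qdb) + (kcd - qdc) + (kde - qde)) + ((- kae - qea) + (kbe - qeb) + (- kce - qec) + (kde - qed))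
    = - 1 / 2 * (wa - wb + wc - wd + we)"
  using assms by argo

lemma d_psi_frame:
  assumes z: "z \<in> V" and s: "[a, b, c, d, e] \<in> set (filter (\<lambda>is. length is = 5) (subseqs I7))"
  shows "euclidean_d (\<lambda>z ws. psi (map ((*v) (E z)) ws)) z (map (\<lambda>i. F z *v ax i) [a, b, c, d, e])
    = dpsi (th z) [a, b, c, d, e]"
proof -
  define K where "K a b = Kf a z *v ax b" for a b
  define Q where "Q a b = omf a z *v ax b" for a b
  have Ks: "K b a = K a b" for a b unfolding K_def by (rule Kf_ax)
  have M: "Mf a z *v ax b = K a b - Q a b" for a b unfolding K_def Q_def by (rule Mf_ax)
  have m: "multilin 4 psi" by (rule altf_multilin[OF altf_psi])
  have diff: "psi [x - x', y, w, v] = psi [x, y, w, v] - psi [x', y, w, v]" "psi [x, y - y', w, v] = psi [x, y, w, v] - psi [x, y', w, v]"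
    "psi [x, y, w - w', v] = psi [x, y, w, v] - psi [x, y, w', v]" "psi [x, y, w, v - v'] = psi [x, y, w, v] - psi [x, y, w, v']"
    for x x' y y' w w' v v'
    using linear_psi(1)[of 1 x "-1" x' y w v] linear_psi(2)[of x 1 y "-1" y' w v] linear_psi(3)[of x y 1 w "-1" w' v]
      linear_psi(4)[of x y w 1 v "-1" v'] by simp_all
  let ?S = "set (filter (\<lambda>is. length is = 4) (subseqs I7))"
  have r: "[b, c, d, e] \<in> ?S" "[a, c, d, e] \<in> ?S" "[a, b, d, e] \<in> ?S" "[a, b, c, e] \<in> ?S" "[a, b, c, d] \<in> ?S"
    using s unfolding subseqs_4 subseqs_5 list.set insert_iff list.inject empty_iff
    by - ((elim disjE conjE; simp)+)
  have sk: "psi [Q a x, ax y, ax w, ax v] + psi [ax x, Q a y, ax w, ax v] + psi [ax x, ax y, Q a w, ax v] + psi [ax x, ax y, ax w, Q a v]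
      = 1 / 2 * wedge 1 3 (lform (th z a)) phi [ax x, ax y, ax w, ax v]" if "[x, y, w, v] \<in> ?S" for a x y w v
    unfolding Q_def th_def by (rule skew_psi[OF omf_skew[OF z] that])
  \<comment> \<open>Each symmetric term occurs twice, in different slots; these swaps bring both
    copies to the same slot, where they cancel.\<close>
  have kk: "psi [K a c, ax b, ax d, ax e] = - psi [ax b, K a c, ax d, ax e]"
    "psi [K a d, ax b, ax c, ax e] = psi [ax b, ax c, K a d, ax e]"
    "psi [K a e, ax b, ax c, ax d] = - psi [ax b, ax c, ax d, K a e]"
    "psi [ax a, K b d, ax c, ax e] = - psi [ax a, ax c, K b d, ax e]"
    "psi [ax a, K b e, ax c, ax d] = psi [ax a, ax c, ax d, K b e]"
    "psi [ax a, ax b, K c e, ax d] = - psi [ax a, ax b, ax d, K c e]"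
    using psi_swap(1)[of "ax b" "K a c" "ax d" "ax e"]
      psi_swap(1)[of "ax b" "K a d" "ax c" "ax e"] psi_swap(2)[of "ax b" "ax c" "K a d" "ax e"]
      psi_swap(1)[of "ax b" "K a e" "ax c" "ax d"] psi_swap(2)[of "ax b" "ax c" "K a e" "ax d"] psi_swap(3)[of "ax b" "ax c" "ax d" "K a e"]
      psi_swap(2)[of "ax a" "ax c" "K b d" "ax e"]
      psi_swap(2)[of "ax a" "ax c" "K b e" "ax d"] psi_swap(3)[of "ax a" "ax c" "ax d" "K b e"]
      psi_swap(3)[of "ax a" "ax b" "ax d" "K c e"]
    by linarith+
  have "euclidean_d (\<lambda>z ws. psi (map ((*v) (E z)) ws)) z (map (\<lambda>i. F z *v ax i) [a, b, c, d, e])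
    = (psi [K a b - Q a b, ax c, ax d, ax e] + psi [ax b, K a c - Q a c, ax d, ax e] + psi [ax b, ax c, K a d - Q a d, ax e] + psi [ax b, ax c, ax d, K a e - Q a e])
    - (psi [K b a - Q b a, ax c, ax d, ax e] + psi [ax a, K b c - Q b c, ax d, ax e] + psi [ax a, ax c, K b d - Q b d, ax e] + psi [ax a, ax c, ax d, K b e - Q b e])
    + (psi [K c a - Q c a, ax b, ax d, ax e] + psi [ax a, K c b - Q c b, ax d, ax e] + psi [ax a, ax b, K c d - Q c d, ax e] + psi [ax a, ax b, ax d, K c e - Q c e])
    - (psi [K d a - Q d a, ax b, ax c, ax e] + psi [ax a, K d b - Q d b, ax c, ax e] + psi [ax a, ax b, K d c - Q d c, ax e] + psi [ax a, ax b, ax c, K d e - Q d e])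
    + (psi [K e a - Q e a, ax b, ax c, ax d] + psi [ax a, K e b - Q e b, ax c, ax d] + psi [ax a, ax b, K e c - Q e c, ax d] + psi [ax a, ax b, ax c, K e d - Q e d])"
    unfolding M[symmetric]
    by (subst d_pullback_frame[OF z m]) (simp_all add: eval_nat_numeral)
  also have "\<dots> = - 1 / 2 * (wedge 1 3 (lform (th z a)) phi [ax b, ax c, ax d, ax e] - wedge 1 3 (lform (th z b)) phi [ax a, ax c, ax d, ax e]
      + wedge 1 3 (lform (th z c)) phi [ax a, ax b, ax d, ax e] - wedge 1 3 (lform (th z d)) phi [ax a, ax b, ax c, ax e]
      + wedge 1 3 (lform (th z e)) phi [ax a, ax b, ax c, ax d])"
    unfolding diff Ks[of b a] Ks[of c a] Ks[of d a] Ks[of e a] Ks[of c b] Ks[of d b] Ks[of e b] Ks[of d c] Ks[of e c] Ks[of e d] kk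
    by (rule d_psi_arith[OF sk[OF r(1), of a] sk[OF r(2), of b] sk[OF r(3), of c] sk[OF r(4), of d] sk[OF r(5), of e]])
  also have "\<dots> = dpsi (th z) [a, b, c, d, e]"
    by (simp add: dpsi_def eval_nat_numeral)
  finally show ?thesis .
qed

end

section \<open>Smooth \<open>G\<^sub>2\<close>-coframes of a definite form\<close>

definition pulls_back :: "(real ^ 7) covector \<Rightarrow> (real ^ 7 \<Rightarrow> real ^ 7) \<Rightarrow> bool" where
  "pulls_back s u \<longleftrightarrow> linear u \<and> inj u \<and> (\<forall>vs. length vs = 3 \<longrightarrow> s vs = phi (map u vs))"

text \<open>If \<open>s\<close> is \<open>phi\<close> pulled back by \<open>u\<close> with
  determinant D, then \<open>bform s\<close> is 6 D times the metric, whose Gram determinant is D^2.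
  The 7 by 7 determinant is therefore 6^7 D^9, and an odd root recovers D with its sign.\<close>

definition det_of :: "(real ^ 7) covector \<Rightarrow> real" where
  "det_of s = root 9 (det (\<chi> i j. bform s (ax i) (ax j)) / 6 ^ 7)"

definition inner_of :: "(real ^ 7) covector \<Rightarrow> real ^ 7 \<Rightarrow> real ^ 7 \<Rightarrow> real" where
  "inner_of s v w = bform s v w / (6 * det_of s)"

lemma rows_linear: "linear u \<Longrightarrow> (\<chi> i. u (ax i)) = transpose (matrix u)" for u :: "real ^ 7 \<Rightarrow> real ^ 7"
  by (simp add: matrix_def transpose_def vec_eq_iff)

lemma det_of: assumes "pulls_back s u" shows "det_of s = det (\<chi> i. u (ax i))" and "det_of s \<noteq> 0"
proof -
  from assms have u: "linear u" and i: "inj u" and s: "\<And>vs. length vs = 3 \<Longrightarrow> s vs = phi (map u vs)"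
    by (auto simp: pulls_back_def)
  let ?U = "\<chi> i. u (ax i)" let ?d = "det ?U"
  have "bform s (ax i) (ax j) = (6 * ?d) * (u (ax i) \<bullet> u (ax j))" for i j
    using bform_pullback[OF u s] by simp
  then have "(\<chi> i j. bform s (ax i) (ax j)) = (\<chi> i. (6 * ?d) *s (?U ** transpose ?U) $ i)"
    by (simp add: vec_eq_iff matrix_matrix_mult_def transpose_def inner_vec_def)
  then have "det (\<chi> i j. bform s (ax i) (ax j)) = (6 * ?d) ^ 7 * (?d * ?d)"
    by (simp add: det_rows_mul det_mul)
  then have "det (\<chi> i j. bform s (ax i) (ax j)) / 6 ^ 7 = ?d ^ 9"
    by (simp add: power_mult_distrib power_numeral_reduce)
  then show *: "det_of s = ?d" by (simp add: det_of_def odd_real_root_power_cancel)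
  have "invertible (matrix u)"
    using linear_injective_left_inverse[OF u i] u
    by (metis invertible_left_inverse matrix_compose matrix_id_mat_1 id_apply)
  then show "det_of s \<noteq> 0" unfolding * rows_linear[OF u] by (simp add: invertible_det_nz)
qed

lemma inner_of: assumes "pulls_back s u" shows "inner_of s v w = u v \<bullet> u w"
  using bform_pullback[of u s v w] assms det_of[OF assms] by (simp add: inner_of_def pulls_back_def)

lemma smooth_bform:
  assumes V: "open V" and S: "\<And>ws. length ws = 3 \<Longrightarrow> smooth_on V (\<lambda>y. S y ws)"
  shows "smooth_on V (\<lambda>y. bform (S y) v w)"
  unfolding bform_def wedge_def divide_inverse
  by (intro smooth_on_sum smooth_on_mult smooth_on_const V S) simp_all

lemma smooth_on_congI:
  "open W \<Longrightarrow> smooth_on W g \<Longrightarrow> (\<And>y. y \<in> W \<Longrightarrow> f y = g y) \<Longrightarrow> smooth_on W f"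
  using smooth_on_cong by blast

lemma linear_ax_sum: "linear u \<Longrightarrow> u v = (\<Sum>i\<in>UNIV. v $ i *\<^sub>R u (ax i))" for u :: "real ^ 7 \<Rightarrow> real ^ 7"
  by (subst vec_ax_sum[of v]) (simp only: linear_sum linear_scale)

lemma open_pos: "open V \<Longrightarrow> smooth_on V f \<Longrightarrow> open {y \<in> V. (f y :: real) > 0}"
  using continuous_openin_preimage_gen[OF smooth_on_continuous[of V f], of "{0<..}"]
  by (auto simp: openin_open_eq vimage_def Int_def)

lemma smoothV_subset: "W \<subseteq> V \<Longrightarrow> smoothV V f \<Longrightarrow> smoothV W f"
  unfolding smoothV_def using smooth_on_subset by blast

section \<open>A smooth coframe by Gram-Schmidt\<close>

locale definite_field =
  fixes V :: "(real ^ 7) set" and S :: "real ^ 7 \<Rightarrow> (real ^ 7) covector" and u :: "real ^ 7 \<Rightarrow> real ^ 7 \<Rightarrow> real ^ 7"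
  assumes V: "open V" and S: "\<And>ws. length ws = 3 \<Longrightarrow> smooth_on V (\<lambda>y. S y ws)"
    and pb: "\<And>y. y \<in> V \<Longrightarrow> pulls_back (S y) (u y)"
begin

lemma lin: "y \<in> V \<Longrightarrow> linear (u y)" and inj: "y \<in> V \<Longrightarrow> inj (u y)"
  and S_phi: "y \<in> V \<Longrightarrow> length vs = 3 \<Longrightarrow> S y vs = phi (map (u y) vs)"
  using pb by (auto simp: pulls_back_def)

lemma smooth_det_of: "smooth_on V (\<lambda>y. det_of (S y))"
proof -
  have s: "smooth_on V (\<lambda>y. det (\<chi> i j. bform (S y) (ax i) (ax j)) / 6 ^ 7)"
    by (intro smooth_on_divide smooth_on_det smooth_on_const V) (simp_all add: smooth_bform[OF V S])
  have "det (\<chi> i j. bform (S y) (ax i) (ax j)) / 6 ^ 7 \<noteq> 0" if "y \<in> V" for y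
    using det_of(2)[OF pb[OF that]] by (auto simp: det_of_def)
  from smooth_on_root9[OF V s this] show ?thesis by (simp add: det_of_def[abs_def])
qed

text \<open>Nothing is known about how \<open>u y\<close> depends on \<open>y\<close>, but this
  product equals \<open>inner_of (S y) v w\<close>, which is built from the smooth components of
  \<open>S\<close>.\<close>

lemma smooth_gij: "smooth_on V (\<lambda>y. u y v \<bullet> u y w)"
proof -
  have "smooth_on V (\<lambda>y. inner_of (S y) v w)" unfolding inner_of_def
    by (intro smooth_on_divide smooth_bform smooth_on_mult smooth_on_const smooth_det_of V S)
      (use det_of(2)[OF pb] in simp_all)
  then show ?thesis using smooth_on_cong[OF V, of "\<lambda>y. inner_of (S y) v w" "\<lambda>y. u y v \<bullet> u y w"] inner_of[OF pb] by blast
qed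

lemma smooth_inner:
  assumes W: "open W" "W \<subseteq> V" and f: "smoothV W f" and h: "smoothV W h"
  shows "smooth_on W (\<lambda>y. u y (f y) \<bullet> u y (h y))"
proof -
  have "smooth_on W (\<lambda>y. \<Sum>i\<in>UNIV. \<Sum>j\<in>UNIV. f y $ i * (h y $ j * (u y (ax i) \<bullet> u y (ax j))))"
    by (intro smooth_on_sum smooth_on_mult W(1) smoothVD[OF f] smoothVD[OF h] smooth_on_subset[OF W(2) smooth_gij])
  moreover have "u y (f y) \<bullet> u y (h y) = (\<Sum>i\<in>UNIV. \<Sum>j\<in>UNIV. f y $ i * (h y $ j * (u y (ax i) \<bullet> u y (ax j))))" if "y \<in> W" for y
  proof -
    have l: "linear (u y)" using lin W(2) that by blast
    have 1: "u y (f y) \<bullet> w = (\<Sum>i\<in>UNIV. f y $ i * (u y (ax i) \<bullet> w))" for w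
      by (subst linear_ax_sum[OF l, of "f y"]) (simp add: inner_sum_left)
    have 2: "w \<bullet> u y (h y) = (\<Sum>j\<in>UNIV. h y $ j * (w \<bullet> u y (ax j)))" for w
      by (subst linear_ax_sum[OF l, of "h y"]) (simp add: inner_sum_right)
    show ?thesis by (subst 1) (simp only: 2 sum_distrib_left)
  qed
  ultimately show ?thesis by (rule smooth_on_congI[OF W(1)])
qed

lemma smooth_phi:
  assumes W: "open W" "W \<subseteq> V" and f: "smoothV W f" and h: "smoothV W h" and k: "smoothV W k"
  shows "smooth_on W (\<lambda>y. phi [u y (f y), u y (h y), u y (k y)])"
proof -
  have "smooth_on W (\<lambda>y. \<Sum>i\<in>UNIV. f y $ i * (\<Sum>j\<in>UNIV. h y $ j * (\<Sum>l\<in>UNIV. k y $ l * S y [ax i, ax j, ax l])))"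
    by (intro smooth_on_sum smooth_on_mult W(1) smoothVD[OF f] smoothVD[OF h] smoothVD[OF k] smooth_on_subset[OF W(2) S]) simp
  moreover have "phi [u y (f y), u y (h y), u y (k y)]
     = (\<Sum>i\<in>UNIV. f y $ i * (\<Sum>j\<in>UNIV. h y $ j * (\<Sum>l\<in>UNIV. k y $ l * S y [ax i, ax j, ax l])))" if "y \<in> W" for y
  proof -
    have y: "y \<in> V" using W(2) that by blast
    have 1: "phi [u y (f y), v, w] = (\<Sum>i\<in>UNIV. f y $ i * phi [u y (ax i), v, w])" for v w
      by (subst linear_ax_sum[OF lin[OF y], of "f y"]) (rule phi_sum1)
    have 2: "phi [v, u y (h y), w] = (\<Sum>i\<in>UNIV. h y $ i * phi [v, u y (ax i), w])" for v w
      by (subst linear_ax_sum[OF lin[OF y], of "h y"]) (rule phi_sum2)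
    have 3: "phi [v, w, u y (k y)] = (\<Sum>i\<in>UNIV. k y $ i * phi [v, w, u y (ax i)])" for v w
      by (subst linear_ax_sum[OF lin[OF y], of "k y"]) (rule phi_sum3)
    have 4: "S y [ax i, ax j, ax l] = phi [u y (ax i), u y (ax j), u y (ax l)]" for i j l
      by (simp add: S_phi[OF y])
    show ?thesis by (subst 1) (simp only: 4, subst 2, subst 3, rule refl)
  qed
  ultimately show ?thesis by (rule smooth_on_congI[OF W(1)])
qed

lemma smoothV_scale: "open W \<Longrightarrow> smooth_on W c \<Longrightarrow> smoothV W f \<Longrightarrow> smoothV W (\<lambda>y. c y *\<^sub>R f y)"
  by (simp add: smoothV_def smooth_on_mult)

lemma smoothV_minus: "open W \<Longrightarrow> smoothV W f \<Longrightarrow> smoothV W h \<Longrightarrow> smoothV W (\<lambda>y. f y - h y)"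
  by (simp add: smoothV_def smooth_on_diff)

lemma smoothV_unit:
  assumes "open W" "W \<subseteq> V" "smoothV W f" "\<forall>y\<in>W. u y (f y) \<bullet> u y (f y) > 0"
  defines "n \<equiv> \<lambda>y. (1 / sqrt (u y (f y) \<bullet> u y (f y))) *\<^sub>R f y"
  shows "smoothV W n" and "\<And>y. y \<in> W \<Longrightarrow> u y (n y) \<bullet> u y (n y) = 1"
    "\<And>y. y \<in> W \<Longrightarrow> u y (n y) = (1 / sqrt (u y (f y) \<bullet> u y (f y))) *\<^sub>R u y (f y)"
proof -
  have "0 < sqrt (u y (f y) \<bullet> u y (f y))" if "y \<in> W" for y using assms(4) that by simp
  then show "smoothV W n" unfolding n_def using assms(1-4)
    by (intro smoothV_scale smooth_on_divide smooth_on_const smooth_on_sqrt smooth_inner) (auto simp: less_le)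
  show e: "u y (n y) = (1 / sqrt (u y (f y) \<bullet> u y (f y))) *\<^sub>R u y (f y)" if "y \<in> W" for y
    unfolding n_def using assms(2) that by (subst linear_scale[OF lin]) auto
  show "u y (n y) \<bullet> u y (n y) = 1" if "y \<in> W" for y
    unfolding e[OF that] using assms(4) that
    by (simp add: real_sqrt_mult_self[symmetric] power2_eq_square[symmetric] divide_simps)
qed

lemma det_gram: "y \<in> V \<Longrightarrow> det (\<chi> i j. u y (ax i) \<bullet> u y (ax j)) \<noteq> 0"
proof -
  assume y: "y \<in> V"
  have "(\<chi> i j. u y (ax i) \<bullet> u y (ax j)) = (\<chi> i. u y (ax i)) ** transpose (\<chi> i. u y (ax i))"
    by (simp add: vec_eq_iff matrix_matrix_mult_def transpose_def inner_vec_def)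
  then show ?thesis using det_of[OF pb[OF y]] by (simp add: det_mul)
qed

text \<open>Gram-Schmidt in the varying metric produces three orthonormal fields, and cross products
  complete them to a G2-frame. Only inner products and values of \<open>phi\<close> enter
  \<open>E\<close>, and these are smooth although \<open>u\<close> need not be.\<close>

lemma ex_smooth_coframe:
  assumes p: "p \<in> V"
  shows "\<exists>W (E :: real ^ 7 \<Rightarrow> real ^ 7 ^ 7). open W \<and> p \<in> W \<and> W \<subseteq> V \<and> smoothM W E \<and> (\<forall>y\<in>W. pulls_back (S y) ((*v) (E y)))"
proof -
  have bij: "bij (u p)" using lin[OF p] inj[OF p] linear_injective_imp_surjective[of "u p"] by (simp add: bij_def)
  \<comment> \<open>At \<open>p\<close> these vectors already form the standard triple that
    generates the frame, so there Gram-Schmidt changes nothing and \<open>p\<close> lies in both of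
    the open sets \<open>V1\<close> and \<open>W\<close>.\<close>
  define x1 x2 x4 where "x1 = inv (u p) (ax 1)" and "x2 = inv (u p) (ax 2)" and "x4 = inv (u p) (ax 4)"
  have x: "u p x1 = ax 1" "u p x2 = ax 2" "u p x4 = ax 4"
    unfolding x1_def x2_def x4_def by (simp_all add: bij_is_surj[OF bij] surj_f_inv_f)
  have "x1 \<noteq> 0" using x(1) linear_0[OF lin[OF p]] by (auto simp: axis_eq_0_iff)
  have pos1: "\<forall>y\<in>V. u y x1 \<bullet> u y x1 > 0"
  proof
    fix y assume "y \<in> V"
    then show "u y x1 \<bullet> u y x1 > 0"
      using inj[of y] \<open>x1 \<noteq> 0\<close> linear_0[OF lin[of y]] by (auto simp: inj_def)
  qed
  define f1 where "f1 y = (1 / sqrt (u y x1 \<bullet> u y x1)) *\<^sub>R x1" for y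
  note n1 = smoothV_unit[OF V subset_refl smoothV_const pos1, folded f1_def]
  define t2 where "t2 y = x2 - (u y x2 \<bullet> u y (f1 y)) *\<^sub>R f1 y" for y
  have s2: "smoothV V t2" unfolding t2_def
    by (intro smoothV_minus smoothV_const smoothV_scale smooth_inner V n1 subset_refl)
  define V1 where "V1 = {y \<in> V. u y (t2 y) \<bullet> u y (t2 y) > 0}"
  have V1: "open V1" "V1 \<subseteq> V" unfolding V1_def using open_pos[OF V smooth_inner[OF V subset_refl s2 s2]] by auto
  have V1D: "y \<in> V" if "y \<in> V1" for y using that V1(2) by blast
  have pos2: "\<forall>y\<in>V1. u y (t2 y) \<bullet> u y (t2 y) > 0" by (simp add: V1_def)
  define f2 where "f2 y = (1 / sqrt (u y (t2 y) \<bullet> u y (t2 y))) *\<^sub>R t2 y" for y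
  note n2 = smoothV_unit[OF V1 smoothV_subset[OF V1(2) s2] pos2, folded f2_def]
  have s1: "smoothV V1 f1" by (rule smoothV_subset[OF V1(2) n1(1)])
  define f3 where "f3 y = inv (u y) (cr (u y (f1 y)) (u y (f2 y)))" for y
  have f3: "u y (f3 y) = cr (u y (f1 y)) (u y (f2 y))" if "y \<in> V" for y
    unfolding f3_def using linear_injective_imp_surjective[OF lin[OF that] inj[OF that]] by (simp add: surj_f_inv_f)
  \<comment> \<open>\<open>f3\<close> is defined through the inverse of the possibly rough
    \<open>u y\<close>, but it solves a linear system with smooth right-hand side whose matrix is
    the smooth, invertible Gram matrix.\<close>
  have s3: "smoothV V1 f3" unfolding smoothV_def
  proof (rule allI, rule smooth_on_solve[OF V1(1), where A = "\<lambda>y. \<chi> i j. u y (ax i) \<bullet> u y (ax j)"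
        and b = "\<lambda>y. \<chi> i. phi [u y (f1 y), u y (f2 y), u y (ax i)]"])
    show "smooth_on V1 (\<lambda>y. (\<chi> i j. u y (ax i) \<bullet> u y (ax j)) $ i $ j)" for i j
      by (simp add: smooth_on_subset[OF V1(2) smooth_gij])
    show "smooth_on V1 (\<lambda>y. (\<chi> i. phi [u y (f1 y), u y (f2 y), u y (ax i)]) $ i)" for i
      by (simp add: smooth_phi[OF V1 s1 n2(1) smoothV_const])
    fix y assume y: "y \<in> V1"
    show "det (\<chi> i j. u y (ax i) \<bullet> u y (ax j)) \<noteq> 0" by (rule det_gram[OF V1D[OF y]])
    show "(\<chi> i j. u y (ax i) \<bullet> u y (ax j)) *v f3 y = (\<chi> i. phi [u y (f1 y), u y (f2 y), u y (ax i)])"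
    proof -
      have "(\<Sum>j\<in>UNIV. (u y (ax i) \<bullet> u y (ax j)) * f3 y $ j) = u y (ax i) \<bullet> u y (f3 y)" for i
        by (subst (2) linear_ax_sum[OF lin[OF V1D[OF y]]]) (simp add: inner_sum_right mult.commute)
      then show ?thesis by (simp add: vec_eq_iff matrix_vector_mult_def f3[OF V1D[OF y]] phi_cr inner_commute)
    qed
  qed
  define t4 where "t4 y = x4 - (u y x4 \<bullet> u y (f1 y)) *\<^sub>R f1 y - (u y x4 \<bullet> u y (f2 y)) *\<^sub>R f2 y
     - (u y x4 \<bullet> u y (f3 y)) *\<^sub>R f3 y" for y
  have s4: "smoothV V1 t4" unfolding t4_def
    by (intro smoothV_minus smoothV_const smoothV_scale smooth_inner V1 n2 s1 s3)
  define W where "W = {y \<in> V1. u y (t4 y) \<bullet> u y (t4 y) > 0}"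
  have W: "open W" "W \<subseteq> V1" unfolding W_def using open_pos[OF V1(1) smooth_inner[OF V1 s4 s4]] by auto
  have WV: "W \<subseteq> V" using W V1 by blast
  have WD: "y \<in> V" "y \<in> V1" if "y \<in> W" for y using that V1(2) W(2) by blast+
  have pos4: "\<forall>y\<in>W. u y (t4 y) \<bullet> u y (t4 y) > 0" by (simp add: W_def)
  define f4 where "f4 y = (1 / sqrt (u y (t4 y) \<bullet> u y (t4 y))) *\<^sub>R t4 y" for y
  note n4 = smoothV_unit[OF W(1) WV smoothV_subset[OF W(2) s4] pos4, folded f4_def]
  note sW = smoothV_subset[OF W(2) s1] smoothV_subset[OF W(2) n2(1)] smoothV_subset[OF W(2) s3]
  have lc: "u y (v - c *\<^sub>R w) = u y v - c *\<^sub>R u y w" if "y \<in> V" for y v c w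
    using lin[OF that] by (simp add: linear_diff linear_scale)
  have o12: "u y (f1 y) \<bullet> u y (f2 y) = 0" if "y \<in> V1" for y
    using n1(2)[OF V1D[OF that]] unfolding n2(3)[OF that] t2_def lc[OF V1D[OF that]]
    by (simp add: inner_diff_right inner_commute)
  have perp: "cr a b \<bullet> a = 0" "cr a b \<bullet> b = 0" for a b :: "real ^ 7"
    unfolding phi_cr[symmetric] by (rule alt_phi)+
  have n3: "u y (f3 y) \<bullet> u y (f3 y) = 1" if "y \<in> V1" for y
    using n1(2)[OF V1D[OF that]] n2(2)[OF that] o12[OF that]
    unfolding f3[OF V1D[OF that]] by (simp add: cr_inner inner_commute)
  have p1: "u p (f1 p) = ax 1" using n1(3)[OF p] by (simp add: x ax_inner)
  have pt2: "u p (t2 p) = ax 2" unfolding t2_def lc[OF p] by (simp add: x p1 ax_inner)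
  have pV1: "p \<in> V1" using p by (simp add: V1_def pt2 ax_inner)
  have p2: "u p (f2 p) = ax 2" using n2(3)[OF pV1] by (simp add: pt2 ax_inner)
  have "u p (t4 p) = ax 4" unfolding t4_def lc[OF p]
    by (simp add: x p1 p2 ax_inner f3[OF p] inner_commute[of "ax 4" "cr _ _"] phi_cr[symmetric] phi_ph ph_table)
  then have pW: "p \<in> W" using pV1 by (simp add: W_def ax_inner)
  \<comment> \<open>Row i pairs the image of \<open>ax j\<close> with row i of the
    \<open>g2_frame\<close> spanned by the images of \<open>f1\<close>, \<open>f2\<close>,
    \<open>f4\<close>. Pairings with a cross product are values of \<open>phi\<close>.\<close>
  define E :: "real ^ 7 \<Rightarrow> real ^ 7 ^ 7" where "E y = (\<chi> i j. if i = 1 then u y (f1 y) \<bullet> u y (ax j) else if i = 2 then u y (f2 y) \<bullet> u y (ax j)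
      else if i = 3 then phi [u y (f1 y), u y (f2 y), u y (ax j)] else if i = 4 then u y (f4 y) \<bullet> u y (ax j)
      else if i = 5 then phi [u y (f1 y), u y (f4 y), u y (ax j)] else if i = 6 then phi [u y (f2 y), u y (f4 y), u y (ax j)]
      else - phi [u y (f3 y), u y (f4 y), u y (ax j)])" for y
  have "smoothM W E" unfolding smoothM_def
  proof (intro allI)
    fix i j
    note si = smooth_inner[OF W(1) WV _ smoothV_const] and sp = smooth_phi[OF W(1) WV _ _ smoothV_const]
    show "smooth_on W (\<lambda>y. E y $ i $ j)"
      unfolding E_def using exhaust_7[of i]
      by (elim disjE) (simp_all add: si[OF sW(1)] si[OF sW(2)] si[OF n4(1)] sp[OF sW(1,2)] sp[OF sW(1) n4(1)] sp[OF sW(2) n4(1)]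
        sp[OF sW(3) n4(1)] smooth_on_uminus W(1))
  qed
  moreover have "pulls_back (S y) ((*v) (E y))" if y: "y \<in> W" for y
  proof -
    define a b d where "a = u y (f1 y)" and "b = u y (f2 y)" and "d = u y (f4 y)"
    let ?K = "g2_frame a b d"
    have n: "a \<bullet> a = 1" "b \<bullet> b = 1" "d \<bullet> d = 1" "a \<bullet> b = 0" 
      using n1(2) n2(2) n4(2) o12 WD[OF y] y by (simp_all add: a_def b_def d_def)
    have WyV: "y \<in> V" using WD y by blast
    have t: "u y (t4 y) = u y x4 - (u y x4 \<bullet> a) *\<^sub>R a - (u y x4 \<bullet> b) *\<^sub>R b - (u y x4 \<bullet> cr a b) *\<^sub>R cr a b"
      unfolding t4_def lc[OF WD(1)[OF y]] f3[OF WD(1)[OF y]] a_def b_def ..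
    have c1: "cr a b \<bullet> cr a b = 1" using n3[OF WD(2)[OF y]] unfolding f3[OF WD(1)[OF y]] a_def b_def .
    have "a \<bullet> u y (t4 y) = 0" "b \<bullet> u y (t4 y) = 0" "cr a b \<bullet> u y (t4 y) = 0"
      unfolding t using n c1 perp[of a b] by (simp_all add: inner_diff_right inner_commute)
    then have o: "a \<bullet> d = 0" "b \<bullet> d = 0" "d \<bullet> cr a b = 0"
      unfolding d_def n4(3)[OF y] by (simp_all add: inner_commute)
    note gf = g2_frame_phi[OF n(1-3,4) o]
    \<comment> \<open>Thus \<open>E y\<close> differs from \<open>u y\<close> by a matrix that
      preserves \<open>phi\<close>, and pulls \<open>phi\<close> back to the same form.\<close>
    have Eu: "E y *v w = ?K *v u y w" for w
    proof -
      have row: "(\<Sum>j\<in>UNIV. (k \<bullet> u y (ax j)) * w $ j) = k \<bullet> u y w" for k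
        by (subst (2) linear_ax_sum[OF lin[OF WD(1)[OF y]]]) (simp add: inner_sum_right mult.commute)
      have e: "E y $ i $ j = ?K $ i \<bullet> u y (ax j)" for i j
        using exhaust_7[of i]
        by (elim disjE) (simp_all add: E_def g2_frame_def phi_cr a_def b_def d_def f3[OF WD(1)[OF y]])
      have "(E y *v w) $ i = (?K *v u y w) $ i" for i
      proof -
        have "(E y *v w) $ i = (\<Sum>j\<in>UNIV. (?K $ i \<bullet> u y (ax j)) * w $ j)"
          by (simp only: matrix_vector_mult_def vec_lambda_beta e)
        also have "\<dots> = ?K $ i \<bullet> u y w" by (rule row)
        finally show ?thesis by (simp add: matrix_vector_mult_def inner_vec_def)
      qed
      then show ?thesis by (simp add: vec_eq_iff)
    qed
    show ?thesis unfolding pulls_back_def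
    proof (intro conjI allI impI)
      show "linear ((*v) (E y))" by simp
      have "inj ((*v) ?K)"         by (rule inj_on_inverseI[of _ "(*v) (transpose ?K)"]) (simp only: matrix_vector_mul_assoc gf(1) matrix_vector_mul_lid)
      moreover have "(*v) (E y) = (*v) ?K \<circ> u y" by (rule ext) (simp only: Eu o_apply)
      ultimately show "inj ((*v) (E y))" using inj_compose[OF _ inj[OF WyV]] by (simp only:)
      fix vs :: "(real ^ 7) list" assume "length vs = 3"
      then obtain v1 v2 v3 where "vs = [v1, v2, v3]" unfolding length3 by blast
      then show "S y vs = phi (map ((*v) (E y)) vs)" using gf(2) by (simp add: S_phi[OF WyV] Eu)
    qed
  qed
  ultimately show ?thesis using W(1) WV pW by blast
qed

end

section \<open>Charts and tangent vectors\<close>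

locale smooth_mfd =
  fixes M :: "'m topology" and A :: "('m, 'n::finite) chart set"
  assumes mfd: "smooth_manifold M A"
begin

abbreviation img :: "('m, 'n) chart \<Rightarrow> (real ^ 'n) set" where "img c \<equiv> snd c ` fst c"

lemma chart_top: "c \<in> A \<Longrightarrow> topological_chart M c"
  and chart_cover: "(\<Union>c\<in>A. fst c) = topspace M"
  and chart_smooth: "c \<in> A \<Longrightarrow> c' \<in> A \<Longrightarrow> smooth_on (snd c ` (fst c \<inter> fst c')) (transition c c')"
  using mfd unfolding smooth_manifold_def by blast+

lemma chart_openin: "c \<in> A \<Longrightarrow> openin M (fst c)" and open_img: "c \<in> A \<Longrightarrow> open (img c)"
  and chart_homeo: "c \<in> A \<Longrightarrow> homeomorphic_map (subtopology M (fst c)) (top_of_set (img c)) (snd c)"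
  using chart_top unfolding topological_chart_def by blast+

lemma chart_inj: "c \<in> A \<Longrightarrow> inj_on (snd c) (fst c)"
  using chart_homeo[of c] chart_openin[of c] openin_subset[of M "fst c"]
  by (auto simp: homeomorphic_map_def Int_absorb1)

lemma chart_inv_left: "c \<in> A \<Longrightarrow> q \<in> fst c \<Longrightarrow> chart_inv c (snd c q) = q"
  unfolding chart_inv_def by (rule inv_into_f_f[OF chart_inj])

lemma chart_inv_right: "y \<in> img c \<Longrightarrow> snd c (chart_inv c y) = y" "y \<in> img c \<Longrightarrow> chart_inv c y \<in> fst c"
  unfolding chart_inv_def by (rule f_inv_into_f, assumption) (rule inv_into_into)

lemma open_overlap: "c \<in> A \<Longrightarrow> c' \<in> A \<Longrightarrow> c'' \<in> A \<Longrightarrow> open (snd c ` (fst c \<inter> fst c' \<inter> fst c''))"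
proof -
  assume c: "c \<in> A" "c' \<in> A" "c'' \<in> A"
  have "openin (subtopology M (fst c)) (fst c \<inter> (fst c' \<inter> fst c''))"
    using openin_subtopology_Int2[of M "fst c' \<inter> fst c''" "fst c"] chart_openin c by blast
  then have "openin (top_of_set (img c)) (snd c ` (fst c \<inter> (fst c' \<inter> fst c'')))"
    using homeomorphic_imp_open_map[OF chart_homeo[OF c(1)]] unfolding open_map_def by blast
  then show ?thesis using openin_open_trans[OF _ open_img[OF c(1)]] by (simp only: Int_assoc)
qed

lemma open_overlap2: "c \<in> A \<Longrightarrow> c' \<in> A \<Longrightarrow> open (snd c ` (fst c \<inter> fst c'))"
  using open_overlap[of c c' c'] by (simp add: Int_assoc)

lemma transition_snd: "c \<in> A \<Longrightarrow> q \<in> fst c \<Longrightarrow> transition c c' (snd c q) = snd c' q"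
  by (simp add: transition_def chart_inv_left)

definition Dt :: "('m, 'n) chart \<Rightarrow> ('m, 'n) chart \<Rightarrow> 'm \<Rightarrow> real ^ 'n \<Rightarrow> real ^ 'n" where
  "Dt c c' q = frechet_derivative (transition c c') (at (snd c q))"

lemma transition_derivative:
  assumes "c \<in> A" "c' \<in> A" "q \<in> fst c" "q \<in> fst c'"
  shows "(transition c c' has_derivative Dt c c' q) (at (snd c q))"
  unfolding Dt_def by (rule smooth_on_has_derivative[OF chart_smooth[OF assms(1,2)]]) (use assms in auto)

lemma Dt_linear: "c \<in> A \<Longrightarrow> c' \<in> A \<Longrightarrow> q \<in> fst c \<Longrightarrow> q \<in> fst c' \<Longrightarrow> linear (Dt c c' q)"
  by (rule has_derivative_linear[OF transition_derivative])

lemma Dt_compose: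
  assumes "c \<in> A" "c' \<in> A" "c'' \<in> A" "q \<in> fst c" "q \<in> fst c'" "q \<in> fst c''"
  shows "Dt c' c'' q (Dt c c' q w) = Dt c c'' q w"
proof -
  have "(transition c' c'' has_derivative Dt c' c'' q) (at (transition c c' (snd c q)))"
    using transition_derivative assms by (simp add: transition_snd)
  from has_derivative_compose[OF transition_derivative[of c c' q] this]
  have "((\<lambda>x. transition c' c'' (transition c c' x)) has_derivative (\<lambda>x. Dt c' c'' q (Dt c c' q x))) (at (snd c q))"
    using assms by blast
  moreover have "frechet_derivative (\<lambda>x. transition c' c'' (transition c c' x)) (at (snd c q)) = Dt c c'' q"
    unfolding Dt_def
    by (rule frechet_derivative_cong[OF open_overlap[OF assms(1-3)]]) (use assms in \<open>auto simp: transition_snd\<close>)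
  ultimately show ?thesis using frechet_derivative_eqI by metis
qed

lemma Dt_id: assumes "c \<in> A" "q \<in> fst c" shows "Dt c c q w = w"
proof -
  have "Dt c c q = frechet_derivative (\<lambda>x. x) (at (snd c q))"
    unfolding Dt_def by (rule frechet_derivative_cong[OF open_img[OF assms(1)]]) (use assms in \<open>auto simp: transition_snd\<close>)
  then show ?thesis by (simp add: frechet_derivative_eqI[OF has_derivative_ident])
qed

lemma tvec_of: "tvec_of A c q w = (\<lambda>c'. if c' \<in> charts_at A q then Dt c c' q w else 0)"
  unfolding tvec_of_def Dt_def ..

lemma tvec_of_in: assumes "c \<in> charts_at A q" shows "tvec_of A c q w \<in> tangent_space A q"
  unfolding tangent_space_def tvec_of using assms Dt_compose[of c _ _ q w]
  by (auto simp: charts_at_def Dt_def[symmetric])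

lemma tvec_of_coord: "c \<in> charts_at A q \<Longrightarrow> tvec_of A c q w c = w"
  unfolding tvec_of using Dt_id by (simp add: charts_at_def)

lemma tvec_of_surj: assumes "c \<in> charts_at A q" "v \<in> tangent_space A q" shows "tvec_of A c q (v c) = v"
proof
  fix c' show "tvec_of A c q (v c) c' = v c'"
  proof (cases "c' \<in> charts_at A q")
    case True
    then have "v c' = Dt c c' q (v c)" using assms unfolding tangent_space_def Dt_def by blast
    then show ?thesis using True by (simp add: tvec_of)
  next
    case False
    then have "v c' = 0" using assms unfolding tangent_space_def by blast
    then show ?thesis using False by (simp add: tvec_of)
  qed
qed

lemma tvec_of_linear: assumes "c \<in> charts_at A q"
  shows "tvec_of A c q (a *\<^sub>R v + b *\<^sub>R w) = (\<lambda>c'. a *\<^sub>R tvec_of A c q v c' + b *\<^sub>R tvec_of A c q w c')"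
proof
  fix c' show "tvec_of A c q (a *\<^sub>R v + b *\<^sub>R w) c' = a *\<^sub>R tvec_of A c q v c' + b *\<^sub>R tvec_of A c q w c'"
  proof (cases "c' \<in> charts_at A q")
    case True
    then have "linear (Dt c c' q)" using assms Dt_linear by (auto simp: charts_at_def)
    then show ?thesis using True by (simp add: tvec_of linear_add linear_scale)
  qed (simp add: tvec_of)
qed

lemma tvec_of_change:
  assumes "c \<in> charts_at A q" "c' \<in> charts_at A q"
  shows "tvec_of A c q w = tvec_of A c' q (Dt c c' q w)"
  using tvec_of_surj[OF assms(2) tvec_of_in[OF assms(1)], of w] assms(2) by (simp add: tvec_of)

lemma chart_inv_charts_at: "c \<in> A \<Longrightarrow> y \<in> img c \<Longrightarrow> c \<in> charts_at A (chart_inv c y)"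
  by (simp add: charts_at_def chart_inv_right)

lemma chart_at: "q \<in> topspace M \<Longrightarrow> chart_at A q \<in> charts_at A q"
  unfolding chart_at_def using chart_cover by (intro someI_ex[of "\<lambda>c. c \<in> charts_at A q"]) (fastforce simp: charts_at_def)

lemma chart_topspace: "c \<in> A \<Longrightarrow> q \<in> fst c \<Longrightarrow> q \<in> topspace M" using chart_cover by blast

lemma altf_pullback_tvec:
  assumes c: "c \<in> charts_at A q" and \<alpha>: "alternating_on (tangent_space A q) k \<alpha>"
  shows "altf k (pullback (tvec_of A c q) \<alpha>)"
  unfolding altf_def multilin_def
proof (intro conjI allI impI)
  fix vs :: "(real ^ 'n) list" and m v w and a b :: real assume l: "length vs = k" and m: "m < k"
  let ?T = "tvec_of A c q"
  have u: "map ?T (vs[m := x]) = map ?T (take m vs) @ ?T x # map ?T (drop (Suc m) vs)" for x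
    using l m by (simp add: upd_conv_take_nth_drop)
  have i: "set (map ?T xs) \<subseteq> tangent_space A q" for xs using tvec_of_in[OF c] by auto
  show "pullback ?T \<alpha> (vs[m := a *\<^sub>R v + b *\<^sub>R w]) = a * pullback ?T \<alpha> (vs[m := v]) + b * pullback ?T \<alpha> (vs[m := w])"
    unfolding pullback_def u tvec_of_linear[OF c]
    using \<alpha> unfolding alternating_on_def using i[of "take m vs"] i[of "drop (Suc m) vs"] tvec_of_in[OF c] l m
    by (simp del: set_map)
next
  fix vs :: "(real ^ 'n) list" assume "length vs = k" "\<not> distinct vs"
  moreover have "set (map (tvec_of A c q) vs) \<subseteq> tangent_space A q" using tvec_of_in[OF c] by auto
  ultimately show "pullback (tvec_of A c q) \<alpha> vs = 0"
    using \<alpha> unfolding alternating_on_def pullback_def by (simp add: distinct_map)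
qed

lemma altf_local_rep:
  assumes "\<omega> \<in> Omega M A k" "c \<in> A" "y \<in> img c"
  shows "altf k (local_rep A c \<omega> y)"
  unfolding local_rep_def using assms chart_topspace[OF assms(2) chart_inv_right(2)[OF assms(3)]]
  by (intro altf_pullback_tvec chart_inv_charts_at) (auto simp: Omega_def)

lemma smooth_local_rep:
  "\<omega> \<in> Omega M A k \<Longrightarrow> c \<in> A \<Longrightarrow> length ws = k \<Longrightarrow> smooth_on (img c) (\<lambda>y. local_rep A c \<omega> y ws)"
  by (simp add: Omega_def)

end

section \<open>Naturality of the exterior derivative on 3-forms\<close>

lemma multilin3_expand:
  assumes "multilin 3 \<alpha>"
  shows "\<alpha> [x, y, w] = (\<Sum>a\<in>UNIV. \<Sum>b\<in>UNIV. \<Sum>c\<in>UNIV. \<alpha> [ax a, ax b, ax c] * (x $ a * y $ b * w $ c))"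
proof -
  have m: "multilin (Suc 2) \<alpha>" using assms by (simp add: numeral_3_eq_3)
  have m2: "multilin (Suc 1) (\<lambda>vs. \<alpha> (v # vs))" for v using multilin_tail[OF m, of v] by (simp add: numeral_2_eq_2)
  have m1: "multilin (Suc 0) (\<lambda>vs. \<alpha> (v # v' # vs))" for v v' using multilin_tail[OF m2[of v], of v'] by simp
  have 1: "\<alpha> [x, v, v'] = (\<Sum>a\<in>UNIV. x $ a * \<alpha> [ax a, v, v'])" for v v'
    using multilin_head_sum[OF m, of "[v, v']" "\<lambda>a. x $ a" ax UNIV] vec_ax_sum[of x] by simp
  have 2: "\<alpha> [v, y, v'] = (\<Sum>a\<in>UNIV. y $ a * \<alpha> [v, ax a, v'])" for v v'
    using multilin_head_sum[OF m2[of v], of "[v']" "\<lambda>a. y $ a" ax UNIV] vec_ax_sum[of y] by simp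
  have 3: "\<alpha> [v, v', w] = (\<Sum>a\<in>UNIV. w $ a * \<alpha> [v, v', ax a])" for v v'
    using multilin_head_sum[OF m1[of v v'], of "[]" "\<lambda>a. w $ a" ax UNIV] vec_ax_sum[of w] by simp
  show ?thesis
    by (subst 1, subst 2, subst 3) (simp add: sum_distrib_left mult_ac)
qed

text \<open>Chain and product rule: the first summand differentiates the coefficients of \<eta>, the
  other three differentiate the Jacobian in one slot each.\<close>

lemma pullback_3form_derivative:
  fixes t :: "real ^ 'n::finite \<Rightarrow> real ^ 'n" and J :: "real ^ 'n \<Rightarrow> real ^ 'n ^ 'n"
  assumes V: "open V" and J: "smoothM V J" and z: "z \<in> V" and t: "(t has_derivative (*v) (J z)) (at z)"
    and V': "open V'" "t ` V \<subseteq> V'" and \<eta>: "\<And>y. y \<in> V' \<Longrightarrow> multilin 3 (\<eta> y)"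
    and d\<eta>: "\<And>ws. length ws = 3 \<Longrightarrow> (\<lambda>y. \<eta> y ws) differentiable (at (t z))"
  shows "frechet_derivative (\<lambda>z. \<eta> (t z) (map ((*v) (J z)) [p, q, r])) (at z) v
    = frechet_derivative (\<lambda>y. \<eta> y (map ((*v) (J z)) [p, q, r])) (at (t z)) (J z *v v)
      + (\<eta> (t z) [\<Sum>m\<in>UNIV. v $ m *\<^sub>R (pdm m J z *v p), J z *v q, J z *v r]
       + \<eta> (t z) [J z *v p, \<Sum>m\<in>UNIV. v $ m *\<^sub>R (pdm m J z *v q), J z *v r]
       + \<eta> (t z) [J z *v p, J z *v q, \<Sum>m\<in>UNIV. v $ m *\<^sub>R (pdm m J z *v r)])"
proof -
  \<comment> \<open>Coordinate 3-tensors instead of basis 3-forms: \<open>pderiv_pullback\<close>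
    asks for multilinearity alone, and the expansion stays free of signs.\<close>
  define e :: "'n \<Rightarrow> 'n \<Rightarrow> 'n \<Rightarrow> (real ^ 'n) covector" where
    "e a b c vs = vs ! 0 $ a * vs ! 1 $ b * vs ! 2 $ c" for a b c vs
  have e3: "e a b c [x, y, w] = x $ a * y $ b * w $ c" for a b c x y w by (simp add: e_def)
  have em: "multilin 3 (e a b c)" for a b c
    unfolding multilin_def
  proof (intro allI impI)
    fix vs :: "(real ^ 'n) list" and m :: nat and v w :: "real ^ 'n" and \<mu> \<nu> :: real
    assume "length vs = 3" "m < 3"
    show "e a b c (vs[m := \<mu> *\<^sub>R v + \<nu> *\<^sub>R w]) = \<mu> * e a b c (vs[m := v]) + \<nu> * e a b c (vs[m := w])"
    proof -
      obtain x y w' where vs: "vs = [x, y, w']" using \<open>length vs = 3\<close> unfolding length3 by blast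
      have "m = 0 \<or> m = 1 \<or> m = 2" using \<open>m < 3\<close> by linarith
      then show ?thesis unfolding vs
        by (elim disjE) (simp_all only: list_update_code One_nat_def numeral_2_eq_2 e3
            vector_add_component vector_scaleR_component real_scaleR_def ring_distribs mult_ac)
    qed
  qed
  define g where "g a b c z = e a b c (map ((*v) (J z)) [p, q, r])" for a b c z
  define h where "h a b c y = \<eta> y [ax a, ax b, ax c]" for a b c y
  define H where "H w = (\<Sum>m\<in>UNIV. v $ m *\<^sub>R (pdm m J z *v w))" for w
  have expd: "\<eta> y [x, x', x''] = (\<Sum>a\<in>UNIV. \<Sum>b\<in>UNIV. \<Sum>c\<in>UNIV. h a b c y * e a b c [x, x', x''])" if "y \<in> V'" for y x x' x''
    unfolding h_def e3 by (rule multilin3_expand[OF \<eta>[OF that]])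
  have len: "length [p, q, r] = 3" by simp
  note pp = pderiv_pullback[OF V J em len, folded g_def]
  have dg: "(g a b c has_derivative (frechet_derivative (g a b c) (at z))) (at z)" for a b c
    by (rule smooth_on_has_derivative[OF conjunct1[OF pp] z])
  have gv: "frechet_derivative (g a b c) (at z) v
     = e a b c [H p, J z *v q, J z *v r] + e a b c [J z *v p, H q, J z *v r] + e a b c [J z *v p, J z *v q, H r]" for a b c
  proof -
    have "frechet_derivative (g a b c) (at z) v = (\<Sum>m\<in>UNIV. v $ m *
        (e a b c [pdm m J z *v p, J z *v q, J z *v r] + e a b c [J z *v p, pdm m J z *v q, J z *v r]
         + e a b c [J z *v p, J z *v q, pdm m J z *v r]))"
      using pp z differentiableI[OF dg] by (subst frechet_pderiv) (simp_all add: eval_nat_numeral)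
    also have "\<dots> = e a b c [H p, J z *v q, J z *v r] + e a b c [J z *v p, H q, J z *v r] + e a b c [J z *v p, J z *v q, H r]"
    proof -
      have Hn: "H w $ i = (\<Sum>m\<in>UNIV. v $ m * (pdm m J z *v w) $ i)" for w i by (simp add: H_def)
      show ?thesis unfolding e3 Hn sum_distrib_right sum_distrib_left sum.distrib[symmetric]
        by (intro sum.cong refl) (simp only: distrib_left mult_ac)
    qed
    finally show ?thesis .
  qed
  have dh: "((\<lambda>y. h a b c y) has_derivative frechet_derivative (h a b c) (at (t z))) (at (t z))" for a b c
    unfolding h_def using d\<eta>[of "[ax a, ax b, ax c]"] by (simp add: frechet_derivative_works)
  have dht: "((\<lambda>z. h a b c (t z)) has_derivative (\<lambda>v. frechet_derivative (h a b c) (at (t z)) (J z *v v))) (at z)" for a b c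
    by (rule has_derivative_compose[OF t dh])
  have L: "((\<lambda>z. \<Sum>a\<in>UNIV. \<Sum>b\<in>UNIV. \<Sum>c\<in>UNIV. h a b c (t z) * g a b c z) has_derivative
     (\<lambda>v. \<Sum>a\<in>UNIV. \<Sum>b\<in>UNIV. \<Sum>c\<in>UNIV. h a b c (t z) * frechet_derivative (g a b c) (at z) v
        + frechet_derivative (h a b c) (at (t z)) (J z *v v) * g a b c z)) (at z)"
    by (intro has_derivative_sum has_derivative_mult dht dg)
  have "frechet_derivative (\<lambda>z. \<eta> (t z) (map ((*v) (J z)) [p, q, r])) (at z)
     = frechet_derivative (\<lambda>z. \<Sum>a\<in>UNIV. \<Sum>b\<in>UNIV. \<Sum>c\<in>UNIV. h a b c (t z) * g a b c z) (at z)"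
    by (rule frechet_derivative_cong[OF V z]) (use V'(2) in \<open>auto simp: expd g_def\<close>)
  then have 1: "frechet_derivative (\<lambda>z. \<eta> (t z) (map ((*v) (J z)) [p, q, r])) (at z) v
     = (\<Sum>a\<in>UNIV. \<Sum>b\<in>UNIV. \<Sum>c\<in>UNIV. h a b c (t z) * frechet_derivative (g a b c) (at z) v)
     + (\<Sum>a\<in>UNIV. \<Sum>b\<in>UNIV. \<Sum>c\<in>UNIV. frechet_derivative (h a b c) (at (t z)) (J z *v v) * g a b c z)"
    using frechet_derivative_eqI[OF L] by (simp only: sum.distrib)
  have tz: "t z \<in> V'" using z V'(2) by blast
  have 2: "(\<Sum>a\<in>UNIV. \<Sum>b\<in>UNIV. \<Sum>c\<in>UNIV. h a b c (t z) * frechet_derivative (g a b c) (at z) v)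
     = \<eta> (t z) [H p, J z *v q, J z *v r] + \<eta> (t z) [J z *v p, H q, J z *v r] + \<eta> (t z) [J z *v p, J z *v q, H r]"
    unfolding gv expd[OF tz] by (simp only: distrib_left sum.distrib)
  have 3: "(\<Sum>a\<in>UNIV. \<Sum>b\<in>UNIV. \<Sum>c\<in>UNIV. frechet_derivative (h a b c) (at (t z)) (J z *v v) * g a b c z)
     = frechet_derivative (\<lambda>y. \<eta> y (map ((*v) (J z)) [p, q, r])) (at (t z)) (J z *v v)"
  proof -
    have "((\<lambda>y. \<Sum>a\<in>UNIV. \<Sum>b\<in>UNIV. \<Sum>c\<in>UNIV. h a b c y * g a b c z) has_derivative
       (\<lambda>v. \<Sum>a\<in>UNIV. \<Sum>b\<in>UNIV. \<Sum>c\<in>UNIV. frechet_derivative (h a b c) (at (t z)) v * g a b c z)) (at (t z))"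
      by (intro has_derivative_sum has_derivative_mult_left dh)
    moreover have "frechet_derivative (\<lambda>y. \<eta> y (map ((*v) (J z)) [p, q, r])) (at (t z))
       = frechet_derivative (\<lambda>y. \<Sum>a\<in>UNIV. \<Sum>b\<in>UNIV. \<Sum>c\<in>UNIV. h a b c y * g a b c z) (at (t z))"
      by (rule frechet_derivative_cong[OF V'(1) tz]) (simp add: expd g_def)
    ultimately show ?thesis by (simp only: frechet_derivative_eqI)
  qed
  show ?thesis unfolding 1 2 3 H_def by simp
qed

text \<open>The second derivatives of the coordinate change enter only through \<open>H\<close>,
  which is symmetric in its arguments by \<open>sym\<close>, and so cancel in the alternating
  sum.\<close>

lemma euclidean_d_pullback_3form:
  fixes t :: "real ^ 'n::finite \<Rightarrow> real ^ 'n" and J :: "real ^ 'n \<Rightarrow> real ^ 'n ^ 'n"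
  assumes V: "open V" and J: "smoothM V J" and z: "z \<in> V" and t: "(t has_derivative (*v) (J z)) (at z)"
    and V': "open V'" "t ` V \<subseteq> V'" and \<eta>: "\<And>y. y \<in> V' \<Longrightarrow> altf 3 (\<eta> y)"
    and d\<eta>: "\<And>ws. length ws = 3 \<Longrightarrow> (\<lambda>y. \<eta> y ws) differentiable (at (t z))"
    and sym: "\<And>m i j. pdm m J z $ i $ j = pdm j J z $ i $ m"
  shows "euclidean_d (\<lambda>z ws. \<eta> (t z) (map ((*v) (J z)) ws)) z [p, q, r, s]
    = euclidean_d \<eta> (t z) (map ((*v) (J z)) [p, q, r, s])"
proof -
  define H where "H v w = (\<Sum>m\<in>UNIV. v $ m *\<^sub>R (pdm m J z *v w))" for v w
  have Hs: "H w v = H v w" for v w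
  proof -
    have "H w v $ i = (\<Sum>m\<in>UNIV. \<Sum>j\<in>UNIV. w $ m * (pdm m J z $ i $ j * v $ j))" for v w i
      by (simp add: H_def matrix_vector_mult_def sum_distrib_left)
    then have e: "H w v $ i = (\<Sum>m\<in>UNIV. \<Sum>j\<in>UNIV. w $ m * (pdm m J z $ i $ j * v $ j))" for v w i by blast
    have "H w v $ i = H v w $ i" for i
      unfolding e by (subst sum.swap, intro sum.cong refl) (subst sym, simp)
    then show ?thesis by (simp add: vec_eq_iff)
  qed
  have altz: "altf 3 (\<eta> (t z))" using \<eta> V'(2) z by blast
  note pd = pullback_3form_derivative[OF V J z t V' altf_multilin[OF \<eta>] d\<eta>, folded H_def]
  note sw = alt3_swap[OF altz]
  define a b c d where "a = J z *v p" and "b = J z *v q" and "c = J z *v r" and "d = J z *v s"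
  have k: "\<eta> (t z) [H p r, b, d] = - \<eta> (t z) [b, H p r, d]" "\<eta> (t z) [H p s, b, c] = \<eta> (t z) [b, c, H p s]"
    "\<eta> (t z) [a, H q s, c] = - \<eta> (t z) [a, c, H q s]"
    using sw(1)[of b "H p r" d] sw(1)[of b "H p s" c] sw(2)[of b c "H p s"] sw(2)[of a c "H q s"] by linarith+
  let ?D = "\<lambda>w x y v. frechet_derivative (\<lambda>y'. \<eta> y' [w, x, y]) (at (t z)) v"
  have "euclidean_d (\<lambda>z ws. \<eta> (t z) (map ((*v) (J z)) ws)) z [p, q, r, s]
    = (?D b c d a + (\<eta> (t z) [H p q, c, d] + \<eta> (t z) [b, H p r, d] + \<eta> (t z) [b, c, H p s]))
    - (?D a c d b + (\<eta> (t z) [H q p, c, d] + \<eta> (t z) [a, H q r, d] + \<eta> (t z) [a, c, H q s]))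
    + (?D a b d c + (\<eta> (t z) [H r p, b, d] + \<eta> (t z) [a, H r q, d] + \<eta> (t z) [a, b, H r s]))
    - (?D a b c d + (\<eta> (t z) [H s p, b, c] + \<eta> (t z) [a, H s q, c] + \<eta> (t z) [a, b, H s r]))"
    unfolding euclidean_d_def using pd[of q r s p] pd[of p r s q] pd[of p q s r] pd[of p q r s]
    by (simp add: eval_nat_numeral a_def b_def c_def d_def)
  also have "\<dots> = ?D b c d a - ?D a c d b + ?D a b d c - ?D a b c d"
    unfolding Hs[of q p] Hs[of r p] Hs[of s p] Hs[of r q] Hs[of s q] Hs[of s r] k by simp
  also have "\<dots> = euclidean_d \<eta> (t z) (map ((*v) (J z)) [p, q, r, s])"
    unfolding euclidean_d_def by (simp add: eval_nat_numeral a_def b_def c_def d_def)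
  finally show ?thesis .
qed

context smooth_mfd
begin

text \<open>At \<open>q\<close> the exterior derivative is evaluated in the chart picked for
  \<open>q\<close>. This allows d\<sigma> to be computed in one fixed chart at all points near a
  given one.\<close>

lemma ext_deriv_3form_chart:
  assumes \<omega>: "\<omega> \<in> Omega M A 3" and c: "c \<in> charts_at A q" and vs: "length vs = 4" "set vs \<subseteq> tangent_space A q"
  shows "ext_deriv A \<omega> q vs = euclidean_d (local_rep A c \<omega>) (snd c q) (map (\<lambda>v. v c) vs)"
proof -
  have cA: "c \<in> A" "q \<in> fst c" using c by (auto simp: charts_at_def)
  define c' where "c' = chart_at A q"
  have c': "c' \<in> charts_at A q" unfolding c'_def by (rule chart_at[OF chart_topspace[OF cA]])
  have c'A: "c' \<in> A" "q \<in> fst c'" using c' by (auto simp: charts_at_def)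
  define V where "V = snd c ` (fst c \<inter> fst c')"
  define t where "t = transition c c'"
  define J where "J z = matrix (frechet_derivative t (at z))" for z
  have V: "open V" unfolding V_def by (rule open_overlap2[OF cA(1) c'A(1)])
  have ts: "smooth_on V t" unfolding V_def t_def by (rule chart_smooth[OF cA(1) c'A(1)])
  define z where "z = snd c q"
  have z: "z \<in> V" using cA c'A by (auto simp: V_def z_def)
  have tz: "t z = snd c' q" by (simp add: t_def z_def transition_snd cA)
  have tc: "smooth_on V (\<lambda>y. t y $ i)" for i
    by (rule smooth_on_bounded_linear[OF V bounded_linear_vec_nth ts])
  have Jc: "J y $ i $ j = frechet_derivative (\<lambda>y. t y $ i) (at y) (ax j)" if "y \<in> V" for y i j
    using frechet_derivative_eqI[OF bounded_linear.has_derivative[OF bounded_linear_vec_nth smooth_on_has_derivative[OF ts that]], of i]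
    by (simp add: J_def matrix_def)
  have Jp: "J y $ i $ j = pderiv_at j (\<lambda>y. t y $ i) y" if "y \<in> V" for y i j
    using Jc[OF that] by (simp add: pderiv_at_def)
  have J: "smoothM V J" unfolding smoothM_def
    using smooth_on_congI[OF V smooth_on_pderiv[OF tc] Jp] by blast
  have Jlin: "(*v) (J y) = frechet_derivative t (at y)" if "y \<in> V" for y
    unfolding J_def by (rule matrix_vector_mul(2)[OF has_derivative_linear[OF smooth_on_has_derivative[OF ts that]]])
  have dt: "(t has_derivative (*v) (J z)) (at z)"
    unfolding Jlin[OF z] by (rule smooth_on_has_derivative[OF ts z])
  have sym: "pdm m J z $ i $ j = pdm j J z $ i $ m" for m i j
  proof -
    have "pdm m J z $ i $ j = pderiv_at m (pderiv_at j (\<lambda>y. t y $ i)) z" for m j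
      unfolding pdm_nth by (rule pderiv_cong[OF V z]) (rule Jp)
    then show ?thesis using pderiv_symmetric[OF V tc z] by simp
  qed
  have V': "open (img c')" by (rule open_img[OF c'A(1)])
  have tV: "t ` V \<subseteq> img c'" by (auto simp: V_def t_def transition_snd cA)
  have rep: "local_rep A c \<omega> y ws = local_rep A c' \<omega> (t y) (map ((*v) (J y)) ws)" if yV: "y \<in> V" for y ws
  proof -
    obtain q' where q': "q' \<in> fst c" "q' \<in> fst c'" "y = snd c q'" using yV by (auto simp: V_def)
    have i: "chart_inv c y = q'" "chart_inv c' (t y) = q'"
      using q' cA c'A by (simp_all add: t_def transition_snd chart_inv_left)
    have Jl: "J y *v w = Dt c c' q' w" for w
      unfolding Jlin[OF yV] by (simp only: Dt_def t_def q'(3))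
    have "tvec_of A c q' = (\<lambda>w. tvec_of A c' q' (J y *v w))"
      unfolding Jl by (rule ext, rule tvec_of_change) (use q' cA(1) c'A(1) in \<open>simp_all add: charts_at_def\<close>)
    then show ?thesis by (simp only: local_rep_def i pullback_def list.map_comp comp_def)
  qed
  have len: "length (map (\<lambda>v. v c) vs) = 4" using vs by simp
  then obtain p1 p2 p3 p4 where ps: "map (\<lambda>v. v c) vs = [p1, p2, p3, p4]"
    by (auto simp: length_Suc_conv eval_nat_numeral)
  have cong: "euclidean_d (local_rep A c \<omega>) z ws = euclidean_d (\<lambda>y ws. local_rep A c' \<omega> (t y) (map ((*v) (J y)) ws)) z ws" for ws
    unfolding euclidean_d_def
    by (intro sum.cong refl arg_cong2[where f = "(*)"] fun_cong[OF frechet_derivative_cong[OF V z rep]])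
  have diff: "(\<lambda>y. local_rep A c' \<omega> y ws) differentiable (at (t z))" if "length ws = 3" for ws
    using smooth_on_has_derivative[OF smooth_local_rep[OF \<omega> c'A(1) that]] tV z differentiableI by blast
  have "euclidean_d (local_rep A c \<omega>) z (map (\<lambda>v. v c) vs)
      = euclidean_d (local_rep A c' \<omega>) (t z) (map ((*v) (J z)) (map (\<lambda>v. v c) vs))"
    unfolding cong ps
    by (rule euclidean_d_pullback_3form[OF V J z dt V' tV altf_local_rep[OF \<omega> c'A(1)] diff sym])
  also have "map ((*v) (J z)) (map (\<lambda>v. v c) vs) = map (\<lambda>v. v c') vs"
  proof -
    have "J z *v v c = v c'" if "v \<in> tangent_space A q" for v
    proof -
      have "\<forall>c\<in>charts_at A q. \<forall>c'\<in>charts_at A q. v c' = frechet_derivative (transition c c') (at (snd c q)) (v c)"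
        using that unfolding tangent_space_def mem_Collect_eq by (rule conjunct2)
      from this[rule_format, OF c c'] show ?thesis unfolding Jlin[OF z] unfolding t_def z_def by (rule HOL.sym)
    qed
    then have "\<forall>v\<in>set vs. J z *v v c = v c'" using vs(2) by blast
    then show ?thesis by simp
  qed
  finally show ?thesis unfolding ext_deriv_def Let_def pullback_def c'_def[symmetric] tz z_def[symmetric] by simp
qed

end

section \<open>The volume form and the codifferential\<close>

lemma altf_cong: "altf k \<beta> \<Longrightarrow> (\<And>vs. length vs = k \<Longrightarrow> \<alpha> vs = \<beta> vs) \<Longrightarrow> altf k \<alpha>"
  by (simp add: altf_def multilin_def)

lemma sum_lists_1: "(\<Sum>is | length is = 1. f is) = (\<Sum>a\<in>UNIV. f [a])" for f :: "'n::finite list \<Rightarrow> 'b::comm_monoid_add"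
  by (simp only: One_nat_def sum_lists_Suc sum_lists_0)

lemma subseqs_7: "filter (\<lambda>is. length is = 7) (subseqs I7) = [I7]"
  by (simp add: Let_def)

lemma vol_ax_I7: "vol (map ax I7) = 1"
  using vol_ax[of I7] by simp

lemma altf7_eqI:
  assumes "altf 7 \<alpha>" "altf 7 \<beta>" "\<alpha> (map ax I7) = \<beta> (map ax I7)" "length vs = 7"
  shows "\<alpha> vs = \<beta> vs"
proof -
  have b: "\<forall>js\<in>set (filter (\<lambda>is. length is = 7) (subseqs I7)). \<alpha> (map ax js) = \<beta> (map ax js)"
    unfolding subseqs_7 using assms(3) by (simp only: list.set ball_simps simp_thms)
  show ?thesis
    by (rule altf_eqI_7[OF assms(1,2)]) (fact assms(4) b)+
qed

lemma det_rows: "det (\<chi> i. B *v ax i) = det B" for B :: "real ^ 7 ^ 7"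
proof -
  have "(\<chi> i. B *v ax i) = transpose B"
    by (simp add: vec_eq_iff transpose_def matrix_ax)
  then show ?thesis
    by (simp only: det_transpose)
qed

lemma vol_map: assumes "length vs = 7" shows "vol (map ((*v) B) vs) = det B * vol vs"
proof -
  have 1: "altf 7 (pullback ((*v) B) vol)"
    by (rule altf_pullback[OF _ altf_vol]) simp
  have 2: "altf 7 (\<lambda>vs. det B * vol vs)"
    by (rule altf_cmult[OF altf_vol])
  have a: "altf (length I7) vol"
    by (simp only: I7(3) altf_vol)
  have "vol (map (\<lambda>i. B *v ax i) I7) = det B * vol (map ax I7)"
    using top_form_det[OF a I7(1,2), of "\<lambda>i. B *v ax i"] by (simp only: det_rows)
  then have 3: "pullback ((*v) B) vol (map ax I7) = det B * vol (map ax I7)"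
    by (simp only: pullback_def list.map_comp comp_def)
  show ?thesis
    using altf7_eqI[OF 1 2 3 assms] by (simp only: pullback_def)
qed

text \<open>The contraction of \<open>vol\<close> with \<open>ax i\<close> lacks exactly the
  covector of index i, so wedging restores \<open>vol\<close> or gives zero. This pairing is what
  makes d produce a divergence.\<close>

lemma wedge_vol: assumes "length ws = 7"
  shows "wedge 1 6 (lform (ax m)) (\<lambda>us. vol (ax i # us)) ws = (if i = m then 1 else 0) * vol ws"
proof -
  have v: "altf (Suc 6) vol"
    using altf_vol by simp
  have v6: "altf 6 (\<lambda>us. vol (ax i # us))"
    by (rule altf_tail[OF v])
  have 1: "altf 7 (wedge 1 6 (lform (ax m)) (\<lambda>us. vol (ax i # us)))"
    using altf_wedge[OF altf_lform v6, of "ax m"] by simp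
  have 2: "altf 7 (\<lambda>ws. (if i = m then 1 else 0) * vol ws)"
    by (rule altf_cmult[OF altf_vol])
  have vx: "vol (ax i # map ax js) = epsl (i # js) I7" if "length js = 6" for js
    using vol_ax[of "i # js"] that by simp
  have l: "lform (ax m) [ax j] = (if j = m then 1 else 0)" for j
    by (auto simp: lform_def ax_inner)
  have "wedge 1 6 (lform (ax m)) (\<lambda>us. vol (ax i # us)) (map ax I7)
      = (\<Sum>j<Suc 6. (-1) ^ j * lform (ax m) [map ax I7 ! j] * vol (ax i # (take j (map ax I7) @ drop (Suc j) (map ax I7))))"
    by (rule wedge_1_left[OF altf_lform v6]) simp
  also have "\<dots> = (\<Sum>j<Suc 6. (-1) ^ j * (if I7 ! j = m then 1 else 0) * epsl (i # (take j I7 @ drop (Suc j) I7)) I7)"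
    by (intro sum.cong refl) (simp only: take_map drop_map map_append[symmetric] nth_map I7(3) lessThan_iff l, subst vx, simp, simp add: l)
  also have "\<dots> = (if i = m then 1 else 0)"
    using exhaust_7[of i] by (elim disjE) (simp_all add: eval_nat_numeral)
  finally have 3: "wedge 1 6 (lform (ax m)) (\<lambda>us. vol (ax i # us)) (map ax I7) = (if i = m then 1 else 0) * vol (map ax I7)"
    by (simp only: vol_ax_I7 mult_1_right)
  show ?thesis
    by (rule altf7_eqI[OF 1 2 3 assms])
qed

text \<open>Expanding \<open>Y\<close> in the basis leaves the wedge of dY^i with the contraction of
  \<open>vol\<close> by \<open>ax i\<close>, and \<open>wedge_vol\<close> keeps the derivative of
  Y^i in direction i.\<close>

lemma euclidean_d_vol:
  assumes V: "open V" and Y: "smoothV V Y" and y: "y \<in> V" and ws: "length ws = 7"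
  shows "euclidean_d (\<lambda>z ws. vol (Y z # ws)) y ws = (\<Sum>m\<in>UNIV. pderiv_at m (\<lambda>z. Y z $ m) y) * vol ws"
proof -
  have v: "multilin (Suc 6) vol"
    using altf_multilin[OF altf_vol] by simp
  have ex: "vol (x # us) = (\<Sum>i\<in>UNIV. vol (ax i # us) * x $ i)" if "length us = 6" for x us
    using multilin_head_sum[OF v that, of "\<lambda>i. x $ i" ax UNIV] unfolding vec_ax_sum[of x, symmetric] by (simp only: mult.commute)
  have d: "frechet_derivative (\<lambda>z. vol (Y z # us)) (at y) v = (\<Sum>i\<in>UNIV. \<Sum>m\<in>UNIV. pderiv_at m (\<lambda>z. Y z $ i) y * (v $ m * vol (ax i # us)))"
    if us: "length us = 6" for us v
  proof -
    have h: "((\<lambda>z. Y z $ i) has_derivative frechet_derivative (\<lambda>z. Y z $ i) (at y)) (at y)" for i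
      by (rule smooth_on_has_derivative[OF smoothVD[OF Y] y])
    have "((\<lambda>z. \<Sum>i\<in>UNIV. vol (ax i # us) * Y z $ i) has_derivative (\<lambda>v. \<Sum>i\<in>UNIV. vol (ax i # us) * frechet_derivative (\<lambda>z. Y z $ i) (at y) v)) (at y)"
      by (intro has_derivative_sum has_derivative_mult_right h)
    then have D1: "frechet_derivative (\<lambda>z. \<Sum>i\<in>UNIV. vol (ax i # us) * Y z $ i) (at y) v = (\<Sum>i\<in>UNIV. vol (ax i # us) * frechet_derivative (\<lambda>z. Y z $ i) (at y) v)"
      by (simp only: frechet_derivative_eqI)
    have D2: "frechet_derivative (\<lambda>z. Y z $ i) (at y) v = (\<Sum>m\<in>UNIV. v $ m * pderiv_at m (\<lambda>z. Y z $ i) y)" for i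
      by (rule frechet_pderiv[OF differentiableI[OF h]])
    have eq: "(\<lambda>z. vol (Y z # us)) = (\<lambda>z. \<Sum>i\<in>UNIV. vol (ax i # us) * Y z $ i)"
      by (rule ext) (rule ex[OF us])
    show ?thesis
      unfolding eq D1 D2 sum_distrib_left by (intro sum.cong refl) (simp only: mult_ac)
  qed
  have "euclidean_d (\<lambda>z ws. vol (Y z # ws)) y ws
      = (\<Sum>j<Suc 6. (-1) ^ j * (\<Sum>i\<in>UNIV. \<Sum>m\<in>UNIV. pderiv_at m (\<lambda>z. Y z $ i) y * (ws ! j $ m * vol (ax i # (take j ws @ drop (Suc j) ws)))))"
    unfolding euclidean_d_def using ws by (intro sum.cong) (simp_all add: d)
  also have "\<dots> = (\<Sum>j<Suc 6. \<Sum>i\<in>UNIV. \<Sum>m\<in>UNIV. pderiv_at m (\<lambda>z. Y z $ i) y * ((-1) ^ j * lform (ax m) [ws ! j] * vol (ax i # (take j ws @ drop (Suc j) ws))))"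
    unfolding sum_distrib_left by (intro sum.cong refl) (simp add: lform_def inner_axis' algebra_simps)
  also have "\<dots> = (\<Sum>i\<in>UNIV. \<Sum>m\<in>UNIV. \<Sum>j<Suc 6. pderiv_at m (\<lambda>z. Y z $ i) y * ((-1) ^ j * lform (ax m) [ws ! j] * vol (ax i # (take j ws @ drop (Suc j) ws))))"
    by (subst sum.swap) (intro sum.cong refl sum.swap)
  also have "\<dots> = (\<Sum>i\<in>UNIV. \<Sum>m\<in>UNIV. pderiv_at m (\<lambda>z. Y z $ i) y * ((if i = m then 1 else 0) * vol ws))"
  proof (intro sum.cong refl)
    fix i m :: 7
    have v6: "altf 6 (\<lambda>us. vol (ax i # us))"
      by (rule altf_tail) (use altf_vol in simp)
    have s7: "length ws = Suc 6"
      using ws by simp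
    have w1: "wedge 1 6 (lform (ax m)) (\<lambda>us. vol (ax i # us)) ws = (\<Sum>j<Suc 6. (-1) ^ j * lform (ax m) [ws ! j] * vol (ax i # (take j ws @ drop (Suc j) ws)))"
      by (rule wedge_1_left[OF altf_lform v6 s7])
    show "(\<Sum>j<Suc 6. pderiv_at m (\<lambda>z. Y z $ i) y * ((-1) ^ j * lform (ax m) [ws ! j] * vol (ax i # (take j ws @ drop (Suc j) ws)))) = pderiv_at m (\<lambda>z. Y z $ i) y * ((if i = m then 1 else 0) * vol ws)"
      by (simp only: sum_distrib_left[symmetric] w1[symmetric] wedge_vol[OF ws])
  qed
  also have "\<dots> = (\<Sum>i\<in>UNIV. \<Sum>m\<in>UNIV. if i = m then pderiv_at i (\<lambda>z. Y z $ i) y * vol ws else 0)"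
    by (intro sum.cong refl) auto
  also have "\<dots> = (\<Sum>m\<in>UNIV. pderiv_at m (\<lambda>z. Y z $ m) y) * vol ws"
    by (simp add: sum_distrib_right)
  finally show ?thesis .
qed

lemma euclidean_d_cong:
  assumes "open V" "y \<in> V" "\<And>z us. z \<in> V \<Longrightarrow> Suc (length us) = length ws \<Longrightarrow> \<eta> z us = \<zeta> z us"
  shows "euclidean_d \<eta> y ws = euclidean_d \<zeta> y ws"
  unfolding euclidean_d_def
proof (intro sum.cong refl arg_cong2[where f = "(*)"])
  fix j assume j: "j \<in> {..<length ws}"
  then have l: "Suc (length (take j ws @ drop (Suc j) ws)) = length ws"
    by simp
  show "frechet_derivative (\<lambda>z. \<eta> z (take j ws @ drop (Suc j) ws)) (at y) (ws ! j) = frechet_derivative (\<lambda>z. \<zeta> z (take j ws @ drop (Suc j) ws)) (at y) (ws ! j)"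
    by (rule fun_cong[OF frechet_derivative_cong[OF assms(1,2)]]) (rule assms(3)[OF _ l])
qed

section \<open>\<open>G\<^sub>2\<close>-structures in charts\<close>

locale g2_structure = smooth_mfd M A for M :: "'m topology" and A :: "('m, 7) chart set" +
  fixes \<sigma> :: "('m, 7) form"
  assumes definite: "\<sigma> \<in> definite_forms M A"
begin

lemma sigma_Omega: "\<sigma> \<in> Omega M A 3"
  using definite unfolding definite_forms_def by blast

lemma coframe_at: assumes "q \<in> topspace M" shows "g2_coframe A \<sigma> q (g2_coframe_at A \<sigma> q)"
proof -
  have "\<exists>u. g2_coframe A \<sigma> q u"
    using definite assms unfolding definite_forms_def by blast
  then show ?thesis
    unfolding g2_coframe_at_def by (rule someI_ex)
qed

text \<open>The coframe underlying \<open>g2_metric\<close> and \<open>g2_volume\<close>, in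
  coordinates. It is an arbitrary choice at each point.\<close>

definition uc where "uc c y = (\<lambda>w. g2_coframe_at A \<sigma> (chart_inv c y) (tvec_of A c (chart_inv c y) w))"

lemma pulls_back_uc: assumes c: "c \<in> A" and y: "y \<in> img c" shows "pulls_back (local_rep A c \<sigma> y) (uc c y)"
proof -
  define q where "q = chart_inv c y"
  have cq: "c \<in> charts_at A q"
    unfolding q_def by (rule chart_inv_charts_at[OF c y])
  have q: "q \<in> topspace M"
    using chart_topspace[of c q] cq by (simp add: charts_at_def)
  define u where "u = g2_coframe_at A \<sigma> q"
  have iso: "tangent_iso A q u" and ph: "\<And>vs. length vs = 3 \<Longrightarrow> set vs \<subseteq> tangent_space A q \<Longrightarrow> pullback u phi vs = \<sigma> q vs"
    using coframe_at[OF q] unfolding g2_coframe_def u_def by blast+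
  have uw: "uc c y w = u (tvec_of A c q w)" for w
    by (simp only: uc_def u_def q_def)
  have lin: "uc c y (a *\<^sub>R v + b *\<^sub>R w) = a *\<^sub>R uc c y v + b *\<^sub>R uc c y w" for a b v w
    using iso tvec_of_in[OF cq, of v] tvec_of_in[OF cq, of w] unfolding uw tvec_of_linear[OF cq] tangent_iso_def by blast
  have "linear (uc c y)"
    using lin[of 1 _ 1 _] lin[of _ _ 0 0] by (intro linearI) simp_all
  moreover have "inj (uc c y)"
  proof (rule injI)
    fix v w assume "uc c y v = uc c y w"
    then have e: "u (tvec_of A c q v) = u (tvec_of A c q w)"
      by (simp only: uw)
    have i: "inj_on u (tangent_space A q)"
      using iso unfolding tangent_iso_def bij_betw_def by blast
    have "tvec_of A c q v = tvec_of A c q w"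
      by (rule inj_onD[OF i e tvec_of_in[OF cq] tvec_of_in[OF cq]])
    then show "v = w"
      using tvec_of_coord[OF cq] by metis
  qed
  moreover have "local_rep A c \<sigma> y vs = phi (map (uc c y) vs)" if l: "length vs = 3" for vs
  proof -
    have "set (map (tvec_of A c q) vs) \<subseteq> tangent_space A q"
      using tvec_of_in[OF cq] by auto
    then have "pullback u phi (map (tvec_of A c q) vs) = \<sigma> q (map (tvec_of A c q) vs)"
      using ph l by (simp only: length_map)
    moreover have "uc c y = (\<lambda>w. u (tvec_of A c q w))"
      by (rule ext) (rule uw)
    ultimately show ?thesis
      by (simp only: local_rep_def pullback_def q_def[symmetric] list.map_comp comp_def)
  qed
  ultimately show ?thesis
    unfolding pulls_back_def by blast
qed

lemma definite_field_chart: "c \<in> A \<Longrightarrow> definite_field (img c) (local_rep A c \<sigma>) (uc c)"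
  by (rule definite_field.intro[OF open_img smooth_local_rep[OF sigma_Omega] pulls_back_uc])

lemma metric_sym: "g2_metric A \<sigma> q v w = g2_metric A \<sigma> q w v"
  by (simp only: g2_metric_def inner_commute)

lemma metric_uc: "g2_metric A \<sigma> (chart_inv c y) (tvec_of A c (chart_inv c y) v) (tvec_of A c (chart_inv c y) w) = uc c y v \<bullet> uc c y w"
  by (simp only: g2_metric_def uc_def)

end

section \<open>Metric, star and norms in a smooth coframe\<close>

locale g2_chart = g2_structure M A \<sigma> for M :: "'m topology" and A :: "('m, 7) chart set" and \<sigma> :: "('m, 7) form" +
  fixes c :: "('m, 7) chart" and W :: "(real ^ 7) set" and E :: "real ^ 7 \<Rightarrow> real ^ 7 ^ 7"
  assumes cA: "c \<in> A" and oW: "open W" and Wc: "W \<subseteq> img c" and sE: "smoothM W E"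
    and pbE: "\<And>y. y \<in> W \<Longrightarrow> pulls_back (local_rep A c \<sigma> y) ((*v) (E y))"
begin

abbreviation P where "P \<equiv> chart_inv c"
abbreviation GG where "GG \<equiv> metric_matrix A (g2_metric A \<sigma>) c"

lemma W_img: "y \<in> W \<Longrightarrow> y \<in> img c"
  using Wc by blast

lemma P_chart: "y \<in> W \<Longrightarrow> c \<in> charts_at A (P y)"
  by (rule chart_inv_charts_at[OF cA W_img])

lemma P_top: "y \<in> W \<Longrightarrow> P y \<in> topspace M"
  using P_chart[of y] chart_topspace[of c "P y"] by (simp add: charts_at_def)

text \<open>Both coframes pull \<open>phi\<close> back to the same form, and \<open>inner_of\<close>
  reads the metric off that form; \<open>det_uc\<close> argues in the same way with
  \<open>det_of\<close>.\<close>

lemma inner_uc: assumes "y \<in> W" shows "uc c y v \<bullet> uc c y w = (E y *v v) \<bullet> (E y *v w)"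
  using inner_of[OF pulls_back_uc[OF cA W_img[OF assms]]] inner_of[OF pbE[OF assms]] by metis

lemma det_uc: assumes "y \<in> W" shows "det (matrix (uc c y)) = det (E y)" and "det (E y) \<noteq> 0"
proof -
  have l: "linear (uc c y)"
    using pulls_back_uc[OF cA W_img[OF assms]] unfolding pulls_back_def by blast
  have 1: "det_of (local_rep A c \<sigma> y) = det (matrix (uc c y))"
    using det_of(1)[OF pulls_back_uc[OF cA W_img[OF assms]]] unfolding rows_linear[OF l] by (simp only: det_transpose)
  have 2: "det_of (local_rep A c \<sigma> y) = det (E y)"
    using det_of(1)[OF pbE[OF assms]] by (simp only: det_rows)
  show "det (matrix (uc c y)) = det (E y)"
    using 1 2 by simp
  show "det (E y) \<noteq> 0"
    using det_of(2)[OF pbE[OF assms]] 2 by simp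
qed

lemma GG_E: assumes "y \<in> W" shows "GG y = transpose (E y) ** E y"
proof -
  have "GG y $ i $ j = (E y *v ax i) \<bullet> (E y *v ax j)" for i j
    unfolding metric_matrix_def vec_lambda_beta metric_uc by (rule inner_uc[OF assms])
  then show ?thesis
    by (simp add: vec_eq_iff matrix_matrix_mult_def transpose_def inner_vec_def matrix_ax)
qed

lemma coframe_7: "coframe_field_7 W E GG"
proof (unfold_locales)
  show "open W"
    by (rule oW)
  show "smoothM W E"
    by (rule sE)
  show "invertible (E z)" if "z \<in> W" for z
    using det_uc(2)[OF that] by (simp only: invertible_det_nz not_False_eq_True)
  show "GG z = transpose (E z) ** E z" if "z \<in> W" for z
    by (rule GG_E[OF that])
  show "GG z $ i $ j = GG z $ j $ i" for z i j
    unfolding metric_matrix_def vec_lambda_beta by (rule metric_sym)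
qed

sublocale cf: coframe_field_7 W E GG
  by (rule coframe_7)

text \<open>The inverse of the coframe \<open>E\<close> as a map into the tangent space; it matches
  \<sigma>, its metric and its volume form with the standard ones.\<close>

definition T where "T y w = tvec_of A c (P y) (cf.F y *v w)"
definition rep where "rep \<omega> y = pullback (T y) (\<omega> (P y))"

lemma T_fun: "T y = (\<lambda>w. tvec_of A c (P y) (cf.F y *v w))"
  by (rule ext) (rule T_def)

lemma EF_v: "y \<in> W \<Longrightarrow> E y *v (cf.F y *v w) = w"
  by (simp only: matrix_vector_mul_assoc cf.EF matrix_vector_mul_lid)

lemma FE_v: "y \<in> W \<Longrightarrow> cf.F y *v (E y *v w) = w"
  by (simp only: matrix_vector_mul_assoc cf.FE matrix_vector_mul_lid)

lemma T_in: "y \<in> W \<Longrightarrow> T y w \<in> tangent_space A (P y)"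
  unfolding T_def by (rule tvec_of_in[OF P_chart])

lemma T_set: "y \<in> W \<Longrightarrow> set (map (T y) ws) \<subseteq> tangent_space A (P y)"
  using T_in[of y] by auto

lemma T_coord: "y \<in> W \<Longrightarrow> T y w c = cf.F y *v w"
  unfolding T_def by (rule tvec_of_coord[OF P_chart])

lemma rep_local: "rep \<omega> y vs = local_rep A c \<omega> y (map ((*v) (cf.F y)) vs)"
  by (simp add: rep_def pullback_def local_rep_def T_fun comp_def)

lemma local_rep_rep: assumes "y \<in> W" shows "local_rep A c \<omega> y ws = rep \<omega> y (map ((*v) (E y)) ws)"
  by (simp add: rep_local comp_def FE_v[OF assms])

lemma altf_rep: assumes "altf k (local_rep A c \<omega> y)" shows "altf k (rep \<omega> y)"
proof -
  have "rep \<omega> y = pullback ((*v) (cf.F y)) (local_rep A c \<omega> y)"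
    by (rule ext) (simp only: rep_local pullback_def)
  then show ?thesis
    using altf_pullback[OF _ assms, of "(*v) (cf.F y)"] by simp
qed

lemma altf_rep_Omega: "y \<in> W \<Longrightarrow> \<omega> \<in> Omega M A k \<Longrightarrow> altf k (rep \<omega> y)"
  by (rule altf_rep[OF altf_local_rep[OF _ cA W_img]])

lemma rep_sigma: assumes "y \<in> W" "length vs = 3" shows "rep \<sigma> y vs = phi vs"
proof -
  have "local_rep A c \<sigma> y (map ((*v) (cf.F y)) vs) = phi (map ((*v) (E y)) (map ((*v) (cf.F y)) vs))"
    using pbE[OF assms(1)] assms(2) unfolding pulls_back_def by (simp only: length_map)
  then show ?thesis
    by (simp add: rep_local comp_def EF_v[OF assms(1)])
qed

text \<open>The coframe that defines the volume form and the smooth one have the same determinant,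
  hence the same volume form.\<close>

lemma volume_T: assumes "y \<in> W" "length vs = 7" shows "g2_volume A \<sigma> (P y) (map (T y) vs) = vol vs"
proof -
  have l: "linear (uc c y)"
    using pulls_back_uc[OF cA W_img[OF assms(1)]] unfolding pulls_back_def by blast
  have m: "(*v) (matrix (uc c y)) = uc c y"
    by (rule matrix_vector_mul(2)[OF l])
  have "g2_volume A \<sigma> (P y) (map (T y) vs) = vol (map (uc c y) (map ((*v) (cf.F y)) vs))"
    by (simp add: g2_volume_def pullback_def vol_def T_def uc_def comp_def)
  also have "\<dots> = det (E y) * (det (cf.F y) * vol vs)"
    using vol_map[of "map ((*v) (cf.F y)) vs" "matrix (uc c y)"] vol_map[of vs "cf.F y"] assms(2) unfolding m det_uc(1)[OF assms(1)] by simp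
  also have "\<dots> = vol vs"
    using arg_cong[OF cf.EF[OF assms(1)], of det] unfolding det_mul by simp
  finally show ?thesis .
qed

text \<open>The frame picked by \<open>SOME\<close> differs from the image of the standard basis by
  a matrix with orthonormal rows. Its columns are then orthonormal too, which is the relation that
  \<open>contract_orth\<close> asks for.\<close>

lemma frame_at_T: assumes y: "y \<in> W"
  obtains w where "\<And>i. frame_at A (g2_metric A \<sigma>) (P y) i = T y (w i)"
    and "\<And>j k. (\<Sum>i\<in>UNIV. w i $ j * w i $ k) = (if j = k then 1 else 0)"
proof -
  let ?g = "g2_metric A \<sigma>"
  have gT: "?g (P y) (T y v) (T y w) = v \<bullet> w" for v w
    unfolding T_def metric_uc inner_uc[OF y] EF_v[OF y] ..
  have "orthonormal_frame A ?g (P y) (\<lambda>i. T y (ax i))"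
    unfolding orthonormal_frame_def gT ax_inner using T_in[OF y] by simp
  then have onf: "orthonormal_frame A ?g (P y) (frame_at A ?g (P y))"
    unfolding frame_at_def by (rule someI[of "\<lambda>e. orthonormal_frame A ?g (P y) e"])
  define w where "w i = E y *v (frame_at A ?g (P y) i c)" for i
  have fi: "frame_at A ?g (P y) i \<in> tangent_space A (P y)" for i
    using onf unfolding orthonormal_frame_def by blast
  have fw: "frame_at A ?g (P y) i = T y (w i)" for i
    unfolding T_def w_def FE_v[OF y] by (rule tvec_of_surj[OF P_chart[OF y] fi, symmetric])
  have ww: "w i \<bullet> w j = (if i = j then 1 else 0)" for i j
    using onf unfolding orthonormal_frame_def fw gT by blast
  define Q :: "real ^ 7 ^ 7" where "Q = (\<chi> i. w i)"
  have "Q ** transpose Q = mat 1"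
    using ww by (simp add: vec_eq_iff matrix_matrix_mult_def transpose_def mat_def Q_def inner_vec_def)
  then have "transpose Q ** Q = mat 1"
    by (simp only: matrix_left_right_inverse)
  then have "(transpose Q ** Q) $ j $ k = mat 1 $ j $ k" for j k
    by simp
  then have "(\<Sum>i\<in>UNIV. w i $ j * w i $ k) = (if j = k then 1 else 0)" for j k
    by (simp add: matrix_matrix_mult_def transpose_def mat_def Q_def)
  with fw show thesis
    by (rule that)
qed

lemma star_T:
  assumes y: "y \<in> W" and a: "altf k (local_rep A c \<omega> y)" and k: "k + length ws = 7"
  shows "g2_star A \<sigma> k \<omega> (P y) (map (T y) ws) = star k (rep \<omega> y) ws"
proof -
  obtain w where fw: "\<And>i. frame_at A (g2_metric A \<sigma>) (P y) i = T y (w i)"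
    and ww: "\<And>j k. (\<Sum>i\<in>UNIV. w i $ j * w i $ k) = (if j = k then 1 else 0)"
    using frame_at_T[OF y] by blast
  have mf: "map (frame_at A (g2_metric A \<sigma>) (P y)) is = map (T y) (map w is)" for "is"
    by (simp add: fw)
  have "altf (k + length ws) vol"
    using altf_vol by (simp only: k)
  then have v: "multilin k (\<lambda>vs. vol (vs @ ws))"
    by (rule altf_multilin[OF altf_append])
  have t: "\<omega> (P y) (map (T y) (map w is)) * g2_volume A \<sigma> (P y) (map (T y) (map w is) @ map (T y) ws) = rep \<omega> y (map w is) * vol (map w is @ ws)" if l: "length is = k" for "is"
    using volume_T[OF y, of "map w is @ ws"] l k by (simp add: rep_def pullback_def)
  have "g2_star A \<sigma> k \<omega> (P y) (map (T y) ws) = (\<Sum>is | length is = k. rep \<omega> y (map w is) * vol (map w is @ ws)) / fact k"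
    unfolding g2_star_def hodge_star_def mf using t by (intro arg_cong2[where f = "(/)"] sum.cong refl) simp
  also have "(\<Sum>is | length is = k. rep \<omega> y (map w is) * vol (map w is @ ws)) = (\<Sum>is | length is = k. rep \<omega> y (map ax is) * vol (map ax is @ ws))"
    by (rule contract_orth[where e = w and f = ax and Q = "\<lambda>i j. w i $ j" and \<alpha> = "rep \<omega> y" and \<beta> = "\<lambda>vs. vol (vs @ ws)", OF vec_ax_sum ww altf_multilin[OF altf_rep[OF a]] v])
  finally show ?thesis
    by (simp only: star_def)
qed

lemma norm_T:
  assumes y: "y \<in> W" and a: "altf k (local_rep A c \<omega> y)"
  shows "(form_norm A (g2_metric A \<sigma>) k \<omega> (P y))\<^sup>2 = (\<Sum>is | length is = k. (rep \<omega> y (map ax is))\<^sup>2) / fact k"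
proof -
  obtain w where fw: "\<And>i. frame_at A (g2_metric A \<sigma>) (P y) i = T y (w i)"
    and ww: "\<And>j k. (\<Sum>i\<in>UNIV. w i $ j * w i $ k) = (if j = k then 1 else 0)"
    using frame_at_T[OF y] by blast
  have ff: "frame_at A (g2_metric A \<sigma>) (P y) = (\<lambda>i. T y (w i))"
    by (rule ext) (rule fw)
  have mf: "\<omega> (P y) (map (frame_at A (g2_metric A \<sigma>) (P y)) is) = rep \<omega> y (map w is)" for "is"
    by (simp add: ff rep_def pullback_def comp_def)
  have n: "0 \<le> (\<Sum>is | length is = k. (rep \<omega> y (map w is))\<^sup>2) / fact k"
    by (intro divide_nonneg_nonneg sum_nonneg) simp_all
  have m: "multilin k (rep \<omega> y)"
    by (rule altf_multilin[OF altf_rep[OF a]])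
  have ce: "(\<Sum>is | length is = k. rep \<omega> y (map w is) * rep \<omega> y (map w is)) = (\<Sum>is | length is = k. rep \<omega> y (map ax is) * rep \<omega> y (map ax is))"
    by (rule contract_orth[where e = w and f = ax and Q = "\<lambda>i j. w i $ j" and \<alpha> = "rep \<omega> y" and \<beta> = "rep \<omega> y", OF vec_ax_sum ww m m])
  show ?thesis
    unfolding form_norm_def mf real_sqrt_pow2[OF n] unfolding power2_eq_square ce ..
qed

lemma wedge_T: "length vs = k + l \<Longrightarrow> wedge_form k l \<alpha> \<beta> (P y) (map (T y) vs) = wedge k l (rep \<alpha> y) (rep \<beta> y) vs"
  unfolding wedge_form_def rep_def by (rule wedge_pullback[symmetric])

lemma star_sigma: assumes "y \<in> W" shows "star 3 (rep \<sigma> y) ws = star 3 phi ws"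
  unfolding star_def using rep_sigma[OF assms] by (intro arg_cong2[where f = "(/)"] sum.cong refl) simp

lemma rep_star_sigma: assumes "y \<in> W" "length ws = 4" shows "rep (g2_star A \<sigma> 3 \<sigma>) y ws = star 3 phi ws"
proof -
  have "rep (g2_star A \<sigma> 3 \<sigma>) y ws = g2_star A \<sigma> 3 \<sigma> (P y) (map (T y) ws)"
    by (simp only: rep_def pullback_def)
  also have "\<dots> = star 3 (rep \<sigma> y) ws"
    by (rule star_T[OF assms(1) altf_local_rep[OF sigma_Omega cA W_img[OF assms(1)]]]) (simp add: assms)
  also have "\<dots> = star 3 phi ws"
    by (rule star_sigma[OF assms(1)])
  finally show ?thesis .
qed

text \<open>Valid throughout \<open>W\<close>, whichever chart \<open>ext_deriv\<close> uses at
  \<open>P y\<close>; this makes the first torsion equation usable on a neighbourhood.\<close>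

lemma d_sigma:
  assumes y: "y \<in> W" and l: "length is = 4"
  shows "ext_deriv A \<sigma> (P y) (map (T y) (map ax is)) = dphi (cf.th y) is"
proof -
  have s: "snd c (P y) = y"
    by (rule chart_inv_right[OF W_img[OF y]])
  have m: "map (\<lambda>v. v c) (map (T y) (map ax is)) = map (\<lambda>i. cf.F y *v ax i) is"
    by (simp add: T_coord[OF y])
  have l4: "length (map (T y) (map ax is)) = 4"
    by (simp add: l)
  obtain i j k n where ijkn: "is = [i, j, k, n]"
    using l by (auto simp: length_Suc_conv eval_nat_numeral)
  have "ext_deriv A \<sigma> (P y) (map (T y) (map ax is)) = euclidean_d (local_rep A c \<sigma>) y (map (\<lambda>i. cf.F y *v ax i) is)"
    using ext_deriv_3form_chart[OF sigma_Omega P_chart[OF y] l4 T_set[OF y]] unfolding s m .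
  also have "\<dots> = euclidean_d (\<lambda>z ws. phi (map ((*v) (E z)) ws)) y (map (\<lambda>i. cf.F y *v ax i) is)"
    by (rule euclidean_d_cong[OF oW y]) (use pbE l in \<open>simp add: pulls_back_def\<close>)
  also have "\<dots> = dphi (cf.th y) is"
    unfolding ijkn by (rule cf.d_phi_frame[OF y])
  finally show ?thesis .
qed

end

section \<open>The torsion equations and the codifferential in the coframe\<close>

locale g2_torsion = g2_chart M A \<sigma> c W E
  for M :: "'m topology" and A :: "('m, 7) chart set" and \<sigma> :: "('m, 7) form" and c W E +
  fixes \<tau>\<^sub>0 :: "'m \<Rightarrow> real" and \<tau>\<^sub>1 \<tau>\<^sub>2 \<tau>\<^sub>3 :: "('m, 7) form"
  assumes tors: "torsion_forms M A \<sigma> \<tau>\<^sub>0 \<tau>\<^sub>1 \<tau>\<^sub>2 \<tau>\<^sub>3"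
begin

lemma form_eq_T:
  assumes f: "form_eq M A k \<alpha> \<beta>" and y: "y \<in> W" and l: "length ws = k"
  shows "\<alpha> (P y) (map (T y) ws) = \<beta> (P y) (map (T y) ws)"
  using f[unfolded form_eq_def, rule_format, OF P_top[OF y], of "map (T y) ws"] T_set[OF y, of ws] l by simp

lemma t1: "\<tau>\<^sub>1 \<in> Omega M A 1" and t2: "\<tau>\<^sub>2 \<in> Omega M A 2" and t3: "\<tau>\<^sub>3 \<in> Omega M A 3"
  using tors unfolding torsion_forms_def Omega2_14_def Omega3_27_def by blast+

lemma t2_14: "form_eq M A 5 (wedge_form 2 3 \<tau>\<^sub>2 \<sigma>) (\<lambda>p vs. - g2_star A \<sigma> 2 \<tau>\<^sub>2 p vs)"
  using tors unfolding torsion_forms_def Omega2_14_def by blast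

lemma t3_7: "form_eq M A 6 (wedge_form 3 3 \<tau>\<^sub>3 \<sigma>) (\<lambda>p vs. 0)"
  using tors unfolding torsion_forms_def Omega3_27_def by blast

lemma t3_1: "form_eq M A 7 (wedge_form 3 4 \<tau>\<^sub>3 (g2_star A \<sigma> 3 \<sigma>)) (\<lambda>p vs. 0)"
  using tors unfolding torsion_forms_def Omega3_27_def by blast

lemma dsigma_eq: "form_eq M A 4 (ext_deriv A \<sigma>) (\<lambda>p vs. \<tau>\<^sub>0 p * g2_star A \<sigma> 3 \<sigma> p vs + 3 * wedge_form 1 3 \<tau>\<^sub>1 \<sigma> p vs + g2_star A \<sigma> 3 \<tau>\<^sub>3 p vs)"
  using tors unfolding torsion_forms_def by blast

lemma dpsi_eq: "form_eq M A 5 (ext_deriv A (g2_star A \<sigma> 3 \<sigma>)) (\<lambda>p vs. 4 * wedge_form 1 4 \<tau>\<^sub>1 (g2_star A \<sigma> 3 \<sigma>) p vs + wedge_form 2 3 \<tau>\<^sub>2 \<sigma> p vs)"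
  using tors unfolding torsion_forms_def by blast

lemma wedge_sigma: "y \<in> W \<Longrightarrow> wedge k 3 \<alpha> (rep \<sigma> y) vs = wedge k 3 \<alpha> phi vs"
  by (rule wedge_cong) (simp_all only: rep_sigma)

lemma wedge_star_sigma: "y \<in> W \<Longrightarrow> wedge k 4 \<alpha> (rep (g2_star A \<sigma> 3 \<sigma>) y) vs = wedge k 4 \<alpha> (star 3 phi) vs"
  by (rule wedge_cong) (simp_all only: rep_star_sigma)

lemma pointwise: assumes y: "y \<in> W" shows "pointwise_torsion (cf.th y) (\<tau>\<^sub>0 (P y)) (rep \<tau>\<^sub>1 y) (rep \<tau>\<^sub>3 y)"
proof (rule pointwise_torsion.intro)
  show "altf 1 (rep \<tau>\<^sub>1 y)"
    by (rule altf_rep_Omega[OF y t1])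
  show "altf 3 (rep \<tau>\<^sub>3 y)"
    by (rule altf_rep_Omega[OF y t3])
  fix "is" assume i: "is \<in> set (filter (\<lambda>is. length is = 4) (subseqs I7))"
  have l: "length is = 4"
    using i by (simp only: set_filter mem_Collect_eq)
  have l4: "length (map ax is :: (real ^ 7) list) = 4" and l13: "length (map ax is :: (real ^ 7) list) = 1 + 3" and l34: "3 + length (map ax is :: (real ^ 7) list) = 7"
    using l by simp_all
  have s1: "g2_star A \<sigma> 3 \<sigma> (P y) (map (T y) (map ax is)) = star 3 phi (map ax is)"
    using star_T[OF y altf_local_rep[OF sigma_Omega cA W_img[OF y]] l34] star_sigma[OF y] by (simp only:)
  have s2: "g2_star A \<sigma> 3 \<tau>\<^sub>3 (P y) (map (T y) (map ax is)) = star 3 (rep \<tau>\<^sub>3 y) (map ax is)"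
    by (rule star_T[OF y altf_local_rep[OF t3 cA W_img[OF y]] l34])
  have s3: "wedge_form 1 3 \<tau>\<^sub>1 \<sigma> (P y) (map (T y) (map ax is)) = wedge 1 3 (rep \<tau>\<^sub>1 y) phi (map ax is)"
    unfolding wedge_T[OF l13] by (rule wedge_sigma[OF y])
  show "dphi (cf.th y) is = \<tau>\<^sub>0 (P y) * star 3 phi (map ax is) + 3 * wedge 1 3 (rep \<tau>\<^sub>1 y) phi (map ax is) + star 3 (rep \<tau>\<^sub>3 y) (map ax is)"
    using form_eq_T[OF dsigma_eq y l4] unfolding d_sigma[OF y l] s1 s2 s3 .
next
  fix vs :: "(real ^ 7) list" assume "length vs = 6"
  then have l: "length vs = 6" and l2: "length vs = 3 + 3"
    by simp_all
  show "wedge 3 3 (rep \<tau>\<^sub>3 y) phi vs = 0"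
    using form_eq_T[OF t3_7 y l] unfolding wedge_T[OF l2] wedge_sigma[OF y] .
next
  fix vs :: "(real ^ 7) list" assume "length vs = 7"
  then have l: "length vs = 7" and l2: "length vs = 3 + 4"
    by simp_all
  show "wedge 3 4 (rep \<tau>\<^sub>3 y) (star 3 phi) vs = 0"
    using form_eq_T[OF t3_1 y l] unfolding wedge_T[OF l2] wedge_star_sigma[OF y] .
qed

lemma rep_t1: "y \<in> W \<Longrightarrow> rep \<tau>\<^sub>1 y [ax a] = - cf.tv y $ a / 12"
  using pointwise_torsion.T1_tvec[OF pointwise, of y a] by (simp add: cf.tv_def)

text \<open>Coordinates of the vector dual to \<open>\<tau>\<^sub>1\<close>, multiplied by the
  density \<open>det (E z)\<close>: contracting it with the coordinate volume form gives the star of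
  \<open>\<tau>\<^sub>1\<close>.\<close>

definition Y where "Y z = (\<chi> m. (- 1 / 12) * (det (E z) * (cf.F z *v cf.tv z) $ m))"

lemma smooth_dF: "smooth_on W (\<lambda>z. det (E z) * (cf.F z *v cf.tv z) $ m)"
  by (intro smooth_on_mult smooth_on_det oW smoothMD[OF sE] smoothVD[OF smoothV_mv[OF oW cf.smF cf.smtv]])

lemma smooth_Y: "smoothV W Y"
  unfolding smoothV_def Y_def by (simp only: vec_lambda_beta) (intro allI smooth_on_mult[OF oW smooth_on_const smooth_dF])

lemma local_star_t1:
  assumes y: "y \<in> W" and l: "length ws = 6"
  shows "local_rep A c (g2_star A \<sigma> 1 \<tau>\<^sub>1) y ws = vol (Y y # ws)"
proof -
  let ?us = "map ((*v) (E y)) ws"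
  have v: "multilin (Suc 6) vol"
    using altf_multilin[OF altf_vol] by simp
  have lu: "length ?us = 6" and k: "1 + length ?us = 7" and l7: "length ((cf.F y *v cf.tv y) # ws) = 7" and l7': "length (Y y # ws) = 7"
    using l by simp_all
  have "local_rep A c (g2_star A \<sigma> 1 \<tau>\<^sub>1) y ws = star 1 (rep \<tau>\<^sub>1 y) ?us"
    unfolding local_rep_rep[OF y] rep_def[of "g2_star A \<sigma> 1 \<tau>\<^sub>1"] pullback_def by (rule star_T[OF y altf_local_rep[OF t1 cA W_img[OF y]] k])
  also have "\<dots> = (\<Sum>a\<in>UNIV. rep \<tau>\<^sub>1 y [ax a] * vol (ax a # ?us))"
    by (simp only: star_def sum_lists_1 fact_1 div_by_1 list.map append.simps)
  also have "\<dots> = (\<Sum>a\<in>UNIV. (- 1 / 12 * cf.tv y $ a) * vol (ax a # ?us))"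
    by (intro sum.cong refl) (simp add: rep_t1[OF y])
  also have "\<dots> = - 1 / 12 * (\<Sum>a\<in>UNIV. cf.tv y $ a * vol (ax a # ?us))"
    unfolding sum_distrib_left by (simp only: mult.assoc)
  also have "(\<Sum>a\<in>UNIV. cf.tv y $ a * vol (ax a # ?us)) = vol (cf.tv y # ?us)"
    using multilin_head_sum[OF v lu, of "\<lambda>a. cf.tv y $ a" ax UNIV] unfolding vec_ax_sum[of "cf.tv y", symmetric] by simp
  also have "vol (cf.tv y # ?us) = vol (map ((*v) (E y)) ((cf.F y *v cf.tv y) # ws))"
    by (simp only: list.map EF_v[OF y])
  also have "\<dots> = det (E y) * vol ((cf.F y *v cf.tv y) # ws)"
    by (rule vol_map[OF l7])
  also have "- 1 / 12 * \<dots> = vol (Y y # ws)"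
  proof -
    have "Y y = (- 1 / 12 * det (E y)) *\<^sub>R (cf.F y *v cf.tv y)"
      by (simp add: vec_eq_iff Y_def)
    then show ?thesis
      using linear_scale[OF multilin_head[OF v l], of "- 1 / 12 * det (E y)" "cf.F y *v cf.tv y"] by simp
  qed
  finally show ?thesis .
qed

text \<open>The star of \<open>\<tau>\<^sub>1\<close> is known on all of \<open>W\<close>, so its
  derivative is the coordinate divergence of \<open>Y\<close>, computed by
  \<open>divergence_tv\<close>. The minus signs of \<open>codiff1\<close> and \<open>rep_t1\<close>
  cancel, and so do 12 and 1/12.\<close>

lemma codiff: assumes y: "y \<in> W" and c: "chart_at A (P y) = c"
  shows "12 * codiff1 A \<sigma> \<tau>\<^sub>1 (P y) = cf.divt y"
proof -
  define \<eta> where "\<eta> = ext_deriv A (g2_star A \<sigma> 1 \<tau>\<^sub>1)"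
  define r where "r = (\<Sum>m\<in>UNIV. pderiv_at m (\<lambda>z. Y z $ m) y)"
  have s: "snd c (P y) = y"
    by (rule chart_inv_right[OF W_img[OF y]])
  have loc: "local_rep A c \<eta> y ws = r * vol ws" if l: "length ws = 7" for ws
  proof -
    have mc: "map (\<lambda>v. v c) (map (tvec_of A c (P y)) ws) = ws"
      by (simp add: comp_def tvec_of_coord[OF P_chart[OF y]])
    have "local_rep A c \<eta> y ws = euclidean_d (local_rep A c (g2_star A \<sigma> 1 \<tau>\<^sub>1)) y ws"
      unfolding local_rep_def[of A c \<eta>] unfolding \<eta>_def ext_deriv_def Let_def c s pullback_def mc ..
    also have "\<dots> = euclidean_d (\<lambda>z ws. vol (Y z # ws)) y ws"
      by (rule euclidean_d_cong[OF oW y]) (rule local_star_t1, assumption, simp add: l)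
    also have "\<dots> = r * vol ws"
      unfolding r_def by (rule euclidean_d_vol[OF oW smooth_Y y l])
    finally show ?thesis .
  qed
  have a: "altf 7 (local_rep A c \<eta> y)"
    by (rule altf_cong[OF altf_cmult[OF altf_vol] loc])
  have l7: "length (map ((*v) (cf.F y)) (map ax I7)) = 7" and l7': "length (map ax I7 :: (real ^ 7) list) = 7"
    by simp_all
  have "g2_star A \<sigma> 7 \<eta> (P y) (map (T y) []) = star 7 (rep \<eta> y) []"
    by (rule star_T[OF y a]) simp
  also have "star 7 (rep \<eta> y) [] = rep \<eta> y (map ax (compl7 [])) * epsl (compl7 [] @ []) I7"
    using star_ax[OF altf_rep[OF a], of "[]"] by simp
  also have "\<dots> = rep \<eta> y (map ax I7)"
    by (simp add: compl7_def)
  also have "\<dots> = r * det (cf.F y)"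
    unfolding rep_local loc[OF l7] vol_map[OF l7'] vol_ax_I7 by simp
  finally have st: "codiff1 A \<sigma> \<tau>\<^sub>1 (P y) = - (r * det (cf.F y))"
    unfolding codiff1_def \<eta>_def by simp
  have "r = (\<Sum>m\<in>UNIV. - 1 / 12 * pderiv_at m (\<lambda>z. det (E z) * (cf.F z *v cf.tv z) $ m) y)"
    unfolding r_def Y_def vec_lambda_beta by (intro sum.cong refl pderiv_cmult[OF smooth_dF y])
  also have "\<dots> = - 1 / 12 * (det (E y) * cf.divt y)"
    unfolding sum_distrib_left[symmetric] cf.divergence_tv[OF y] ..
  finally have "12 * (- (r * det (cf.F y))) = (det (E y) * det (cf.F y)) * cf.divt y"
    by (simp add: mult_ac)
  moreover have "det (E y) * det (cf.F y) = 1"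
    using arg_cong[OF cf.EF[OF y], of det] unfolding det_mul by simp
  ultimately show ?thesis
    unfolding st by simp
qed

text \<open>The hypothesis on \<open>chart_at\<close> lets \<open>ext_deriv\<close> of the 4-form
  unfold directly in the chart \<open>c\<close>, where the form is \<open>psi\<close> pulled back by
  \<open>E\<close>.\<close>

lemma pointwise2: assumes y: "y \<in> W" and c: "chart_at A (P y) = c"
  shows "pointwise_torsion2 (cf.th y) (\<tau>\<^sub>0 (P y)) (rep \<tau>\<^sub>1 y) (rep \<tau>\<^sub>3 y) (rep \<tau>\<^sub>2 y)"
proof (rule pointwise_torsion2.intro[OF pointwise[OF y] pointwise_torsion2_axioms.intro])
  show "altf 2 (rep \<tau>\<^sub>2 y)"
    by (rule altf_rep_Omega[OF y t2])
next
  fix "is" assume i: "is \<in> set (filter (\<lambda>is. length is = 5) (subseqs I7))"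
  have l: "length is = 5"
    using i by (simp only: set_filter mem_Collect_eq)
  then obtain i1 i2 i3 i4 i5 where is5: "is = [i1, i2, i3, i4, i5]"
    by (auto simp: length_Suc_conv eval_nat_numeral)
  have l5: "length (map ax is :: (real ^ 7) list) = 5" and l14: "length (map ax is :: (real ^ 7) list) = 1 + 4" and l23: "length (map ax is :: (real ^ 7) list) = 2 + 3"
    using l by simp_all
  have s: "snd c (P y) = y"
    by (rule chart_inv_right[OF W_img[OF y]])
  have m: "map (\<lambda>v. v c) (map (T y) (map ax is)) = map (\<lambda>i. cf.F y *v ax i) is"
    by (simp add: T_coord[OF y])
  have "ext_deriv A (g2_star A \<sigma> 3 \<sigma>) (P y) (map (T y) (map ax is)) = euclidean_d (local_rep A c (g2_star A \<sigma> 3 \<sigma>)) y (map (\<lambda>i. cf.F y *v ax i) is)"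
    unfolding ext_deriv_def Let_def c s pullback_def m ..
  also have "\<dots> = euclidean_d (\<lambda>z ws. psi (map ((*v) (E z)) ws)) y (map (\<lambda>i. cf.F y *v ax i) is)"
    by (rule euclidean_d_cong[OF oW y]) (simp add: local_rep_rep rep_star_sigma star_phi l)
  also have "\<dots> = dpsi (cf.th y) is"
    using cf.d_psi_frame[OF y i[unfolded is5]] unfolding is5 .
  finally have d: "ext_deriv A (g2_star A \<sigma> 3 \<sigma>) (P y) (map (T y) (map ax is)) = dpsi (cf.th y) is" .
  show "dpsi (cf.th y) is = 4 * wedge 1 4 (rep \<tau>\<^sub>1 y) (star 3 phi) (map ax is) + wedge 2 3 (rep \<tau>\<^sub>2 y) phi (map ax is)"
    using form_eq_T[OF dpsi_eq y l5] unfolding d wedge_T[OF l14] wedge_T[OF l23] wedge_sigma[OF y] wedge_star_sigma[OF y] .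
next
  fix vs :: "(real ^ 7) list" assume "length vs = 5"
  then have l: "length vs = 5" and l23: "length vs = 2 + 3" and l2: "2 + length vs = 7"
    by simp_all
  show "wedge 2 3 (rep \<tau>\<^sub>2 y) phi vs = - star 2 (rep \<tau>\<^sub>2 y) vs"
    using form_eq_T[OF t2_14 y l] unfolding wedge_T[OF l23] wedge_sigma[OF y] star_T[OF y altf_local_rep[OF t2 cA W_img[OF y]] l2] .
qed

lemma scalar_curvature_torsion: assumes y: "y \<in> W" and c: "chart_at A (P y) = c"
  shows "scalar_curvature A (g2_metric A \<sigma>) (P y) =
      12 * codiff1 A \<sigma> \<tau>\<^sub>1 (P y) + 21 / 8 * (\<tau>\<^sub>0 (P y))\<^sup>2
      + 30 * (form_norm A (g2_metric A \<sigma>) 1 \<tau>\<^sub>1 (P y))\<^sup>2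
      - 1 / 2 * (form_norm A (g2_metric A \<sigma>) 2 \<tau>\<^sub>2 (P y))\<^sup>2
      - 1 / 2 * (form_norm A (g2_metric A \<sigma>) 3 \<tau>\<^sub>3 (P y))\<^sup>2"
proof -
  have s: "snd c (P y) = y"
    by (rule chart_inv_right[OF W_img[OF y]])
  have sc: "scalar_curvature A (g2_metric A \<sigma>) (P y) = cf.divt y + qform (cf.th y)"
    unfolding scalar_curvature_def Let_def c s by (rule cf.scalar_formula[OF y])
  have n1: "(form_norm A (g2_metric A \<sigma>) 1 \<tau>\<^sub>1 (P y))\<^sup>2 = (\<Sum>a\<in>UNIV. (rep \<tau>\<^sub>1 y [ax a])\<^sup>2)"
    unfolding norm_T[OF y altf_local_rep[OF t1 cA W_img[OF y]]] sum_lists_1 by simp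
  have n2: "(form_norm A (g2_metric A \<sigma>) 2 \<tau>\<^sub>2 (P y))\<^sup>2 = (\<Sum>is\<leftarrow>filter (\<lambda>is. length is = 2) (subseqs I7). (rep \<tau>\<^sub>2 y (map ax is))\<^sup>2)"
    unfolding norm_T[OF y altf_local_rep[OF t2 cA W_img[OF y]]] by (rule norm_sorted_2[OF altf_rep_Omega[OF y t2]])
  have n3: "(form_norm A (g2_metric A \<sigma>) 3 \<tau>\<^sub>3 (P y))\<^sup>2 = (\<Sum>is\<leftarrow>filter (\<lambda>is. length is = 3) (subseqs I7). (rep \<tau>\<^sub>3 y (map ax is))\<^sup>2)"
    unfolding norm_T[OF y altf_local_rep[OF t3 cA W_img[OF y]]] by (rule norm_sorted_3[OF altf_rep_Omega[OF y t3]])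
  have "d + q = d + a + b - x - w" if "a + b - x - w = q" for d q a b x w :: real
    using that by simp
  from this[OF pointwise_torsion2.torsion_norms[OF pointwise2[OF y c]]] show ?thesis
    unfolding sc n1 n2 n3 codiff[OF y c] .
qed

end

theorem mainTheorem1:
  fixes M :: "'m topology"
    and A :: "('m, 7) chart set"
    and \<sigma> :: "('m, 7) form"
    and \<tau>\<^sub>0 :: "'m \<Rightarrow> real"
    and \<tau>\<^sub>1 \<tau>\<^sub>2 \<tau>\<^sub>3 :: "('m, 7) form"
  assumes "smooth_manifold M A"
    and "\<sigma> \<in> definite_forms M A"
    and "torsion_forms M A \<sigma> \<tau>\<^sub>0 \<tau>\<^sub>1 \<tau>\<^sub>2 \<tau>\<^sub>3"
  shows "\<forall>p\<in>topspace M.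
    scalar_curvature A (g2_metric A \<sigma>) p =
      12 * codiff1 A \<sigma> \<tau>\<^sub>1 p + 21 / 8 * (\<tau>\<^sub>0 p)\<^sup>2
      + 30 * (form_norm A (g2_metric A \<sigma>) 1 \<tau>\<^sub>1 p)\<^sup>2
      - 1 / 2 * (form_norm A (g2_metric A \<sigma>) 2 \<tau>\<^sub>2 p)\<^sup>2
      - 1 / 2 * (form_norm A (g2_metric A \<sigma>) 3 \<tau>\<^sub>3 p)\<^sup>2"
proof
  fix p assume p: "p \<in> topspace M"
  interpret g2_structure M A \<sigma>
    by unfold_locales (rule assms(1), rule assms(2))
  \<comment> \<open>The very chart in which \<open>scalar_curvature\<close> and
    \<open>ext_deriv\<close> are evaluated at \<open>p\<close>.\<close>
  define c where "c = chart_at A p"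
  have cp: "c \<in> A" "p \<in> fst c"
    using chart_at[OF p] by (simp_all add: c_def charts_at_def)
  have inv: "chart_inv c (snd c p) = p"
    by (rule chart_inv_left[OF cp])
  have yp: "snd c p \<in> img c"
    using cp(2) by blast
  obtain W and E :: "real ^ 7 \<Rightarrow> real ^ 7 ^ 7" where W: "open W" "snd c p \<in> W" "W \<subseteq> img c" "smoothM W E" "\<forall>y\<in>W. pulls_back (local_rep A c \<sigma> y) ((*v) (E y))"
    using definite_field.ex_smooth_coframe[OF definite_field_chart[OF cp(1)] yp] by blast
  interpret g2_torsion M A \<sigma> c W E \<tau>\<^sub>0 \<tau>\<^sub>1 \<tau>\<^sub>2 \<tau>\<^sub>3
    by unfold_locales (use cp W assms(3) in blast)+
  have ca: "chart_at A (chart_inv c (snd c p)) = c"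
    unfolding inv by (simp only: c_def)
  show "scalar_curvature A (g2_metric A \<sigma>) p =
      12 * codiff1 A \<sigma> \<tau>\<^sub>1 p + 21 / 8 * (\<tau>\<^sub>0 p)\<^sup>2
      + 30 * (form_norm A (g2_metric A \<sigma>) 1 \<tau>\<^sub>1 p)\<^sup>2
      - 1 / 2 * (form_norm A (g2_metric A \<sigma>) 2 \<tau>\<^sub>2 p)\<^sup>2
      - 1 / 2 * (form_norm A (g2_metric A \<sigma>) 3 \<tau>\<^sub>3 p)\<^sup>2"
    using scalar_curvature_torsion[OF W(2) ca] unfolding inv .
qed

end
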